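(* Let $f:S_d\to[0,+\infty]$ be convex, positively $1$-homogeneous and lower semicontinuous, with $\operatorname{dom}(f)\subset S_d^+$, $\operatorname{dom}(f)\neq\emptyset$, and $\operatorname{dom}(f)\cap S_d^{++}$ dense in $\operatorname{dom}(f)$. Assume that $f$ is coercive. Then the following assertions are equivalent. (i) For all $\mu,\nu,p\in\mathcal P_2(\mathbb R^d)$, $H(\mu,\nu)\le H(\mu,p)+H(p,\nu)$. (ii) For each $x\in\mathbb R^d$, each $\nu,p\in\mathcal P_2(\mathbb R^d)$ and each analytically measurable probability kernel $y\in\mathbb R^d\mapsto\gamma^y\in\mathcal P_2(\mathbb R^d)$, $$G(x,\nu)\le G(x,p)+\int_{\mathbb R^d}G(y,\gamma^y)\,dp(y)\quad\text{whenever}\quad \nu=\int_{\mathbb R^d}\gamma^y\,dp(y).$$ (iii) For each $\varphi\in\mathcal S_b(\mathbb R^d)$, $\varphi^{GG}=\varphi^G$.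
   Context: $S_d$ is the space of real symmetric $d\times d$ matrices with inner product $A:B=\operatorname{tr}(A^{T}B)$ and norm $\|A\|=\sqrt{A:A}$; $S_d^+$ (resp. $S_d^{++}$) is the set of nonnegative (resp. positive) definite ones. $\operatorname{dom}(f)=\{M\in S_d: f(M)<+\infty\}$. Positively $1$-homogeneous means $f(tA)=tf(A)$ for all $A\in S_d$, $t\ge 0$. Coercive means $f(A)\to+\infty$ as $\|A\|\to\infty$. $\mathcal S_b(\mathbb R^d)$ is the set of bounded lower semicontinuous functions $\mathbb R^d\to\mathbb R$. Analytically measurable means measurable with respect to the $\sigma$-algebra generated by the analytic subsets of $\mathbb R^d$, where $\mathcal P_2(\mathbb R^d)$ carries the topology of the $2$-Wasserstein distance. $\mathcal P_2(\mathbb R^d)$ is the set of Borel probability measures on $\mathbb R^d$ with finite second moment; $\mathcal P_2((0,1)\times\mathbb R^d)$ is the set of Borel probability measures $\varrho$ on $(0,1)\times\mathbb R^d$ with $\int |x|^2\,d\varrho(t,x)<\infty$. $\mathcal M((0,1)\times\mathbb R^d,S_d^+)$ is the set of $S_d$-valued Borel measures $\lambda$ on $(0,1)\times\mathbb R^d$ with $\lambda(E)\in S_d^+$ for every Borel $E$; $|\cdot|$ of a measure is its total variation measure. $C_b^{1,2}((0,1)\times\mathbb R^d)$ is the space of functions $\varphi$ that are once continuously differentiable in $t$ and twice in $x$ with $\partial_t\varphi$ and $\nabla_x^2\varphi$ uniformly bounded. Fokker-Planck equation. A pair $(\varrho,\lambda)\in\mathcal P_2((0,1)\times\mathbb R^d)\times\mathcal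 M((0,1)\times\mathbb R^d,S_d^+)$ which can be disintegrated as $\varrho=\varrho_t\otimes\mathcal L^1|_{(0,1)}$, $\lambda=\lambda_t\otimes\mathcal L^1|_{(0,1)}$ solves $\partial_t\varrho=\operatorname{tr}(\frac12\nabla^2\lambda)$ if $\int_0^1|\lambda_t|(\mathbb R^d)\,dt<\infty$ and $$\int_0^1\int_{\mathbb R^d}\partial_t\varphi\,d\varrho_t\,dt=-\int_0^1\int_{\mathbb R^d}\tfrac12\nabla_x^2\varphi:d\lambda_t\,dt$$ for all $\varphi\in C_b^{1,2}((0,1)\times\mathbb R^d)$ whose closed support is contained in $(0,1)\times\mathbb R^d$. For such a solution $t\mapsto\varrho_t$ has a narrowly continuous representative on $[0,1]$ with values in $\mathcal P_2(\mathbb R^d)$, which is always used; $\varrho_0,\varrho_1$ denote its endpoint values. Dynamic cost: $$F(\mu,\nu)=\inf\left\{\int_0^1\int_{\mathbb R^d}f\left(\frac{d\lambda_t}{d|\lambda_t|}\right)d|\lambda_t|\,dt \;:\; \partial_t\varrho=\operatorname{tr}\left(\tfrac12\nabla^2\lambda\right),\ \varrho_0=\mu,\ \varrho_1=\nu\right\},$$ with $\inf\emptyset=+\infty$. Weak transport. $G(x,p)=F(\delta_x,p)$ for $x\in\mathbb R^d$, $p\in\mathcal P_2(\mathbb R^d)$. $\Pi(\mu,\nu)$ is the set of Borel probability measures on $\mathbb R^d\times\mathbb R^d$ with first marginal $\mu$ and second marginal $\nu$; each is disintegrated as $\gamma=\gamma^x\otimes\mu$. Then $H(\mu,\nu)=\inf\{\int_{\mathbb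 R^d}G(x,\gamma^x)\,d\mu(x):\gamma\in\Pi(\mu,\nu)\}$. $G$-transform. For a universally measurable $\varphi:\mathbb R^d\to\mathbb R$ with $|\varphi(x)|\le C(1+|x|^2)$ for some $C>0$, $\varphi^G(x)=\inf\{\int_{\mathbb R^d}\varphi\,dp+G(x,p): p\in\mathcal P_2(\mathbb R^d)\}$, and $\varphi^{GG}=(\varphi^G)^G$. *)

theory Defs
  imports "HOL-Probability.Probability"
begin

section \<open>Integrands on symmetric matrices\<close>

text \<open>The library inner product and norm on \<open>real ^ 'n ^ 'n\<close> are \<open>A : B = tr (A\<^sup>T B)\<close> and
  the associated Frobenius norm. An integrand \<open>f\<close> on \<open>S\<^sub>d\<close> is a function on all of
  \<open>real ^ 'n ^ 'n\<close> of which only the values on \<open>sym_mats\<close> matter.\<close>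

definition sym_mats :: "(real ^ 'n ^ 'n) set" where
  "sym_mats = {A. transpose A = A}"

definition psd_mats :: "(real ^ 'n ^ 'n) set" where
  "psd_mats = {A \<in> sym_mats. \<forall>v. 0 \<le> v \<bullet> (A *v v)}"

definition pd_mats :: "(real ^ 'n ^ 'n) set" where
  "pd_mats = {A \<in> sym_mats. \<forall>v. v \<noteq> 0 \<longrightarrow> 0 < v \<bullet> (A *v v)}"

definition eff_dom :: "(real ^ 'n ^ 'n \<Rightarrow> ennreal) \<Rightarrow> (real ^ 'n ^ 'n) set" where
  "eff_dom f = {A \<in> sym_mats. f A < \<infinity>}"

definition convex_integrand :: "(real ^ 'n ^ 'n \<Rightarrow> ennreal) \<Rightarrow> bool" where
  "convex_integrand f \<longleftrightarrow>
     (\<forall>A\<in>sym_mats. \<forall>B\<in>sym_mats. \<forall>t\<in>{0..1}.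
        f ((1 - t) *\<^sub>R A + t *\<^sub>R B) \<le> ennreal (1 - t) * f A + ennreal t * f B)"

text \<open>With the convention \<open>0 * \<infinity> = 0\<close> in \<open>ennreal\<close>; hence \<open>f 0 = 0\<close>.\<close>

definition pos_homogeneous :: "(real ^ 'n ^ 'n \<Rightarrow> ennreal) \<Rightarrow> bool" where
  "pos_homogeneous f \<longleftrightarrow> (\<forall>A\<in>sym_mats. \<forall>t\<ge>0. f (t *\<^sub>R A) = ennreal t * f A)"

definition coercive :: "(real ^ 'n ^ 'n \<Rightarrow> ennreal) \<Rightarrow> bool" where
  "coercive f \<longleftrightarrow> (f \<longlongrightarrow> \<infinity>) (inf at_infinity (principal sym_mats))"

definition lsc_on :: "'a::topological_space set \<Rightarrow> ('a \<Rightarrow> 'b::linorder) \<Rightarrow> bool" where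
  "lsc_on S f \<longleftrightarrow> (\<forall>x\<in>S. \<forall>c<f x. \<forall>\<^sub>F y in at x within S. c < f y)"


section \<open>Vector measures\<close>

text \<open>A vector measure on \<open>(space M, sets M)\<close> is a function on sets; only its values on
  \<open>sets M\<close> matter.\<close>

definition vector_measure :: "'a measure \<Rightarrow> ('a set \<Rightarrow> 'b::real_normed_vector) \<Rightarrow> bool" where
  "vector_measure M l \<longleftrightarrow>
     l {} = 0 \<and>
     (\<forall>A. range A \<subseteq> sets M \<longrightarrow> disjoint_family A \<longrightarrow> (\<lambda>i::nat. l (A i)) sums l (\<Union>i. A i))"

definition total_variation ::
    "'a measure \<Rightarrow> ('a set \<Rightarrow> 'b::real_normed_vector) \<Rightarrow> 'a measure" where
  "total_variation M l =
     measure_of (space M) (sets M)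
       (\<lambda>E. SUP A\<in>{A::nat \<Rightarrow> 'a set. range A \<subseteq> sets M \<and> disjoint_family A \<and> (\<Union>i. A i) = E}.
          \<Sum>i. ennreal (norm (l (A i))))"

text \<open>The density \<open>dl / d|l|\<close>, determined \<open>|l|\<close>-almost everywhere.\<close>

definition polar_density ::
    "'a measure \<Rightarrow> ('a set \<Rightarrow> 'b::euclidean_space) \<Rightarrow> 'a \<Rightarrow> 'b" where
  "polar_density M l =
     (SOME g. integrable (total_variation M l) g \<and>
        (\<forall>E\<in>sets M. l E = (LINT x:E|total_variation M l. g x)))"

definition vector_lint ::
    "'a measure \<Rightarrow> ('a set \<Rightarrow> 'b::euclidean_space) \<Rightarrow> ('a \<Rightarrow> 'b) \<Rightarrow> real" where
  "vector_lint M l \<Phi> = (\<integral>x. \<Phi> x \<bullet> polar_density M l x \<partial>total_variation M l)"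

definition psd_measure :: "'a measure \<Rightarrow> ('a set \<Rightarrow> real ^ 'n ^ 'n) \<Rightarrow> bool" where
  "psd_measure M l \<longleftrightarrow> vector_measure M l \<and> (\<forall>E\<in>sets M. l E \<in> psd_mats)"


section \<open>Probability measures, disintegrations, couplings\<close>

definition P2 :: "(real ^ 'n) measure set" where
  "P2 = {\<mu>. sets \<mu> = sets borel \<and> prob_space \<mu> \<and> (\<integral>\<^sup>+x. ennreal ((norm x)\<^sup>2) \<partial>\<mu>) < \<infinity>}"

definition unit_time :: "real measure" where
  "unit_time = restrict_space lborel {0<..<1}"

definition spacetime :: "(real \<times> (real ^ 'n)) measure" where
  "spacetime = restrict_space borel ({0<..<1} \<times> UNIV)"

definition P2_spacetime :: "(real \<times> (real ^ 'n)) measure set" where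
  "P2_spacetime =
     {\<rho>. sets \<rho> = sets spacetime \<and> prob_space \<rho> \<and> (\<integral>\<^sup>+z. ennreal ((norm (snd z))\<^sup>2) \<partial>\<rho>) < \<infinity>}"

text \<open>\<open>\<gamma> = \<kappa>\<^sub>x \<otimes> \<mu>\<close> for a measurable kernel \<open>\<kappa>\<close> of Borel probability measures.\<close>

definition disintegration ::
    "('a \<times> 'b::topological_space) measure \<Rightarrow> 'a measure \<Rightarrow> ('a \<Rightarrow> 'b measure) \<Rightarrow> bool" where
  "disintegration \<gamma> \<mu> \<kappa> \<longleftrightarrow>
     \<kappa> \<in> measurable \<mu> (prob_algebra borel) \<and>
     (\<forall>E\<in>sets \<gamma>. emeasure \<gamma> E = (\<integral>\<^sup>+x. emeasure (\<kappa> x) (Pair x -` E) \<partial>\<mu>))"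

definition couplings ::
    "(real ^ 'n) measure \<Rightarrow> (real ^ 'n) measure \<Rightarrow> ((real ^ 'n) \<times> (real ^ 'n)) measure set" where
  "couplings \<mu> \<nu> =
     {\<gamma>. sets \<gamma> = sets borel \<and> prob_space \<gamma> \<and> distr \<gamma> borel fst = \<mu> \<and> distr \<gamma> borel snd = \<nu>}"

definition wasserstein2 :: "(real ^ 'n) measure \<Rightarrow> (real ^ 'n) measure \<Rightarrow> real" where
  "wasserstein2 \<mu> \<nu> =
     sqrt (enn2real (INF \<gamma>\<in>couplings \<mu> \<nu>. \<integral>\<^sup>+z. ennreal ((dist (fst z) (snd z))\<^sup>2) \<partial>\<gamma>))"

definition wasserstein2_open :: "(real ^ 'n) measure set \<Rightarrow> bool" where
  "wasserstein2_open U \<longleftrightarrow>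
     U \<subseteq> P2 \<and> (\<forall>\<mu>\<in>U. \<exists>r>0. \<forall>\<nu>\<in>P2. wasserstein2 \<mu> \<nu> < r \<longrightarrow> \<nu> \<in> U)"

definition P2_borel :: "(real ^ 'n) measure measure" where
  "P2_borel = sigma P2 {U. wasserstein2_open U}"

text \<open>Analytic sets as continuous images of Baire space.\<close>

definition analytic_set :: "'a::topological_space set \<Rightarrow> bool" where
  "analytic_set A \<longleftrightarrow>
     A = {} \<or> (\<exists>g::(nat \<Rightarrow> nat) \<Rightarrow> 'a. continuous_on UNIV g \<and> A = range g)"

definition analytic_kernels :: "(real ^ 'n \<Rightarrow> (real ^ 'n) measure) set" where
  "analytic_kernels = measurable (sigma UNIV {A. analytic_set A}) P2_borel"


section \<open>The Fokker-Planck equation\<close>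

text \<open>\<open>\<phi>\<close> is in \<open>C\<^sub>b\<^sup>1\<^sup>,\<^sup>2((0,1) \<times> \<real>\<^sup>d)\<close> with time derivative \<open>\<phi>t\<close>, spatial
  gradient \<open>g\<close> and spatial Hessian \<open>h\<close>.\<close>

definition Cb12 ::
    "(real \<times> (real ^ 'n) \<Rightarrow> real) \<Rightarrow> (real \<times> (real ^ 'n) \<Rightarrow> real) \<Rightarrow>
     (real \<times> (real ^ 'n) \<Rightarrow> real ^ 'n) \<Rightarrow> (real \<times> (real ^ 'n) \<Rightarrow> real ^ 'n ^ 'n) \<Rightarrow> bool" where
  "Cb12 \<phi> \<phi>t g h \<longleftrightarrow>
     (\<forall>t\<in>{0<..<1}. \<forall>x.
        ((\<lambda>s. \<phi> (s, x)) has_real_derivative \<phi>t (t, x)) (at t) \<and>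
        ((\<lambda>y. \<phi> (t, y)) has_derivative (\<lambda>v. g (t, x) \<bullet> v)) (at x) \<and>
        ((\<lambda>y. g (t, y)) has_derivative (\<lambda>v. h (t, x) *v v)) (at x)) \<and>
     continuous_on ({0<..<1} \<times> UNIV) \<phi> \<and> continuous_on ({0<..<1} \<times> UNIV) \<phi>t \<and>
     continuous_on ({0<..<1} \<times> UNIV) g \<and> continuous_on ({0<..<1} \<times> UNIV) h \<and>
     bounded (\<phi>t ` ({0<..<1} \<times> UNIV)) \<and> bounded (h ` ({0<..<1} \<times> UNIV))"

text \<open>The support is closed in \<open>\<real> \<times> \<real>\<^sup>d\<close>, so it cannot touch \<open>t = 0\<close> or \<open>t = 1\<close>;
  it need not be compact.\<close>

definition supported_inside :: "(real \<times> (real ^ 'n) \<Rightarrow> real) \<Rightarrow> bool" where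
  "supported_inside \<phi> \<longleftrightarrow>
     closure {z \<in> {0<..<1} \<times> UNIV. \<phi> z \<noteq> 0} \<subseteq> {0<..<1} \<times> UNIV"

definition psd_disintegration ::
    "((real \<times> (real ^ 'n)) set \<Rightarrow> real ^ 'n ^ 'n) \<Rightarrow>
     (real \<Rightarrow> (real ^ 'n) set \<Rightarrow> real ^ 'n ^ 'n) \<Rightarrow> bool" where
  "psd_disintegration l lt \<longleftrightarrow>
     (\<forall>t\<in>{0<..<1}. psd_measure borel (lt t)) \<and>
     (\<forall>B\<in>sets borel. (\<lambda>t. lt t B) \<in> borel_measurable unit_time) \<and>
     (\<forall>E\<in>sets spacetime. integrable unit_time (\<lambda>t. lt t (Pair t -` E)) \<and>
        l E = (\<integral>t. lt t (Pair t -` E) \<partial>unit_time))"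

definition fokker_planck ::
    "(real \<times> (real ^ 'n)) measure \<Rightarrow> (real \<Rightarrow> (real ^ 'n) measure) \<Rightarrow>
     ((real \<times> (real ^ 'n)) set \<Rightarrow> real ^ 'n ^ 'n) \<Rightarrow>
     (real \<Rightarrow> (real ^ 'n) set \<Rightarrow> real ^ 'n ^ 'n) \<Rightarrow> bool" where
  "fokker_planck \<rho> \<rho>t l lt \<longleftrightarrow>
     \<rho> \<in> P2_spacetime \<and> psd_measure spacetime l \<and>
     disintegration \<rho> unit_time \<rho>t \<and> psd_disintegration l lt \<and>
     (\<integral>\<^sup>+t. emeasure (total_variation borel (lt t)) UNIV \<partial>unit_time) < \<infinity> \<and>
     (\<forall>\<phi> \<phi>t g h. Cb12 \<phi> \<phi>t g h \<longrightarrow> supported_inside \<phi> \<longrightarrow>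
        (\<integral>t. (\<integral>x. \<phi>t (t, x) \<partial>\<rho>t t) \<partial>unit_time) =
        - (\<integral>t. vector_lint borel (lt t) (\<lambda>x. (1 / 2) *\<^sub>R h (t, x)) \<partial>unit_time))"

definition narrowly_continuous :: "(real \<Rightarrow> (real ^ 'n) measure) \<Rightarrow> bool" where
  "narrowly_continuous \<rho>c \<longleftrightarrow>
     (\<forall>u::real ^ 'n \<Rightarrow> real. continuous_on UNIV u \<longrightarrow> bounded (range u) \<longrightarrow>
        continuous_on {0..1} (\<lambda>t. \<integral>x. u x \<partial>\<rho>c t))"

text \<open>The curve \<open>\<rho>c\<close> on \<open>[0,1]\<close> is the narrowly continuous representative of \<open>\<rho>t\<close>.\<close>

definition continuous_representative ::
    "(real \<Rightarrow> (real ^ 'n) measure) \<Rightarrow> (real \<Rightarrow> (real ^ 'n) measure) \<Rightarrow> bool" where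
  "continuous_representative \<rho>t \<rho>c \<longleftrightarrow>
     (\<forall>t\<in>{0..1}. \<rho>c t \<in> P2) \<and> narrowly_continuous \<rho>c \<and> (AE t in unit_time. \<rho>c t = \<rho>t t)"


section \<open>Costs and the transform\<close>

definition action ::
    "(real ^ 'n ^ 'n \<Rightarrow> ennreal) \<Rightarrow> (real \<Rightarrow> (real ^ 'n) set \<Rightarrow> real ^ 'n ^ 'n) \<Rightarrow> ennreal" where
  "action f lt =
     (\<integral>\<^sup>+t. (\<integral>\<^sup>+x. f (polar_density borel (lt t) x) \<partial>total_variation borel (lt t)) \<partial>unit_time)"

definition dyn_cost ::
    "(real ^ 'n ^ 'n \<Rightarrow> ennreal) \<Rightarrow> (real ^ 'n) measure \<Rightarrow> (real ^ 'n) measure \<Rightarrow> ennreal" where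
  "dyn_cost f \<mu> \<nu> =
     Inf {action f lt | \<rho> \<rho>t l lt \<rho>c. fokker_planck \<rho> \<rho>t l lt \<and>
        continuous_representative \<rho>t \<rho>c \<and> \<rho>c 0 = \<mu> \<and> \<rho>c 1 = \<nu>}"

definition point_cost ::
    "(real ^ 'n ^ 'n \<Rightarrow> ennreal) \<Rightarrow> real ^ 'n \<Rightarrow> (real ^ 'n) measure \<Rightarrow> ennreal" where
  "point_cost f x p = dyn_cost f (return borel x) p"

text \<open>\<open>\<kappa> x\<close> lies in \<open>P2\<close> for \<open>\<mu>\<close>-almost every \<open>x\<close> only; outside \<open>P2\<close> the dynamic cost is
  \<open>\<infinity>\<close>, as the infimum of the empty set.\<close>

definition weak_cost ::
    "(real ^ 'n ^ 'n \<Rightarrow> ennreal) \<Rightarrow> (real ^ 'n) measure \<Rightarrow> (real ^ 'n) measure \<Rightarrow> ennreal" where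
  "weak_cost f \<mu> \<nu> =
     Inf {\<integral>\<^sup>+x. point_cost f x (\<kappa> x) \<partial>\<mu> | \<gamma> \<kappa>. \<gamma> \<in> couplings \<mu> \<nu> \<and> disintegration \<gamma> \<mu> \<kappa>}"

text \<open>The completions account for integrands that are only universally measurable.\<close>

definition g_transform ::
    "(real ^ 'n ^ 'n \<Rightarrow> ennreal) \<Rightarrow> (real ^ 'n \<Rightarrow> real) \<Rightarrow> real ^ 'n \<Rightarrow> ereal" where
  "g_transform f \<phi> x =
     (INF p\<in>P2. ereal (\<integral>y. \<phi> y \<partial>completion p) + enn2ereal (point_cost f x p))"

text \<open>For bounded \<open>\<phi>\<close> the transform is finite, so that it can be iterated as a real function:
  it is bounded below by \<open>inf \<phi>\<close>, and above by \<open>\<phi> x\<close>, as \<open>point_cost f x (return borel x) = 0\<close>.\<close>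

definition g_transform2 ::
    "(real ^ 'n ^ 'n \<Rightarrow> ennreal) \<Rightarrow> (real ^ 'n \<Rightarrow> real) \<Rightarrow> real ^ 'n \<Rightarrow> ereal" where
  "g_transform2 f \<phi> = g_transform f (\<lambda>x. real_of_ereal (g_transform f \<phi> x))"

definition bounded_lsc :: "(real ^ 'n \<Rightarrow> real) set" where
  "bounded_lsc = {\<phi>. bounded (range \<phi>) \<and> lsc_on UNIV \<phi>}"

definition mixture ::
    "(real ^ 'n) measure \<Rightarrow> (real ^ 'n \<Rightarrow> (real ^ 'n) measure) \<Rightarrow> (real ^ 'n) measure \<Rightarrow> bool" where
  "mixture p \<kappa> \<nu> \<longleftrightarrow>
     (\<forall>E\<in>sets borel. emeasure \<nu> E = (\<integral>\<^sup>+y. emeasure (\<kappa> y) E \<partial>completion p))"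

end

theory Submission
  imports Defs
begin

text \<open>
  All three assertions hold, because the cost \<open>G x p = point_cost f x p\<close> has a dual description that is linear in \<open>p\<close>:
  \<open>G x p\<close> is the supremum of \<open>\<integral>u dp - u x\<close> over compactly supported \<open>u\<close> of class \<open>C\<^sup>2\<close> such that half the Hessian of \<open>u\<close>
  takes values in the polar set \<open>{B. \<forall>A. B \<bullet> A \<le> f A}\<close> (lemma \<open>duality\<close>).

  The integrand is positively homogeneous, so the problem is stationary: if the static equation
  \<open>p - \<delta>\<^sub>x = tr (\<nabla>\<^sup>2 \<sigma>) / 2\<close> holds for a matrix measure \<open>\<sigma>\<close>, then the linear interpolation from \<open>\<delta>\<^sub>x\<close> to \<open>p\<close> with the constant
  flux \<open>\<sigma>\<close> solves the Fokker-Planck equation with action \<open>\<integral>f d\<sigma>\<close> (\<open>point_cost_le_static\<close>). Testing an arbitrary solution with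
  products \<open>\<eta> t * u x\<close> gives one inequality of the duality (\<open>weak_duality\<close>). For the other one, the
  Hahn-Banach theorem extends the functional \<open>u x - \<integral>u dp\<close>, defined on the pairs of \<open>u\<close> and minus half its Hessian, to all pairs of bounded
  continuous functions, and the Riesz representation theorem turns the extension into a matrix measure \<open>\<sigma>\<close> that is an optimal flux
  (\<open>matrix_functional_representation\<close>, \<open>point_cost_le_dual_cost\<close>). Coercivity makes the polar set a neighbourhood of \<open>0\<close>, as the extension
  requires; since the domain of \<open>f\<close> consists of nonnegative definite matrices, the polar set contains enough rays to make the
  extension positive; and convexity and lower semicontinuity identify \<open>f\<close> with the support function of the polar set.

  Now (ii) follows by splitting \<open>\<integral>u d\<nu> - u x\<close> along \<open>\<nu> = \<integral>\<kappa>\<^sub>y dp(y)\<close> (\<open>point_cost_bind\<close>), and (i) by composing kernels and integrating. For (iii) the same extension argument, with the target measure as an additional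
  unknown (\<open>primal_attainment\<close>), shows that the transform of \<open>\<phi>\<close> is the supremum of the subsolutions \<open>v \<le> \<phi>\<close>, those \<open>v = a + u\<close> for
  which \<open>- u\<close> is admissible in the dual problem. The transform leaves this supremum fixed, which is idempotence.
\<close>


section \<open>Extension of linear functionals\<close>

definition sublinear :: "('a::real_vector \<Rightarrow> real) \<Rightarrow> bool" where
  "sublinear P \<longleftrightarrow> (\<forall>x y. P (x + y) \<le> P x + P y) \<and> (\<forall>t\<ge>0. \<forall>x. P (t *\<^sub>R x) \<le> t * P x)"

lemma sublinear_scale:
  assumes "sublinear P" "t \<ge> 0"
  shows "P (t *\<^sub>R x) = t * P x"
proof (cases "t = 0")
  case True
  have "P 0 \<le> 0" using assms unfolding sublinear_def by (metis mult_zero_left order_refl scaleR_zero_left)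
  moreover have "P 0 \<le> P 0 + P 0" using assms unfolding sublinear_def by (metis add_0)
  ultimately show ?thesis using True by simp
next
  case False
  then have t: "t > 0" using assms by simp
  have "P ((1/t) *\<^sub>R (t *\<^sub>R x)) \<le> (1/t) * P (t *\<^sub>R x)"
    using assms t unfolding sublinear_def by (meson less_eq_real_def zero_less_divide_1_iff)
  then have "t * P x \<le> P (t *\<^sub>R x)" using t by (simp add: field_simps)
  then show ?thesis using assms unfolding sublinear_def by (meson antisym)
qed

lemma sublinear_lower: assumes "sublinear P" shows "- P (- x) \<le> P x"
proof -
  have "P (x + - x) \<le> P x + P (- x)" using assms unfolding sublinear_def by blast
  moreover have "P (0 *\<^sub>R x) = 0 * P x" by (rule sublinear_scale[OF assms]) simp
  ultimately show ?thesis by simp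
qed

text \<open>Two members of a chain can both be bounded below by the smaller of them; this is where subadditivity
  of the infimum comes from.\<close>

lemma sublinear_Inf_chain:
  assumes ne: "C \<noteq> {}" and sub: "\<And>Q. Q \<in> C \<Longrightarrow> sublinear Q"
    and chain: "\<And>Q R. Q \<in> C \<Longrightarrow> R \<in> C \<Longrightarrow> Q \<le> R \<or> R \<le> Q"
    and bdd: "\<And>x. bdd_below ((\<lambda>Q. Q x) ` C)"
  shows "sublinear (\<lambda>x. INF Q\<in>C. Q x)"
  unfolding sublinear_def
proof (intro conjI allI impI)
  let ?I = "\<lambda>x. INF Q\<in>C. Q x"
  fix x y
  have le: "?I (x + y) \<le> Q x + R y" if Q: "Q \<in> C" and R: "R \<in> C" for Q R
  proof -
    obtain T where T: "T \<in> C" "T \<le> Q" "T \<le> R" using chain[OF Q R] Q R by auto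
    have "?I (x + y) \<le> T (x + y)" by (rule cINF_lower[OF bdd T(1)])
    also have "\<dots> \<le> T x + T y" using sub[OF T(1)] unfolding sublinear_def by blast
    also have "\<dots> \<le> Q x + R y" using T by (auto simp: le_fun_def intro: add_mono)
    finally show ?thesis .
  qed
  have "?I (x + y) - R y \<le> ?I x" if R: "R \<in> C" for R
    by (rule cINF_greatest[OF ne]) (use le R in \<open>force simp: algebra_simps\<close>)
  then have "?I (x + y) - ?I x \<le> ?I y"
    by (intro cINF_greatest[OF ne]) (force simp: algebra_simps)
  then show "?I (x + y) \<le> ?I x + ?I y" by simp
next
  let ?I = "\<lambda>x. INF Q\<in>C. Q x"
  fix t :: real and x assume t: "0 \<le> t"
  have le: "?I (t *\<^sub>R x) \<le> t * Q x" if "Q \<in> C" for Q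
  proof -
    have "?I (t *\<^sub>R x) \<le> Q (t *\<^sub>R x)" by (rule cINF_lower[OF bdd that])
    then show ?thesis using sublinear_scale[OF sub[OF that] t] by simp
  qed
  show "?I (t *\<^sub>R x) \<le> t * ?I x"
  proof (cases "t = 0")
    case True then show ?thesis using le ne by auto
  next
    case False
    then have "?I (t *\<^sub>R x) / t \<le> ?I x"
      by (intro cINF_greatest[OF ne]) (use le t in \<open>auto simp: field_simps\<close>)
    then show ?thesis using False t by (simp add: field_simps)
  qed
qed

text \<open>The infimum over \<open>t \<ge> 0\<close> of \<open>Q (y + t *\<^sub>R z) - t * Q z\<close> is
  sublinear and at most \<open>Q y\<close>, hence equal to it by minimality. The value at \<open>t = 1\<close>
  is the claim.\<close>

lemma minimal_sublinear_superadditive: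
  assumes Q: "sublinear Q" and min: "\<And>R. sublinear R \<Longrightarrow> R \<le> Q \<Longrightarrow> R = Q"
  shows "Q y + Q z \<le> Q (y + z)"
proof -
  let ?R = "\<lambda>y. INF t\<in>{0::real..}. Q (y + t *\<^sub>R z) - t * Q z"
  have add: "\<And>x y. Q (x + y) \<le> Q x + Q y" using Q unfolding sublinear_def by blast
  have bdd: "bdd_below ((\<lambda>t. Q (y + t *\<^sub>R z) - t * Q z) ` {0::real..})" for y
  proof (rule bdd_belowI2)
    fix t :: real assume "t \<in> {0..}"
    have "Q (t *\<^sub>R z) \<le> Q (- y) + Q (y + t *\<^sub>R z)" using add[of "- y" "y + t *\<^sub>R z"] by simp
    then show "- Q (- y) \<le> Q (y + t *\<^sub>R z) - t * Q z"
      using sublinear_scale[OF Q, of t z] \<open>t \<in> {0..}\<close> by simp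
  qed
  have low: "?R y \<le> Q (y + t *\<^sub>R z) - t * Q z" if "t \<ge> 0" for y t
    by (rule cINF_lower[OF bdd]) (use that in simp)
  have "sublinear ?R" unfolding sublinear_def
  proof (intro conjI allI impI)
    fix x y
    have le: "?R (x + y) \<le> (Q (x + s *\<^sub>R z) - s * Q z) + (Q (y + t *\<^sub>R z) - t * Q z)"
      if "s \<ge> 0" "t \<ge> 0" for s t
    proof -
      have "Q (x + y + (s + t) *\<^sub>R z) \<le> Q (x + s *\<^sub>R z) + Q (y + t *\<^sub>R z)"
        using add[of "x + s *\<^sub>R z" "y + t *\<^sub>R z"] by (simp add: algebra_simps)
      with low[of "s + t" "x + y"] that show ?thesis by (simp add: algebra_simps)
    qed
    have "?R (x + y) - (Q (y + t *\<^sub>R z) - t * Q z) \<le> ?R x" if "t \<ge> 0" for t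
      by (rule cINF_greatest) (use le[OF _ that] in \<open>force simp: algebra_simps\<close>)+
    then have "?R (x + y) - ?R x \<le> ?R y"
      by (intro cINF_greatest) (force simp: algebra_simps)+
    then show "?R (x + y) \<le> ?R x + ?R y" by simp
  next
    fix s :: real and x assume s: "0 \<le> s"
    have le: "?R (s *\<^sub>R x) \<le> s * (Q (x + t *\<^sub>R z) - t * Q z)" if "t \<ge> 0" for t
      using low[of "s * t" "s *\<^sub>R x"] sublinear_scale[OF Q s, of "x + t *\<^sub>R z"] s that
      by (simp add: algebra_simps)
    show "?R (s *\<^sub>R x) \<le> s * ?R x"
    proof (cases "s = 0")
      case True then show ?thesis using le[of 0] by simp
    next
      case False
      then have "?R (s *\<^sub>R x) / s \<le> ?R x"
        by (intro cINF_greatest) (use le s in \<open>auto simp: field_simps\<close>)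
      then show ?thesis using False s by (simp add: field_simps)
    qed
  qed
  moreover have "?R \<le> Q" using low[of 0] by (simp add: le_fun_def)
  ultimately have "?R = Q" by (rule min)
  then have "Q y = ?R y" by (rule fun_cong[OF sym])
  with low[of 1 y] show ?thesis by simp
qed

text \<open>By Zorn's lemma there is a minimal sublinear functional below \<open>P\<close>, and minimal ones are
  additive.\<close>

lemma ex_linear_below_sublinear:
  fixes P :: "'a::real_vector \<Rightarrow> real"
  assumes P: "sublinear P"
  shows "\<exists>L. linear L \<and> (\<forall>x. L x \<le> P x)"
proof -
  let ?A = "{Q. sublinear Q \<and> Q \<le> P}"
  let ?ge = "\<lambda>Q R. (R::'a \<Rightarrow> real) \<le> Q"
  have "\<exists>m\<in>?A. \<forall>a\<in>?A. ?ge m a \<longrightarrow> a = m"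
  proof (rule predicate_Zorn)
    show "partial_order_on ?A (relation_of ?ge ?A)"
      by (rule partial_order_on_relation_ofI) auto
    fix C assume C: "C \<in> Chains (relation_of ?ge ?A)"
    have CA: "Q \<in> C \<Longrightarrow> sublinear Q \<and> Q \<le> P" for Q
      using C unfolding Chains_def relation_of_def by blast
    show "\<exists>u\<in>?A. \<forall>a\<in>C. ?ge a u"
    proof (cases "C = {}")
      case True then show ?thesis using P by auto
    next
      case False
      have bdd: "bdd_below ((\<lambda>Q. Q x) ` C)" for x
      proof (rule bdd_belowI2)
        fix Q assume "Q \<in> C"
        then have "Q (- x) \<le> P (- x)" "- Q (- x) \<le> Q x"
          using CA sublinear_lower by (auto simp: le_fun_def)
        then show "- P (- x) \<le> Q x" by linarith
      qed
      let ?I = "\<lambda>x. INF Q\<in>C. Q x"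
      have "sublinear ?I"
        by (rule sublinear_Inf_chain[OF False]) (use CA C bdd in \<open>auto simp: Chains_def relation_of_def\<close>)
      moreover have low: "?I \<le> Q" if "Q \<in> C" for Q
        using cINF_lower[OF bdd that] by (simp add: le_fun_def)
      moreover have "?I \<le> P" using False low CA by (meson all_not_in_conv order_trans)
      ultimately show ?thesis by blast
    qed
  qed
  then obtain Q where Q: "sublinear Q" "Q \<le> P" and min: "\<And>R. sublinear R \<Longrightarrow> R \<le> P \<Longrightarrow> R \<le> Q \<Longrightarrow> R = Q"
    by auto
  have min': "R = Q" if "sublinear R" "R \<le> Q" for R using min that Q(2) by (meson order_trans)
  have add: "Q (y + z) = Q y + Q z" for y z
    using minimal_sublinear_superadditive[OF Q(1) min'] Q(1) unfolding sublinear_def by (meson antisym)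
  have zero: "Q 0 = 0" using add[of 0 0] by simp
  have neg: "Q (- x) = - Q x" for x using add[of x "- x"] zero by simp
  have "Q (r *\<^sub>R x) = r * Q x" for r x
  proof (cases "r \<ge> 0")
    case True then show ?thesis using sublinear_scale[OF Q(1)] by simp
  next
    case False
    then show ?thesis using sublinear_scale[OF Q(1), of "- r" x] neg[of "r *\<^sub>R x"] by simp
  qed
  then have "linear Q" using add by (intro linearI) auto
  then show ?thesis using Q(2) by (auto simp: le_fun_def)
qed

text \<open>The functional \<open>z \<mapsto> INF w\<in>W. P (z + w) - L0 w\<close> is sublinear. A linear
  functional below it is at most \<open>L0\<close> on \<open>W\<close>, and therefore equal to it, because
  \<open>W\<close> contains \<open>- w\<close> along with \<open>w\<close>.\<close>

lemma Hahn_Banach_sublinear: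
  fixes P :: "'a::real_vector \<Rightarrow> real"
  assumes P: "sublinear P" and W: "subspace W" and L0: "linear L0"
    and le: "\<And>w. w \<in> W \<Longrightarrow> L0 w \<le> P w"
  obtains L where "linear L" "\<And>w. w \<in> W \<Longrightarrow> L w = L0 w" "\<And>x. L x \<le> P x"
proof -
  let ?Q = "\<lambda>z. INF w\<in>W. P (z + w) - L0 w"
  have ne: "W \<noteq> {}" using subspace_0[OF W] by auto
  have add: "\<And>x y. P (x + y) \<le> P x + P y" using P unfolding sublinear_def by blast
  have bdd: "bdd_below ((\<lambda>w. P (z + w) - L0 w) ` W)" for z
  proof (rule bdd_belowI2)
    fix w assume "w \<in> W"
    then show "- P (- z) \<le> P (z + w) - L0 w" using le[of w] add[of "- z" "z + w"] by simp
  qed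
  have low: "?Q z \<le> P (z + w) - L0 w" if "w \<in> W" for z w
    by (rule cINF_lower[OF bdd that])
  have "sublinear ?Q" unfolding sublinear_def
  proof (intro conjI allI impI)
    fix x y
    have le: "?Q (x + y) \<le> (P (x + s) - L0 s) + (P (y + t) - L0 t)" if "s \<in> W" "t \<in> W" for s t
      using low[OF subspace_add[OF W that], of "x + y"] add[of "x + s" "y + t"] linear_add[OF L0, of s t]
      by (simp add: algebra_simps)
    have "?Q (x + y) - (P (y + t) - L0 t) \<le> ?Q x" if "t \<in> W" for t
      by (rule cINF_greatest[OF ne]) (use le[OF _ that] in \<open>force simp: algebra_simps\<close>)+
    then have "?Q (x + y) - ?Q x \<le> ?Q y"
      by (intro cINF_greatest[OF ne]) (force simp: algebra_simps)+
    then show "?Q (x + y) \<le> ?Q x + ?Q y" by simp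
  next
    fix s :: real and x assume s: "0 \<le> s"
    have le: "?Q (s *\<^sub>R x) \<le> s * (P (x + t) - L0 t)" if "t \<in> W" for t
      using low[OF subspace_scale[OF W that], of "s *\<^sub>R x" s] sublinear_scale[OF P s, of "x + t"] 
        linear_cmul[OF L0, of s t] by (simp add: algebra_simps)
    show "?Q (s *\<^sub>R x) \<le> s * ?Q x"
    proof (cases "s = 0")
      case True then show ?thesis using le[OF subspace_0[OF W]] by simp
    next
      case False
      then have "?Q (s *\<^sub>R x) / s \<le> ?Q x"
        by (intro cINF_greatest[OF ne]) (use le s in \<open>auto simp: field_simps\<close>)
      then show ?thesis using False s by (simp add: field_simps)
    qed
  qed
  then obtain L where L: "linear L" "\<And>x. L x \<le> ?Q x" using ex_linear_below_sublinear by blast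
  have P0: "P 0 = 0" using sublinear_scale[OF P, of 0 0] by simp
  have Lle: "L w \<le> L0 w" if "w \<in> W" for w
    using L(2)[of w] low[OF subspace_neg[OF W that], of w] P0 linear_neg[OF L0, of w] by simp
  have "L w = L0 w" if "w \<in> W" for w
    using Lle[OF that] Lle[OF subspace_neg[OF W that]] linear_neg[OF L0, of w] linear_neg[OF L(1), of w]
    by simp
  moreover have "L x \<le> P x" for x
    using L(2)[of x] low[OF subspace_0[OF W], of x] linear_0[OF L0] by simp
  ultimately show ?thesis using that L(1) by blast
qed

text \<open>The sublinear bound is \<open>K\<close> times the Minkowski gauge of \<open>S\<close>. Both duality
  results below are instances: there \<open>S\<close> encodes the dual constraints and \<open>W\<close> the
  differential equation.\<close>

lemma Hahn_Banach_absorbing: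
  fixes S :: "'a::real_vector set" and K :: real
  assumes S: "convex S" "0 \<in> S" and absorb: "\<And>z. \<exists>t>0. (1 / t) *\<^sub>R z \<in> S"
    and W: "subspace W" and L0: "linear L0" and K: "0 \<le> K"
    and le: "\<And>w. w \<in> W \<Longrightarrow> w \<in> S \<Longrightarrow> L0 w \<le> K"
  obtains L where "linear L" "\<And>w. w \<in> W \<Longrightarrow> L w = L0 w" "\<And>z. z \<in> S \<Longrightarrow> L z \<le> K"
proof -
  let ?T = "\<lambda>z. {t. t > 0 \<and> (1 / t) *\<^sub>R z \<in> S}"
  let ?g = "\<lambda>z. Inf (?T z)"
  have ne: "?T z \<noteq> {}" for z using absorb[of z] by blast
  have bdd: "bdd_below (?T z)" for z by (rule bdd_belowI[of _ 0]) auto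
  have low: "?g z \<le> t" if "t > 0" "(1 / t) *\<^sub>R z \<in> S" for z t
    by (rule cInf_lower[OF _ bdd]) (use that in auto)
  have g0: "0 \<le> ?g z" for z by (rule cInf_greatest[OF ne]) auto
  have "sublinear ?g" unfolding sublinear_def
  proof (intro conjI allI impI)
    fix x y
    have le: "?g (x + y) \<le> s + t" if "s \<in> ?T x" "t \<in> ?T y" for s t
    proof (rule low)
      show "s + t > 0" using that by auto
      have "(s / (s + t)) *\<^sub>R ((1 / s) *\<^sub>R x) + (t / (s + t)) *\<^sub>R ((1 / t) *\<^sub>R y) \<in> S"
        using that by (intro convexD[OF S(1)]) (auto simp: add_divide_distrib[symmetric])
      then show "(1 / (s + t)) *\<^sub>R (x + y) \<in> S" using that by (simp add: algebra_simps)
    qed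
    have "?g (x + y) - t \<le> ?g x" if "t \<in> ?T y" for t
      by (rule cInf_greatest[OF ne]) (use le[OF _ that] in \<open>force simp: algebra_simps\<close>)+
    then have "?g (x + y) - ?g x \<le> ?g y"
      by (intro cInf_greatest[OF ne]) (force simp: algebra_simps)+
    then show "?g (x + y) \<le> ?g x + ?g y" by simp
  next
    fix s :: real and x assume s: "0 \<le> s"
    show "?g (s *\<^sub>R x) \<le> s * ?g x"
    proof (cases "s = 0")
      case True
      have "?g 0 \<le> 0" by (rule field_le_epsilon) (use low[of _ 0] S in auto)
      then show ?thesis using True by simp
    next
      case False
      have "?g (s *\<^sub>R x) \<le> s * t" if "t \<in> ?T x" for t
        by (rule low) (use that False s in auto)
      then have "?g (s *\<^sub>R x) / s \<le> ?g x"
        by (intro cInf_greatest[OF ne]) (use False s in \<open>auto simp: field_simps\<close>)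
      then show ?thesis using False s by (simp add: field_simps)
    qed
  qed
  then have sub: "sublinear (\<lambda>z. K * ?g z)"
    using K unfolding sublinear_def
    by (metis (no_types, lifting) distrib_left mult.left_commute mult_left_mono)
  have "L0 w \<le> K * ?g w" if w: "w \<in> W" for w
  proof -
    have *: "L0 w \<le> K * t" if "t \<in> ?T w" for t
    proof -
      have "L0 ((1 / t) *\<^sub>R w) \<le> K" using le[OF subspace_scale[OF W w]] that by blast
      then show ?thesis using that linear_cmul[OF L0, of "1 / t" w] by (auto simp: field_simps)
    qed
    show ?thesis
    proof (cases "K = 0")
      case True then show ?thesis using * ne[of w] by auto
    next
      case False
      then have "L0 w / K \<le> ?g w"
        by (intro cInf_greatest[OF ne]) (use * K in \<open>auto simp: field_simps\<close>)
      then show ?thesis using False K by (simp add: field_simps)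
    qed
  qed
  then obtain L where L: "linear L" "\<And>w. w \<in> W \<Longrightarrow> L w = L0 w" "\<And>z. L z \<le> K * ?g z"
    using Hahn_Banach_sublinear[OF sub W L0] by blast
  have "L z \<le> K" if "z \<in> S" for z
  proof -
    have "?g z \<le> 1" by (rule low) (use that in auto)
    then have "K * ?g z \<le> K" using K by (metis mult.right_neutral mult_left_mono)
    then show ?thesis using L(3)[of z] by simp
  qed
  then show ?thesis using that L by blast
qed


section \<open>Riesz representation on functions with compact support\<close>

definition Cc :: "('a::topological_space \<Rightarrow> real) set" where
  "Cc = {g. continuous_on UNIV g \<and> (\<exists>K. compact K \<and> (\<forall>x. x \<notin> K \<longrightarrow> g x = 0))}"

lemma Cc_continuous: "g \<in> Cc \<Longrightarrow> continuous_on UNIV g"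
  by (simp add: Cc_def)

lemma Cc_measurable [measurable]: "g \<in> Cc \<Longrightarrow> g \<in> borel_measurable borel"
  by (intro borel_measurable_continuous_onI Cc_continuous)

lemma Cc_I: 
  assumes "g \<in> Cc" "continuous_on UNIV h" "\<And>x. g x = 0 \<Longrightarrow> h x = 0" shows "h \<in> Cc"
  using assms unfolding Cc_def by blast

lemma Cc_add: 
  assumes "g \<in> Cc" "h \<in> Cc" shows "(\<lambda>x. g x + h x) \<in> Cc"
proof -
  obtain K K' where "compact K" "\<And>x. x \<notin> K \<Longrightarrow> g x = 0" "compact K'" "\<And>x. x \<notin> K' \<Longrightarrow> h x = 0"
    using assms unfolding Cc_def by auto
  then show ?thesis using assms unfolding Cc_def
    by (auto intro!: continuous_intros exI[of _ "K \<union> K'"] compact_Un)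
qed

lemma Cc_cmult: assumes "g \<in> Cc" shows "(\<lambda>x. c * g x) \<in> Cc"
  by (rule Cc_I[OF assms]) (auto intro!: continuous_intros Cc_continuous[OF assms])

lemma Cc_diff: 
  assumes "g \<in> Cc" "h \<in> Cc" shows "(\<lambda>x. g x - h x) \<in> Cc"
  using Cc_add[OF assms(1) Cc_cmult[OF assms(2), of "-1"]] by simp

lemma Cc_zero: "(\<lambda>x. 0) \<in> Cc" unfolding Cc_def by (auto intro!: exI[of _ "{}"])

lemma Cc_sum: "finite I \<Longrightarrow> (\<And>i. i \<in> I \<Longrightarrow> g i \<in> Cc) \<Longrightarrow> (\<lambda>x. \<Sum>i\<in>I. g i x) \<in> Cc"
  by (induction I rule: finite_induct) (auto intro: Cc_zero Cc_add)

lemma Cc_bounded: assumes "g \<in> Cc" obtains c where "c > 0" "\<And>x. \<bar>g x\<bar> \<le> c"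
proof -
  obtain K where K: "compact K" "\<And>x. x \<notin> K \<Longrightarrow> g x = 0" using assms unfolding Cc_def by auto
  have "compact (g ` K)" using K(1) Cc_continuous[OF assms] 
    by (meson compact_continuous_image continuous_on_subset subset_UNIV)
  then obtain c where c: "c > 0" "\<And>x. x \<in> K \<Longrightarrow> \<bar>g x\<bar> \<le> c"
    using compact_imp_bounded[of "g ` K"] unfolding bounded_pos by auto
  have "\<bar>g x\<bar> \<le> c" for x using c K(2)[of x] by (cases "x \<in> K") auto
  then show ?thesis using that c(1) by blast
qed

lemma compact_superlevel:
  fixes g :: "'a::t2_space \<Rightarrow> real"
  assumes "g \<in> Cc" "e > 0" shows "compact {x. e \<le> g x}"
proof -
  obtain K where K: "compact K" "\<And>x. x \<notin> K \<Longrightarrow> g x = 0" using assms unfolding Cc_def by auto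
  have "closed {x. e \<le> g x}" using Cc_continuous[OF assms(1)] by (intro closed_Collect_le) auto
  moreover have "{x. e \<le> g x} = K \<inter> {x. e \<le> g x}" using K(2) assms(2) by force
  ultimately show ?thesis using K(1) by (metis compact_Int_closed)
qed

text \<open>A compactly supported majorant of the indicator of \<open>K\<close>; it converts uniform bounds on
  \<open>K\<close> into bounds for a positive functional.\<close>

lemma Cc_plateau:
  fixes K :: "'a::euclidean_space set"
  assumes "compact K" obtains w where "w \<in> Cc" "\<And>x. 0 \<le> w x" "\<And>x. w x \<le> 1" "\<And>x. x \<in> K \<Longrightarrow> w x = 1"
proof -
  obtain r where r: "\<And>x. x \<in> K \<Longrightarrow> norm x \<le> r" using compact_imp_bounded[OF assms] bounded_iff by blast
  let ?w = "\<lambda>x::'a. max 0 (min 1 (r + 1 - norm x))"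
  have "?w \<in> Cc" unfolding Cc_def
    by (intro CollectI conjI continuous_intros exI[of _ "cball 0 (r+1)"]) auto
  moreover have "x \<in> K \<Longrightarrow> ?w x = 1" for x using r[of x] by auto
  ultimately show ?thesis using that[of ?w] by auto
qed

locale bounded_positive_functional =
  fixes L :: "('a::euclidean_space \<Rightarrow> real) \<Rightarrow> real" and B :: real
  assumes add: "g \<in> Cc \<Longrightarrow> h \<in> Cc \<Longrightarrow> L (\<lambda>x. g x + h x) = L g + L h"
    and cmult: "g \<in> Cc \<Longrightarrow> L (\<lambda>x. c * g x) = c * L g"
    and pos: "g \<in> Cc \<Longrightarrow> (\<And>x. 0 \<le> g x) \<Longrightarrow> 0 \<le> L g"
    and bdd: "g \<in> Cc \<Longrightarrow> (\<And>x. g x \<le> 1) \<Longrightarrow> L g \<le> B"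
begin

lemma diff: "g \<in> Cc \<Longrightarrow> h \<in> Cc \<Longrightarrow> L (\<lambda>x. g x - h x) = L g - L h"
  using add[of g "\<lambda>x. (-1) * h x"] cmult[of h "-1"] Cc_cmult[of h "-1"] by simp

lemma mono: "g \<in> Cc \<Longrightarrow> h \<in> Cc \<Longrightarrow> (\<And>x. g x \<le> h x) \<Longrightarrow> L g \<le> L h"
  using pos[of "\<lambda>x. h x - g x"] diff[of h g] Cc_diff[of h g] by simp

lemma zero: "L (\<lambda>x. 0) = 0"
  using cmult[OF Cc_zero, of 0] by simp

lemma sum: "finite I \<Longrightarrow> (\<And>i. i \<in> I \<Longrightarrow> g i \<in> Cc) \<Longrightarrow> L (\<lambda>x. \<Sum>i\<in>I. g i x) = (\<Sum>i\<in>I. L (g i))"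
proof (induction I rule: finite_induct)
  case (insert i I)
  then show ?case using add[of "g i" "\<lambda>x. \<Sum>i\<in>I. g i x"] Cc_sum[of I g] by simp
qed (simp add: zero)

definition below :: "'a set \<Rightarrow> ('a \<Rightarrow> real) set" where
  "below U = {g \<in> Cc. \<forall>x. 0 \<le> g x \<and> g x \<le> indicat_real U x}"

text \<open>The value that a representing measure has to give to the open set \<open>U\<close>;
  \<open>outer\<close> extends it by outer regularity.\<close>

definition content :: "'a set \<Rightarrow> ennreal" where
  "content U = (SUP g\<in>below U. ennreal (L g))"

definition outer :: "'a set \<Rightarrow> ennreal" where
  "outer E = (INF U\<in>{U. open U \<and> E \<subseteq> U}. content U)"

lemma below_ne: "below U \<noteq> {}" using Cc_zero unfolding below_def by auto

lemma content_upper: "g \<in> below U \<Longrightarrow> ennreal (L g) \<le> content U"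
  unfolding content_def by (rule SUP_upper)

lemma below_mono: "U \<subseteq> V \<Longrightarrow> below U \<subseteq> below V"
  unfolding below_def by (auto simp: indicator_def split: if_splits) (metis order_trans zero_le_one)+

lemma content_mono: "U \<subseteq> V \<Longrightarrow> content U \<le> content V"
  unfolding content_def by (intro SUP_subset_mono below_mono) auto

lemma content_bounded: "content U \<le> ennreal B"
  unfolding content_def
proof (rule SUP_least)
  fix g assume "g \<in> below U"
  then have "g \<in> Cc" "g x \<le> 1" for x
    using order_trans[OF _ indicator_le_1[of U x], of "g x"] unfolding below_def by blast+
  then show "ennreal (L g) \<le> ennreal B" using bdd by (intro ennreal_leI) auto
qed

lemma outer_upper: "open U \<Longrightarrow> E \<subseteq> U \<Longrightarrow> outer E \<le> content U"
  unfolding outer_def by (rule INF_lower) auto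

lemma outer_open: "open U \<Longrightarrow> outer U = content U"
  by (intro antisym outer_upper) (auto simp: outer_def intro!: INF_greatest content_mono)

lemma outer_mono: "E \<subseteq> F \<Longrightarrow> outer E \<le> outer F"
  unfolding outer_def by (rule INF_superset_mono) auto

lemma Cc_truncate: "g \<in> Cc \<Longrightarrow> e \<ge> 0 \<Longrightarrow> (\<lambda>x. max 0 (g x - e)) \<in> Cc"
  by (rule Cc_I, assumption, intro continuous_intros, rule Cc_continuous) auto

text \<open>Lowering \<open>g\<close> by \<open>e\<close> confines it to the compact set
  \<open>{x. e \<le> g x}\<close>. The loss is at most \<open>e\<close> times a plateau function on the support
  of \<open>g\<close>, so it vanishes with \<open>e\<close>.\<close>

lemma truncate:
  assumes g: "g \<in> Cc" and d: "\<delta> > 0"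
  obtains e where "e > 0" "L g \<le> L (\<lambda>x. max 0 (g x - e)) + \<delta>"
proof -
  obtain K where K: "compact K" "\<And>x. x \<notin> K \<Longrightarrow> g x = 0" using g unfolding Cc_def by auto
  obtain w where w: "w \<in> Cc" "\<And>x. 0 \<le> w x" "\<And>x. w x \<le> 1" "\<And>x. x \<in> K \<Longrightarrow> w x = 1"
    using Cc_plateau[OF K(1)] by blast
  let ?e = "\<delta> / (L w + 1)"
  have L0: "0 \<le> L w" using pos w by auto
  have e: "?e > 0" using L0 d by (simp add: add_nonneg_pos)
  have le: "g x \<le> max 0 (g x - ?e) + ?e * w x" for x
    using mult_nonneg_nonneg[OF less_imp_le[OF e] w(2)[of x]] w(4)[of x] K(2)[of x] e by (cases "x \<in> K") auto
  have "L g \<le> L (\<lambda>x. max 0 (g x - ?e) + ?e * w x)"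
    by (rule mono[OF g _ le]) (intro Cc_add Cc_truncate g Cc_cmult w(1) less_imp_le[OF e])
  also have "\<dots> = L (\<lambda>x. max 0 (g x - ?e)) + ?e * L w"
    using add[OF Cc_truncate[OF g less_imp_le[OF e]] Cc_cmult[OF w(1), of ?e]] cmult[OF w(1), of ?e] by simp
  also have "?e * L w \<le> \<delta>" using L0 d by (simp add: field_simps)
  finally show ?thesis using that e by simp
qed

text \<open>After truncation a function below the indicator of the union lives on a compact set, hence on
  finitely many \<open>U i\<close>, and is split by a partition of unity made of the distances to the
  complements. The lower bound \<open>m\<close> of their sum on the compact set keeps the quotients continuous
  everywhere.\<close>

lemma content_subadditive:
  fixes U :: "nat \<Rightarrow> 'a set"
  assumes op: "\<And>i. open (U i)"
  shows "content (\<Union>i. U i) \<le> (\<Sum>i. content (U i))"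
  unfolding content_def[of "\<Union>i. U i"]
proof (rule SUP_least)
  fix g assume g: "g \<in> below (\<Union>i. U i)"
  then have gC: "g \<in> Cc" and g0: "\<And>x. 0 \<le> g x" and g1: "\<And>x. g x \<le> indicator (\<Union>i. U i) x"
    unfolding below_def by auto
  show "ennreal (L g) \<le> (\<Sum>i. content (U i))"
  proof (rule ennreal_le_epsilon)
    fix \<delta> :: real assume "\<delta> > 0"
    then obtain e where e: "e > 0" "L g \<le> L (\<lambda>x. max 0 (g x - e)) + \<delta>" using truncate[OF gC] by blast
    let ?K = "{x. e \<le> g x}"
    have "?K \<subseteq> (\<Union>i. U i)"
    proof
      fix x assume "x \<in> ?K" then show "x \<in> (\<Union>i. U i)" using g1[of x] e(1) by (cases "x \<in> (\<Union>i. U i)") auto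
    qed
    then obtain I where I: "finite I" "?K \<subseteq> (\<Union>i\<in>I. U i)"
      using compactE_image[OF compact_superlevel[OF gC e(1)], of UNIV U] op by metis
    \<comment> \<open>\<open>infdist\<close> to the empty set is \<open>0\<close>, so the whole space needs a value of its own.\<close>
    define d where "d i x = (if U i = UNIV then 1 else infdist x (- U i))" for i x
    have dc: "continuous_on UNIV (d i)" for i unfolding d_def 
      by (cases "U i = UNIV") (auto intro!: continuous_intros)
    have d0: "0 \<le> d i x" for i x unfolding d_def by (auto intro: infdist_nonneg)
    have dpos: "0 < d i x" if "x \<in> U i" for i x
    proof (cases "U i = UNIV")
      case False
      then have "infdist x (- U i) \<noteq> 0" using in_closed_iff_infdist_zero[of "- U i" x] op[of i] that by auto
      then show ?thesis using d0[of i x] False unfolding d_def by auto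
    qed (simp add: d_def)
    have dz: "d i x = 0" if "x \<notin> U i" for i x using that unfolding d_def by auto
    let ?s = "\<lambda>x. \<Sum>i\<in>I. d i x"
    have sc: "continuous_on UNIV ?s" by (intro continuous_intros dc)
    have "\<exists>m>0. \<forall>x\<in>?K. m \<le> ?s x"
    proof (cases "?K = {}")
      case False
      then obtain x0 where x0: "x0 \<in> ?K" "\<And>x. x \<in> ?K \<Longrightarrow> ?s x0 \<le> ?s x"
        using continuous_attains_inf[OF compact_superlevel[OF gC e(1)] False, of ?s] 
          continuous_on_subset[OF sc] by blast
      obtain i where "i \<in> I" "x0 \<in> U i" using I x0(1) by blast
      then have "?s x0 > 0" using I(1) dpos d0 by (meson sum_pos2)
      then show ?thesis using x0 by blast
    qed (auto intro: exI[of _ 1])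
    then obtain m where m: "m > 0" "\<And>x. x \<in> ?K \<Longrightarrow> m \<le> ?s x" by blast
    let ?g = "\<lambda>x. max 0 (g x - e)"
    define h where "h i x = ?g x * (d i x / max (?s x) m)" for i x
    have mx: "max (?s x) m > 0" for x using m by auto
    have hC: "h i \<in> Cc" for i unfolding h_def
      by (rule Cc_I[OF gC]) (use e mx in \<open>auto intro!: continuous_intros dc Cc_continuous[OF gC] simp: less_imp_neq[THEN not_sym]\<close>)
    have hb: "h i \<in> below (U i)" if "i \<in> I" for i
    proof -
      have "0 \<le> h i x \<and> h i x \<le> indicator (U i) x" for x
      proof -
        have "d i x \<le> ?s x" using member_le_sum[OF that, of "\<lambda>i. d i x"] d0 I(1) by simp
        then have q: "0 \<le> d i x / max (?s x) m" "d i x / max (?s x) m \<le> 1" using d0[of i x] mx[of x]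
          by (auto simp: divide_le_eq_1)
        have "g x \<le> 1" using g1[of x] by (smt (verit) indicator_le_1)
        then have "?g x \<le> 1" "0 \<le> ?g x" using e(1) by auto
        then have "0 \<le> h i x" "h i x \<le> 1" unfolding h_def using q
          by (meson mult_nonneg_nonneg mult_le_one)+
        then show ?thesis using dz[of x i] unfolding h_def by (cases "x \<in> U i") auto
      qed
      then show ?thesis using hC unfolding below_def by blast
    qed
    have hs: "(\<Sum>i\<in>I. h i x) = ?g x" for x
    proof (cases "x \<in> ?K")
      case True
      then show ?thesis using m(1) m(2)[of x] unfolding h_def 
        by (simp add: sum_distrib_left[symmetric] sum_divide_distrib[symmetric] max_def)
    qed (use e(1) in \<open>simp add: h_def\<close>)
    have "ennreal (L ?g) = ennreal (\<Sum>i\<in>I. L (h i))" using sum[OF I(1) hC, of "\<lambda>i. i"] hs by simp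
    also have "\<dots> = (\<Sum>i\<in>I. ennreal (L (h i)))"
      using pos[OF hC] hb unfolding below_def by (intro sum_ennreal[symmetric]) blast
    also have "\<dots> \<le> (\<Sum>i\<in>I. content (U i))" by (intro sum_mono content_upper hb)
    also have "\<dots> \<le> (\<Sum>i. content (U i))" by (rule sum_le_suminf) (auto intro: I(1))
    finally have 1: "ennreal (L ?g) \<le> (\<Sum>i. content (U i))" .
    have "0 \<le> L ?g" using e(1) by (intro pos Cc_truncate gC) auto
    then have 2: "ennreal (L g) \<le> ennreal (L ?g) + ennreal \<delta>"
      using e(2) \<open>\<delta> > 0\<close> by (simp add: ennreal_plus[symmetric] ennreal_leI del: ennreal_plus)
    show "ennreal (L g) \<le> (\<Sum>i. content (U i)) + ennreal \<delta>"
      by (rule order_trans[OF 2 add_right_mono[OF 1]])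
  qed
qed

lemma outer_subadditive: "outer (\<Union>i::nat. E i) \<le> (\<Sum>i. outer (E i))"
proof (rule ennreal_le_epsilon)
  fix \<delta> :: real assume d: "\<delta> > 0"
  have fin: "outer (E i) < \<infinity>" for i
    using order_trans[OF outer_upper[of UNIV "E i"] content_bounded] by (simp add: order_le_less_trans)
  have "\<exists>U. open U \<and> E i \<subseteq> U \<and> content U \<le> outer (E i) + ennreal (\<delta> * (1/2)^Suc i)" for i
  proof -
    have "(INF U\<in>{U. open U \<and> E i \<subseteq> U}. content U) < outer (E i) + ennreal (\<delta> * (1/2)^Suc i)"
    proof -
      have "outer (E i) + 0 < outer (E i) + ennreal (\<delta> * (1/2)^Suc i)"
        using fin[of i] d by (subst ennreal_add_left_cancel_less) auto
      then show ?thesis unfolding outer_def by simp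
    qed
    then obtain U where "U \<in> {U. open U \<and> E i \<subseteq> U}" "content U < outer (E i) + ennreal (\<delta> * (1/2)^Suc i)"
      unfolding INF_less_iff by (elim bexE)
    then show ?thesis by (intro exI[of _ U]) (simp add: less_imp_le)
  qed
  then obtain U where U: "\<And>i. open (U i)" "\<And>i. E i \<subseteq> U i"
      "\<And>i. content (U i) \<le> outer (E i) + ennreal (\<delta> * (1/2)^Suc i)" by metis
  have "outer (\<Union>i. E i) \<le> content (\<Union>i. U i)" using U by (intro outer_upper open_UN) blast+
  also have "\<dots> \<le> (\<Sum>i. content (U i))" by (rule content_subadditive[OF U(1)])
  also have "\<dots> \<le> (\<Sum>i. outer (E i) + ennreal (\<delta> * (1/2)^Suc i))" using U(3) by (intro suminf_le) auto
  also have "\<dots> = (\<Sum>i. outer (E i)) + (\<Sum>i. ennreal (\<delta> * (1/2)^Suc i))" by (rule suminf_add[symmetric]) auto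
  also have "(\<Sum>i. ennreal (\<delta> * (1/2)^Suc i)) = ennreal \<delta>"
    using d sums_mult[OF power_half_series, of \<delta>] by (intro suminf_ennreal_eq) auto
  finally show "outer (\<Union>i. E i) \<le> (\<Sum>i. outer (E i)) + ennreal \<delta>" .
qed

lemma outer_empty: "outer {} = 0"
proof -
  have "L g \<le> 0" if "g \<in> below {}" for g
    using that mono[OF _ Cc_zero, of g] zero unfolding below_def by auto
  then have "content {} \<le> 0" unfolding content_def by (intro SUP_least) (auto simp: ennreal_neg)
  then show ?thesis by (simp add: outer_open)
qed

text \<open>The Caratheodory condition for open sets. A function almost optimal for \<open>U \<inter> V\<close>
  is truncated to live on a compact set \<open>K\<close>; every function below the indicator of
  \<open>U - K\<close> can then be added to it without exceeding the indicator of \<open>U\<close>.\<close>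

lemma outer_split_open:
  assumes V: "open V"
  shows "outer (E \<inter> V) + outer (E - V) \<le> outer E"
proof -
  have "outer (E \<inter> V) + outer (E - V) \<le> content U" if U: "open U" "E \<subseteq> U" for U
  proof -
    have "ennreal (L g) + outer (E - V) \<le> content U" if g: "g \<in> below (U \<inter> V)" for g
    proof (rule ennreal_le_epsilon)
      fix \<delta> :: real assume d: "\<delta> > 0"
      have gC: "g \<in> Cc" and g0: "\<And>x. 0 \<le> g x" and g1: "\<And>x. g x \<le> indicator (U \<inter> V) x"
        using g unfolding below_def by auto
      obtain e where e: "e > 0" "L g \<le> L (\<lambda>x. max 0 (g x - e)) + \<delta>" using truncate[OF gC d] by blast
      let ?K = "{x. e \<le> g x}" and ?g = "\<lambda>x. max 0 (g x - e)"
      have gC': "?g \<in> Cc" using Cc_truncate[OF gC] e by auto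
      have KUV: "?K \<subseteq> U \<inter> V"
      proof
        fix x assume "x \<in> ?K" then show "x \<in> U \<inter> V" using g1[of x] e(1) by (cases "x \<in> U \<inter> V") auto
      qed
      have opn: "open (U - ?K)" using U(1) compact_imp_closed[OF compact_superlevel[OF gC e(1)]] by blast
      have "ennreal (L ?g) + content (U - ?K) = (SUP h\<in>below (U - ?K). ennreal (L ?g) + ennreal (L h))"
        unfolding content_def by (rule ennreal_SUP_add_right[OF below_ne])
      also have "\<dots> \<le> content U"
      proof (rule SUP_least)
        fix h assume h: "h \<in> below (U - ?K)"
        then have hC: "h \<in> Cc" and h0: "\<And>x. 0 \<le> h x" and h1: "\<And>x. h x \<le> indicator (U - ?K) x"
          unfolding below_def by auto
        have "0 \<le> ?g x + h x \<and> ?g x + h x \<le> indicator U x" for x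
        proof (cases "x \<in> ?K")
          case True
          then have "x \<in> U" "g x \<le> 1" using KUV order_trans[OF g1[of x] indicator_le_1] by auto
          then show ?thesis using h0[of x] h1[of x] e(1) True by auto
        next
          case False
          then show ?thesis using h0[of x] h1[of x] e(1) by (auto simp: indicator_def split: if_splits)
        qed
        then have "(\<lambda>x. ?g x + h x) \<in> below U" using Cc_add[OF gC' hC] unfolding below_def by auto
        from content_upper[OF this] show "ennreal (L ?g) + ennreal (L h) \<le> content U"
          using add[OF gC' hC] pos[OF gC'] pos[OF hC h0] by (simp add: ennreal_plus)
      qed
      finally have 1: "ennreal (L ?g) + content (U - ?K) \<le> content U" .
      have 2: "outer (E - V) \<le> content (U - ?K)" using U KUV by (intro outer_upper opn) blast
      have "0 \<le> L ?g" by (intro pos gC') auto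
      then have 3: "ennreal (L g) \<le> ennreal (L ?g) + ennreal \<delta>"
        using e(2) d by (simp add: ennreal_plus[symmetric] ennreal_leI del: ennreal_plus)
      have "ennreal (L g) + outer (E - V) \<le> (ennreal (L ?g) + ennreal \<delta>) + content (U - ?K)"
        by (rule add_mono[OF 3 2])
      also have "\<dots> = (ennreal (L ?g) + content (U - ?K)) + ennreal \<delta>" by (simp add: ac_simps)
      also have "\<dots> \<le> content U + ennreal \<delta>" by (rule add_right_mono[OF 1])
      finally show "ennreal (L g) + outer (E - V) \<le> content U + ennreal \<delta>" .
    qed
    then have 1: "content (U \<inter> V) + outer (E - V) \<le> content U"
      unfolding content_def[of "U \<inter> V"]
      by (subst ennreal_SUP_add_left[OF below_ne, symmetric]) (rule SUP_least)
    have "outer (E \<inter> V) \<le> content (U \<inter> V)" using U V by (intro outer_upper) auto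
    then show ?thesis by (rule order_trans[OF add_right_mono 1])
  qed
  then show ?thesis unfolding outer_def[of E] by (intro INF_greatest) auto
qed

lemma outer_measure_space: "measure_space UNIV (sets borel) outer"
proof -
  have oms: "outer_measure_space (Pow UNIV) outer"
    unfolding outer_measure_space_def positive_def increasing_def countably_subadditive_def
    using outer_mono outer_empty outer_subadditive by auto
  have alg: "algebra (UNIV::'a set) (Pow UNIV)" by (rule algebra_Pow)
  have ms: "measure_space UNIV (lambda_system UNIV (Pow UNIV) outer) outer"
    by (rule sigma_algebra.caratheodory_lemma[OF sigma_algebra_Pow oms])
  have "V \<in> lambda_system UNIV (Pow UNIV) outer" if "open V" for V
  proof -
    have "outer E \<le> outer (E \<inter> V) + outer (E - V)" for E
    proof -
      have sub: "subadditive (Pow UNIV) outer" 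
        using oms unfolding outer_measure_space_def
        by (intro ring_of_sets.countably_subadditive_subadditive[OF ring_of_sets_Pow]) auto
      have "outer ((E \<inter> V) \<union> (E - V)) \<le> outer (E \<inter> V) + outer (E - V)"
        by (rule subadditiveD[OF sub]) auto
      then show ?thesis by (simp add: Int_Diff_Un)
    qed
    then show ?thesis unfolding algebra.lambda_system_eq[OF alg]
      using outer_split_open[OF that] by (auto intro: antisym)
  qed
  then have "sets borel \<subseteq> lambda_system UNIV (Pow UNIV) outer"
    using ms unfolding sets_borel measure_space_def by (intro sigma_algebra.sigma_sets_subset) auto
  then show ?thesis by (intro measure_down[OF ms]) (auto simp: sets.sigma_algebra_axioms[of borel, simplified])
qed

definition repr :: "'a measure" where "repr = measure_of UNIV (sets borel) outer"

lemma sets_repr [measurable_cong, simp]: "sets repr = sets borel"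
  unfolding repr_def by (metis sets.sets_measure_of_eq space_borel)

lemma emeasure_repr: "E \<in> sets borel \<Longrightarrow> emeasure repr E = outer E"
  unfolding repr_def using outer_measure_space unfolding measure_space_def
  by (intro emeasure_measure_of_sigma) auto

lemma finite_measure_repr: "finite_measure repr"
proof
  have "emeasure repr UNIV \<le> ennreal B" using emeasure_repr[of UNIV] outer_open[of UNIV] content_bounded[of UNIV] by simp
  then show "emeasure repr (space repr) \<noteq> \<infinity>"
    by (auto simp: sets_eq_imp_space_eq[OF sets_repr] top_unique)
qed

lemma integrable_repr: assumes g: "g \<in> Cc" shows "integrable repr g"
proof -
  interpret finite_measure repr by (rule finite_measure_repr)
  obtain c where "\<And>x. \<bar>g x\<bar> \<le> c" using Cc_bounded[OF g] by blast
  then show ?thesis using g by (intro integrable_const_bound[of _ c]) auto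
qed

text \<open>Slice \<open>g\<close> horizontally into \<open>n\<close> layers of height \<open>1 / n\<close>.
  Both \<open>L\<close> and the integral of a layer lie between the measures of two consecutive superlevel sets,
  so the differences telescope to an error of order \<open>1 / n\<close>.\<close>

lemma representation_unit:
  assumes g: "g \<in> Cc" and g0: "\<And>x. 0 \<le> g x" and g1: "\<And>x. g x \<le> 1"
  shows "L g = (\<integral>x. g x \<partial>repr)"
proof -
  interpret finite_measure repr by (rule finite_measure_repr)
  have bound: "real n * \<bar>L g - (\<integral>x. g x \<partial>repr)\<bar> \<le> measure repr UNIV" if n: "n > 0" for n :: nat
  proof -
    define s where "s k x = min (max (real n * g x - real k) 0) 1" for k x
    have sC: "s k \<in> Cc" for k unfolding s_def
      by (rule Cc_I[OF g]) (auto intro!: continuous_intros Cc_continuous[OF g])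
    have s0: "0 \<le> s k x" for k x unfolding s_def by auto
    let ?U = "\<lambda>k::nat. {x. real k < real n * g x}"
    define t where "t k = measure repr (?U k)" for k
    have opU: "open (?U k)" for k using Cc_continuous[OF g] by (intro open_Collect_less continuous_intros) auto
    have tU: "content (?U k) = ennreal (t k)" for k
      using emeasure_repr[of "?U k"] outer_open[OF opU] opU unfolding t_def by (simp add: emeasure_eq_measure)
    have sum_s: "(\<Sum>k<n. s k x) = real n * g x" for x
    proof -
      have "(\<Sum>k<m. s k x) = min (real n * g x) (real m)" for m
        using g0[of x] by (induction m) (auto simp: s_def)
      then show ?thesis using g1[of x] by (simp add: min_def mult_left_le)
    qed
    have L_up: "L (s k) \<le> t k" for k
    proof -
      have "s k \<in> below (?U k)" unfolding below_def using sC s0 by (auto simp: s_def indicator_def)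
      from content_upper[OF this] show ?thesis unfolding tU by (simp add: t_def)
    qed
    have L_low: "t (Suc k) \<le> L (s k)" for k
    proof -
      have "content (?U (Suc k)) \<le> ennreal (L (s k))" unfolding content_def
      proof (rule SUP_least, rule ennreal_leI)
        fix h assume h: "h \<in> below (?U (Suc k))"
        have "h x \<le> s k x" for x
        proof (cases "x \<in> ?U (Suc k)")
          case True
          then have "s k x = 1" unfolding s_def by auto
          moreover have "h x \<le> 1" using h True unfolding below_def by (smt (verit) indicator_le_1 mem_Collect_eq)
          ultimately show ?thesis by simp
        next
          case False
          then have "h x \<le> 0" using h unfolding below_def by (auto dest!: spec[of _ x])
          then show ?thesis using s0[of k x] by simp
        qed
        then show "L h \<le> L (s k)" using h sC unfolding below_def by (intro mono) auto
      qed
      then show ?thesis unfolding tU using pos[OF sC s0] by (simp add: ennreal_le_iff)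
    qed
    have iI: "integrable repr (indicat_real (?U k))" for k
      using opU[of k] by (intro integrable_real_indicator) (auto simp: emeasure_eq_measure)
    have I_up: "(\<integral>x. s k x \<partial>repr) \<le> t k" for k
    proof -
      have "(\<integral>x. s k x \<partial>repr) \<le> (\<integral>x. indicator (?U k) x \<partial>repr)"
        by (intro integral_mono[OF integrable_repr[OF sC] iI]) (auto simp: s_def indicator_def)
      then show ?thesis using opU[of k] unfolding t_def by simp
    qed
    have I_low: "t (Suc k) \<le> (\<integral>x. s k x \<partial>repr)" for k
    proof -
      have "(\<integral>x. indicator (?U (Suc k)) x \<partial>repr) \<le> (\<integral>x. s k x \<partial>repr)"
        by (intro integral_mono[OF iI integrable_repr[OF sC]]) (auto simp: s_def indicator_def)
      then show ?thesis using opU[of "Suc k"] unfolding t_def by simp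
    qed
    have "real n * \<bar>L g - (\<integral>x. g x \<partial>repr)\<bar> = \<bar>real n * L g - real n * (\<integral>x. g x \<partial>repr)\<bar>"
      by (simp add: abs_mult right_diff_distrib[symmetric])
    also have "real n * L g = (\<Sum>k<n. L (s k))"
      using sum[of "{..<n}" s] sC cmult[OF g, of "real n"] sum_s by simp
    also have "real n * (\<integral>x. g x \<partial>repr) = (\<Sum>k<n. \<integral>x. s k x \<partial>repr)"
      using sum_s by (subst Bochner_Integration.integral_sum[symmetric]) (auto intro: integrable_repr sC)
    also have "\<bar>(\<Sum>k<n. L (s k)) - (\<Sum>k<n. \<integral>x. s k x \<partial>repr)\<bar> \<le> (\<Sum>k<n. t k - t (Suc k))"
    proof -
      have "\<bar>L (s k) - (\<integral>x. s k x \<partial>repr)\<bar> \<le> t k - t (Suc k)" for k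
        using L_up[of k] L_low[of k] I_up[of k] I_low[of k] by linarith
      then show ?thesis unfolding sum_subtractf[symmetric] by (intro order_trans[OF sum_abs] sum_mono)
    qed
    also have "\<dots> = t 0 - t n" by (rule sum_lessThan_telescope')
    also have "\<dots> \<le> measure repr UNIV"
    proof -
      have "t 0 \<le> measure repr UNIV" unfolding t_def by (rule finite_measure_mono) auto
      moreover have "0 \<le> t n" unfolding t_def by simp
      ultimately show ?thesis by linarith
    qed
    finally show ?thesis .
  qed
  have "\<bar>L g - (\<integral>x. g x \<partial>repr)\<bar> = 0"
  proof (rule ccontr)
    assume ne: "\<bar>L g - (\<integral>x. g x \<partial>repr)\<bar> \<noteq> 0"
    then obtain n :: nat where "measure repr UNIV / \<bar>L g - (\<integral>x. g x \<partial>repr)\<bar> < real n" "n > 0"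
      using reals_Archimedean2[of "measure repr UNIV / \<bar>L g - (\<integral>x. g x \<partial>repr)\<bar>"]
      by (metis of_nat_0_less_iff measure_nonneg abs_ge_zero divide_nonneg_nonneg order_le_less_trans)
    then show False using bound[of n] ne by (simp add: field_simps)
  qed
  then show ?thesis by simp
qed

theorem representation:
  assumes g: "g \<in> Cc"
  shows "L g = (\<integral>x. g x \<partial>repr)"
proof -
  obtain c where c: "c > 0" "\<And>x. \<bar>g x\<bar> \<le> c" using Cc_bounded[OF g] by blast
  let ?p = "\<lambda>x. max 0 (g x) / c" and ?n = "\<lambda>x. max 0 (- g x) / c"
  have pC: "?p \<in> Cc" and nC: "?n \<in> Cc"
    using c(1) by (auto intro!: Cc_I[OF g] continuous_intros Cc_continuous[OF g])
  have b: "?p x \<le> 1" "?n x \<le> 1" for x using c(2)[of x] c(1) by (auto simp: divide_le_eq_1 abs_le_iff)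
  have geq: "g = (\<lambda>x. c * (?p x - ?n x))" using c(1) by (auto simp: max_def fun_eq_iff)
  have "L g = c * (L ?p - L ?n)"
    by (subst geq) (simp only: cmult[OF Cc_diff[OF pC nC]] diff[OF pC nC])
  also have "\<dots> = c * ((\<integral>x. ?p x \<partial>repr) - (\<integral>x. ?n x \<partial>repr))"
    using representation_unit[OF pC] representation_unit[OF nC] b c(1) by simp
  also have "\<dots> = (\<integral>x. c * (?p x - ?n x) \<partial>repr)"
    using integrable_repr[OF pC] integrable_repr[OF nC] by simp
  also have "\<dots> = (\<integral>x. g x \<partial>repr)" using geq by metis
  finally show ?thesis .
qed

end


section \<open>The integrand and its polar set\<close>

text \<open>The integrand will turn out to be the support function of this set. Nonsymmetric \<open>B\<close>
  are admitted: every antisymmetric matrix is then a direction of recession, which forces symmetry without a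
  separate argument.\<close>

definition polar_set :: "(real ^ 'n ^ 'n \<Rightarrow> ennreal) \<Rightarrow> (real ^ 'n ^ 'n) set" where
  "polar_set f = {B. \<forall>A\<in>sym_mats. ennreal (B \<bullet> A) \<le> f A}"

text \<open>Infinite off the symmetric matrices, so that it is the supremum of its linear minorants on the whole
  matrix space.\<close>

definition sym_ext :: "(real ^ 'n ^ 'n \<Rightarrow> ennreal) \<Rightarrow> real ^ 'n ^ 'n \<Rightarrow> ennreal" where
  "sym_ext f A = (if A \<in> sym_mats then f A else \<infinity>)"

definition mat_unit :: "'n \<Rightarrow> 'n \<Rightarrow> real ^ 'n ^ 'n" where
  "mat_unit i j = axis i (axis j 1)"

lemma inner_mat_unit: "mat_unit i j \<bullet> A = A $ i $ j"
  unfolding mat_unit_def by (simp add: inner_axis' )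

lemma inner_mat1: "mat 1 \<bullet> (A::real^'n^'n) = trace A"
proof -
  have "mat 1 \<bullet> A = (\<Sum>i\<in>UNIV. \<Sum>j\<in>UNIV. if i = j then A $ i $ j else 0)"
    unfolding inner_vec_def mat_def by (intro sum.cong) auto
  then show ?thesis by (simp add: trace_def)
qed

lemma mat_unit_nth: "mat_unit i j $ k $ l = (if i = k then if j = l then 1 else 0 else 0)"
  unfolding mat_unit_def by (auto simp: axis_def)

lemma mat_expansion: "(A::real^'n^'n) = (\<Sum>i\<in>UNIV. \<Sum>j\<in>UNIV. A $ i $ j *\<^sub>R mat_unit i j)"
proof -
  have "(\<Sum>i\<in>UNIV. \<Sum>j\<in>UNIV. A $ i $ j *\<^sub>R mat_unit i j) $ k $ l = A $ k $ l" for k l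
  proof -
    have "(\<Sum>j\<in>UNIV. A $ i $ j * mat_unit i j $ k $ l) = (if i = k then A $ i $ l else 0)" for i
      by (cases "i = k") (simp_all add: mat_unit_nth if_distrib[of "\<lambda>x. _ * x"] cong: if_cong)
    then show ?thesis by simp
  qed
  then show ?thesis by (simp add: vec_eq_iff)
qed

lemma closed_sym_mats: "closed (sym_mats :: (real^'n^'n) set)"
proof -
  have "closed {A::real^'n^'n. A $ j $ i = A $ i $ j}" for i j
    by (intro closed_Collect_eq continuous_intros)
  then have "closed (\<Inter>i. \<Inter>j. {A::real^'n^'n. A $ j $ i = A $ i $ j})" by (intro closed_INT ballI)
  moreover have "(\<Inter>i. \<Inter>j. {A::real^'n^'n. A $ j $ i = A $ i $ j}) = (sym_mats :: (real^'n^'n) set)"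
    unfolding sym_mats_def transpose_def by (auto simp: vec_eq_iff)
  ultimately show ?thesis by metis
qed

lemma sym_mats_scaleR: "A \<in> sym_mats \<Longrightarrow> c *\<^sub>R A \<in> sym_mats"
  unfolding sym_mats_def by (auto simp: transpose_def vec_eq_iff)

lemma sym_mats_add: "A \<in> sym_mats \<Longrightarrow> B \<in> sym_mats \<Longrightarrow> A + B \<in> sym_mats"
  unfolding sym_mats_def by (auto simp: transpose_def vec_eq_iff)

lemma zero_sym_mats: "0 \<in> sym_mats"
  unfolding sym_mats_def by (auto simp: transpose_def vec_eq_iff)

lemma matrix_vector_axis: "(A *v axis i 1) $ k = (A::real^'n^'n) $ k $ i"
  by (simp add: matrix_vector_mult_basis column_def)

lemma psd_diag: assumes "A \<in> psd_mats" shows "0 \<le> A $ i $ i"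
proof -
  have "0 \<le> axis i 1 \<bullet> (A *v axis i 1)" using assms unfolding psd_mats_def by blast
  then show ?thesis by (simp add: inner_axis' matrix_vector_axis)
qed

text \<open>Test the quadratic form with \<open>e\<^sub>i \<plusminus> e\<^sub>j\<close>. Thanks to this bound
  the trace of a nonnegative definite measure dominates all entries.\<close>

lemma psd_entry_le_trace: assumes A: "A \<in> psd_mats" shows "\<bar>A $ i $ j\<bar> \<le> trace A"
proof (cases "i = j")
  case True
  have "A $ i $ i \<le> trace A" unfolding trace_def
    by (rule member_le_sum) (auto intro: psd_diag[OF A])
  then show ?thesis using True psd_diag[OF A, of i] by simp
next
  case False
  have sym: "A $ j $ i = A $ i $ j" using A unfolding psd_mats_def sym_mats_def transpose_def
    by (auto simp: vec_eq_iff)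
  have q: "0 \<le> (axis i 1 + c *\<^sub>R axis j 1) \<bullet> (A *v (axis i 1 + c *\<^sub>R axis j 1))" for c :: real
    using A unfolding psd_mats_def by blast
  have e: "(axis i 1 + c *\<^sub>R axis j 1) \<bullet> (A *v (axis i 1 + c *\<^sub>R axis j 1))
      = A $ i $ i + 2 * c * A $ i $ j + c\<^sup>2 * A $ j $ j" for c :: real
    by (simp add: matrix_vector_right_distrib inner_add_left inner_add_right inner_axis'
        matrix_vector_axis sym power2_eq_square scaleR_matrix_vector_assoc[symmetric]
        vector_scaleR_matrix_ac matrix_vector_mult_scaleR algebra_simps)
  have "2 * \<bar>A $ i $ j\<bar> \<le> A $ i $ i + A $ j $ j"
    using q[of 1] q[of "-1"] unfolding e by (auto simp: abs_if)
  moreover have "A $ i $ i + A $ j $ j \<le> trace A"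
  proof -
    have "(\<Sum>k\<in>{i,j}. A $ k $ k) \<le> trace A" unfolding trace_def
      by (rule sum_mono2) (auto intro: psd_diag[OF A])
    then show ?thesis using False by simp
  qed
  ultimately show ?thesis by linarith
qed

locale integrand =
  fixes f :: "real ^ 'n ^ 'n \<Rightarrow> ennreal"
  assumes convex: "convex_integrand f"
    and homogeneous: "pos_homogeneous f"
    and lsc: "lsc_on sym_mats f"
    and dom_psd: "eff_dom f \<subseteq> psd_mats"
    and coercive: "coercive f"
begin

lemma scale: "A \<in> sym_mats \<Longrightarrow> t \<ge> 0 \<Longrightarrow> f (t *\<^sub>R A) = ennreal t * f A"
  using homogeneous unfolding pos_homogeneous_def by blast

lemma f_zero: "f 0 = 0"
  using scale[OF zero_sym_mats, of 0] by simp

lemma polar_iff: "B \<in> polar_set f \<longleftrightarrow> (\<forall>A\<in>eff_dom f. B \<bullet> A \<le> enn2real (f A))"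
proof -
  have "ennreal (B \<bullet> A) \<le> f A \<longleftrightarrow> (f A < \<infinity> \<longrightarrow> B \<bullet> A \<le> enn2real (f A))" for A
  proof (cases "f A")
    case (real r)
    then show ?thesis by (auto simp: ennreal_le_iff2 enn2real_ennreal)
  qed simp
  then show ?thesis unfolding polar_set_def eff_dom_def by blast
qed

lemma polar_convex: "convex (polar_set f)"
proof (rule convexI)
  fix B1 B2 :: "real^'n^'n" and u v :: real
  assume "B1 \<in> polar_set f" "B2 \<in> polar_set f" and uv: "0 \<le> u" "0 \<le> v" "u + v = 1"
  then have B: "\<And>A. A \<in> eff_dom f \<Longrightarrow> B1 \<bullet> A \<le> enn2real (f A)" "\<And>A. A \<in> eff_dom f \<Longrightarrow> B2 \<bullet> A \<le> enn2real (f A)"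
    unfolding polar_iff by auto
  show "u *\<^sub>R B1 + v *\<^sub>R B2 \<in> polar_set f"
    unfolding polar_iff inner_add_left inner_scaleR_left
    using B uv by (auto intro!: convex_bound_le)
qed

lemma polar_zero: "0 \<in> polar_set f" unfolding polar_iff by simp

lemma polar_shrink: "B \<in> polar_set f \<Longrightarrow> 0 \<le> t \<Longrightarrow> t \<le> 1 \<Longrightarrow> t *\<^sub>R B \<in> polar_set f"
  using convexD[OF polar_convex, of B 0 t "1 - t"] polar_zero by simp

text \<open>Coercivity makes \<open>f\<close> larger than 1 outside some ball, and homogeneity turns this into
  linear growth.\<close>

lemma coercive_bound: obtains c where "c > 0" "\<And>A. A \<in> sym_mats \<Longrightarrow> ennreal (c * norm A) \<le> f A"
proof -
  have "\<forall>\<^sub>F A in inf at_infinity (principal sym_mats). 1 < f A"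
    using coercive unfolding coercive_def by (rule order_tendstoD) simp
  then obtain b where b: "\<And>A. b \<le> norm A \<Longrightarrow> A \<in> sym_mats \<Longrightarrow> 1 < f A"
    unfolding eventually_inf_principal eventually_at_infinity by blast
  define R where "R = max b 1"
  have R: "R > 0" unfolding R_def by simp
  have "ennreal ((1 / R) * norm A) \<le> f A" if A: "A \<in> sym_mats" for A
  proof (cases "A = 0")
    case False
    have "1 \<le> f ((R / norm A) *\<^sub>R A)"
      using R False by (intro less_imp_le[OF b] sym_mats_scaleR A) (auto simp: R_def)
    then have "ennreal (norm A / R) * 1 \<le> ennreal (norm A / R) * (ennreal (R / norm A) * f A)"
      using scale[OF A, of "R / norm A"] R by (intro mult_left_mono) auto
    also have "\<dots> = f A"
      unfolding mult.assoc[symmetric] using R False by (subst ennreal_mult[symmetric]) auto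
    finally show ?thesis by simp
  qed simp
  then show ?thesis using that[of "1 / R"] R by simp
qed

lemma polar_ball: obtains c where "c > 0" "\<And>B. norm B \<le> c \<Longrightarrow> B \<in> polar_set f"
proof -
  obtain c where c: "c > 0" "\<And>A. A \<in> sym_mats \<Longrightarrow> ennreal (c * norm A) \<le> f A" using coercive_bound by blast
  have "B \<in> polar_set f" if "norm B \<le> c" for B
    unfolding polar_set_def
  proof safe
    fix A :: "real^'n^'n" assume A: "A \<in> sym_mats"
    have "B \<bullet> A \<le> norm B * norm A" by (rule norm_cauchy_schwarz)
    also have "\<dots> \<le> c * norm A" by (rule mult_right_mono[OF that]) simp
    finally show "ennreal (B \<bullet> A) \<le> f A" using c(2)[OF A] by (meson ennreal_leI order_trans)
  qed
  then show ?thesis using that c by blast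
qed

lemma polar_absorbing: obtains t where "t > 0" "(1 / t) *\<^sub>R B \<in> polar_set f"
proof -
  obtain c where c: "c > 0" "\<And>B. norm B \<le> c \<Longrightarrow> B \<in> polar_set f" using polar_ball by blast
  let ?t = "(norm B + 1) / c"
  have t: "?t > 0" using c(1) by (simp add: add_nonneg_pos)
  have "norm ((1 / ?t) *\<^sub>R B) \<le> c" using c(1) 
    by (simp add: divide_le_eq mult_left_mono add_nonneg_pos)
  then show ?thesis using that[OF t] c(2) by blast
qed

text \<open>These matrices pair nonpositively with the domain of \<open>f\<close>, hence the polar set contains
  entire rays. A functional that is bounded above on polar-valued functions is therefore positive on nonnegative
  multiples of \<open>mat 1 \<plusminus> mat_unit i j\<close>.\<close>

lemma polar_neg_dominating:
  assumes "t \<ge> 0" "\<bar>s\<bar> \<le> 1"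
  shows "- t *\<^sub>R (mat 1 + s *\<^sub>R mat_unit i j) \<in> polar_set f"
  unfolding polar_iff
proof safe
  fix A assume "A \<in> eff_dom f"
  then have "\<bar>A $ i $ j\<bar> \<le> trace A" using dom_psd psd_entry_le_trace by blast
  then have "\<bar>s * A $ i $ j\<bar> \<le> trace A"
    using assms(2) unfolding abs_mult by (meson mult_left_le_one_le abs_ge_zero order_trans)
  then have "0 \<le> t * (trace A + s * A $ i $ j)" using assms(1) by (intro mult_nonneg_nonneg) auto
  then have "- t *\<^sub>R (mat 1 + s *\<^sub>R mat_unit i j) \<bullet> A \<le> 0"
    by (simp add: inner_mat1 inner_mat_unit inner_add_left)
  then show "- t *\<^sub>R (mat 1 + s *\<^sub>R mat_unit i j) \<bullet> A \<le> enn2real (f A)"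
    using enn2real_nonneg order_trans by blast
qed

definition epigraph :: "((real^'n^'n) \<times> real) set" where
  "epigraph = {(A, r). A \<in> sym_mats \<and> 0 \<le> r \<and> f A \<le> ennreal r}"

lemma closed_epigraph: "closed epigraph"
  unfolding closed_sequential_limits
proof safe
  fix x :: "nat \<Rightarrow> (real^'n^'n) \<times> real" and A r
  assume x: "\<forall>n. x n \<in> epigraph" and lim: "x \<longlonglongrightarrow> (A, r)"
  have limA: "(\<lambda>n. fst (x n)) \<longlonglongrightarrow> A" and limr: "(\<lambda>n. snd (x n)) \<longlonglongrightarrow> r"
    using tendsto_fst[OF lim] tendsto_snd[OF lim] by simp_all
  have x': "fst (x n) \<in> sym_mats" "0 \<le> snd (x n)" "f (fst (x n)) \<le> ennreal (snd (x n))" for n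
    using x[rule_format, of n] unfolding epigraph_def by (auto simp: case_prod_beta)
  have A: "A \<in> sym_mats" using closed_sequentially[OF closed_sym_mats _ limA] x'(1) by blast
  have r: "0 \<le> r" using LIMSEQ_le_const[OF limr] x'(2) by blast
  have "f A \<le> ennreal r"
  proof (rule ccontr)
    assume "\<not> ?thesis"
    then obtain c where c: "ennreal r < c" "c < f A" using dense[of "ennreal r" "f A"] by (auto simp: not_le)
    have "\<forall>\<^sub>F y in at A within sym_mats. c < f y" using lsc A c(2) unfolding lsc_on_def by blast
    then obtain U where U: "open U" "A \<in> U" "\<And>y. y \<in> U \<Longrightarrow> y \<in> sym_mats \<Longrightarrow> y \<noteq> A \<Longrightarrow> c < f y"
      unfolding eventually_at_topological by blast
    have "\<forall>\<^sub>F n in sequentially. fst (x n) \<in> U" by (rule topological_tendstoD[OF limA U(1,2)])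
    moreover have "\<forall>\<^sub>F n in sequentially. ennreal (snd (x n)) < c"
      by (rule order_tendstoD(2)[OF tendsto_ennrealI[OF limr] c(1)])
    ultimately have "\<forall>\<^sub>F n in sequentially. fst (x n) \<in> U \<and> ennreal (snd (x n)) < c"
      by (rule eventually_conj)
    then obtain n where n: "fst (x n) \<in> U" "ennreal (snd (x n)) < c" 
      unfolding eventually_sequentially by blast
    have "c < f (fst (x n))" using U(3)[OF n(1) x'(1)] c(2) by (cases "fst (x n) = A") auto
    then show False using n(2) x'(3)[of n] by (meson order_less_le_trans order_less_trans order_less_irrefl)
  qed
  then show "(A, r) \<in> epigraph" using A r unfolding epigraph_def by simp
qed

lemma epigraph_cone: "z \<in> epigraph \<Longrightarrow> t \<ge> 0 \<Longrightarrow> t *\<^sub>R z \<in> epigraph"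
  unfolding epigraph_def by (auto simp: sym_mats_scaleR scale ennreal_mult intro!: mult_left_mono)

lemma convex_epigraph: "convex epigraph"
proof (rule convexI)
  fix y z :: "(real^'n^'n) \<times> real" and u v :: real
  assume "y \<in> epigraph" "z \<in> epigraph" and uv: "0 \<le> u" "0 \<le> v" "u + v = 1"
  then obtain A r B s where yz: "y = (A, r)" "z = (B, s)" "A \<in> sym_mats" "B \<in> sym_mats" "0 \<le> r" "0 \<le> s"
      "f A \<le> ennreal r" "f B \<le> ennreal s" unfolding epigraph_def by auto
  have "f (u *\<^sub>R A + v *\<^sub>R B) \<le> ennreal u * f A + ennreal v * f B"
    using convex yz(3,4) uv unfolding convex_integrand_def by (metis add_diff_cancel_right' atLeastAtMost_iff le_add_same_cancel2 uv(3))
  also have "\<dots> \<le> ennreal u * ennreal r + ennreal v * ennreal s"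
    by (intro add_mono mult_left_mono yz) auto
  also have "\<dots> = ennreal (u * r + v * s)" using uv yz by (simp add: ennreal_plus ennreal_mult)
  finally show "u *\<^sub>R y + v *\<^sub>R z \<in> epigraph"
    using yz uv unfolding epigraph_def by (auto intro!: sym_mats_add sym_mats_scaleR)
qed

text \<open>Separate \<open>(A, r)\<close> from the epigraph, a closed convex cone. If the hyperplane is
  vertical (\<open>\<beta> = 0\<close>), its normal spans a ray in the polar set and a large multiple of it does
  the job.\<close>

lemma bipolar_witness:
  assumes r: "0 \<le> r" "ennreal r < sym_ext f A"
  obtains B where "B \<in> polar_set f" "r < B \<bullet> A"
proof -
  have "(A, r) \<notin> epigraph" using r unfolding epigraph_def sym_ext_def by auto
  then obtain a b where ab: "a \<bullet> (A, r) < b" "\<And>x. x \<in> epigraph \<Longrightarrow> b < a \<bullet> x"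
    using separating_hyperplane_closed_point[OF convex_epigraph closed_epigraph] by blast
  obtain N \<beta> where a: "a = (N, \<beta>)" by (cases a)
  have "(0, 0) \<in> epigraph" unfolding epigraph_def by (auto simp: zero_sym_mats f_zero)
  then have b: "b < 0" using ab(2)[of "(0,0)"] unfolding a by simp
  \<comment> \<open>The epigraph is a cone, so the half space may be moved to the origin.\<close>
  have pos: "0 \<le> a \<bullet> x" if x: "x \<in> epigraph" for x
  proof (rule ccontr)
    assume n: "\<not> ?thesis"
    let ?t = "b / (a \<bullet> x)"
    have "b < a \<bullet> (?t *\<^sub>R x)" using n b by (intro ab(2) epigraph_cone x) (auto simp: divide_nonpos_neg)
    then show False using n by simp
  qed
  have "(0, 1) \<in> epigraph" unfolding epigraph_def by (auto simp: zero_sym_mats f_zero)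
  from pos[OF this] have beta: "0 \<le> \<beta>" unfolding a by simp
  have lt: "N \<bullet> A + \<beta> * r < 0" using ab(1) b unfolding a by simp
  have dom: "0 \<le> N \<bullet> A' + \<beta> * enn2real (f A')" if "A' \<in> eff_dom f" for A'
  proof -
    have "(A', enn2real (f A')) \<in> epigraph" using that unfolding epigraph_def eff_dom_def by auto
    from pos[OF this] show ?thesis unfolding a by simp
  qed
  show ?thesis
  proof (cases "\<beta> = 0")
    case False
    then have bp: "\<beta> > 0" using beta by simp
    have "(- 1 / \<beta>) *\<^sub>R N \<in> polar_set f" unfolding polar_iff
      using dom bp by (force simp: field_simps)
    moreover have "r < (- 1 / \<beta>) *\<^sub>R N \<bullet> A" using lt bp by (simp add: field_simps)
    ultimately show ?thesis using that by blast
  next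
    \<comment> \<open>A vertical hyperplane: \<open>N\<close> is nonnegative on the domain of \<open>f\<close> and negative at \<open>A\<close>.\<close>
    case True
    define t where "t = (r + 1) / (- (N \<bullet> A))"
    have n: "N \<bullet> A < 0" using lt True by simp
    have t: "t \<ge> 0" unfolding t_def using n r(1) by (intro divide_nonneg_pos) auto
    have "(- t) *\<^sub>R N \<in> polar_set f" unfolding polar_iff
    proof safe
      fix A' assume "A' \<in> eff_dom f"
      then have "0 \<le> t * (N \<bullet> A')" using dom[of A'] True t by (intro mult_nonneg_nonneg) auto
      then show "(- t) *\<^sub>R N \<bullet> A' \<le> enn2real (f A')" unfolding inner_scaleR_left using enn2real_nonneg[of "f A'"] by linarith
    qed
    moreover have "r < (- t) *\<^sub>R N \<bullet> A" using n unfolding t_def by simp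
    ultimately show ?thesis using that by blast
  qed
qed

lemma polar_le_sym_ext: "B \<in> polar_set f \<Longrightarrow> ennreal (B \<bullet> A) \<le> sym_ext f A"
  unfolding polar_set_def sym_ext_def by auto

text \<open>Countably many linear minorants suffice; the first one is normalised to \<open>0\<close> so that
  finite maxima are nonnegative.\<close>

lemma countable_bipolar:
  obtains D :: "nat \<Rightarrow> real^'n^'n" where "\<And>i. D i \<in> polar_set f" "D 0 = 0"
    "\<And>A. sym_ext f A = (SUP i. ennreal (D i \<bullet> A))"
proof -
  obtain T where T: "countable T" "T \<subseteq> polar_set f" "polar_set f \<subseteq> closure T"
    by (rule separable)
  let ?T = "insert 0 T"
  define D' where "D' n = (case n of 0 \<Rightarrow> 0 | Suc m \<Rightarrow> from_nat_into ?T m)" for n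
  have cT: "countable ?T" using T(1) by simp
  have DP: "D' i \<in> polar_set f" for i
  proof (cases i)
    case (Suc m)
    have "from_nat_into ?T m \<in> ?T" by (rule from_nat_into) simp
    then show ?thesis using T(2) polar_zero Suc unfolding D'_def by auto
  qed (simp add: D'_def polar_zero)
  have TD: "\<exists>i. D' i = B" if "B \<in> T" for B
  proof -
    have "B \<in> ?T" using that by simp
    then obtain m where "from_nat_into ?T m = B" using from_nat_into_surj[OF cT] by meson
    then have "D' (Suc m) = B" unfolding D'_def by simp
    then show ?thesis ..
  qed
  have "sym_ext f A = (SUP i. ennreal (D' i \<bullet> A))" for A
  proof (rule antisym)
    show "(SUP i. ennreal (D' i \<bullet> A)) \<le> sym_ext f A" by (intro SUP_least polar_le_sym_ext DP)
    show "sym_ext f A \<le> (SUP i. ennreal (D' i \<bullet> A))"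
    proof (rule dense_le)
      fix y assume y: "y < sym_ext f A"
      then obtain r where r: "y = ennreal r" "0 \<le> r" by (cases y) auto
      obtain B where B: "B \<in> polar_set f" "r < B \<bullet> A" using bipolar_witness[of r A] y r by auto
      have "open {B. r < B \<bullet> A}" by (intro open_Collect_less continuous_intros)
      then have "{B. r < B \<bullet> A} \<inter> T \<noteq> {}"
        using B T(3) open_Int_closure_eq_empty[of "{B. r < B \<bullet> A}" T] by auto
      then obtain B' where "B' \<in> T" "r < B' \<bullet> A" by auto
      then obtain i where "r < D' i \<bullet> A" using TD by blast
      then have "y \<le> ennreal (D' i \<bullet> A)" unfolding r by (intro ennreal_leI) simp
      also have "\<dots> \<le> (SUP i. ennreal (D' i \<bullet> A))" by (rule SUP_upper) simp
      finally show "y \<le> (SUP i. ennreal (D' i \<bullet> A))" .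
    qed
  qed
  moreover have "D' 0 = 0" unfolding D'_def by simp
  ultimately show ?thesis using that DP by blast
qed

lemma sym_ext_measurable [measurable]: "sym_ext f \<in> borel_measurable borel"
proof -
  obtain D where D: "\<And>A. sym_ext f A = (SUP i::nat. ennreal (D i \<bullet> A))" using countable_bipolar by metis
  have "(\<lambda>A. SUP i::nat. ennreal (D i \<bullet> A)) \<in> borel_measurable borel" by measurable
  then show ?thesis by (simp add: D[abs_def] fun_eq_iff[symmetric] cong: measurable_cong)
qed

lemma sym_ext_scale: "t \<ge> 0 \<Longrightarrow> sym_ext f A < \<infinity> \<Longrightarrow> sym_ext f (t *\<^sub>R A) = ennreal t * sym_ext f A"
  unfolding sym_ext_def by (auto simp: scale sym_mats_scaleR split: if_splits)

lemma sym_ext_finite_psd: "sym_ext f A < \<infinity> \<Longrightarrow> A \<in> psd_mats"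
  using dom_psd unfolding sym_ext_def eff_dom_def by (auto split: if_splits)

end


section \<open>Densities of vector measures\<close>

lemma ex_measure_of_real_set_function:
  fixes s :: "'a set \<Rightarrow> real"
  assumes nn: "\<And>E. E \<in> sets M \<Longrightarrow> 0 \<le> s E" and s0: "s {} = 0"
    and add: "\<And>A. range A \<subseteq> sets M \<Longrightarrow> disjoint_family A \<Longrightarrow> (\<lambda>i::nat. s (A i)) sums s (\<Union>i. A i)"
  obtains N where "sets N = sets M" "space N = space M" "\<And>E. E \<in> sets M \<Longrightarrow> emeasure N E = ennreal (s E)" "finite_measure N"
proof -
  define N where "N = measure_of (space M) (sets M) (\<lambda>E. ennreal (s E))"
  have sN: "sets N = sets M" "space N = space M" unfolding N_def
    by (auto simp: sets.sets_measure_of_eq sets.space_measure_of_eq)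
  have em: "emeasure N E = ennreal (s E)" if "E \<in> sets M" for E
    unfolding N_def
  proof (rule emeasure_measure_of_sigma)
    show "sigma_algebra (space M) (sets M)" ..
    show "positive (sets M) (\<lambda>E. ennreal (s E))" by (simp add: positive_def s0)
    show "countably_additive (sets M) (\<lambda>E. ennreal (s E))"
    proof (rule countably_additiveI)
      fix A :: "nat \<Rightarrow> 'a set" assume A: "range A \<subseteq> sets M" "disjoint_family A"
      have "0 \<le> s (A i)" for i using A nn by auto
      then show "(\<Sum>i. ennreal (s (A i))) = ennreal (s (\<Union>i. A i))"
        by (rule suminf_ennreal_eq) (rule add[OF A])
    qed
  qed fact
  have "finite_measure N" using em[of "space M"] by (intro finite_measureI) (simp add: sN)
  then show ?thesis using that sN em by blast
qed

definition has_vector_density :: "'a measure \<Rightarrow> ('a set \<Rightarrow> 'b::euclidean_space) \<Rightarrow> 'a measure \<Rightarrow> ('a \<Rightarrow> 'b) \<Rightarrow> bool" where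
  "has_vector_density M l \<tau> \<theta> \<longleftrightarrow> finite_measure \<tau> \<and> sets \<tau> = sets M \<and> integrable \<tau> \<theta> \<and>
     (\<forall>E\<in>sets M. l E = (LINT x:E|\<tau>. \<theta> x))"

lemma has_vector_densityD:
  assumes "has_vector_density M l \<tau> \<theta>"
  shows "finite_measure \<tau>" "sets \<tau> = sets M" "space \<tau> = space M" "integrable \<tau> \<theta>" 
    "\<And>E. E \<in> sets M \<Longrightarrow> l E = (LINT x:E|\<tau>. \<theta> x)"
  using assms unfolding has_vector_density_def by (auto dest: sets_eq_imp_space_eq)

lemma norm_set_integral_le:
  fixes \<theta> :: "'a \<Rightarrow> 'b::euclidean_space"
  assumes "integrable \<tau> \<theta>" "E \<in> sets \<tau>"
  shows "ennreal (norm (LINT x:E|\<tau>. \<theta> x)) \<le> emeasure (density \<tau> (\<lambda>x. ennreal (norm (\<theta> x)))) E"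
proof -
  have [measurable]: "\<theta> \<in> borel_measurable \<tau>" "E \<in> sets \<tau>" using assms by auto
  have "ennreal (norm (LINT x:E|\<tau>. \<theta> x)) \<le> (\<integral>\<^sup>+x. ennreal (norm (indicat_real E x *\<^sub>R \<theta> x)) \<partial>\<tau>)"
    unfolding set_lebesgue_integral_def
    by (rule integral_norm_bound_ennreal) (intro integrable_mult_indicator assms)
  also have "\<dots> = emeasure (density \<tau> (\<lambda>x. ennreal (norm (\<theta> x)))) E"
    by (subst emeasure_density) (auto intro!: nn_integral_cong simp: indicator_def)
  finally show ?thesis .
qed

text \<open>The inequality \<open>\<le>\<close> is the triangle inequality. For the other one, cut the range of
  \<open>\<theta>\<close> into countably many cells of radius \<open>e\<close>: on the preimage of a cell
  \<open>\<theta>\<close> is almost constant, so that almost nothing cancels in the integral.\<close>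

lemma total_variation_set_eq:
  fixes \<theta> :: "'a \<Rightarrow> 'b::euclidean_space"
  assumes d: "has_vector_density M l \<tau> \<theta>" and E: "E \<in> sets M"
  shows "(SUP A\<in>{A::nat \<Rightarrow> 'a set. range A \<subseteq> sets M \<and> disjoint_family A \<and> (\<Union>i. A i) = E}.
          \<Sum>i. ennreal (norm (l (A i)))) = emeasure (density \<tau> (\<lambda>x. ennreal (norm (\<theta> x)))) E"
    (is "(SUP A\<in>?P. ?S A) = emeasure ?D E")
proof (rule antisym)
  note D = has_vector_densityD[OF d]
  interpret finite_measure \<tau> by (rule D)
  have [measurable]: "\<theta> \<in> borel_measurable \<tau>" using D(4) by auto
  show "(SUP A\<in>?P. ?S A) \<le> emeasure ?D E"
  proof (rule SUP_least)
    fix A assume A: "A \<in> ?P"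
    then have AM: "A i \<in> sets M" for i by auto
    have "?S A \<le> (\<Sum>i. emeasure ?D (A i))"
      by (intro suminf_le) (auto simp: D(5)[OF AM] D(2) AM intro!: norm_set_integral_le D(4))
    also have "\<dots> = emeasure ?D E"
      using suminf_emeasure[of A ?D] A by (simp add: D(2))
    finally show "?S A \<le> emeasure ?D E" .
  qed
  show "emeasure ?D E \<le> (SUP A\<in>?P. ?S A)"
  proof (rule ennreal_le_epsilon)
    fix \<delta> :: real assume \<delta>: "\<delta> > 0"
    define e where "e = \<delta> / (2 * (measure \<tau> (space \<tau>) + 1))"
    have m0: "measure \<tau> (space \<tau>) + 1 > 0" by (simp add: add_nonneg_pos)
    have e: "e > 0" unfolding e_def using \<delta> m0 by simp
    obtain T :: "'b set" where T: "countable T" "\<And>U. open U \<Longrightarrow> U \<noteq> {} \<Longrightarrow> \<exists>d\<in>T. d \<in> U"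
      by (rule countable_dense_setE) blast
    have Tne: "T \<noteq> {}" using T(2)[of UNIV] by auto
    define d where "d = from_nat_into T"
    define C where "C = disjointed (\<lambda>i. ball (d i) e)"
    have C_dist: "dist (d i) y < e" if "y \<in> C i" for i y
      using that disjointed_subset[of "\<lambda>i. ball (d i) e" i] unfolding C_def by auto
    have C_UN: "(\<Union>i. C i) = UNIV"
    proof -
      have "y \<in> (\<Union>i. ball (d i) e)" for y
      proof -
        obtain t where t: "t \<in> T" "t \<in> ball y e" using T(2)[of "ball y e"] e by auto
        obtain i where "d i = t" using from_nat_into_surj[OF T(1) t(1)] unfolding d_def by blast
        then show ?thesis using t by (auto simp: dist_commute)
      qed
      then show ?thesis unfolding C_def UN_disjointed_eq by blast
    qed
    have "range (\<lambda>i. ball (d i) e) \<subseteq> sets borel" by auto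
    then have C_borel[measurable]: "C i \<in> sets borel" for i
      using sets.range_disjointed_sets unfolding C_def by (metis range_subsetD)
    define A where "A i = E \<inter> (\<theta> -` C i \<inter> space \<tau>)" for i
    have AM: "A i \<in> sets M" for i
    proof -
      have "\<theta> -` C i \<inter> space \<tau> \<in> sets \<tau>" by measurable
      then show ?thesis using E unfolding A_def by (auto simp: D(2))
    qed
    have dis: "disjoint_family A"
      using disjoint_family_disjointed[of "\<lambda>i. ball (d i) e"] unfolding A_def C_def disjoint_family_on_def by blast
    have UN: "(\<Union>i. A i) = E" using C_UN sets.sets_into_space[OF E] unfolding A_def D(3) by blast
    have cell: "emeasure ?D (A i) \<le> ennreal (norm (l (A i))) + ennreal (2 * e) * emeasure \<tau> (A i)" for i
    proof -
      let ?m = "measure \<tau> (A i)"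
      have Ai: "A i \<in> sets \<tau>" using AM D(2) by simp
      have near: "norm (\<theta> x - d i) \<le> e" if "x \<in> A i" for x
        using C_dist[of "\<theta> x" i] that unfolding A_def by (auto simp: dist_norm norm_minus_commute)
      have i1: "integrable \<tau> (\<lambda>x. indicat_real (A i) x *\<^sub>R \<theta> x)" 
        by (intro integrable_mult_indicator Ai D(4))
      have i2: "integrable \<tau> (\<lambda>x. indicat_real (A i) x *\<^sub>R d i)" using Ai by (auto simp: emeasure_eq_measure)
      have i3: "(\<integral>x. indicat_real (A i) x *\<^sub>R d i \<partial>\<tau>) = ?m *\<^sub>R d i" 
        using Ai by (subst integral_scaleR_left) (auto simp: emeasure_eq_measure)
      have "norm (l (A i) - ?m *\<^sub>R d i) = norm (\<integral>x. indicat_real (A i) x *\<^sub>R (\<theta> x - d i) \<partial>\<tau>)"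
        unfolding D(5)[OF AM] set_lebesgue_integral_def scaleR_diff_right
        by (simp only: Bochner_Integration.integral_diff[OF i1 i2] i3)
      also have "\<dots> \<le> (\<integral>x. norm (indicat_real (A i) x *\<^sub>R (\<theta> x - d i)) \<partial>\<tau>)" by (rule integral_norm_bound)
      also have "\<dots> \<le> (\<integral>x. e * indicat_real (A i) x \<partial>\<tau>)"
      proof (rule integral_mono_AE')
        show "integrable \<tau> (\<lambda>x. e * indicat_real (A i) x)"
          using Ai by (intro integrable_mult_right integrable_real_indicator) (auto simp: emeasure_eq_measure)
      qed (use near e in \<open>auto simp: indicator_def\<close>)
      also have "\<dots> = e * ?m" using Ai by simp
      finally have "norm (l (A i) - ?m *\<^sub>R d i) \<le> e * ?m" .
      then have "norm (?m *\<^sub>R d i) \<le> norm (l (A i)) + e * ?m"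
        using norm_triangle_ineq4[of "l (A i)" "l (A i) - ?m *\<^sub>R d i"] by simp
      then have low: "?m * norm (d i) \<le> norm (l (A i)) + e * ?m" by simp
      have "emeasure ?D (A i) = (\<integral>\<^sup>+x. ennreal (norm (\<theta> x)) * indicator (A i) x \<partial>\<tau>)"
        using Ai by (subst emeasure_density) auto
      also have "\<dots> \<le> (\<integral>\<^sup>+x. ennreal (norm (d i) + e) * indicator (A i) x \<partial>\<tau>)"
      proof (rule nn_integral_mono)
        fix x 
        have "x \<in> A i \<Longrightarrow> norm (\<theta> x) \<le> norm (d i) + e"
          using near[of x] norm_triangle_ineq2[of "\<theta> x" "d i"] by simp
        then show "ennreal (norm (\<theta> x)) * indicator (A i) x \<le> ennreal (norm (d i) + e) * indicator (A i) x"
          by (auto simp: indicator_def intro: ennreal_leI)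
      qed
      also have "\<dots> = ennreal ((norm (d i) + e) * ?m)"
        using Ai e by (simp add: nn_integral_cmult_indicator emeasure_eq_measure ennreal_mult)
      also have "\<dots> \<le> ennreal (norm (l (A i)) + 2 * e * ?m)"
        using low by (intro ennreal_leI) (simp add: algebra_simps)
      also have "\<dots> = ennreal (norm (l (A i))) + ennreal (2 * e) * emeasure \<tau> (A i)"
        using e by (simp add: ennreal_plus ennreal_mult emeasure_eq_measure)
      finally show ?thesis .
    qed
    have "emeasure ?D E = (\<Sum>i. emeasure ?D (A i))"
      using suminf_emeasure[of A ?D] AM dis UN by (simp add: D(2) image_subset_iff)
    also have "\<dots> \<le> (\<Sum>i. ennreal (norm (l (A i))) + ennreal (2 * e) * emeasure \<tau> (A i))"
      using cell by (intro suminf_le) auto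
    also have "\<dots> = ?S A + (\<Sum>i. ennreal (2 * e) * emeasure \<tau> (A i))" by (rule suminf_add[symmetric]) auto
    also have "(\<Sum>i. ennreal (2 * e) * emeasure \<tau> (A i)) = ennreal (2 * e) * emeasure \<tau> E"
      using suminf_emeasure[of A \<tau>] AM dis UN by (simp add: D(2) image_subset_iff)
    finally have 1: "emeasure ?D E \<le> ?S A + ennreal (2 * e) * emeasure \<tau> E" .
    have 2: "ennreal (2 * e) * emeasure \<tau> E \<le> ennreal \<delta>"
    proof -
      have "2 * e * measure \<tau> E \<le> 2 * e * (measure \<tau> (space \<tau>) + 1)"
        using e finite_measure_mono[of E "space \<tau>"] sets.sets_into_space[OF E] D(3)
        by (intro mult_left_mono) (auto intro: order_trans[OF bounded_measure])
      also have "\<dots> = \<delta>" unfolding e_def using m0 by (simp add: field_simps)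
      finally show ?thesis using e by (simp add: emeasure_eq_measure ennreal_mult[symmetric] ennreal_leI)
    qed
    have 3: "?S A \<le> (SUP A\<in>?P. ?S A)" by (rule SUP_upper) (use AM dis UN in auto)
    show "emeasure ?D E \<le> (SUP A\<in>?P. ?S A) + ennreal \<delta>"
      by (rule order_trans[OF 1 add_mono[OF 3 2]])
  qed
qed

lemma total_variation_density:
  fixes \<theta> :: "'a \<Rightarrow> 'b::euclidean_space"
  assumes d: "has_vector_density M l \<tau> \<theta>"
  shows "total_variation M l = density \<tau> (\<lambda>x. ennreal (norm (\<theta> x)))"
proof -
  note D = has_vector_densityD[OF d]
  let ?D = "density \<tau> (\<lambda>x. ennreal (norm (\<theta> x)))"
  have "total_variation M l = measure_of (space M) (sets M) (emeasure ?D)"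
    unfolding total_variation_def
    by (rule measure_of_eq[OF sets.space_closed])
       (simp add: sets.sigma_sets_eq total_variation_set_eq[OF d])
  also have "\<dots> = ?D" using measure_of_of_measure[of ?D] by (simp add: D(2,3))
  finally show ?thesis .
qed

lemma finite_measure_total_variation:
  fixes \<theta> :: "'a \<Rightarrow> 'b::euclidean_space"
  assumes d: "has_vector_density M l \<tau> \<theta>"
  shows "finite_measure (total_variation M l)"
proof (rule finite_measureI)
  note D = has_vector_densityD[OF d]
  have [measurable]: "\<theta> \<in> borel_measurable \<tau>" using D(4) by auto
  have "emeasure (density \<tau> (\<lambda>x. ennreal (norm (\<theta> x)))) (space \<tau>) = (\<integral>\<^sup>+x. ennreal (norm (\<theta> x)) \<partial>\<tau>)"
    by (subst emeasure_density) (auto intro!: nn_integral_cong)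
  then show "emeasure (total_variation M l) (space (total_variation M l)) \<noteq> \<infinity>"
    using D(4) unfolding total_variation_density[OF d] by (simp add: integrable_iff_bounded)
qed

lemma set_integral_density_normalized:
  fixes \<theta> :: "'a \<Rightarrow> 'b::euclidean_space"
  assumes \<theta>: "integrable \<tau> \<theta>" and E: "E \<in> sets \<tau>"
  shows "(LINT x:E|density \<tau> (\<lambda>x. ennreal (norm (\<theta> x))). (1 / norm (\<theta> x)) *\<^sub>R \<theta> x) = (LINT x:E|\<tau>. \<theta> x)"
proof -
  have [measurable]: "\<theta> \<in> borel_measurable \<tau>" "E \<in> sets \<tau>" using assms by auto
  show ?thesis unfolding set_lebesgue_integral_def
    by (subst integral_density) (auto intro!: Bochner_Integration.integral_cong simp: indicator_def)
qed

text \<open>The normalised density is a witness for the choice in the definition of the polar density, and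
  densities are unique almost everywhere.\<close>

lemma polar_density_props:
  fixes \<theta> :: "'a \<Rightarrow> 'b::euclidean_space"
  assumes d: "has_vector_density M l \<tau> \<theta>"
  shows "integrable (total_variation M l) (polar_density M l)"
    and "E \<in> sets M \<Longrightarrow> l E = (LINT x:E|total_variation M l. polar_density M l x)"
    and "AE x in total_variation M l. polar_density M l x = (1 / norm (\<theta> x)) *\<^sub>R \<theta> x"
proof -
  note D = has_vector_densityD[OF d]
  let ?V = "total_variation M l" and ?g = "\<lambda>x. (1 / norm (\<theta> x)) *\<^sub>R \<theta> x"
  have [measurable]: "\<theta> \<in> borel_measurable \<tau>" using D(4) by auto
  have V: "?V = density \<tau> (\<lambda>x. ennreal (norm (\<theta> x)))" by (rule total_variation_density[OF d])
  have ig: "integrable ?V ?g" unfolding V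
  proof (subst integrable_density)
    have "(\<lambda>x. norm (\<theta> x) *\<^sub>R ?g x) = \<theta>" by (auto simp: fun_eq_iff)
    then show "integrable \<tau> (\<lambda>x. norm (\<theta> x) *\<^sub>R ?g x)" using D(4) by simp
  qed auto
  have g: "l E = (LINT x:E|?V. ?g x)" if "E \<in> sets M" for E
    unfolding V using set_integral_density_normalized[OF D(4)] D(2,5) that by simp
  have "integrable ?V (polar_density M l) \<and> (\<forall>E\<in>sets M. l E = (LINT x:E|?V. polar_density M l x))"
    unfolding polar_density_def
    by (rule someI[of "\<lambda>g. integrable ?V g \<and> (\<forall>E\<in>sets M. l E = (LINT x:E|?V. g x))" ?g]) (use ig g in blast)
  then show 1: "integrable ?V (polar_density M l)"
    and 2: "\<And>E. E \<in> sets M \<Longrightarrow> l E = (LINT x:E|?V. polar_density M l x)" by auto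
  interpret V: finite_measure ?V by (rule finite_measure_total_variation[OF d])
  show "AE x in ?V. polar_density M l x = ?g x"
  proof (rule V.density_unique_banach[OF 1 ig])
    fix A assume "A \<in> sets ?V"
    then have "A \<in> sets M" unfolding V by (simp add: D(2))
    then show "(LINT x:A|?V. polar_density M l x) = (LINT x:A|?V. ?g x)" using 2 g by simp
  qed
qed

lemma vector_lint_density:
  fixes \<theta> :: "'a \<Rightarrow> 'b::euclidean_space"
  assumes d: "has_vector_density M l \<tau> \<theta>" and \<Phi>: "\<Phi> \<in> borel_measurable M"
  shows "vector_lint M l \<Phi> = (\<integral>x. \<Phi> x \<bullet> \<theta> x \<partial>\<tau>)"
proof -
  note D = has_vector_densityD[OF d]
  have [measurable]: "\<theta> \<in> borel_measurable \<tau>" using D(4) by auto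
  have [measurable]: "\<Phi> \<in> borel_measurable \<tau>" using \<Phi> by (simp add: measurable_cong_sets[OF D(2) refl])
  have V: "total_variation M l = density \<tau> (\<lambda>x. ennreal (norm (\<theta> x)))" by (rule total_variation_density[OF d])
  have pm: "polar_density M l \<in> borel_measurable \<tau>"
    using polar_density_props(1)[OF d] unfolding V by auto
  have "vector_lint M l \<Phi> = (\<integral>x. \<Phi> x \<bullet> ((1 / norm (\<theta> x)) *\<^sub>R \<theta> x) \<partial>density \<tau> (\<lambda>x. ennreal (norm (\<theta> x))))"
    unfolding vector_lint_def V
    using polar_density_props(3)[OF d] pm unfolding V by (intro integral_cong_AE) auto
  also have "\<dots> = (\<integral>x. \<Phi> x \<bullet> \<theta> x \<partial>\<tau>)"
    by (subst integral_density) (auto intro!: Bochner_Integration.integral_cong)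
  finally show ?thesis .
qed

text \<open>The trace of \<open>l\<close> is a finite measure and dominates every entry of \<open>l\<close>.
  Adding it to an entry gives a nonnegative set function, to which the Radon-Nikodym theorem applies.\<close>

lemma ex_density_of_psd_measure:
  fixes l :: "'a set \<Rightarrow> real^'n^'n"
  assumes l: "psd_measure M l"
  obtains \<tau> \<theta> where "has_vector_density M l \<tau> \<theta>"
proof -
  have l0: "l {} = 0" and add: "\<And>A. range A \<subseteq> sets M \<Longrightarrow> disjoint_family A \<Longrightarrow> (\<lambda>i::nat. l (A i)) sums l (\<Union>i. A i)"
    and psd: "\<And>E. E \<in> sets M \<Longrightarrow> l E \<in> psd_mats"
    using l unfolding psd_measure_def vector_measure_def by auto
  have lin: "bounded_linear (\<lambda>A::real^'n^'n. B \<bullet> A)" for B by (rule bounded_linear_inner_right)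
  have addB: "(\<lambda>i::nat. B \<bullet> l (A i)) sums (B \<bullet> l (\<Union>i. A i))"
    if "range A \<subseteq> sets M" "disjoint_family A" for A B
    by (rule bounded_linear.sums[OF lin add[OF that]])
  have tr0: "0 \<le> mat 1 \<bullet> l E" if "E \<in> sets M" for E
    using psd_entry_le_trace[OF psd[OF that]] inner_mat1[of "l E"] by (metis abs_ge_zero order_trans)
  obtain \<tau> where \<tau>: "sets \<tau> = sets M" "space \<tau> = space M" "\<And>E. E \<in> sets M \<Longrightarrow> emeasure \<tau> E = ennreal (mat 1 \<bullet> l E)"
      "finite_measure \<tau>"
    by (rule ex_measure_of_real_set_function[of M "\<lambda>E. mat 1 \<bullet> l E", OF tr0 _ addB]) (auto simp: l0)
  interpret finite_measure \<tau> by (rule \<tau>)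
  have "\<exists>h. integrable \<tau> h \<and> (\<forall>E\<in>sets M. l E $ i $ j = (LINT x:E|\<tau>. h x))" for i j
  proof -
    let ?B = "mat 1 + mat_unit i j :: real^'n^'n"
    have eq: "?B \<bullet> A = trace A + A $ i $ j" for A by (simp add: inner_add_left inner_mat1 inner_mat_unit)
    have nn: "0 \<le> ?B \<bullet> l E" if "E \<in> sets M" for E
      unfolding eq using psd_entry_le_trace[OF psd[OF that], of i j] by linarith
    obtain N where N: "sets N = sets M" "space N = space M" "\<And>E. E \<in> sets M \<Longrightarrow> emeasure N E = ennreal (?B \<bullet> l E)"
        "finite_measure N"
      by (rule ex_measure_of_real_set_function[of M "\<lambda>E. ?B \<bullet> l E", OF nn _ addB]) (auto simp: l0)
    have "absolutely_continuous \<tau> N"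
      unfolding absolutely_continuous_def
    proof
      fix E assume "E \<in> null_sets \<tau>"
      then have E: "E \<in> sets M" "mat 1 \<bullet> l E \<le> 0" using \<tau> by (auto simp: null_sets_def ennreal_eq_0_iff)
      then have "trace (l E) \<le> 0" by (simp add: inner_mat1)
      then have "?B \<bullet> l E \<le> 0" unfolding eq using psd_entry_le_trace[OF psd[OF E(1)], of i j] by linarith
      then show "E \<in> null_sets N" using E N by (auto simp: null_sets_def ennreal_neg)
    qed
    then obtain h where h: "h \<in> borel_measurable \<tau>" "density \<tau> h = N"
      using Radon_Nikodym[of N] N(1) \<tau>(1) by auto
    have hfin: "(\<integral>\<^sup>+x. h x * indicator E x \<partial>\<tau>) = ennreal (?B \<bullet> l E)" if "E \<in> sets M" for E
      using N(3)[OF that] h that \<tau>(1) by (metis emeasure_density)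
    have "(\<integral>\<^sup>+x. h x \<partial>\<tau>) = ennreal (?B \<bullet> l (space M))"
      using hfin[OF sets.top] by (subst nn_integral_cong[of \<tau> h "\<lambda>x. h x * indicator (space M) x"]) (auto simp: \<tau>(2))
    then have AEfin: "AE x in \<tau>. h x \<noteq> \<infinity>" using h(1) by (intro nn_integral_PInf_AE) auto
    let ?h = "\<lambda>x. enn2real (h x)"
    have hE: "integrable \<tau> (\<lambda>x. indicat_real E x *\<^sub>R ?h x) \<and> (LINT x:E|\<tau>. ?h x) = ?B \<bullet> l E" if E: "E \<in> sets M" for E
    proof -
      have nn_eq: "(\<integral>\<^sup>+x. ennreal (indicat_real E x *\<^sub>R ?h x) \<partial>\<tau>) = ennreal (?B \<bullet> l E)"
        unfolding hfin[OF E, symmetric] using AEfin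
        by (intro nn_integral_cong_AE) (auto simp: indicator_def less_top)
      have m: "(\<lambda>x. indicat_real E x *\<^sub>R ?h x) \<in> borel_measurable \<tau>" using h(1) E \<tau>(1) by measurable
      have "has_bochner_integral \<tau> (\<lambda>x. indicat_real E x *\<^sub>R ?h x) (?B \<bullet> l E)"
        using nn_eq m nn[OF E] by (intro has_bochner_integral_nn_integral) auto
      then show ?thesis unfolding set_lebesgue_integral_def 
        by (auto simp: has_bochner_integral_iff)
    qed
    have ih: "integrable \<tau> ?h"
      using conjunct1[OF hE[OF sets.top]]
      by (subst Bochner_Integration.integrable_cong[of \<tau> \<tau> ?h "\<lambda>x. indicat_real (space M) x *\<^sub>R ?h x"]) (auto simp: \<tau>(2))
    have "l E $ i $ j = (LINT x:E|\<tau>. ?h x - 1)" if E: "E \<in> sets M" for E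
    proof -
      have "(LINT x:E|\<tau>. ?h x - 1) = (LINT x:E|\<tau>. ?h x) - (LINT x:E|\<tau>. 1)"
        using hE[OF E] E \<tau>(1) by (intro set_integral_diff) (auto simp: set_integrable_def emeasure_eq_measure)
      also have "(LINT x:E|\<tau>. (1::real)) = measure \<tau> E" using E \<tau>(1) by (simp add: set_lebesgue_integral_def)
      also have "measure \<tau> E = mat 1 \<bullet> l E" using \<tau>(3)[OF E] tr0[OF E] by (simp add: measure_def)
      finally show ?thesis using hE[OF E] by (simp add: inner_add_left inner_mat_unit)
    qed
    then show ?thesis using ih by (intro exI[of _ "\<lambda>x. ?h x - 1"]) auto
  qed
  then obtain h where h: "\<And>i j. integrable \<tau> (h i j)" 
      "\<And>i j E. E \<in> sets M \<Longrightarrow> l E $ i $ j = (LINT x:E|\<tau>. h i j x)" by metis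
  define \<theta> where "\<theta> x = (\<Sum>i\<in>UNIV. \<Sum>j\<in>UNIV. h i j x *\<^sub>R (mat_unit i j :: real^'n^'n))" for x
  have "l E = (LINT x:E|\<tau>. \<theta> x)" if E: "E \<in> sets M" for E
  proof -
    have "l E = (\<Sum>i\<in>UNIV. \<Sum>j\<in>UNIV. l E $ i $ j *\<^sub>R mat_unit i j)" by (rule mat_expansion)
    also have "\<dots> = (\<Sum>i\<in>UNIV. \<Sum>j\<in>UNIV. (\<integral>x. (indicat_real E x * h i j x) *\<^sub>R mat_unit i j \<partial>\<tau>))"
      unfolding h(2)[OF E] set_lebesgue_integral_def using h(1) E \<tau>(1)
      by (intro sum.cong refl) (simp add: integrable_mult_indicator[where 'b=real, simplified])
    also have "\<dots> = (\<integral>x. (\<Sum>i\<in>UNIV. \<Sum>j\<in>UNIV. (indicat_real E x * h i j x) *\<^sub>R mat_unit i j) \<partial>\<tau>)"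
      using h(1) E \<tau>(1) integrable_mult_indicator[OF _ h(1), of E]
      by (subst Bochner_Integration.integral_sum; (intro Bochner_Integration.integrable_sum integrable_scaleR_left)?)
         (auto intro!: sum.cong Bochner_Integration.integral_sum[symmetric] integrable_scaleR_left)
    also have "\<dots> = (LINT x:E|\<tau>. \<theta> x)" unfolding set_lebesgue_integral_def \<theta>_def
      by (simp add: scaleR_sum_right)
    finally show ?thesis .
  qed
  moreover have "integrable \<tau> \<theta>" unfolding \<theta>_def using h(1)
    by (intro Bochner_Integration.integrable_sum integrable_scaleR_left) auto
  ultimately show ?thesis using that \<tau> unfolding has_vector_density_def by blast
qed

lemma sym_polar_density:
  fixes l :: "'a set \<Rightarrow> real^'n^'n"
  assumes d: "has_vector_density M l \<tau> \<theta>" and sym: "\<And>E. E \<in> sets M \<Longrightarrow> l E \<in> sym_mats"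
  shows "AE x in total_variation M l. polar_density M l x \<in> sym_mats"
proof -
  let ?V = "total_variation M l" and ?g = "polar_density M l"
  have sV: "sets ?V = sets M" using total_variation_density[OF d] has_vector_densityD(2)[OF d] by simp
  have ig: "integrable ?V ?g" by (rule polar_density_props(1)[OF d])
  have comp: "integrable ?V (\<lambda>x. mat_unit i j \<bullet> ?g x)" for i j :: 'n using ig by (intro integrable_inner_right)
  have ci: "(LINT x:E|?V. mat_unit i j \<bullet> ?g x) = l E $ i $ j" if "E \<in> sets M" for E i j
  proof -
    have "(LINT x:E|?V. mat_unit i j \<bullet> ?g x) = (\<integral>x. mat_unit i j \<bullet> (indicat_real E x *\<^sub>R ?g x) \<partial>?V)"
      unfolding set_lebesgue_integral_def by simp
    also have "\<dots> = mat_unit i j \<bullet> l E"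
      unfolding polar_density_props(2)[OF d that] set_lebesgue_integral_def
      using that sV by (intro integral_inner_right integrable_mult_indicator ig) auto
    finally show ?thesis by (simp add: inner_mat_unit)
  qed
  interpret V: finite_measure ?V by (rule finite_measure_total_variation[OF d])
  have "AE x in ?V. mat_unit i j \<bullet> ?g x = mat_unit j i \<bullet> ?g x" for i j :: 'n
  proof (rule V.density_unique_banach[OF comp comp])
    fix A assume "A \<in> sets ?V"
    then have A: "A \<in> sets M" using sV by simp
    have "l A $ i $ j = l A $ j $ i" using sym[OF A] unfolding sym_mats_def transpose_def by (auto simp: vec_eq_iff)
    then show "(LINT x:A|?V. mat_unit i j \<bullet> ?g x) = (LINT x:A|?V. mat_unit j i \<bullet> ?g x)" using ci[OF A] by simp
  qed
  then have "AE x in ?V. \<forall>i j. ?g x $ i $ j = ?g x $ j $ i" by (simp add: AE_all_countable inner_mat_unit)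
  then show ?thesis by eventually_elim (auto simp: sym_mats_def transpose_def vec_eq_iff)
qed


section \<open>From continuous to measurable weights\<close>

lemma ex_real_density:
  assumes "finite_measure \<tau>" "finite_measure N" "sets N = sets \<tau>" "absolutely_continuous \<tau> N"
  obtains h :: "'a \<Rightarrow> real" where "integrable \<tau> h" "\<And>x. 0 \<le> h x" "N = density \<tau> (\<lambda>x. ennreal (h x))"
proof -
  interpret finite_measure \<tau> by fact
  interpret N: finite_measure N by fact
  obtain h where h: "h \<in> borel_measurable \<tau>" "AE x in \<tau>. RN_deriv \<tau> N x = ennreal (h x)" "\<And>x. 0 \<le> h x"
    using real_RN_deriv[OF assms(2,4,3)] by metis
  have "N = density \<tau> (RN_deriv \<tau> N)" by (rule density_RN_deriv[OF assms(4,3), symmetric])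
  also have "\<dots> = density \<tau> (\<lambda>x. ennreal (h x))" using h by (intro density_cong) auto
  finally have eq: "N = density \<tau> (\<lambda>x. ennreal (h x))" .
  have "(\<integral>\<^sup>+x. ennreal (h x) \<partial>\<tau>) = emeasure N (space N)"
    unfolding eq using h(1) by (subst emeasure_density) (auto intro!: nn_integral_cong)
  then have "integrable \<tau> h" using h N.emeasure_finite[of "space N"]
    by (intro integrableI_nonneg) (auto simp: top.not_eq_extremum[symmetric])
  then show ?thesis using that h(3) eq by blast
qed

text \<open>Domination of the functionals passes to open sets and from there, by outer regularity, to null
  sets.\<close>

lemma (in bounded_positive_functional) absolutely_continuous_repr:
  assumes L': "bounded_positive_functional L' B'"
    and le: "\<And>g. g \<in> Cc \<Longrightarrow> (\<And>x. 0 \<le> g x) \<Longrightarrow> L' g \<le> c * L g" and c: "c \<ge> 0"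
  shows "absolutely_continuous repr (bounded_positive_functional.repr L')"
proof -
  interpret L': bounded_positive_functional L' B' by (rule L')
  have cont: "L'.content U \<le> ennreal c * content U" for U
    unfolding L'.content_def
  proof (rule SUP_least)
    fix g assume "g \<in> L'.below U"
    then have g: "g \<in> Cc" "\<And>x. 0 \<le> g x" "g \<in> below U" unfolding L'.below_def below_def by auto
    have "ennreal (L' g) \<le> ennreal (c * L g)" by (intro ennreal_leI le g)
    also have "\<dots> = ennreal c * ennreal (L g)" using c pos[OF g(1,2)] by (rule ennreal_mult)
    also have "\<dots> \<le> ennreal c * content U" by (intro mult_left_mono content_upper g) simp
    finally show "ennreal (L' g) \<le> ennreal c * content U" .
  qed
  show ?thesis unfolding absolutely_continuous_def
  proof
    fix E assume "E \<in> null_sets repr"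
    then have E: "E \<in> sets borel" "outer E = 0" using emeasure_repr by (auto simp: null_sets_def)
    have "L'.outer E \<le> 0"
    proof (rule ennreal_le_epsilon)
      fix e :: real assume e: "e > 0"
      have "outer E < ennreal (e / (c + 1))" using E(2) e c by simp
      then obtain U where U: "open U" "E \<subseteq> U" "content U < ennreal (e / (c + 1))"
        unfolding outer_def INF_less_iff by auto
      have "L'.outer E \<le> L'.content U" by (rule L'.outer_upper[OF U(1,2)])
      also have "\<dots> \<le> ennreal c * content U" by (rule cont)
      also have "\<dots> \<le> ennreal c * ennreal (e / (c + 1))" using U(3) by (intro mult_left_mono) auto
      also have "\<dots> = ennreal (c * (e / (c + 1)))" using c e by (intro ennreal_mult[symmetric]) auto
      also have "\<dots> \<le> ennreal e" using c e by (intro ennreal_leI) (simp add: field_simps)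
      finally show "L'.outer E \<le> 0 + ennreal e" by simp
    qed
    then show "E \<in> null_sets L'.repr" using E(1) L'.emeasure_repr by (auto simp: null_sets_def)
  qed
qed

lemma compact_bump:
  fixes K :: "'a::euclidean_space set"
  assumes K: "compact K"
  obtains w :: "nat \<Rightarrow> 'a \<Rightarrow> real" where "\<And>m. w m \<in> Cc" "\<And>m x. 0 \<le> w m x" "\<And>m x. w m x \<le> 1"
    "\<And>x. (\<lambda>m. w m x) \<longlonglongrightarrow> indicator K x"
proof (cases "K = {}")
  case True
  show ?thesis by (rule that[of "\<lambda>_ _. 0"]) (auto simp: True Cc_zero)
next
  case False
  define w where "w m x = max 0 (1 - real (Suc m) * infdist x K)" for m x
  obtain r where r: "\<And>x. x \<in> K \<Longrightarrow> norm x \<le> r" using compact_imp_bounded[OF K] bounded_iff by blast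
  have wz: "w m x = 0" if "x \<notin> cball 0 (r + 1)" for m x
  proof -
    obtain y where y: "y \<in> K" "infdist x K = dist x y"
      using infdist_attains_inf[OF compact_imp_closed[OF K] False] by blast
    have "1 \<le> dist x y" using r[OF y(1)] that norm_triangle_ineq2[of x y] by (simp add: dist_norm)
    then have "1 \<le> real (Suc m) * infdist x K" unfolding y(2)
      using mult_mono[of 1 "real (Suc m)" 1 "dist x y"] by simp
    then show ?thesis unfolding w_def by simp
  qed
  have "w m \<in> Cc" for m unfolding Cc_def
  proof (intro CollectI conjI exI[of _ "cball 0 (r+1)"] allI impI)
    show "continuous_on UNIV (w m)" unfolding w_def by (intro continuous_intros)
  qed (use wz in auto)
  moreover have "0 \<le> w m x" "w m x \<le> 1" for m x unfolding w_def by (auto simp: infdist_nonneg)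
  moreover have "(\<lambda>m. w m x) \<longlonglongrightarrow> indicator K x" for x
  proof (cases "x \<in> K")
    case True
    then have "w m x = 1" for m unfolding w_def by simp
    then show ?thesis using True by simp
  next
    case out: False
    then have "infdist x K > 0"
      using in_closed_iff_infdist_zero[OF compact_imp_closed[OF K] False, of x] infdist_nonneg[of x K] by linarith
    then obtain N :: nat where N: "1 < real N * infdist x K" using ex_less_of_nat_mult by blast
    have "w m x = 0" if "m \<ge> N" for m
    proof -
      have "real N * infdist x K \<le> real (Suc m) * infdist x K" using that by (intro mult_right_mono) (auto simp: infdist_nonneg)
      then show ?thesis unfolding w_def using N by simp
    qed
    then have "\<forall>\<^sub>F m in sequentially. w m x = 0" unfolding eventually_sequentially by blast
    then show ?thesis using out by (auto intro: tendsto_eventually)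
  qed
  ultimately show ?thesis using that by blast
qed

text \<open>Continuous bumps around the disjoint sets \<open>C i\<close> converge to their indicators but may
  overlap. Dividing by the maximum of 1 and their sum restores the constraint and leaves the limit
  unchanged.\<close>

lemma compact_partition_bound:
  fixes \<tau> :: "'a::euclidean_space measure" and a :: "nat \<Rightarrow> 'a \<Rightarrow> real"
  assumes fin: "finite_measure \<tau>" and sets: "sets \<tau> = sets borel" and a: "\<And>i. integrable \<tau> (a i)"
    and H: "\<And>w. (\<And>i. w i \<in> Cc) \<Longrightarrow> (\<And>i x. 0 \<le> w i x) \<Longrightarrow> (\<And>x. (\<Sum>i\<le>n. w i x) \<le> 1) \<Longrightarrow>
        (\<Sum>i\<le>n. \<integral>x. w i x * a i x \<partial>\<tau>) \<le> K"
    and C: "\<And>i. compact (C i)" and disj: "disjoint_family C"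
  shows "(\<Sum>i\<le>n. \<integral>x. indicator (C i) x * a i x \<partial>\<tau>) \<le> K"
proof -
  have "\<exists>w :: nat \<Rightarrow> 'a \<Rightarrow> real. (\<forall>m. w m \<in> Cc) \<and> (\<forall>m x. 0 \<le> w m x \<and> w m x \<le> 1) \<and> (\<forall>x. (\<lambda>m. w m x) \<longlonglongrightarrow> indicator (C i) x)" for i
    using compact_bump[OF C[of i]] by metis
  then obtain w :: "nat \<Rightarrow> nat \<Rightarrow> 'a \<Rightarrow> real" where w: "\<And>i m. w i m \<in> Cc" "\<And>i m x. 0 \<le> w i m x" "\<And>i m x. w i m x \<le> 1"
      "\<And>i x. (\<lambda>m. w i m x) \<longlonglongrightarrow> indicator (C i) x" by metis
  define s where "s m x = max 1 (\<Sum>i\<le>n. w i m x)" for m x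
  have s1: "1 \<le> s m x" for m x unfolding s_def by simp
  define v where "v m i x = w i m x / s m x" for m i x
  have vC: "v m i \<in> Cc" for m i unfolding v_def s_def
    by (rule Cc_I[OF w(1)]) (auto intro!: continuous_intros Cc_continuous[OF w(1)])
  have v0: "0 \<le> v m i x" for m i x unfolding v_def using w(2) s1[of m x] by (simp add: divide_nonneg_pos)
  have v1: "v m i x \<le> 1" for m i x unfolding v_def using w(2,3)[of i m x] s1[of m x]
    by (simp add: divide_le_eq_1) 
  have vs: "(\<Sum>i\<le>n. v m i x) \<le> 1" for m x
    unfolding v_def sum_divide_distrib[symmetric] s_def by (simp add: divide_le_eq_1 max_def)
  have le: "(\<Sum>i\<le>n. \<integral>x. v m i x * a i x \<partial>\<tau>) \<le> K" for m by (rule H[OF vC v0 vs])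
  have "(\<Sum>i\<le>n. indicat_real (C i) x) \<le> 1" for x
  proof (cases "\<exists>k\<le>n. x \<in> C k")
    case True
    then obtain k where k: "k \<le> n" "x \<in> C k" by blast
    have "indicat_real (C i) x = (if i = k then 1 else 0)" for i
      using k(2) disj unfolding disjoint_family_on_def by (auto simp: indicator_def)
    then show ?thesis using k(1) by simp
  next
    case False
    then have "(\<Sum>i\<le>n. indicat_real (C i) x) = 0" by (intro sum.neutral) auto
    then show ?thesis by simp
  qed
  moreover have "(\<lambda>m. s m x) \<longlonglongrightarrow> max 1 (\<Sum>i\<le>n. indicat_real (C i) x)" for x
    unfolding s_def by (intro tendsto_intros w(4))
  ultimately have slim: "(\<lambda>m. s m x) \<longlonglongrightarrow> 1" for x by (metis max.absorb1)
  have vlim: "(\<lambda>m. v m i x) \<longlonglongrightarrow> indicator (C i) x" for i x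
    unfolding v_def using tendsto_divide[OF w(4)[of i x] slim[of x]] by simp
  have [measurable]: "a i \<in> borel_measurable \<tau>" for i using a by auto
  have [measurable]: "v m i \<in> borel_measurable \<tau>" for m i 
    using Cc_measurable[OF vC[of m i]] by (simp add: measurable_cong_sets[OF sets refl])
  have [measurable]: "C i \<in> sets \<tau>" for i unfolding sets using C compact_imp_closed borel_closed by blast
  have "(\<lambda>m. \<integral>x. v m i x * a i x \<partial>\<tau>) \<longlonglongrightarrow> (\<integral>x. indicator (C i) x * a i x \<partial>\<tau>)" for i
  proof (rule integral_dominated_convergence[where w = "\<lambda>x. \<bar>a i x\<bar>"])
    show "AE x in \<tau>. norm (v m i x * a i x) \<le> \<bar>a i x\<bar>" for m
      using v0[of m i] v1[of m i] by (auto simp: abs_mult intro!: mult_left_le_one_le)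
    show "AE x in \<tau>. (\<lambda>m. v m i x * a i x) \<longlonglongrightarrow> indicator (C i) x * a i x"
      by (intro AE_I2 tendsto_mult_right vlim)
  qed (auto intro: a)
  then have "(\<lambda>m. \<Sum>i\<le>n. \<integral>x. v m i x * a i x \<partial>\<tau>) \<longlonglongrightarrow> (\<Sum>i\<le>n. \<integral>x. indicator (C i) x * a i x \<partial>\<tau>)"
    by (intro tendsto_sum)
  then show ?thesis by (rule LIMSEQ_le_const2) (use le in auto)
qed

text \<open>Inner regularity of the measure with density \<open>\<bar>a i\<bar>\<close> reduces Borel sets to
  compact ones.\<close>

lemma partition_bound:
  fixes \<tau> :: "'a::euclidean_space measure" and a :: "nat \<Rightarrow> 'a \<Rightarrow> real"
  assumes fin: "finite_measure \<tau>" and sets: "sets \<tau> = sets borel" and a: "\<And>i. integrable \<tau> (a i)"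
    and H: "\<And>w. (\<And>i. w i \<in> Cc) \<Longrightarrow> (\<And>i x. 0 \<le> w i x) \<Longrightarrow> (\<And>x. (\<Sum>i\<le>n. w i x) \<le> 1) \<Longrightarrow>
        (\<Sum>i\<le>n. \<integral>x. w i x * a i x \<partial>\<tau>) \<le> K"
    and E: "\<And>i. E i \<in> sets borel" and disj: "disjoint_family E"
  shows "(\<Sum>i\<le>n. \<integral>x. indicator (E i) x * a i x \<partial>\<tau>) \<le> K"
proof (rule field_le_epsilon)
  fix e :: real assume e: "e > 0"
  have am[measurable]: "a i \<in> borel_measurable \<tau>" for i using a by auto
  have Em[measurable]: "E i \<in> sets \<tau>" for i using E sets by auto
  let ?e = "e / real (Suc n)"
  have e': "?e > 0" using e by simp
  have "\<exists>C. compact C \<and> C \<subseteq> E i \<and> (\<integral>x. indicator (E i) x * a i x \<partial>\<tau>) \<le> (\<integral>x. indicator C x * a i x \<partial>\<tau>) + ?e" for i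
  proof -
    let ?N = "density \<tau> (\<lambda>x. ennreal \<bar>a i x\<bar>)"
    have sN: "sets ?N = sets borel" using sets by simp
    have Nfin: "emeasure ?N (space ?N) \<noteq> \<infinity>"
    proof -
      have "emeasure ?N (space ?N) = (\<integral>\<^sup>+x. ennreal \<bar>a i x\<bar> \<partial>\<tau>)"
        by (subst emeasure_density) (auto intro!: nn_integral_cong)
      then show ?thesis using a[of i] by (auto simp: integrable_iff_bounded)
    qed
    interpret N: finite_measure ?N using Nfin by (rule finite_measureI)
    have "emeasure ?N (E i) = (SUP K \<in> {K. K \<subseteq> E i \<and> compact K}. emeasure ?N K)"
      by (rule inner_regular[OF sN Nfin E])
    moreover have "\<exists>C\<in>{K. K \<subseteq> E i \<and> compact K}. emeasure ?N (E i) < emeasure ?N C + ennreal ?e"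
    proof (rule ccontr)
      assume n: "\<not> ?thesis"
      have "(SUP K \<in> {K. K \<subseteq> E i \<and> compact K}. emeasure ?N K + ennreal ?e) \<le> emeasure ?N (E i)"
        using n by (intro SUP_least) (auto simp: not_less)
      then have "(SUP K \<in> {K. K \<subseteq> E i \<and> compact K}. emeasure ?N K) + ennreal ?e \<le> emeasure ?N (E i)"
        by (subst (asm) ennreal_SUP_add_left) auto
      then have "emeasure ?N (E i) + ennreal ?e \<le> emeasure ?N (E i) + 0" using calculation by simp
      then have "ennreal ?e \<le> 0" using N.emeasure_finite[of "E i"]
        by (subst (asm) ennreal_add_left_cancel_le) auto
      then show False using e' by simp
    qed
    ultimately obtain C where C: "C \<subseteq> E i" "compact C" "emeasure ?N (E i) < emeasure ?N C + ennreal ?e" by auto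
    have Cm[measurable]: "C \<in> sets \<tau>" unfolding sets using C(2) compact_imp_closed borel_closed by blast
    have mE: "measure ?N S = (\<integral>x. indicator S x * \<bar>a i x\<bar> \<partial>\<tau>)" if S[measurable]: "S \<in> sets \<tau>" for S
    proof -
      have "emeasure ?N S = (\<integral>\<^sup>+x. ennreal (indicator S x * \<bar>a i x\<bar>) \<partial>\<tau>)"
        by (subst emeasure_density) (auto intro!: nn_integral_cong simp: indicator_def)
      also have "\<dots> = ennreal (\<integral>x. indicator S x * \<bar>a i x\<bar> \<partial>\<tau>)"
        using integrable_mult_indicator[OF S integrable_abs[OF a[of i]]]
        by (intro nn_integral_eq_integral) auto
      finally show ?thesis by (simp add: measure_def)
    qed
    have iE: "integrable \<tau> (\<lambda>x. indicator S x * a i x)" "integrable \<tau> (\<lambda>x. indicator S x * \<bar>a i x\<bar>)"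
      if "S \<in> sets \<tau>" for S
      using integrable_mult_indicator[OF that a[of i]] integrable_mult_indicator[OF that integrable_abs[OF a[of i]]] by auto
    have "measure ?N (E i) < measure ?N C + ?e"
      using C(3) e' by (simp add: N.emeasure_eq_measure ennreal_plus[symmetric] ennreal_less_iff del: ennreal_plus)
    then have "(\<integral>x. indicator (E i) x * \<bar>a i x\<bar> \<partial>\<tau>) < (\<integral>x. indicator C x * \<bar>a i x\<bar> \<partial>\<tau>) + ?e"
      unfolding mE[OF Em] mE[OF Cm] .
    moreover have "(\<integral>x. indicator (E i) x * a i x - indicator C x * a i x \<partial>\<tau>)
        \<le> (\<integral>x. indicator (E i) x * \<bar>a i x\<bar> - indicator C x * \<bar>a i x\<bar> \<partial>\<tau>)"
      using C(1) by (intro integral_mono Bochner_Integration.integrable_diff iE Em Cm)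
         (auto simp: indicator_def)
    ultimately have "(\<integral>x. indicator (E i) x * a i x \<partial>\<tau>) \<le> (\<integral>x. indicator C x * a i x \<partial>\<tau>) + ?e"
      using iE[OF Em] iE[OF Cm] by simp
    then show ?thesis using C by blast
  qed
  then obtain C where C: "\<And>i. compact (C i)" "\<And>i. C i \<subseteq> E i"
      "\<And>i. (\<integral>x. indicator (E i) x * a i x \<partial>\<tau>) \<le> (\<integral>x. indicator (C i) x * a i x \<partial>\<tau>) + ?e" by metis
  have dC: "disjoint_family C" using disj C(2) unfolding disjoint_family_on_def by blast
  have "(\<Sum>i\<le>n. \<integral>x. indicator (E i) x * a i x \<partial>\<tau>) \<le> (\<Sum>i\<le>n. (\<integral>x. indicator (C i) x * a i x \<partial>\<tau>) + ?e)"
    by (intro sum_mono C(3))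
  also have "\<dots> = (\<Sum>i\<le>n. \<integral>x. indicator (C i) x * a i x \<partial>\<tau>) + e" by (simp add: sum.distrib)
  also have "(\<Sum>i\<le>n. \<integral>x. indicator (C i) x * a i x \<partial>\<tau>) \<le> K"
    by (rule compact_partition_bound[OF fin sets a H C(1) dC])
  finally show "(\<Sum>i\<le>n. \<integral>x. indicator (E i) x * a i x \<partial>\<tau>) \<le> K + e" by simp
qed

text \<open>Partition the space according to the first index at which the maximum is attained. This lemma turns
  a bound on continuous convex combinations, which is what a functional on test functions provides, into a bound
  on the integral of a supremum.\<close>

lemma maximum_bound:
  fixes \<tau> :: "'a::euclidean_space measure" and a :: "nat \<Rightarrow> 'a \<Rightarrow> real"
  assumes fin: "finite_measure \<tau>" and sets: "sets \<tau> = sets borel" and a: "\<And>i. integrable \<tau> (a i)"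
    and H: "\<And>w. (\<And>i. w i \<in> Cc) \<Longrightarrow> (\<And>i x. 0 \<le> w i x) \<Longrightarrow> (\<And>x. (\<Sum>i\<le>n. w i x) \<le> 1) \<Longrightarrow>
        (\<Sum>i\<le>n. \<integral>x. w i x * a i x \<partial>\<tau>) \<le> K"
    and a0: "\<And>x. a 0 x = 0"
  shows "(\<integral>\<^sup>+x. (SUP i\<in>{..n}. ennreal (a i x)) \<partial>\<tau>) \<le> ennreal K"
proof -
  have am[measurable]: "a i \<in> borel_measurable \<tau>" for i using a by auto
  define F where "F i = {x. \<forall>j\<le>n. a j x \<le> a i x}" for i
  define E where "E i = (if i \<le> n then disjointed F i else {})" for i
  have sp: "space \<tau> = UNIV" using sets_eq_imp_space_eq[OF sets] by simp
  have Fm: "F i \<in> sets \<tau>" for i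
  proof -
    have "{x \<in> space \<tau>. \<forall>j\<in>{..n}. a j x \<le> a i x} \<in> sets \<tau>" by measurable
    moreover have "{x \<in> space \<tau>. \<forall>j\<in>{..n}. a j x \<le> a i x} = F i" unfolding F_def sp by auto
    ultimately show ?thesis by simp
  qed
  then have "range (disjointed F) \<subseteq> sets \<tau>" by (intro sets.range_disjointed_sets) auto
  then have Em: "E i \<in> sets \<tau>" for i unfolding E_def by auto
  have disj: "disjoint_family E" using disjoint_family_disjointed[of F] unfolding E_def disjoint_family_on_def by auto
  have EF: "E i \<subseteq> F i" for i using disjointed_subset[of F i] unfolding E_def by auto
  have cover: "\<exists>i\<le>n. x \<in> E i" for x
  proof -
    have "Max ((\<lambda>i. a i x) ` {..n}) \<in> (\<lambda>i. a i x) ` {..n}" by (intro Max_in) auto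
    then obtain k where k': "Max ((\<lambda>i. a i x) ` {..n}) = a k x" "k \<in> {..n}" by (elim imageE)
    then have k: "k \<le> n" "\<And>j. j \<le> n \<Longrightarrow> a j x \<le> a k x" by (auto simp: k'(1)[symmetric])
    then have "x \<in> F k" unfolding F_def by auto
    then have ex: "\<exists>k. x \<in> F k" by blast
    define m where "m = (LEAST k. x \<in> F k)"
    have m: "x \<in> F m" unfolding m_def by (rule LeastI_ex[OF ex])
    have mk: "m \<le> k" unfolding m_def by (rule Least_le) fact
    have "x \<notin> F j" if "j < m" for j using that unfolding m_def by (rule not_less_Least)
    then have "x \<in> disjointed F m" unfolding disjointed_def using m by simp
    then show ?thesis using mk k(1) unfolding E_def by (intro exI[of _ m]) auto
  qed
  have pt: "(SUP i\<in>{..n}. ennreal (a i x)) = ennreal (\<Sum>i\<le>n. indicator (E i) x * a i x)"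
    and pos: "0 \<le> (\<Sum>i\<le>n. indicator (E i) x * a i x)" for x
  proof -
    obtain k where k: "k \<le> n" "x \<in> E k" using cover by blast
    have "indicat_real (E i) x = (if i = k then 1 else 0)" for i
      using k(2) disj unfolding disjoint_family_on_def by (auto simp: indicator_def)
    then have s: "(\<Sum>i\<le>n. indicator (E i) x * a i x) = a k x"
      using k(1) by (simp add: if_distrib[of "\<lambda>y. y * _"] cong: if_cong)
    have mx: "a i x \<le> a k x" if "i \<le> n" for i using EF k(2) that unfolding F_def by auto
    show "(SUP i\<in>{..n}. ennreal (a i x)) = ennreal (\<Sum>i\<le>n. indicator (E i) x * a i x)"
      unfolding s using mx k(1) by (intro antisym SUP_least SUP_upper2[of k]) (auto intro: ennreal_leI)
    show "0 \<le> (\<Sum>i\<le>n. indicator (E i) x * a i x)" unfolding s using mx[of 0] a0 by simp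
  qed
  have int: "integrable \<tau> (\<lambda>x. indicator (E i) x * a i x)" for i
    using integrable_mult_indicator[OF Em a] by simp
  have "(\<integral>\<^sup>+x. (SUP i\<in>{..n}. ennreal (a i x)) \<partial>\<tau>) = ennreal (\<integral>x. (\<Sum>i\<le>n. indicator (E i) x * a i x) \<partial>\<tau>)"
    unfolding pt using int pos by (intro nn_integral_eq_integral Bochner_Integration.integrable_sum) auto
  also have "(\<integral>x. (\<Sum>i\<le>n. indicator (E i) x * a i x) \<partial>\<tau>) = (\<Sum>i\<le>n. \<integral>x. indicator (E i) x * a i x \<partial>\<tau>)"
    using int by (rule Bochner_Integration.integral_sum)
  also have "\<dots> \<le> K" using Em sets by (intro partition_bound[OF fin sets a H _ disj]) auto
  finally show ?thesis by (simp add: ennreal_leI)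
qed


section \<open>Functionals on matrix-valued functions\<close>

lemma Cc_scaleR_bcontfun:
  fixes A :: "'b::real_normed_vector"
  assumes "g \<in> Cc" shows "(\<lambda>x. g x *\<^sub>R A) \<in> bcontfun"
proof -
  obtain c where c: "c > 0" "\<And>x. \<bar>g x\<bar> \<le> c" using Cc_bounded[OF assms] by blast
  show ?thesis
  proof (rule bcontfun_normI)
    show "continuous_on UNIV (\<lambda>x. g x *\<^sub>R A)" using Cc_continuous[OF assms] by (intro continuous_intros)
    show "norm (g x *\<^sub>R A) \<le> c * norm A" for x using c(2)[of x] by (simp add: mult_right_mono)
  qed
qed

lemma apply_sum_bcontfun: "finite I \<Longrightarrow> apply_bcontfun (\<Sum>i\<in>I. h i) x = (\<Sum>i\<in>I. apply_bcontfun (h i) x :: 'b::real_normed_vector)"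
  by (induction I rule: finite_induct) auto

context integrand
begin

text \<open>The functional \<open>g \<mapsto> \<Lambda> (g *\<^sub>R mat 1)\<close> is positive and yields the
  measure \<open>\<tau>\<close>. The functionals belonging to \<open>mat 1 \<plusminus> mat_unit i j\<close> are
  positive too, so their measures are at most twice \<open>\<tau>\<close>, and the entries of
  \<open>\<Lambda>\<close> acquire densities \<open>h i j\<close> with respect to \<open>\<tau>\<close>. For the
  bound on the cost, write \<open>sym_ext f\<close> as a supremum of \<open>D i \<bullet> _\<close> with
  \<open>D i\<close> in the polar set and use that convex combinations of the \<open>D i\<close> with continuous
  weights are polar-valued.\<close>

lemma matrix_functional_representation:
  fixes \<Lambda> :: "('a::euclidean_space \<Rightarrow>\<^sub>C (real^'n^'n)) \<Rightarrow> real"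
  assumes lin: "linear \<Lambda>" and bd: "\<And>\<psi>. (\<And>x. apply_bcontfun \<psi> x \<in> polar_set f) \<Longrightarrow> \<Lambda> \<psi> \<le> K"
  obtains \<tau> :: "'a measure" and \<theta> where "finite_measure \<tau>" "sets \<tau> = sets borel" "integrable \<tau> \<theta>"
    "\<And>\<psi>. (\<And>i j. (\<lambda>x. apply_bcontfun \<psi> x $ i $ j) \<in> Cc) \<Longrightarrow> \<Lambda> \<psi> = (\<integral>x. apply_bcontfun \<psi> x \<bullet> \<theta> x \<partial>\<tau>)"
    "(\<integral>\<^sup>+x. sym_ext f (\<theta> x) \<partial>\<tau>) \<le> ennreal K"
proof -
  define em where "em g A = Bcontfun (\<lambda>x::'a. g x *\<^sub>R (A::real^'n^'n))" for g A
  have em: "apply_bcontfun (em g A) x = g x *\<^sub>R A" if "g \<in> Cc" for g A x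
    unfolding em_def by (simp add: Bcontfun_inverse Cc_scaleR_bcontfun that)
  have em_add: "em (\<lambda>x. g x + h x) A = em g A + em h A" if "g \<in> Cc" "h \<in> Cc" for g h A
    by (rule bcontfun_eqI) (simp add: em that Cc_add scaleR_add_left)
  have em_cmult: "em (\<lambda>x. c * g x) A = c *\<^sub>R em g A" if "g \<in> Cc" for g c A
    by (rule bcontfun_eqI) (simp add: em that Cc_cmult)
  have em_addA: "em g (A + B) = em g A + em g B" if "g \<in> Cc" for g A B
    by (rule bcontfun_eqI) (simp add: em that scaleR_add_right)
  have em_cmultA: "em g (c *\<^sub>R A) = c *\<^sub>R em g A" if "g \<in> Cc" for g c A
    by (rule bcontfun_eqI) (simp add: em that)
  note L_add = linear_add[OF lin] and L_scale = linear_cmul[OF lin, unfolded real_scaleR_def]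
  have K0: "0 \<le> K" using bd[of 0] polar_zero linear_0[OF lin] by simp
  let ?M = "\<lambda>s i j. mat 1 + s *\<^sub>R mat_unit i j :: real^'n^'n"
  have bpf: "\<exists>B. bounded_positive_functional (\<lambda>g. \<Lambda> (em g (?M s i j))) B" if s: "\<bar>s\<bar> \<le> 1" for s i j
  proof -
    let ?B = "?M s i j"
    \<comment> \<open>The ray of nonpositive multiples of \<open>g *\<^sub>R ?B\<close> is polar-valued, and \<open>\<Lambda>\<close> is bounded above on it.\<close>
    have pos: "0 \<le> \<Lambda> (em g ?B)" if g: "g \<in> Cc" "\<And>x. 0 \<le> g x" for g
    proof -
      have le: "- t * \<Lambda> (em g ?B) \<le> K" if "t \<ge> 0" for t
      proof -
        have "- (t * g x) *\<^sub>R ?B \<in> polar_set f" for x using that g(2) by (intro polar_neg_dominating s) simp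
        then have "\<Lambda> ((- t) *\<^sub>R em g ?B) \<le> K" by (intro bd) (simp add: em[OF g(1)])
        then show ?thesis by (simp add: linear_neg[OF lin] L_scale)
      qed
      show ?thesis
      proof (rule ccontr)
        assume n: "\<not> ?thesis"
        have "- ((K + 1) / (- \<Lambda> (em g ?B))) * \<Lambda> (em g ?B) \<le> K"
          using n K0 by (intro le divide_nonneg_pos) auto
        then show False using n by simp
      qed
    qed
    obtain t where t: "t > 0" "(1 / t) *\<^sub>R ?B \<in> polar_set f" using polar_absorbing by blast
    have "bounded_positive_functional (\<lambda>g. \<Lambda> (em g ?B)) (t * K)"
    proof
      fix g h :: "'a \<Rightarrow> real" assume g: "g \<in> Cc"
      show "h \<in> Cc \<Longrightarrow> \<Lambda> (em (\<lambda>x. g x + h x) ?B) = \<Lambda> (em g ?B) + \<Lambda> (em h ?B)" 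
        using g by (simp add: em_add L_add)
      show "\<Lambda> (em (\<lambda>x. c * g x) ?B) = c * \<Lambda> (em g ?B)" for c using g by (simp add: em_cmult L_scale)
      show "(\<And>x. 0 \<le> g x) \<Longrightarrow> 0 \<le> \<Lambda> (em g ?B)" using pos g by blast
      assume g1: "\<And>x. g x \<le> 1"
      \<comment> \<open>The bound is stated for \<open>g \<le> 1\<close> of either sign; only the positive part is scaled into the polar set, the negative part
        helps by positivity.\<close>
      let ?p = "\<lambda>x. max 0 (g x)" and ?n = "\<lambda>x. max 0 (- g x)"
      have pC: "?p \<in> Cc" and nC: "?n \<in> Cc"
        by (auto intro!: Cc_I[OF g] continuous_intros Cc_continuous[OF g])
      have "?p = (\<lambda>x. g x + ?n x)" by (auto simp: max_def fun_eq_iff)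
      then have "\<Lambda> (em ?p ?B) = \<Lambda> (em g ?B) + \<Lambda> (em ?n ?B)" using em_add[OF g nC] L_add by metis
      moreover have "0 \<le> \<Lambda> (em ?n ?B)" using pos[OF nC] by simp
      moreover have "\<Lambda> ((1 / t) *\<^sub>R em ?p ?B) \<le> K"
      proof (rule bd)
        fix x
        have "?p x *\<^sub>R ((1 / t) *\<^sub>R ?B) \<in> polar_set f" using g1 by (intro polar_shrink[OF t(2)]) auto
        then show "apply_bcontfun ((1 / t) *\<^sub>R em ?p ?B) x \<in> polar_set f" by (simp add: em[OF pC])
      qed
      ultimately show "\<Lambda> (em g ?B) \<le> t * K" using t(1) by (simp add: L_scale field_simps)
    qed
    then show ?thesis ..
  qed
  obtain i0 :: 'n where True by blast
  obtain B0 where "bounded_positive_functional (\<lambda>g. \<Lambda> (em g (?M 0 i0 i0))) B0" using bpf[of 0] by auto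
  then interpret T: bounded_positive_functional "\<lambda>g. \<Lambda> (em g (mat 1))" B0 by simp
  define \<tau> where "\<tau> = T.repr"
  have \<tau>fin: "finite_measure \<tau>" unfolding \<tau>_def by (rule T.finite_measure_repr)
  have \<tau>s: "sets \<tau> = sets borel" unfolding \<tau>_def by simp
  have T0: "0 \<le> \<Lambda> (em g (mat 1))" if "g \<in> Cc" "\<And>x. 0 \<le> g x" for g using T.pos that .
  have "\<exists>h. integrable \<tau> h \<and> (\<forall>g\<in>Cc. \<Lambda> (em g (mat_unit i j)) = (\<integral>x. g x * h x \<partial>\<tau>))" for i j
  proof -
    obtain B1 where B1: "bounded_positive_functional (\<lambda>g. \<Lambda> (em g (?M 1 i j))) B1" using bpf[of 1] by auto
    obtain B2 where B2: "bounded_positive_functional (\<lambda>g. \<Lambda> (em g (?M (-1) i j))) B2" using bpf[of "-1"] by auto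
    interpret P: bounded_positive_functional "\<lambda>g. \<Lambda> (em g (?M 1 i j))" B1 by (rule B1)
    interpret N: bounded_positive_functional "\<lambda>g. \<Lambda> (em g (?M (-1) i j))" B2 by (rule B2)
    have split: "\<Lambda> (em g (?M s i j)) = \<Lambda> (em g (mat 1)) + s * \<Lambda> (em g (mat_unit i j))" if "g \<in> Cc" for g s
      using that by (simp add: em_addA em_cmultA L_add L_scale)
    have ac: "absolutely_continuous \<tau> P.repr" unfolding \<tau>_def
    proof (rule T.absolutely_continuous_repr[OF B1])
      fix g :: "'a \<Rightarrow> real" assume g: "g \<in> Cc" "\<And>x. 0 \<le> g x"
      show "\<Lambda> (em g (?M 1 i j)) \<le> 2 * \<Lambda> (em g (mat 1))"
        using N.pos[OF g] split[OF g(1), of 1] split[OF g(1), of "-1"] by linarith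
    qed simp
    have "sets P.repr = sets \<tau>" unfolding \<tau>s by (rule P.sets_repr)
    then obtain h where h: "integrable \<tau> h" "\<And>x. 0 \<le> h x" "P.repr = density \<tau> (\<lambda>x. ennreal (h x))"
      using ex_real_density[OF \<tau>fin P.finite_measure_repr _ ac] by metis
    have "\<Lambda> (em g (mat_unit i j)) = (\<integral>x. g x * (h x - 1) \<partial>\<tau>)" if g: "g \<in> Cc" for g
    proof -
      have gm: "g \<in> borel_measurable \<tau>" using Cc_measurable[OF g] by (simp add: measurable_cong_sets[OF \<tau>s refl])
      have ig: "integrable \<tau> g" unfolding \<tau>_def by (rule T.integrable_repr[OF g])
      have igh: "integrable \<tau> (\<lambda>x. h x * g x)"
        using P.integrable_repr[OF g] h gm unfolding h(3) by (subst (asm) integrable_density) auto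
      have "\<Lambda> (em g (?M 1 i j)) = (\<integral>x. g x \<partial>P.repr)" by (rule P.representation[OF g])
      also have "\<dots> = (\<integral>x. h x * g x \<partial>\<tau>)" unfolding h(3) using h(1,2) gm by (subst integral_density) auto
      finally have "\<Lambda> (em g (mat_unit i j)) = (\<integral>x. h x * g x \<partial>\<tau>) - (\<integral>x. g x \<partial>\<tau>)"
        using split[OF g, of 1] T.representation[OF g] unfolding \<tau>_def by simp
      also have "\<dots> = (\<integral>x. g x * (h x - 1) \<partial>\<tau>)"
        using igh ig by (subst Bochner_Integration.integral_diff[symmetric]) (auto simp: algebra_simps)
      finally show ?thesis .
    qed
    moreover have "integrable \<tau> (\<lambda>x. h x - 1)"
      by (intro Bochner_Integration.integrable_diff h(1) finite_measure.integrable_const[OF \<tau>fin])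
    ultimately show ?thesis by blast
  qed
  then obtain h where h: "\<And>i j. integrable \<tau> (h i j)" 
      "\<And>i j g. g \<in> Cc \<Longrightarrow> \<Lambda> (em g (mat_unit i j)) = (\<integral>x. g x * h i j x \<partial>\<tau>)" by metis
  define \<theta> where "\<theta> x = (\<Sum>i\<in>UNIV. \<Sum>j\<in>UNIV. h i j x *\<^sub>R (mat_unit i j :: real^'n^'n))" for x
  have \<theta>i: "integrable \<tau> \<theta>" unfolding \<theta>_def using h(1)
    by (intro Bochner_Integration.integrable_sum integrable_scaleR_left) auto
  have [measurable]: "\<theta> \<in> borel_measurable \<tau>" using \<theta>i by auto
  have rep: "\<Lambda> \<psi> = (\<integral>x. apply_bcontfun \<psi> x \<bullet> \<theta> x \<partial>\<tau>)" if \<psi>: "\<And>i j. (\<lambda>x. apply_bcontfun \<psi> x $ i $ j) \<in> Cc" for \<psi>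
  proof -
    let ?c = "\<lambda>i j x. apply_bcontfun \<psi> x $ i $ j"
    have "\<psi> = (\<Sum>i\<in>UNIV. \<Sum>j\<in>UNIV. em (?c i j) (mat_unit i j))"
      by (rule bcontfun_eqI) (simp add: apply_sum_bcontfun em[OF \<psi>] mat_expansion[symmetric])
    then have "\<Lambda> \<psi> = \<Lambda> (\<Sum>i\<in>UNIV. \<Sum>j\<in>UNIV. em (?c i j) (mat_unit i j))" by (rule arg_cong)
    also have "\<dots> = (\<Sum>i\<in>UNIV. \<Sum>j\<in>UNIV. \<Lambda> (em (?c i j) (mat_unit i j)))"
      by (simp only: linear_sum[OF lin])
    also have "\<dots> = (\<Sum>i\<in>UNIV. \<Sum>j\<in>UNIV. \<integral>x. ?c i j x * h i j x \<partial>\<tau>)" by (simp add: h(2)[OF \<psi>])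
    also have "\<dots> = (\<integral>x. (\<Sum>i\<in>UNIV. \<Sum>j\<in>UNIV. ?c i j x * h i j x) \<partial>\<tau>)"
    proof -
      have "integrable \<tau> (\<lambda>x. ?c i j x * h i j x)" for i j
      proof -
        obtain c where c: "\<And>x. \<bar>?c i j x\<bar> \<le> c" using Cc_bounded[OF \<psi>[of i j]] by blast
        have m: "?c i j \<in> borel_measurable \<tau>" using Cc_measurable[OF \<psi>[of i j]] by (simp add: measurable_cong_sets[OF \<tau>s refl])
        show ?thesis
          by (rule Bochner_Integration.integrable_bound[of _ "\<lambda>x. c * h i j x"])
             (use h(1)[of i j] m c in \<open>auto simp: abs_mult intro!: mult_right_mono order_trans[OF c abs_ge_self]\<close>)
      qed
      then show ?thesis by (simp add: Bochner_Integration.integral_sum Bochner_Integration.integrable_sum)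
    qed
    also have "\<dots> = (\<integral>x. apply_bcontfun \<psi> x \<bullet> \<theta> x \<partial>\<tau>)"
      unfolding \<theta>_def by (simp add: inner_sum_right inner_commute[of _ "mat_unit _ _"] inner_mat_unit mult.commute)
    finally show ?thesis .
  qed
  obtain D :: "nat \<Rightarrow> real^'n^'n" where D: "\<And>i. D i \<in> polar_set f" "D 0 = 0"
      "\<And>A. sym_ext f A = (SUP i. ennreal (D i \<bullet> A))" using countable_bipolar by blast
  have mx: "(\<integral>\<^sup>+x. (SUP i\<in>{..n}. ennreal (D i \<bullet> \<theta> x)) \<partial>\<tau>) \<le> ennreal K" for n
  proof (rule maximum_bound[OF \<tau>fin \<tau>s])
    show "integrable \<tau> (\<lambda>x. D i \<bullet> \<theta> x)" for i using \<theta>i by simp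
    show "D 0 \<bullet> \<theta> x = 0" for x by (simp add: D(2))
    fix w :: "nat \<Rightarrow> 'a \<Rightarrow> real"
    assume w: "\<And>i. w i \<in> Cc" "\<And>i x. 0 \<le> w i x" "\<And>x. (\<Sum>i\<le>n. w i x) \<le> 1"
    define \<psi> where "\<psi> = (\<Sum>i\<le>n. em (w i) (D i))"
    have \<psi>: "apply_bcontfun \<psi> x = (\<Sum>i\<le>n. w i x *\<^sub>R D i)" for x
      unfolding \<psi>_def by (simp add: apply_sum_bcontfun em w(1))
    have "apply_bcontfun \<psi> x \<in> polar_set f" for x
    proof -
      \<comment> \<open>The weight of index 0 absorbs the defect to 1, which changes nothing because \<open>D 0 = 0\<close>.\<close>
      let ?a = "\<lambda>i. w i x + (if i = 0 then 1 - (\<Sum>i\<le>n. w i x) else 0)"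
      have "(\<Sum>i\<le>n. ?a i *\<^sub>R D i) \<in> polar_set f"
        using w(2) w(3)[of x] D(1)
        by (intro convex_sum polar_convex) (auto simp: sum.distrib add_nonneg_nonneg)
      moreover have "?a i *\<^sub>R D i = w i x *\<^sub>R D i" for i using D(2) by auto
      ultimately show ?thesis unfolding \<psi> by simp
    qed
    then have le: "\<Lambda> \<psi> \<le> K" by (rule bd)
    have "(\<lambda>x. apply_bcontfun \<psi> x $ i $ j) \<in> Cc" for i j
      unfolding \<psi> using Cc_cmult[OF w(1)] by (simp add: mult.commute[of "w _ _"]) (intro Cc_sum; simp)
    from rep[OF this] have "\<Lambda> \<psi> = (\<integral>x. (\<Sum>i\<le>n. w i x * (D i \<bullet> \<theta> x)) \<partial>\<tau>)" 
      unfolding \<psi> by (simp add: inner_sum_left)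
    also have "\<dots> = (\<Sum>i\<le>n. \<integral>x. w i x * (D i \<bullet> \<theta> x) \<partial>\<tau>)"
    proof (rule Bochner_Integration.integral_sum)
      fix i
      obtain c where c: "\<And>x. \<bar>w i x\<bar> \<le> c" using Cc_bounded[OF w(1)[of i]] by blast
      have m: "w i \<in> borel_measurable \<tau>" using Cc_measurable[OF w(1)[of i]] by (simp add: measurable_cong_sets[OF \<tau>s refl])
      show "integrable \<tau> (\<lambda>x. w i x * (D i \<bullet> \<theta> x))"
        by (rule Bochner_Integration.integrable_bound[of _ "\<lambda>x. c * (D i \<bullet> \<theta> x)"])
           (use \<theta>i m c in \<open>auto simp: abs_mult intro!: mult_right_mono order_trans[OF c abs_ge_self]\<close>)
    qed
    finally show "(\<Sum>i\<le>n. \<integral>x. w i x * (D i \<bullet> \<theta> x) \<partial>\<tau>) \<le> K" using le by simp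
  qed
  have "(\<integral>\<^sup>+x. sym_ext f (\<theta> x) \<partial>\<tau>) = (\<integral>\<^sup>+x. (SUP n. SUP i\<in>{..n}. ennreal (D i \<bullet> \<theta> x)) \<partial>\<tau>)"
  proof (rule nn_integral_cong)
    fix x
    show "sym_ext f (\<theta> x) = (SUP n. SUP i\<in>{..n}. ennreal (D i \<bullet> \<theta> x))"
      unfolding D(3) by (intro antisym SUP_least) (auto intro: SUP_upper2 SUP_upper)
  qed
  also have "\<dots> = (SUP n. \<integral>\<^sup>+x. (SUP i\<in>{..n}. ennreal (D i \<bullet> \<theta> x)) \<partial>\<tau>)"
  proof (rule nn_integral_monotone_convergence_SUP)
    show "incseq (\<lambda>n x. SUP i\<in>{..n}. ennreal (D i \<bullet> \<theta> x))"
      by (auto simp: incseq_def le_fun_def intro!: SUP_subset_mono)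
    show "(\<lambda>x. SUP i\<in>{..n}. ennreal (D i \<bullet> \<theta> x)) \<in> borel_measurable \<tau>" for n by measurable
  qed
  also have "\<dots> \<le> ennreal K" by (intro SUP_least mx)
  finally have cost: "(\<integral>\<^sup>+x. sym_ext f (\<theta> x) \<partial>\<tau>) \<le> ennreal K" .
  show ?thesis by (rule that[OF \<tau>fin \<tau>s \<theta>i rep cost])
qed

end


section \<open>Test functions, cutoffs and the static equation\<close>

definition C2 :: "(real^'n \<Rightarrow> real) \<Rightarrow> (real^'n \<Rightarrow> real^'n) \<Rightarrow> (real^'n \<Rightarrow> real^'n^'n) \<Rightarrow> bool" where
  "C2 u g h \<longleftrightarrow> (\<forall>x. (u has_derivative (\<lambda>v. g x \<bullet> v)) (at x)) \<and>
     (\<forall>x. (g has_derivative (\<lambda>v. h x *v v)) (at x)) \<and> continuous_on UNIV h"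

definition C2c :: "(real^'n \<Rightarrow> real) \<Rightarrow> (real^'n \<Rightarrow> real^'n) \<Rightarrow> (real^'n \<Rightarrow> real^'n^'n) \<Rightarrow> bool" where
  "C2c u g h \<longleftrightarrow> C2 u g h \<and> (\<exists>R. \<forall>x. R \<le> norm x \<longrightarrow> u x = 0 \<and> g x = 0 \<and> h x = 0)"

lemma C2D:
  assumes "C2 u g h"
  shows "(u has_derivative (\<lambda>v. g x \<bullet> v)) (at x)" "(g has_derivative (\<lambda>v. h x *v v)) (at x)"
    "continuous_on UNIV u" "continuous_on UNIV g" "continuous_on UNIV h"
proof -
  have 1: "(u has_derivative (\<lambda>v. g x \<bullet> v)) (at x)" and 2: "(g has_derivative (\<lambda>v. h x *v v)) (at x)" for x
    using assms unfolding C2_def by auto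
  show "(u has_derivative (\<lambda>v. g x \<bullet> v)) (at x)" "(g has_derivative (\<lambda>v. h x *v v)) (at x)" by (rule 1 2)+
  show "continuous_on UNIV h" using assms unfolding C2_def by auto
  show "continuous_on UNIV u" "continuous_on UNIV g"
    using has_derivative_continuous[OF 1] has_derivative_continuous[OF 2] by (auto simp: continuous_on_eq_continuous_at)
qed

lemma C2_const: "C2 (\<lambda>x. c) (\<lambda>x. 0) (\<lambda>x. 0)"
  unfolding C2_def by (auto intro!: derivative_eq_intros)

lemma C2_add: "C2 u g h \<Longrightarrow> C2 u' g' h' \<Longrightarrow> C2 (\<lambda>x. u x + u' x) (\<lambda>x. g x + g' x) (\<lambda>x. h x + h' x)"
  unfolding C2_def by (auto intro!: derivative_eq_intros continuous_intros simp: inner_add_left matrix_vector_mult_add_rdistrib)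

lemma C2_scale: "C2 u g h \<Longrightarrow> C2 (\<lambda>x. c * u x) (\<lambda>x. c *\<^sub>R g x) (\<lambda>x. c *\<^sub>R h x)"
  unfolding C2_def by (auto intro!: derivative_eq_intros continuous_intros simp: scaleR_matrix_vector_assoc)

lemma C2c_add: "C2c u g h \<Longrightarrow> C2c u' g' h' \<Longrightarrow> C2c (\<lambda>x. u x + u' x) (\<lambda>x. g x + g' x) (\<lambda>x. h x + h' x)"
proof -
  assume a: "C2c u g h" "C2c u' g' h'"
  then obtain R R' where "\<And>x. R \<le> norm x \<Longrightarrow> u x = 0 \<and> g x = 0 \<and> h x = 0"
    "\<And>x. R' \<le> norm x \<Longrightarrow> u' x = 0 \<and> g' x = 0 \<and> h' x = 0" unfolding C2c_def by auto
  then have "\<exists>R. \<forall>x. R \<le> norm x \<longrightarrow> u x + u' x = 0 \<and> g x + g' x = 0 \<and> h x + h' x = 0"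
    by (intro exI[of _ "max R R'"]) auto
  then show ?thesis using a C2_add unfolding C2c_def by blast
qed

lemma C2c_scale: "C2c u g h \<Longrightarrow> C2c (\<lambda>x. c * u x) (\<lambda>x. c *\<^sub>R g x) (\<lambda>x. c *\<^sub>R h x)"
  unfolding C2c_def by (auto intro: C2_scale)

lemma C2c_zero: "C2c (\<lambda>x. 0) (\<lambda>x. 0) (\<lambda>x. 0)"
  unfolding C2c_def using C2_const by auto

lemma C2c_Cc: 
  assumes "C2c u g h" shows "u \<in> Cc" "(\<lambda>x. h x $ i $ j) \<in> Cc"
proof -
  obtain R where R: "\<And>x. R \<le> norm x \<Longrightarrow> u x = 0 \<and> g x = 0 \<and> h x = 0" using assms unfolding C2c_def by auto
  have z: "u x = 0 \<and> h x = 0" if "x \<notin> cball 0 R" for x using R[of x] that by auto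
  have c: "continuous_on UNIV u" "continuous_on UNIV h" using assms C2D unfolding C2c_def by blast+
  show "u \<in> Cc" unfolding Cc_def using c z by (auto intro!: exI[of _ "cball 0 R"])
  show "(\<lambda>x. h x $ i $ j) \<in> Cc" unfolding Cc_def using c z by (auto intro!: exI[of _ "cball 0 R"] continuous_intros)
qed

definition outer_product :: "real^'n \<Rightarrow> real^'n \<Rightarrow> real^'n^'n" where
  "outer_product x y = (\<chi> i j. x $ i * y $ j)"

lemma outer_product_vector: "outer_product x y *v v = (y \<bullet> v) *\<^sub>R x"
  unfolding outer_product_def
  by (simp add: vec_eq_iff matrix_vector_mult_def inner_vec_def sum_distrib_left mult_ac)

lemma norm_outer_product: "norm (outer_product x y) = norm x * norm (y::real^'n)"
proof -
  have "outer_product x y \<bullet> outer_product x y = (x \<bullet> x) * (y \<bullet> y)"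
    unfolding outer_product_def by (simp add: inner_vec_def sum_product mult_ac)
  then show ?thesis by (simp add: norm_eq_sqrt_inner real_sqrt_mult)
qed

lemma continuous_on_outer_product [continuous_intros]:
  "continuous_on S a \<Longrightarrow> continuous_on S b \<Longrightarrow> continuous_on S (\<lambda>x. outer_product (a x) (b x))"
  unfolding outer_product_def by (intro continuous_intros)

lemma C2_mult:
  assumes "C2 u g h" "C2 u' g' h'"
  shows "C2 (\<lambda>x. u x * u' x) (\<lambda>x. u x *\<^sub>R g' x + u' x *\<^sub>R g x)
     (\<lambda>x. u x *\<^sub>R h' x + outer_product (g' x) (g x) + u' x *\<^sub>R h x + outer_product (g x) (g' x))"
  unfolding C2_def
proof (intro conjI allI)
  note a = C2D[OF assms(1)] and b = C2D[OF assms(2)]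
  fix x
  show "((\<lambda>x. u x * u' x) has_derivative (\<lambda>v. (u x *\<^sub>R g' x + u' x *\<^sub>R g x) \<bullet> v)) (at x)"
    by (rule has_derivative_eq_rhs[OF has_derivative_mult[OF a(1) b(1)]]) (auto simp: inner_add_left algebra_simps)
  show "((\<lambda>x. u x *\<^sub>R g' x + u' x *\<^sub>R g x) has_derivative (\<lambda>v. (u x *\<^sub>R h' x + outer_product (g' x) (g x) 
     + u' x *\<^sub>R h x + outer_product (g x) (g' x)) *v v)) (at x)"
    by (rule has_derivative_eq_rhs[OF has_derivative_add[OF has_derivative_scaleR[OF a(1) b(2)] has_derivative_scaleR[OF b(1) a(2)]]])
       (auto simp: matrix_vector_mult_add_rdistrib outer_product_vector scaleR_matrix_vector_assoc algebra_simps)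
qed (auto intro!: continuous_intros C2D[OF assms(1)] C2D[OF assms(2)])

text \<open>Powers of the positive part are differentiable across \<open>0\<close>; they serve to glue all
  cutoffs below.\<close>

lemma DERIV_max0_power:
  "((\<lambda>y::real. max 0 y ^ Suc (Suc k)) has_real_derivative real (Suc (Suc k)) * max 0 y ^ Suc k) (at y)"
proof (cases y "0::real" rule: linorder_cases)
  case less
  have "((\<lambda>y::real. 0) has_real_derivative real (Suc (Suc k)) * max 0 y ^ Suc k) (at y)" using less by simp
  then show ?thesis
    by (rule has_field_derivative_transform_within_open[where S = "{..<0}"]) (use less in auto)
next
  case greater
  have "((\<lambda>y::real. y ^ Suc (Suc k)) has_real_derivative real (Suc (Suc k)) * max 0 y ^ Suc k) (at y)"
    using DERIV_pow[of "Suc (Suc k)" y] greater by simp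
  then show ?thesis
    by (rule has_field_derivative_transform_within_open[where S = "{0<..}"]) (use greater in auto)
next
  case equal
  have "((\<lambda>h::real. max 0 h ^ Suc (Suc k) / h) \<longlongrightarrow> 0) (at 0)"
  proof (rule Lim_null_comparison[where g = "\<lambda>h. \<bar>h\<bar> ^ Suc k"])
    show "\<forall>\<^sub>F h in at 0. norm (max 0 h ^ Suc (Suc k) / h) \<le> \<bar>h\<bar> ^ Suc k"
    proof (intro always_eventually allI)
      fix h :: real
      show "norm (max 0 h ^ Suc (Suc k) / h) \<le> \<bar>h\<bar> ^ Suc k"
        by (cases "h > 0") (simp_all add: max_absorb1 max_absorb2 del: power_Suc, simp)
    qed
    show "((\<lambda>h::real. \<bar>h\<bar> ^ Suc k) \<longlongrightarrow> 0) (at 0)" by (auto intro!: tendsto_eq_intros)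
  qed
  then show ?thesis unfolding equal DERIV_def by simp
qed

text \<open>Twice continuously differentiable, supported in the ball of radius \<open>R\<close>, and tending to
  1 as \<open>R \<longlongrightarrow> \<infinity>\<close> with Hessian of order
  \<open>1 / R\<^sup>2\<close>.\<close>

definition bump :: "real \<Rightarrow> real^'n \<Rightarrow> real" where
  "bump R x = max 0 (1 - (norm x)\<^sup>2 / R\<^sup>2) ^ 3"

definition bump_grad :: "real \<Rightarrow> real^'n \<Rightarrow> real^'n" where
  "bump_grad R x = (- (6 / R\<^sup>2) * max 0 (1 - (norm x)\<^sup>2 / R\<^sup>2) ^ 2) *\<^sub>R x"

definition bump_hess :: "real \<Rightarrow> real^'n \<Rightarrow> real^'n^'n" where
  "bump_hess R x = (- (6 / R\<^sup>2) * max 0 (1 - (norm x)\<^sup>2 / R\<^sup>2) ^ 2) *\<^sub>R mat 1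
     + (24 / R^4 * max 0 (1 - (norm x)\<^sup>2 / R\<^sup>2)) *\<^sub>R outer_product x x"

lemma C2_bump: "C2 (bump R) (bump_grad R) (bump_hess R :: real^'n \<Rightarrow> _)"
  unfolding C2_def
proof (intro conjI allI)
  fix x :: "real^'n"
  let ?s = "\<lambda>x::real^'n. 1 - (norm x)\<^sup>2 / R\<^sup>2"
  have s: "(?s has_derivative (\<lambda>v. - (2 / R\<^sup>2) * (x \<bullet> v))) (at x)"
  proof -
    have "((\<lambda>x::real^'n. 1 - (1 / R\<^sup>2) * (x \<bullet> x)) has_derivative (\<lambda>v. - (2 / R\<^sup>2) * (x \<bullet> v))) (at x)"
      by (rule derivative_eq_intros refl)+ (auto simp: inner_commute)
    then show ?thesis by (simp add: power2_norm_eq_inner)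
  qed
  have comp: "((\<lambda>x. max 0 (?s x) ^ Suc (Suc k)) has_derivative
      (\<lambda>v. (real (Suc (Suc k)) * max 0 (?s x) ^ Suc k) * (- (2 / R\<^sup>2) * (x \<bullet> v)))) (at x)" for k
    using has_derivative_compose[OF s DERIV_max0_power[of k "?s x", unfolded has_field_derivative_def]] by simp
  show "(bump R has_derivative (\<lambda>v. bump_grad R x \<bullet> v)) (at x)"
    unfolding bump_def bump_grad_def
    using comp[of 1] by (simp add: numeral_eq_Suc mult_ac)
  have "((\<lambda>x. (- (6 / R\<^sup>2) * max 0 (?s x) ^ 2) *\<^sub>R x) has_derivative
     (\<lambda>v. (- (6 / R\<^sup>2) * max 0 (?s x) ^ 2) *\<^sub>R v + (- (6 / R\<^sup>2) * (2 * max 0 (?s x) * (- (2 / R\<^sup>2) * (x \<bullet> v)))) *\<^sub>R x)) (at x)"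
    using comp[of 0] by (intro has_derivative_scaleR has_derivative_ident has_derivative_mult_right) (simp add: numeral_eq_Suc)
  then show "(bump_grad R has_derivative (\<lambda>v. bump_hess R x *v v)) (at x)"
    unfolding bump_grad_def[abs_def]
  proof (rule has_derivative_eq_rhs, intro ext)
    fix v
    let ?t = "max 0 (?s x)"
    have c: "24 / R^4 = (6 / R\<^sup>2) * (2 * (2 / R\<^sup>2))" by (simp add: power4_eq_xxxx power2_eq_square)
    have "bump_hess R x *v v = (- (6 / R\<^sup>2) * ?t ^ 2) *\<^sub>R v + (24 / R^4 * ?t * (x \<bullet> v)) *\<^sub>R x"
      unfolding bump_hess_def
      by (simp only: matrix_vector_mult_add_rdistrib scaleR_matrix_vector_assoc[symmetric] outer_product_vector
          matrix_vector_mul_lid scaleR_scaleR)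
    also have "24 / R^4 * ?t * (x \<bullet> v) = - (6 / R\<^sup>2) * (2 * ?t * (- (2 / R\<^sup>2) * (x \<bullet> v)))"
      unfolding c by simp
    finally show "(- (6 / R\<^sup>2) * ?t ^ 2) *\<^sub>R v + (- (6 / R\<^sup>2) * (2 * ?t * (- (2 / R\<^sup>2) * (x \<bullet> v)))) *\<^sub>R x
        = bump_hess R x *v v" ..
  qed
next
  show "continuous_on UNIV (bump_hess R :: real^'n \<Rightarrow> _)"
    unfolding bump_hess_def divide_inverse by (intro continuous_intros)
qed

lemma C2c_bump: assumes "R > 0" shows "C2c (bump R) (bump_grad R) (bump_hess R :: real^'n \<Rightarrow> _)"
proof -
  have "max 0 (1 - (norm x)\<^sup>2 / R\<^sup>2) = 0" if "R \<le> norm x" for x :: "real^'n"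
    using that assms power_mono[of R "norm x" 2] by (simp add: max_def field_simps)
  then have "bump R x = 0 \<and> bump_grad R x = 0 \<and> bump_hess R x = 0" if "R \<le> norm x" for x :: "real^'n"
    using that unfolding bump_def bump_grad_def bump_hess_def by simp
  then show ?thesis unfolding C2c_def using C2_bump by blast
qed

lemma bump_bounds: "0 \<le> bump R x" "bump R x \<le> 1"
  unfolding bump_def by (auto intro!: power_le_one)

lemma bump_base: 
  assumes "R > 0" obtains s where "max 0 (1 - (norm x)\<^sup>2 / R\<^sup>2) = s" "0 \<le> s" "s \<le> 1" "s > 0 \<Longrightarrow> norm x \<le> R"
proof -
  have "norm x \<le> R" if "max 0 (1 - (norm x)\<^sup>2 / R\<^sup>2) > 0"
  proof (rule ccontr)
    assume "\<not> ?thesis"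
    then have "R\<^sup>2 \<le> (norm x)\<^sup>2" using assms by (intro power_mono) auto
    then show False using that assms by (simp add: field_simps)
  qed
  then show ?thesis using that[OF refl] by simp
qed

lemma bump_grad_bound: assumes "R > 0" shows "norm (bump_grad R x) \<le> 6 / R"
proof -
  obtain s where s: "max 0 (1 - (norm x)\<^sup>2 / R\<^sup>2) = s" "0 \<le> s" "s \<le> 1" "s > 0 \<Longrightarrow> norm x \<le> R"
    using bump_base[OF assms] by metis
  have "s\<^sup>2 * norm x \<le> R"
  proof (cases "s = 0")
    case False
    then have "s\<^sup>2 * norm x \<le> 1 * R" using s by (intro mult_mono power_le_one) auto
    then show ?thesis by simp
  qed (use assms in simp)
  then have "6 / R\<^sup>2 * (s\<^sup>2 * norm x) \<le> 6 / R\<^sup>2 * R" by (intro mult_left_mono) auto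
  then show ?thesis unfolding bump_grad_def s(1) using assms by (simp add: power2_eq_square abs_mult)
qed

lemma bump_hess_bound:
  assumes "R > 0" shows "norm (bump_hess R (x::real^'n)) \<le> (6 * norm (mat 1 :: real^'n^'n) + 24) / R\<^sup>2"
proof -
  obtain s where s: "max 0 (1 - (norm x)\<^sup>2 / R\<^sup>2) = s" "0 \<le> s" "s \<le> 1" "s > 0 \<Longrightarrow> norm x \<le> R"
    using bump_base[OF assms] by metis
  have 1: "s * (norm x * norm x) \<le> R\<^sup>2"
  proof (cases "s = 0")
    case False
    then have "s * (norm x * norm x) \<le> 1 * (R * R)" using s assms by (intro mult_mono) auto
    then show ?thesis by (simp add: power2_eq_square)
  qed simp
  have "norm (bump_hess R x) \<le> norm ((- (6 / R\<^sup>2) * s ^ 2) *\<^sub>R (mat 1 :: real^'n^'n)) + norm ((24 / R^4 * s) *\<^sub>R outer_product x x)"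
    unfolding bump_hess_def s(1) by (rule norm_triangle_ineq)
  also have "norm ((- (6 / R\<^sup>2) * s ^ 2) *\<^sub>R (mat 1 :: real^'n^'n)) = 6 / R\<^sup>2 * s\<^sup>2 * norm (mat 1 :: real^'n^'n)" by simp
  also have "\<dots> \<le> 6 / R\<^sup>2 * 1 * norm (mat 1 :: real^'n^'n)" using s by (intro mult_mono power_le_one) auto
  also have "norm ((24 / R^4 * s) *\<^sub>R outer_product x x) = 24 / R^4 * (s * (norm x * norm x))" 
    using s(2) by (simp add: norm_outer_product)
  also have "\<dots> \<le> 24 / R^4 * R\<^sup>2" by (rule mult_left_mono[OF 1]) simp
  also have "\<dots> = 24 / R\<^sup>2" using assms by (simp add: power4_eq_xxxx power2_eq_square)
  finally show ?thesis by (simp add: add_divide_distrib)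
qed

lemma bump_tendsto:
  "(\<lambda>m. bump (real (Suc m)) x) \<longlonglongrightarrow> 1"
proof -
  have "(\<lambda>m. inverse (real (Suc m))) \<longlonglongrightarrow> 0" by (rule LIMSEQ_inverse_real_of_nat)
  then have "(\<lambda>m. max 0 (1 - (norm x)\<^sup>2 * (inverse (real (Suc m)))\<^sup>2) ^ 3) \<longlonglongrightarrow> max 0 (1 - (norm x)\<^sup>2 * 0\<^sup>2) ^ 3"
    by (intro tendsto_intros)
  then show ?thesis unfolding bump_def by (simp add: power_inverse divide_inverse)
qed

lemma bump_grad_tendsto: "(\<lambda>m. bump_grad (real (Suc m)) x) \<longlonglongrightarrow> 0"
proof (rule Lim_null_comparison[where g = "\<lambda>m. 6 * inverse (real (Suc m))"])
  show "(\<lambda>m. 6 * inverse (real (Suc m))) \<longlonglongrightarrow> 0"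
    using tendsto_mult_right_zero[OF LIMSEQ_inverse_real_of_nat] by blast
  show "\<forall>\<^sub>F m in sequentially. norm (bump_grad (real (Suc m)) x) \<le> 6 * inverse (real (Suc m))"
    using bump_grad_bound[of "real (Suc _)" x] by (intro always_eventually allI) (simp add: divide_inverse)
qed

lemma bump_hess_tendsto: "(\<lambda>m. bump_hess (real (Suc m)) (x::real^'n)) \<longlonglongrightarrow> 0"
proof (rule Lim_null_comparison[where g = "\<lambda>m. (6 * norm (mat 1 :: real^'n^'n) + 24) * (inverse (real (Suc m)))\<^sup>2"])
  have "(\<lambda>m. (6 * norm (mat 1 :: real^'n^'n) + 24) * (inverse (real (Suc m)))\<^sup>2) \<longlonglongrightarrow> (6 * norm (mat 1 :: real^'n^'n) + 24) * 0\<^sup>2"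
    by (intro tendsto_intros LIMSEQ_inverse_real_of_nat)
  then show "(\<lambda>m. (6 * norm (mat 1 :: real^'n^'n) + 24) * (inverse (real (Suc m)))\<^sup>2) \<longlonglongrightarrow> 0" by simp
  show "\<forall>\<^sub>F m in sequentially. norm (bump_hess (real (Suc m)) x) \<le> (6 * norm (mat 1 :: real^'n^'n) + 24) * (inverse (real (Suc m)))\<^sup>2"
    using bump_hess_bound[of "real (Suc _)" x] by (intro always_eventually allI) (simp add: divide_inverse power_inverse)
qed

text \<open>Hence \<open>R\<^sup>2 * (1 - bump R x)\<close> is a substitute for \<open>(norm x)\<^sup>2\<close>
  which is constant far out and has a Hessian bounded uniformly in \<open>R\<close>.\<close>

lemma capped_square_bounds:
  assumes "R > 0"
  shows "min ((norm x)\<^sup>2) (R\<^sup>2) \<le> R\<^sup>2 * (1 - bump R x)" "R\<^sup>2 * (1 - bump R x) \<le> 3 * (norm x)\<^sup>2"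
proof -
  let ?q = "(norm x)\<^sup>2 / R\<^sup>2"
  define s where "s = max 0 (1 - ?q)"
  have q: "0 \<le> ?q" by simp
  then have s: "0 \<le> s" "s \<le> 1" "1 - s = min ?q 1" unfolding s_def by auto
  have b: "bump R x = s ^ 3" unfolding bump_def s_def ..
  have f: "1 - s ^ 3 = (1 - s) * (1 + s + s\<^sup>2)" by (simp add: power2_eq_square power3_eq_cube algebra_simps)
  have "(1 - s) * 1 \<le> (1 - s) * (1 + s + s\<^sup>2)" using s by (intro mult_left_mono) auto
  then have "R\<^sup>2 * min ?q 1 \<le> R\<^sup>2 * (1 - bump R x)" unfolding b f s(3)[symmetric] by (intro mult_left_mono) auto
  moreover have "R\<^sup>2 * min ?q 1 = min ((norm x)\<^sup>2) (R\<^sup>2)" using assms by (auto simp: min_def field_simps)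
  ultimately show "min ((norm x)\<^sup>2) (R\<^sup>2) \<le> R\<^sup>2 * (1 - bump R x)" by simp
  have "s\<^sup>2 \<le> 1" using s by (intro power_le_one) auto
  then have "(1 - s) * (1 + s + s\<^sup>2) \<le> (1 - s) * 3" using s by (intro mult_left_mono) auto
  also have "\<dots> \<le> ?q * 3" using s(3) by (intro mult_right_mono) auto
  finally have "R\<^sup>2 * (1 - bump R x) \<le> R\<^sup>2 * (?q * 3)" unfolding b f by (intro mult_left_mono) auto
  then show "R\<^sup>2 * (1 - bump R x) \<le> 3 * (norm x)\<^sup>2" using assms by simp
qed

text \<open>The static continuity equation \<open>\<nu> - \<delta>\<^sub>x = tr (\<nabla>\<^sup>2 (\<theta> \<tau>)) / 2\<close> in the sense of distributions.\<close>

definition static_equation :: "real^'n \<Rightarrow> (real^'n) measure \<Rightarrow> (real^'n) measure \<Rightarrow> (real^'n \<Rightarrow> real^'n^'n) \<Rightarrow> bool" where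
  "static_equation x0 \<nu> \<tau> \<theta> \<longleftrightarrow>
     (\<forall>u g h. C2c u g h \<longrightarrow> (\<integral>x. u x \<partial>\<nu>) - u x0 = (\<integral>x. ((1/2) *\<^sub>R h x) \<bullet> \<theta> x \<partial>\<tau>))"

lemma gradient_growth:
  fixes g :: "real^'n \<Rightarrow> real^'n"
  assumes g: "\<And>x. (g has_derivative (\<lambda>v. h x *v v)) (at x)" and h: "\<And>x. norm (h x) \<le> M"
  shows "norm (g x) \<le> norm (g 0) + M * norm x"
proof -
  have "onorm (\<lambda>v. h x *v v) \<le> M" for x
  proof (rule onorm_le)
    fix v
    have "norm (h x *v v) \<le> norm (h x) * norm v"
    proof -
      have "(h x *v v) \<bullet> (h x *v v) = h x \<bullet> outer_product (h x *v v) v"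
        unfolding outer_product_def by (simp add: inner_vec_def matrix_vector_mult_def sum_distrib_left sum_distrib_right mult_ac)
      also have "\<dots> \<le> norm (h x) * (norm (h x *v v) * norm v)"
        using norm_cauchy_schwarz[of "h x" "outer_product (h x *v v) v"] by (simp add: norm_outer_product)
      finally have "norm (h x *v v) * norm (h x *v v) \<le> norm (h x *v v) * (norm (h x) * norm v)"
        by (simp add: dot_square_norm power2_eq_square mult_ac)
      then show ?thesis by (cases "norm (h x *v v) = 0") (auto simp: mult_le_cancel_left_pos)
    qed
    also have "\<dots> \<le> M * norm v" by (rule mult_right_mono[OF h]) simp
    finally show "norm (h x *v v) \<le> M * norm v" .
  qed
  then have "norm (g x - g 0) \<le> M * norm (x - 0)"
    by (intro differentiable_bound[where S = UNIV]) (auto intro: g)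
  then show ?thesis using norm_triangle_ineq2[of "g x" "g 0"] by simp
qed

text \<open>Multiply by \<open>bump R\<close> and let \<open>R \<longlongrightarrow> \<infinity>\<close>. The
  critical term is the product of the gradients: that of \<open>u\<close> grows at most linearly, that of
  \<open>bump R\<close> is of order \<open>1 / R\<close> and lives on the ball of radius \<open>R\<close>, so
  the product stays bounded.\<close>

lemma static_equation_bounded:
  fixes x0 :: "real^'n"
  assumes eq: "static_equation x0 \<nu> \<tau> \<theta>" and \<nu>: "prob_space \<nu>" "sets \<nu> = sets borel"
    and \<tau>: "sets \<tau> = sets borel" "integrable \<tau> \<theta>"
    and u: "C2 u g h" and ub: "\<And>x. \<bar>u x\<bar> \<le> B" and hb: "\<And>x. norm (h x) \<le> M"
  shows "(\<integral>x. u x \<partial>\<nu>) - u x0 = (\<integral>x. ((1/2) *\<^sub>R h x) \<bullet> \<theta> x \<partial>\<tau>)"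
proof -
  interpret prob_space \<nu> by fact
  note u' = C2D[OF u]
  have B0: "0 \<le> B" using ub[of 0] by simp
  have M0: "0 \<le> M" using hb[of 0] norm_ge_zero order_trans by blast
  let ?b = "\<lambda>m. bump (real (Suc m)) :: real^'n \<Rightarrow> real" and ?bg = "\<lambda>m. bump_grad (real (Suc m)) :: real^'n \<Rightarrow> _"
    and ?bh = "\<lambda>m. bump_hess (real (Suc m)) :: real^'n \<Rightarrow> _"
  define H where "H m x = u x *\<^sub>R ?bh m x + outer_product (?bg m x) (g x) + ?b m x *\<^sub>R h x + outer_product (g x) (?bg m x)" for m x
  have c2: "C2c (\<lambda>x. u x * ?b m x) (\<lambda>x. u x *\<^sub>R ?bg m x + ?b m x *\<^sub>R g x) (H m)" for m
  proof -
    have "C2c (?b m) (?bg m) (?bh m)" by (rule C2c_bump) simp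
    then obtain R where R: "\<And>x. R \<le> norm x \<Longrightarrow> ?b m x = 0 \<and> ?bg m x = 0 \<and> ?bh m x = 0"
      unfolding C2c_def by auto
    have "u x * ?b m x = 0 \<and> u x *\<^sub>R ?bg m x + ?b m x *\<^sub>R g x = 0 \<and> H m x = 0" if "R \<le> norm x" for x
      using R[OF that] unfolding H_def by (auto simp: outer_product_def vec_eq_iff)
    then show ?thesis unfolding C2c_def H_def[abs_def] using C2_mult[OF u C2_bump] by blast
  qed
  have lhs: "(\<integral>x. u x * ?b m x \<partial>\<nu>) - u x0 * ?b m x0 = (\<integral>x. ((1/2) *\<^sub>R H m x) \<bullet> \<theta> x \<partial>\<tau>)" for m
    using eq c2 unfolding static_equation_def by blast
  have um: "v \<in> borel_measurable \<nu>" if "continuous_on UNIV v" for v :: "real^'n \<Rightarrow> real"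
    using borel_measurable_continuous_onI[OF that] by (simp add: measurable_cong_sets[OF \<nu>(2) refl])
  have hm: "v \<in> borel_measurable \<tau>" if "continuous_on UNIV v" for v :: "real^'n \<Rightarrow> real^'n^'n"
    using borel_measurable_continuous_onI[OF that] by (simp add: measurable_cong_sets[OF \<tau>(1) refl])
  have "(\<lambda>m. \<integral>x. u x * ?b m x \<partial>\<nu>) \<longlonglongrightarrow> (\<integral>x. u x * 1 \<partial>\<nu>)"
  proof (rule integral_dominated_convergence[where w = "\<lambda>_. B"])
    show "AE x in \<nu>. norm (u x * ?b m x) \<le> B" for m
    proof (rule AE_I2)
      fix x
      have "norm (u x * ?b m x) = \<bar>u x\<bar> * ?b m x" by (simp add: abs_mult bump_bounds abs_of_nonneg)
      also have "\<dots> \<le> B * 1" by (intro mult_mono ub bump_bounds B0)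
      finally show "norm (u x * ?b m x) \<le> B" by simp
    qed
    show "AE x in \<nu>. (\<lambda>m. u x * ?b m x) \<longlonglongrightarrow> u x * 1" by (intro AE_I2 tendsto_intros bump_tendsto)
  qed (auto intro!: um continuous_intros u'(3) C2D(3)[OF C2_bump])
  then have L: "(\<lambda>m. (\<integral>x. u x * ?b m x \<partial>\<nu>) - u x0 * ?b m x0) \<longlonglongrightarrow> (\<integral>x. u x \<partial>\<nu>) - u x0 * 1"
    by (intro tendsto_diff tendsto_mult tendsto_const bump_tendsto) simp
  let ?C = "B * (6 * norm (mat 1 :: real^'n^'n) + 24) + 12 * (norm (g 0) + M) + M"
  have Hb: "norm (H m x) \<le> ?C" for m x
  proof -
    have gg: "norm (g x) * norm (?bg m x) \<le> 6 * (norm (g 0) + M)"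
    proof (cases "norm x \<le> real (Suc m)")
      case True
      have "norm (g x) \<le> norm (g 0) + M * norm x" by (rule gradient_growth[OF u'(2) hb])
      also have "\<dots> \<le> real (Suc m) * norm (g 0) + M * real (Suc m)"
        using True M0 mult_right_mono[of 1 "real (Suc m)" "norm (g 0)"] by (intro add_mono mult_left_mono) auto
      finally have "norm (g x) * norm (?bg m x) \<le> (real (Suc m) * (norm (g 0) + M)) * (6 / real (Suc m))"
        using M0 by (intro mult_mono bump_grad_bound) (auto simp: algebra_simps)
      also have "\<dots> = 6 * (norm (g 0) + M)" by (simp add: field_simps)
      finally show ?thesis .
    next
      case False
      then have "max 0 (1 - (norm x)\<^sup>2 / (real (Suc m))\<^sup>2) = 0"
        using power_mono[of "real (Suc m)" "norm x" 2] by (simp add: max_def field_simps)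
      then have "?bg m x = 0" unfolding bump_grad_def by simp
      then show ?thesis using M0 by simp
    qed
    have "norm (?bh m x) \<le> (6 * norm (mat 1 :: real^'n^'n) + 24) / (real (Suc m))\<^sup>2" by (rule bump_hess_bound) simp
    also have "\<dots> \<le> (6 * norm (mat 1 :: real^'n^'n) + 24) / 1"
      by (intro divide_left_mono) (auto simp: one_le_power)
    finally have "\<bar>u x\<bar> * norm (?bh m x) \<le> B * (6 * norm (mat 1 :: real^'n^'n) + 24)"
      using ub[of x] B0 by (intro mult_mono) auto
    moreover have "\<bar>?b m x\<bar> * norm (h x) \<le> 1 * M" 
      using bump_bounds[of "real (Suc m)" x] hb by (intro mult_mono) auto
    moreover have "norm (H m x) \<le> \<bar>u x\<bar> * norm (?bh m x) + norm (g x) * norm (?bg m x) + \<bar>?b m x\<bar> * norm (h x) + norm (g x) * norm (?bg m x)"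
      unfolding H_def
      by (rule norm_triangle_le norm_triangle_mono order_trans[OF norm_triangle_ineq] add_mono | simp add: norm_outer_product mult.commute)+
    ultimately show ?thesis using gg by linarith
  qed
  have Hl: "(\<lambda>m. H m x) \<longlonglongrightarrow> h x" for x
  proof -
    have nz: "(\<lambda>m. norm (?bg m x)) \<longlonglongrightarrow> 0" by (rule tendsto_norm_zero[OF bump_grad_tendsto])
    have o1: "(\<lambda>m. outer_product (?bg m x) (g x)) \<longlonglongrightarrow> 0"
      by (rule tendsto_norm_zero_cancel, unfold norm_outer_product) (rule tendsto_mult_left_zero[OF nz])
    have o2: "(\<lambda>m. outer_product (g x) (?bg m x)) \<longlonglongrightarrow> 0"
      by (rule tendsto_norm_zero_cancel, unfold norm_outer_product) (rule tendsto_mult_right_zero[OF nz])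
    have "(\<lambda>m. H m x) \<longlonglongrightarrow> u x *\<^sub>R 0 + 0 + 1 *\<^sub>R h x + 0" unfolding H_def
      by (intro tendsto_intros o1 o2 bump_hess_tendsto bump_tendsto)
    then show ?thesis by simp
  qed
  have C0: "0 \<le> ?C" using Hb[of 0 0] norm_ge_zero order_trans by blast
  have [measurable]: "\<theta> \<in> borel_measurable \<tau>" using \<tau>(2) by auto
  have [measurable]: "H m \<in> borel_measurable \<tau>" for m
    using c2[of m] C2D(5) unfolding C2c_def by (blast intro: hm)
  have [measurable]: "h \<in> borel_measurable \<tau>" by (rule hm[OF u'(5)])
  have Rl: "(\<lambda>m. \<integral>x. ((1/2) *\<^sub>R H m x) \<bullet> \<theta> x \<partial>\<tau>) \<longlonglongrightarrow> (\<integral>x. ((1/2) *\<^sub>R h x) \<bullet> \<theta> x \<partial>\<tau>)"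
  proof (rule integral_dominated_convergence[where w = "\<lambda>x. ?C * norm (\<theta> x)"])
    show "AE x in \<tau>. (\<lambda>m. ((1/2) *\<^sub>R H m x) \<bullet> \<theta> x) \<longlonglongrightarrow> ((1/2) *\<^sub>R h x) \<bullet> \<theta> x"
      by (intro AE_I2 tendsto_intros Hl)
    show "AE x in \<tau>. norm (((1/2) *\<^sub>R H m x) \<bullet> \<theta> x) \<le> ?C * norm (\<theta> x)" for m
    proof (rule AE_I2)
      fix x
      have "norm (((1/2) *\<^sub>R H m x) \<bullet> \<theta> x) \<le> norm ((1/2) *\<^sub>R H m x) * norm (\<theta> x)" 
        using Cauchy_Schwarz_ineq2 by simp
      also have "\<dots> \<le> ?C * norm (\<theta> x)" using Hb[of m x] C0 by (intro mult_right_mono) auto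
      finally show "norm (((1/2) *\<^sub>R H m x) \<bullet> \<theta> x) \<le> ?C * norm (\<theta> x)" .
    qed
    show "integrable \<tau> (\<lambda>x. ?C * norm (\<theta> x))" using \<tau>(2) by simp
  qed measurable
  show ?thesis using LIMSEQ_unique[OF L[unfolded lhs] Rl] by simp
qed

text \<open>Test the equation with the capped squares, whose Hessians are bounded uniformly, and pass to the
  limit monotonically.\<close>

lemma static_equation_moment:
  fixes x0 :: "real^'n"
  assumes eq: "static_equation x0 \<nu> \<tau> \<theta>" and \<nu>: "prob_space \<nu>" "sets \<nu> = sets borel"
    and \<tau>: "sets \<tau> = sets borel" "integrable \<tau> \<theta>"
  shows "(\<integral>\<^sup>+x. ennreal ((norm x)\<^sup>2) \<partial>\<nu>) < \<infinity>"
proof -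
  interpret prob_space \<nu> by fact
  have [measurable]: "\<theta> \<in> borel_measurable \<tau>" using \<tau>(2) by auto
  define C where "C = (6 * norm (mat 1 :: real^'n^'n) + 24)"
  have C0: "0 \<le> C" unfolding C_def by (simp add: add_nonneg_nonneg)
  let ?K = "3 * (norm x0)\<^sup>2 + C * (\<integral>x. norm (\<theta> x) \<partial>\<tau>)"
  have bound: "(\<integral>\<^sup>+x. ennreal (min ((norm x)\<^sup>2) (R\<^sup>2)) \<partial>\<nu>) \<le> ennreal ?K" if R: "R > 0" for R
  proof -
    let ?v = "\<lambda>x. R\<^sup>2 * (1 - bump R x)"
    have vm: "bump R \<in> borel_measurable \<nu>"
      using borel_measurable_continuous_onI[OF C2D(3)[OF C2_bump]] by (simp add: measurable_cong_sets[OF \<nu>(2) refl])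
    have hm: "bump_hess R \<in> borel_measurable \<tau>"
      using borel_measurable_continuous_onI[OF C2D(5)[OF C2_bump]] by (simp add: measurable_cong_sets[OF \<tau>(1) refl])
    have ib: "integrable \<nu> (bump R)" using bump_bounds vm by (intro integrable_const_bound[of _ 1]) (auto simp: abs_of_nonneg bump_bounds intro!: AE_I2)
    have "(\<integral>x. ?v x \<partial>\<nu>) = R\<^sup>2 * (1 - (\<integral>x. bump R x \<partial>\<nu>))" using ib by (simp add: prob_space)
    also have "(\<integral>x. bump R x \<partial>\<nu>) = bump R x0 + (\<integral>x. ((1/2) *\<^sub>R bump_hess R x) \<bullet> \<theta> x \<partial>\<tau>)"
      using eq[unfolded static_equation_def, rule_format, OF C2c_bump[OF R]] by linarith
    also have "R\<^sup>2 * (1 - (bump R x0 + (\<integral>x. ((1/2) *\<^sub>R bump_hess R x) \<bullet> \<theta> x \<partial>\<tau>))) =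
        ?v x0 + (\<integral>x. - (R\<^sup>2 * (((1/2) *\<^sub>R bump_hess R x) \<bullet> \<theta> x)) \<partial>\<tau>)" by (simp add: algebra_simps)
    also have "(\<integral>x. - (R\<^sup>2 * (((1/2) *\<^sub>R bump_hess R x) \<bullet> \<theta> x)) \<partial>\<tau>) \<le> (\<integral>x. C * norm (\<theta> x) \<partial>\<tau>)"
    proof (rule integral_mono_AE')
      show "integrable \<tau> (\<lambda>x. C * norm (\<theta> x))" using \<tau>(2) by simp
      show "AE x in \<tau>. - (R\<^sup>2 * (((1/2) *\<^sub>R bump_hess R x) \<bullet> \<theta> x)) \<le> C * norm (\<theta> x)"
      proof (rule AE_I2)
        fix x
        have "- (R\<^sup>2 * (((1/2) *\<^sub>R bump_hess R x) \<bullet> \<theta> x)) \<le> R\<^sup>2 * (norm ((1/2) *\<^sub>R bump_hess R x) * norm (\<theta> x))"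
          using Cauchy_Schwarz_ineq2[of "(1/2) *\<^sub>R bump_hess R x" "\<theta> x"] 
          by (simp only: mult_minus_right[symmetric]) (intro mult_left_mono, auto simp: abs_le_iff)
        also have "\<dots> \<le> R\<^sup>2 * (C / R\<^sup>2 * norm (\<theta> x))"
        proof -
          have "norm ((1/2) *\<^sub>R bump_hess R x) \<le> norm (bump_hess R x)" by simp
          also have "\<dots> \<le> C / R\<^sup>2" unfolding C_def by (rule bump_hess_bound[OF R])
          finally show ?thesis by (intro mult_left_mono mult_right_mono) auto
        qed
        also have "\<dots> = C * norm (\<theta> x)" using R by simp
        finally show "- (R\<^sup>2 * (((1/2) *\<^sub>R bump_hess R x) \<bullet> \<theta> x)) \<le> C * norm (\<theta> x)" .
      qed
      show "AE x in \<tau>. 0 \<le> C * norm (\<theta> x)" using C0 by simp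
    qed
    finally have v: "(\<integral>x. ?v x \<partial>\<nu>) \<le> ?K" using capped_square_bounds(2)[OF R, of x0] by simp
    have "(\<integral>\<^sup>+x. ennreal (min ((norm x)\<^sup>2) (R\<^sup>2)) \<partial>\<nu>) \<le> (\<integral>\<^sup>+x. ennreal (?v x) \<partial>\<nu>)"
      by (intro nn_integral_mono ennreal_leI capped_square_bounds R)
    also have "\<dots> = ennreal (\<integral>x. ?v x \<partial>\<nu>)"
      using ib bump_bounds(2)[of R] by (intro nn_integral_eq_integral AE_I2 mult_nonneg_nonneg) auto
    finally show ?thesis using ennreal_leI[OF v] order_trans by blast
  qed
  have "(\<integral>\<^sup>+x. ennreal ((norm x)\<^sup>2) \<partial>\<nu>) = (\<integral>\<^sup>+x. (SUP n. ennreal (min ((norm x)\<^sup>2) ((real (Suc n))\<^sup>2))) \<partial>\<nu>)"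
  proof (rule nn_integral_cong)
    fix x :: "real^'n"
    obtain n :: nat where n: "norm x \<le> real n" using real_arch_simple by blast
    then have "(norm x)\<^sup>2 \<le> (real (Suc n))\<^sup>2" by (intro power_mono) auto
    then have "ennreal ((norm x)\<^sup>2) \<le> ennreal (min ((norm x)\<^sup>2) ((real (Suc n))\<^sup>2))" by simp
    then show "ennreal ((norm x)\<^sup>2) = (SUP n. ennreal (min ((norm x)\<^sup>2) ((real (Suc n))\<^sup>2)))"
      by (intro antisym SUP_upper2[of n] SUP_least ennreal_leI) auto
  qed
  also have "\<dots> = (SUP n. \<integral>\<^sup>+x. ennreal (min ((norm x)\<^sup>2) ((real (Suc n))\<^sup>2)) \<partial>\<nu>)"
  proof (rule nn_integral_monotone_convergence_SUP)
    show "incseq (\<lambda>n x. ennreal (min ((norm x)\<^sup>2) ((real (Suc n))\<^sup>2)))"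
      by (auto simp: incseq_def le_fun_def intro!: ennreal_leI min.coboundedI2 power_mono)
  qed (simp add: measurable_cong_sets[OF \<nu>(2) refl])
  also have "\<dots> \<le> ennreal ?K" by (intro SUP_least bound) simp
  finally show ?thesis by (simp add: order_le_less_trans)
qed


section \<open>Space-time measures and interpolation\<close>

lemma space_unit_time [simp]: "space unit_time = {0<..<1}"
  unfolding unit_time_def by (simp add: space_restrict_space)

lemma prob_space_unit_time: "prob_space unit_time"
proof
  show "emeasure unit_time (space unit_time) = 1"
    unfolding space_unit_time unfolding unit_time_def by (subst emeasure_restrict_space) auto
qed

lemma measurable_unit_time_borel [measurable]: "(\<lambda>t. t) \<in> borel_measurable unit_time"
  unfolding unit_time_def by (rule measurable_restrict_space1) simp

lemma integral_unit_time: 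
  fixes w :: "real \<Rightarrow> real"
  shows "(\<integral>t. w t \<partial>unit_time) = (LINT t:{0<..<1}|lborel. w t)"
  unfolding unit_time_def set_lebesgue_integral_def by (rule integral_restrict_space) simp

lemma unit_time_borel_pair [measurable]:
  "(\<lambda>z. z) \<in> (unit_time \<Otimes>\<^sub>M (borel :: (real^'n) measure)) \<rightarrow>\<^sub>M spacetime"
  unfolding spacetime_def
proof (rule measurable_restrict_space2)
  have "(\<lambda>z. (fst z, snd z)) \<in> unit_time \<Otimes>\<^sub>M (borel :: (real^'n) measure) \<rightarrow>\<^sub>M borel"
    using measurable_compose[OF measurable_fst measurable_unit_time_borel]
    by (intro borel_measurable_Pair measurable_snd)
  then show "(\<lambda>z. z) \<in> unit_time \<Otimes>\<^sub>M (borel :: (real^'n) measure) \<rightarrow>\<^sub>M borel" by simp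
qed (auto simp: space_pair_measure)

lemma Pair_measurable_spacetime: "t \<in> {0<..<1} \<Longrightarrow> Pair t \<in> (borel :: (real^'n) measure) \<rightarrow>\<^sub>M spacetime"
  by (rule measurable_compose[OF _ unit_time_borel_pair]) (auto intro!: measurable_Pair1')

lemma spacetime_slice: "E \<in> sets (spacetime :: (real \<times> (real^'n)) measure) \<Longrightarrow> t \<in> {0<..<1} \<Longrightarrow> Pair t -` E \<in> sets borel"
  using measurable_sets[OF Pair_measurable_spacetime] by fastforce

lemma indicator_spacetime_measurable:
  assumes "E \<in> sets (spacetime :: (real \<times> (real^'n)) measure)" and "sets \<tau> = sets borel"
  shows "(\<lambda>z. indicat_real E z) \<in> borel_measurable (unit_time \<Otimes>\<^sub>M \<tau>)"
proof -
  have s: "sets (unit_time \<Otimes>\<^sub>M \<tau>) = sets (unit_time \<Otimes>\<^sub>M borel)" by (rule sets_pair_measure_cong) (auto simp: assms)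
  show ?thesis unfolding measurable_cong_sets[OF s refl]
    by (rule measurable_compose[OF unit_time_borel_pair borel_measurable_indicator[OF assms(1)]])
qed

text \<open>Linear conditions, hence preserved under integration.\<close>

lemma psd_iff: "A \<in> psd_mats \<longleftrightarrow> (\<forall>i j. mat_unit i j \<bullet> A = mat_unit j i \<bullet> A) \<and> (\<forall>v. 0 \<le> outer_product v v \<bullet> A)"
proof -
  have "outer_product v v \<bullet> A = v \<bullet> (A *v v)" for v
    unfolding outer_product_def by (simp add: inner_vec_def matrix_vector_mult_def sum_distrib_left mult_ac)
  then show ?thesis unfolding psd_mats_def sym_mats_def transpose_def by (auto simp: vec_eq_iff inner_mat_unit)
qed

lemma integral_psd:
  assumes F: "integrable M F" and psd: "AE x in M. F x \<in> psd_mats"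
  shows "(\<integral>x. F x \<partial>M) \<in> (psd_mats :: (real^'n^'n) set)"
proof -
  have i: "B \<bullet> (\<integral>x. F x \<partial>M) = (\<integral>x. B \<bullet> F x \<partial>M)" for B
    using F by (intro integral_inner_right[symmetric]) 
  have "(\<integral>x. mat_unit i j \<bullet> F x \<partial>M) = (\<integral>x. mat_unit j i \<bullet> F x \<partial>M)" for i j
    using F psd by (intro integral_cong_AE) (auto simp: psd_iff)
  moreover have "0 \<le> (\<integral>x. outer_product v v \<bullet> F x \<partial>M)" for v
    using psd by (intro integral_nonneg_AE) (auto simp: psd_iff)
  ultimately show ?thesis unfolding psd_iff i by blast
qed

lemma psd_scale: "A \<in> psd_mats \<Longrightarrow> 0 \<le> c \<Longrightarrow> c *\<^sub>R A \<in> psd_mats"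
  unfolding psd_iff by simp

lemma vector_measure_density:
  fixes \<theta> :: "'a \<Rightarrow> 'b::euclidean_space"
  assumes \<theta>: "integrable \<tau> \<theta>" and s: "sets \<tau> = sets M"
  shows "vector_measure M (\<lambda>E. LINT x:E|\<tau>. \<theta> x)"
  unfolding vector_measure_def
proof (intro conjI allI impI)
  show "(LINT x:{}|\<tau>. \<theta> x) = 0" by (simp add: set_lebesgue_integral_def)
  fix A :: "nat \<Rightarrow> 'a set" assume A: "range A \<subseteq> sets M" "disjoint_family A"
  have [measurable]: "A i \<in> sets \<tau>" for i using A s by auto
  have [measurable]: "\<theta> \<in> borel_measurable \<tau>" using \<theta> by auto
  have "(\<lambda>n. LINT x:(\<Union>i<n. A i)|\<tau>. \<theta> x) \<longlonglongrightarrow> (LINT x:(\<Union>i. A i)|\<tau>. \<theta> x)"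
    unfolding set_lebesgue_integral_def
  proof (rule integral_dominated_convergence[where w = "\<lambda>x. norm (\<theta> x)"])
    show "AE x in \<tau>. (\<lambda>n. indicat_real (\<Union>i<n. A i) x *\<^sub>R \<theta> x) \<longlonglongrightarrow> indicat_real (\<Union>i. A i) x *\<^sub>R \<theta> x"
      by (intro AE_I2 tendsto_intros LIMSEQ_indicator_UN)
  qed (use \<theta> in \<open>auto simp: indicator_def\<close>)
  moreover have "(LINT x:(\<Union>i<n. A i)|\<tau>. \<theta> x) = (\<Sum>i<n. LINT x:A i|\<tau>. \<theta> x)" for n
  proof -
    have "indicat_real (\<Union>i<n. A i) x = (\<Sum>i<n. indicat_real (A i) x)" for x
      using A(2) by (intro indicator_UN_disjoint) (auto simp: disjoint_family_on_def)
    then show ?thesis unfolding set_lebesgue_integral_def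
      using integrable_mult_indicator[OF _ \<theta>]
      by (simp only: scaleR_sum_left) (intro Bochner_Integration.integral_sum, simp)
  qed
  ultimately show "(\<lambda>i. LINT x:A i|\<tau>. \<theta> x) sums (LINT x:(\<Union>i. A i)|\<tau>. \<theta> x)" unfolding sums_def by simp
qed

lemma psd_measure_density:
  fixes \<theta> :: "'a \<Rightarrow> real^'n^'n"
  assumes \<theta>: "integrable \<tau> \<theta>" and s: "sets \<tau> = sets M" and psd: "AE x in \<tau>. \<theta> x \<in> psd_mats"
  shows "psd_measure M (\<lambda>E. LINT x:E|\<tau>. \<theta> x)"
  unfolding psd_measure_def
proof (intro conjI ballI vector_measure_density[OF \<theta> s])
  fix E assume E: "E \<in> sets M"
  show "(LINT x:E|\<tau>. \<theta> x) \<in> psd_mats" unfolding set_lebesgue_integral_def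
    using E s psd by (intro integral_psd integrable_mult_indicator \<theta>) (auto intro: psd_scale)
qed

text \<open>The slices of a space-time set are integrated against a measure that does not depend on
  time.\<close>

lemma slice_density:
  fixes \<theta> :: "real^'n \<Rightarrow> 'b::euclidean_space"
  assumes fin: "finite_measure \<tau>" and s: "sets \<tau> = sets borel" and \<theta>: "integrable \<tau> \<theta>"
    and E: "E \<in> sets spacetime"
  shows "integrable unit_time (\<lambda>t. LINT x:(Pair t -` E)|\<tau>. \<theta> x)"
    and "norm (LINT x:(Pair t -` E)|\<tau>. \<theta> x) \<le> (\<integral>x. norm (\<theta> x) \<partial>\<tau>)"
proof -
  interpret finite_measure \<tau> by fact
  interpret U: prob_space unit_time by (rule prob_space_unit_time)
  have tm[measurable]: "\<theta> \<in> borel_measurable \<tau>" using \<theta> by auto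
  have "(\<lambda>t. \<integral>x. indicat_real E (t, x) *\<^sub>R \<theta> x \<partial>\<tau>) \<in> borel_measurable unit_time"
  proof (rule borel_measurable_lebesgue_integral)
    show "(\<lambda>(t, x). indicat_real E (t, x) *\<^sub>R \<theta> x) \<in> borel_measurable (unit_time \<Otimes>\<^sub>M \<tau>)"
      using indicator_spacetime_measurable[OF E s] by (simp add: case_prod_beta)
  qed
  moreover have ind: "indicat_real E (t, x) = indicat_real (Pair t -` E) x" for t x by (auto simp: indicator_def)
  ultimately have m: "(\<lambda>t. LINT x:(Pair t -` E)|\<tau>. \<theta> x) \<in> borel_measurable unit_time"
    unfolding set_lebesgue_integral_def by simp
  show b: "norm (LINT x:(Pair t -` E)|\<tau>. \<theta> x) \<le> (\<integral>x. norm (\<theta> x) \<partial>\<tau>)" for t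
  proof -
    have "norm (LINT x:(Pair t -` E)|\<tau>. \<theta> x) \<le> (\<integral>x. norm (indicat_real (Pair t -` E) x *\<^sub>R \<theta> x) \<partial>\<tau>)"
      unfolding set_lebesgue_integral_def by (rule integral_norm_bound)
    also have "\<dots> \<le> (\<integral>x. norm (\<theta> x) \<partial>\<tau>)"
      by (rule integral_mono_AE') (use \<theta> in \<open>auto simp: indicator_def\<close>)
    finally show ?thesis .
  qed
  show "integrable unit_time (\<lambda>t. LINT x:(Pair t -` E)|\<tau>. \<theta> x)"
    by (rule U.integrable_const_bound[OF _ m]) (use b in auto)
qed

lemma psd_measure_spacetime:
  fixes \<theta> :: "real^'n \<Rightarrow> real^'n^'n"
  assumes fin: "finite_measure \<tau>" and s: "sets \<tau> = sets borel" and \<theta>: "integrable \<tau> \<theta>"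
    and psd: "AE x in \<tau>. \<theta> x \<in> psd_mats"
  shows "psd_measure spacetime (\<lambda>E. \<integral>t. (LINT x:(Pair t -` E)|\<tau>. \<theta> x) \<partial>unit_time)"
  unfolding psd_measure_def
proof
  let ?l = "\<lambda>B. LINT x:B|\<tau>. \<theta> x"
  have pm: "psd_measure borel ?l" using psd_measure_density[OF \<theta> s psd] .
  then have l0: "?l {} = 0" and sums: "\<And>A. range A \<subseteq> sets borel \<Longrightarrow> disjoint_family A \<Longrightarrow> (\<lambda>i::nat. ?l (A i)) sums ?l (\<Union>i. A i)"
    unfolding psd_measure_def vector_measure_def by auto
  note sl = slice_density[OF fin s \<theta>]
  show "vector_measure spacetime (\<lambda>E. \<integral>t. ?l (Pair t -` E) \<partial>unit_time)"
    unfolding vector_measure_def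
  proof (intro conjI allI impI)
    show "(\<integral>t. ?l (Pair t -` {}) \<partial>unit_time) = 0" using l0 by simp
    fix A :: "nat \<Rightarrow> (real \<times> (real^'n)) set" assume A: "range A \<subseteq> sets spacetime" "disjoint_family A"
    have Ai: "A i \<in> sets spacetime" for i using A by auto
    have pt: "(\<lambda>i. ?l (Pair t -` A i)) sums ?l (Pair t -` (\<Union>i. A i))" if "t \<in> {0<..<1}" for t
    proof -
      have "(\<lambda>i. ?l (Pair t -` A i)) sums ?l (\<Union>i. Pair t -` A i)"
        using A spacetime_slice[OF Ai that] by (intro sums) (auto simp: disjoint_family_on_def)
      then show ?thesis by (simp add: vimage_UN)
    qed
    have UN: "(\<Union>i<n. A i) \<in> sets spacetime" for n using Ai by auto
    have fin_add: "(\<Sum>i<n. ?l (Pair t -` A i)) = ?l (Pair t -` (\<Union>i<n. A i))" if "t \<in> {0<..<1}" for t n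
    proof -
      define A' where "A' i = (if i < n then Pair t -` A i else {})" for i
      have "(\<lambda>i. ?l (A' i)) sums ?l (\<Union>i. A' i)"
        using A(2) spacetime_slice[OF Ai that] by (intro sums) (auto simp: disjoint_family_on_def A'_def)
      moreover have "(\<Union>i. A' i) = Pair t -` (\<Union>i<n. A i)" unfolding A'_def by (auto split: if_splits)
      moreover have "(\<lambda>i. ?l (A' i)) sums (\<Sum>i<n. ?l (A' i))"
        by (rule sums_finite) (auto simp: A'_def l0)
      ultimately show ?thesis by (auto simp: A'_def dest: sums_unique2)
    qed
    have "(\<lambda>n. \<integral>t. (\<Sum>i<n. ?l (Pair t -` A i)) \<partial>unit_time) \<longlonglongrightarrow> (\<integral>t. ?l (Pair t -` (\<Union>i. A i)) \<partial>unit_time)"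
    proof (rule integral_dominated_convergence[where w = "\<lambda>_. \<integral>x. norm (\<theta> x) \<partial>\<tau>"])
      show "(\<lambda>t. ?l (Pair t -` (\<Union>i. A i))) \<in> borel_measurable unit_time"
        using sl(1)[of "\<Union>i. A i"] Ai by auto
      show "(\<lambda>t. \<Sum>i<n. ?l (Pair t -` A i)) \<in> borel_measurable unit_time" for n
        using sl(1)[OF Ai] by (intro borel_measurable_sum) auto
      show "integrable unit_time (\<lambda>_. \<integral>x. norm (\<theta> x) \<partial>\<tau>)"
        using prob_space.finite_measure[OF prob_space_unit_time] by (simp add: finite_measure.integrable_const)
      show "AE t in unit_time. (\<lambda>n. \<Sum>i<n. ?l (Pair t -` A i)) \<longlonglongrightarrow> ?l (Pair t -` (\<Union>i. A i))"
        using pt unfolding sums_def by (intro AE_I2) simp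
      show "AE t in unit_time. norm (\<Sum>i<n. ?l (Pair t -` A i)) \<le> (\<integral>x. norm (\<theta> x) \<partial>\<tau>)" for n
        using fin_add sl(2)[OF UN] by (intro AE_I2) (simp del: vimage_UN)
    qed
    moreover have "(\<integral>t. (\<Sum>i<n. ?l (Pair t -` A i)) \<partial>unit_time) = (\<Sum>i<n. \<integral>t. ?l (Pair t -` A i) \<partial>unit_time)" for n
      using sl(1)[OF Ai] by (rule Bochner_Integration.integral_sum)
    ultimately show "(\<lambda>i. \<integral>t. ?l (Pair t -` A i) \<partial>unit_time) sums (\<integral>t. ?l (Pair t -` (\<Union>i. A i)) \<partial>unit_time)"
      unfolding sums_def by simp
  qed
  show "\<forall>E\<in>sets spacetime. (\<integral>t. ?l (Pair t -` E) \<partial>unit_time) \<in> psd_mats"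
  proof
    fix E :: "(real \<times> (real^'n)) set" assume E: "E \<in> sets spacetime"
    have "?l (Pair t -` E) \<in> psd_mats" if "t \<in> {0<..<1}" for t
      using pm spacetime_slice[OF E that] unfolding psd_measure_def by blast
    then show "(\<integral>t. ?l (Pair t -` E) \<partial>unit_time) \<in> psd_mats" by (intro integral_psd sl(1) E AE_I2) simp
  qed
qed

text \<open>The mixture \<open>(1 - t) \<mu> + t \<nu>\<close>, written with a Bernoulli variable so that
  integrals and measurability follow from the Giry monad.\<close>

definition interpolation :: "(real^'n) measure \<Rightarrow> (real^'n) measure \<Rightarrow> real \<Rightarrow> (real^'n) measure" where
  "interpolation \<mu> \<nu> t = measure_pmf (bernoulli_pmf t) \<bind> (\<lambda>b. if b then \<nu> else \<mu>)"

lemma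
  fixes \<mu> \<nu> :: "(real^'n) measure"
  assumes \<mu>: "prob_space \<mu>" "sets \<mu> = sets borel" and \<nu>: "prob_space \<nu>" "sets \<nu> = sets borel"
  shows sets_interpolation: "sets (interpolation \<mu> \<nu> t) = sets borel"
    and prob_space_interpolation: "prob_space (interpolation \<mu> \<nu> t)"
    and nn_integral_interpolation: "w \<in> borel_measurable borel \<Longrightarrow> t \<in> {0..1} \<Longrightarrow>
       (\<integral>\<^sup>+x. w x \<partial>interpolation \<mu> \<nu> t) = ennreal t * (\<integral>\<^sup>+x. w x \<partial>\<nu>) + ennreal (1 - t) * (\<integral>\<^sup>+x. w x \<partial>\<mu>)"
    and emeasure_interpolation: "E \<in> sets borel \<Longrightarrow> t \<in> {0..1} \<Longrightarrow>
       emeasure (interpolation \<mu> \<nu> t) E = ennreal t * emeasure \<nu> E + ennreal (1 - t) * emeasure \<mu> E"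
    and integral_interpolation: "u \<in> borel_measurable borel \<Longrightarrow> (\<And>x. \<bar>u x\<bar> \<le> B) \<Longrightarrow> t \<in> {0..1} \<Longrightarrow>
       (\<integral>x. u x \<partial>interpolation \<mu> \<nu> t) = t * (\<integral>x. u x \<partial>\<nu>) + (1 - t) * (\<integral>x. u x \<partial>\<mu>)"
proof -
  let ?k = "\<lambda>b. if b then \<nu> else \<mu>"
  have sp: "\<nu> \<in> space (subprob_algebra borel)" "\<mu> \<in> space (subprob_algebra borel)"
    unfolding space_subprob_algebra mem_Collect_eq
    by (intro conjI prob_space_imp_subprob_space assms)+
  have k: "?k \<in> measure_pmf (bernoulli_pmf t) \<rightarrow>\<^sub>M subprob_algebra borel" for t
    unfolding measurable_pmf_measure1 using sp by (intro Pi_I) (simp split: if_split)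
  show "sets (interpolation \<mu> \<nu> t) = sets borel" unfolding interpolation_def
    using assms(2,4) by (intro sets_bind) simp_all
  show "prob_space (interpolation \<mu> \<nu> t)" unfolding interpolation_def
    using assms(1,3) by (intro prob_space.prob_space_bind[OF prob_space_measure_pmf _ k] AE_I2) simp
  show nn: "(\<integral>\<^sup>+x. w x \<partial>interpolation \<mu> \<nu> t) = ennreal t * (\<integral>\<^sup>+x. w x \<partial>\<nu>) + ennreal (1 - t) * (\<integral>\<^sup>+x. w x \<partial>\<mu>)"
    if "w \<in> borel_measurable borel" "t \<in> {0..1}" for w t
    unfolding interpolation_def nn_integral_bind[OF that(1) k] using that(2) by (simp add: mult.commute)
  show "emeasure (interpolation \<mu> \<nu> t) E = ennreal t * emeasure \<nu> E + ennreal (1 - t) * emeasure \<mu> E"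
    if E: "E \<in> sets borel" and t: "t \<in> {0..1}"
    unfolding interpolation_def emeasure_bind[OF prob_space.not_empty[OF prob_space_measure_pmf] k E] using t by (simp add: mult.commute)
  show "(\<integral>x. u x \<partial>interpolation \<mu> \<nu> t) = t * (\<integral>x. u x \<partial>\<nu>) + (1 - t) * (\<integral>x. u x \<partial>\<mu>)"
    if "u \<in> borel_measurable borel" "\<And>x. \<bar>u x\<bar> \<le> B" "t \<in> {0..1}"
  proof -
    interpret M: prob_space \<mu> by fact
    interpret N: prob_space \<nu> by fact
    have um: "u \<in> borel_measurable \<mu>" "u \<in> borel_measurable \<nu>"
      using that(1) by (simp_all add: measurable_cong_sets[OF \<mu>(2) refl] measurable_cong_sets[OF \<nu>(2) refl])
    have "(\<integral>x. u x \<partial>interpolation \<mu> \<nu> t) = (\<integral>b. (\<integral>x. u x \<partial>?k b) \<partial>bernoulli_pmf t)"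
      unfolding interpolation_def
    proof (rule integral_bind[OF that(1) that(2) k])
      show "finite_measure (measure_pmf (bernoulli_pmf t))" by (rule prob_space.finite_measure[OF prob_space_measure_pmf])
      show "AE b in bernoulli_pmf t. emeasure (?k b) (space (?k b)) \<le> ennreal 1"
        using M.emeasure_space_1 N.emeasure_space_1 by (intro AE_I2) simp
    qed
    then show ?thesis using that(3) by (simp add: mult.commute)
  qed
qed

lemma measurable_interpolation:
  assumes \<mu>: "prob_space \<mu>" "sets \<mu> = sets borel" and \<nu>: "prob_space \<nu>" "sets \<nu> = sets borel"
  shows "interpolation \<mu> \<nu> \<in> unit_time \<rightarrow>\<^sub>M prob_algebra borel"
proof (intro measurable_prob_algebraI measurable_subprob_algebra)
  fix A :: "(real^'a) set" assume A: "A \<in> sets borel"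
  have "(\<lambda>t. ennreal t * emeasure \<nu> A + ennreal (1 - t) * emeasure \<mu> A) \<in> borel_measurable unit_time" by measurable
  then show "(\<lambda>t. emeasure (interpolation \<mu> \<nu> t) A) \<in> borel_measurable unit_time"
    using emeasure_interpolation[OF assms A] by (subst measurable_cong) auto
qed (rule prob_space_interpolation[OF assms] sets_interpolation[OF assms]
  prob_space_imp_subprob_space[OF prob_space_interpolation[OF assms]])+


section \<open>Static solutions give dynamic ones\<close>

lemma integral_return_borel: "u \<in> borel_measurable borel \<Longrightarrow> (\<integral>x. u x \<partial>return borel x0) = (u (x0::real^'n) :: real)"
  by (rule integral_return) auto

text \<open>The support is closed but may be unbounded in space; near the initial and final time the test
  function vanishes on an interval whose length depends on \<open>x\<close>.\<close>

lemma test_function_vanishes: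
  fixes \<phi> :: "real \<times> (real^'n) \<Rightarrow> real"
  assumes "supported_inside \<phi>"
  obtains e where "0 < e" "e < 1/2" "\<And>t. 0 < t \<Longrightarrow> t \<le> e \<Longrightarrow> \<phi> (t, x) = 0" "\<And>t. 1 - e \<le> t \<Longrightarrow> t < 1 \<Longrightarrow> \<phi> (t, x) = 0"
proof -
  let ?S = "closure {z \<in> {0<..<1} \<times> UNIV. \<phi> z \<noteq> 0}"
  have ex: "\<exists>e>0. \<forall>t. \<bar>t - s\<bar> < e \<longrightarrow> t \<in> {0<..<1} \<longrightarrow> \<phi> (t, x) = 0" if "s \<notin> {0<..<1}" for s
  proof -
    have "(s, x) \<notin> ?S" using assms that unfolding supported_inside_def by auto
    then have "open (- ?S)" "(s, x) \<in> - ?S" by auto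
    then obtain e where e: "e > 0" "ball (s, x) e \<subseteq> - ?S" using open_contains_ball by blast
    have "\<phi> (t, x) = 0" if t: "\<bar>t - s\<bar> < e" "t \<in> {0<..<1}" for t
    proof (rule ccontr)
      assume "\<phi> (t, x) \<noteq> 0"
      then have "(t, x) \<in> ?S" using t by (intro subsetD[OF closure_subset]) auto
      moreover have "(t, x) \<in> ball (s, x) e" using t by (simp add: dist_Pair_Pair dist_real_def abs_minus_commute)
      ultimately show False using e(2) by blast
    qed
    then show ?thesis using e(1) by blast
  qed
  obtain a where a: "a > 0" "\<And>t. \<bar>t - 0\<bar> < a \<Longrightarrow> t \<in> {0<..<1} \<Longrightarrow> \<phi> (t, x) = 0" using ex[of 0] by auto
  obtain b where b: "b > 0" "\<And>t. \<bar>t - 1\<bar> < b \<Longrightarrow> t \<in> {0<..<1} \<Longrightarrow> \<phi> (t, x) = 0" using ex[of 1] by auto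
  show ?thesis
    by (rule that[of "min (min a b / 2) (1/4)"]) (use a b in \<open>auto simp: min_def split: if_splits\<close>)
qed

text \<open>Integrate the bounded time derivative from a time where the function vanishes.\<close>

lemma test_function_bounded:
  fixes \<phi> :: "real \<times> (real^'n) \<Rightarrow> real"
  assumes c: "Cb12 \<phi> \<phi>t g h" and s: "supported_inside \<phi>" and B: "\<And>t x. t \<in> {0<..<1} \<Longrightarrow> \<bar>\<phi>t (t, x)\<bar> \<le> B"
    and t: "t \<in> {0<..<1}"
  shows "\<bar>\<phi> (t, x)\<bar> \<le> B"
proof -
  obtain e where e: "0 < e" "e < 1/2" "\<And>t. 0 < t \<Longrightarrow> t \<le> e \<Longrightarrow> \<phi> (t, x) = 0" using test_function_vanishes[OF s] by metis
  show ?thesis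
  proof (cases "t \<le> e")
    case True
    have "0 \<le> B" using B[OF t, of x] by linarith
    then show ?thesis using e(3)[of t] True t by simp
  next
    case False
    have der: "((\<lambda>s. \<phi> (s, x)) has_real_derivative \<phi>t (r, x)) (at r)" if "r \<in> {0<..<1}" for r
      using c that unfolding Cb12_def by blast
    have "\<exists>z. e < z \<and> z < t \<and> \<phi> (t, x) - \<phi> (e, x) = (t - e) * \<phi>t (z, x)"
      by (rule MVT2) (use False e t der in auto)
    then obtain z where z: "e < z" "z < t" "\<phi> (t, x) - \<phi> (e, x) = (t - e) * \<phi>t (z, x)" by blast
    have "\<bar>\<phi> (t, x)\<bar> = (t - e) * \<bar>\<phi>t (z, x)\<bar>" using z e(1) e(3)[of e] False by (simp add: abs_mult)
    also have "\<dots> \<le> 1 * B" using z t e(1) False by (intro mult_mono B) auto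
    finally show ?thesis by simp
  qed
qed

text \<open>The fundamental theorem of calculus for \<open>(c0 + c1 * t) * \<phi> (t, x)\<close>, which vanishes
  near both ends.\<close>

lemma integral_by_parts_in_time:
  fixes \<phi> :: "real \<times> (real^'n) \<Rightarrow> real"
  assumes c: "Cb12 \<phi> \<phi>t g h" and s: "supported_inside \<phi>" and B: "\<And>t x. t \<in> {0<..<1} \<Longrightarrow> \<bar>\<phi>t (t, x)\<bar> \<le> B"
  shows "(\<integral>t. (c0 + c1 * t) * \<phi>t (t, x) \<partial>unit_time) = - c1 * (\<integral>t. \<phi> (t, x) \<partial>unit_time)"
    and "integrable unit_time (\<lambda>t. \<phi>t (t, x))" "integrable unit_time (\<lambda>t. \<phi> (t, x))"
proof -
  interpret U: prob_space unit_time by (rule prob_space_unit_time)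
  have ct: "continuous_on {0<..<1} (\<lambda>t. w (t, x))" if "continuous_on ({0<..<1} \<times> UNIV) w" for w :: "real \<times> (real^'n) \<Rightarrow> real"
    by (rule continuous_on_compose2[OF that]) (auto intro!: continuous_intros)
  have cont: "continuous_on {0<..<1} (\<lambda>t. \<phi> (t, x))" "continuous_on {0<..<1} (\<lambda>t. \<phi>t (t, x))"
    using c ct unfolding Cb12_def by blast+
  have meas: "w \<in> borel_measurable unit_time" if "continuous_on {0<..<1} w" for w :: "real \<Rightarrow> real"
  proof -
    have "w \<in> borel_measurable (restrict_space borel {0<..<1})" by (rule borel_measurable_continuous_on_restrict[OF that])
    then show ?thesis unfolding unit_time_def
      by (simp add: measurable_cong_sets[OF sets_restrict_space_cong[OF sets_lborel] refl])
  qed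
  show i1: "integrable unit_time (\<lambda>t. \<phi>t (t, x))"
    by (rule U.integrable_const_bound[OF _ meas[OF cont(2)], of B]) (use B in auto)
  show i2: "integrable unit_time (\<lambda>t. \<phi> (t, x))"
    by (rule U.integrable_const_bound[OF _ meas[OF cont(1)], of B]) (use test_function_bounded[OF c s B] in auto)
  have i3: "integrable unit_time (\<lambda>t. (c0 + c1 * t) * \<phi>t (t, x))"
  proof (rule U.integrable_const_bound[where B = "(\<bar>c0\<bar> + \<bar>c1\<bar>) * B"])
    show "AE t in unit_time. norm ((c0 + c1 * t) * \<phi>t (t, x)) \<le> (\<bar>c0\<bar> + \<bar>c1\<bar>) * B"
    proof (rule AE_I2)
      fix t assume "t \<in> space unit_time"
      then have t: "t \<in> {0<..<1}" by simp
      have "\<bar>c0 + c1 * t\<bar> \<le> \<bar>c0\<bar> + \<bar>c1\<bar> * \<bar>t\<bar>" using abs_triangle_ineq[of c0 "c1 * t"] by (simp add: abs_mult)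
      also have "\<dots> \<le> \<bar>c0\<bar> + \<bar>c1\<bar> * 1" using t by (intro add_left_mono mult_left_mono) auto
      finally show "norm ((c0 + c1 * t) * \<phi>t (t, x)) \<le> (\<bar>c0\<bar> + \<bar>c1\<bar>) * B"
        using B[OF t, of x] by (simp add: abs_mult mult_mono)
    qed
  qed (intro meas continuous_intros cont)
  define F where "F t = (c0 + c1 * t) * \<phi> (t, x)" for t
  let ?f = "\<lambda>t. c1 * \<phi> (t, x) + (c0 + c1 * t) * \<phi>t (t, x)"
  have fi: "integrable unit_time ?f" using i2 i3 by simp
  obtain e where e: "0 < e" "e < 1/2" "\<And>t. 0 < t \<Longrightarrow> t \<le> e \<Longrightarrow> \<phi> (t, x) = 0" "\<And>t. 1 - e \<le> t \<Longrightarrow> t < 1 \<Longrightarrow> \<phi> (t, x) = 0"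
    using test_function_vanishes[OF s] by metis
  have der: "((\<lambda>s. \<phi> (s, x)) has_real_derivative \<phi>t (r, x)) (at r)" if "r \<in> {0<..<1}" for r
    using c that unfolding Cb12_def by blast
  have "(LBINT t=ereal 0..ereal 1. ?f t) = 0 - 0"
  proof (rule interval_integral_FTC_integrable[where F = F])
    show "(F has_vector_derivative ?f t) (at t)" if "ereal 0 < ereal t" "ereal t < ereal 1" for t
    proof -
      have "(F has_real_derivative ?f t) (at t)" unfolding F_def[abs_def]
        by (rule derivative_eq_intros der refl | use that in simp)+
      then show ?thesis by (simp add: has_real_derivative_iff_has_vector_derivative)
    qed
    show "isCont ?f t" if "ereal 0 < ereal t" "ereal t < ereal 1" for t
    proof -
      have "continuous_on {0<..<1} ?f" by (intro continuous_intros cont)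
      then show ?thesis using that by (simp add: continuous_on_eq_continuous_at)
    qed
    show "set_integrable lborel (einterval (ereal 0) (ereal 1)) ?f"
      using fi unfolding set_integrable_def unit_time_def by (simp add: integrable_restrict_space)
    have "\<forall>\<^sub>F t in at_right 0. F t = 0"
      unfolding eventually_at_right[OF zero_less_one] F_def using e by (intro exI[of _ e]) auto
    then show "((F \<circ> real_of_ereal) \<longlongrightarrow> 0) (at_right (ereal 0))"
      unfolding ereal_tendsto_simps by (rule tendsto_eventually)
    have "\<forall>\<^sub>F t in at_left 1. F t = 0"
      unfolding eventually_at_left[OF zero_less_one] F_def using e by (intro exI[of _ "1 - e"]) auto
    then show "((F \<circ> real_of_ereal) \<longlongrightarrow> 0) (at_left (ereal 1))"
      unfolding ereal_tendsto_simps by (rule tendsto_eventually)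
  qed simp
  then have "(\<integral>t. ?f t \<partial>unit_time) = 0"
    unfolding integral_unit_time by (simp add: interval_lebesgue_integral_def)
  then show "(\<integral>t. (c0 + c1 * t) * \<phi>t (t, x) \<partial>unit_time) = - c1 * (\<integral>t. \<phi> (t, x) \<partial>unit_time)"
    using i2 i3 by simp
qed

lemma Cb12_slice:
  fixes \<phi> :: "real \<times> (real^'n) \<Rightarrow> real"
  assumes "Cb12 \<phi> \<phi>t g h" "t \<in> {0<..<1}"
  shows "C2 (\<lambda>x. \<phi> (t, x)) (\<lambda>x. g (t, x)) (\<lambda>x. h (t, x))"
proof -
  have "continuous_on ({0<..<1} \<times> UNIV) h" using assms unfolding Cb12_def by blast
  then have "continuous_on UNIV (\<lambda>x. h (t, x))"
    by (rule continuous_on_compose2) (use assms(2) in \<open>auto intro!: continuous_intros\<close>)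
  then show ?thesis using assms unfolding C2_def Cb12_def by auto
qed

text \<open>The time derivative of the interpolation is \<open>\<nu> - \<delta>\<^sub>x\<close> at every time,
  and by the static equation it equals half the trace of the second derivatives of the constant flux
  \<open>\<theta> \<tau>\<close>. In the weak formulation this is Fubini and integration by parts in
  time.\<close>

lemma interpolation_solves:
  fixes \<phi> :: "real \<times> (real^'n) \<Rightarrow> real"
  assumes eq: "static_equation x0 \<nu> \<tau> \<theta>" and \<nu>: "prob_space \<nu>" "sets \<nu> = sets borel"
    and \<tau>: "sets \<tau> = sets borel" "integrable \<tau> \<theta>"
    and c: "Cb12 \<phi> \<phi>t g h" and s: "supported_inside \<phi>"
  shows "(\<integral>t. (\<integral>x. \<phi>t (t, x) \<partial>interpolation (return borel x0) \<nu> t) \<partial>unit_time) =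
     - (\<integral>t. (\<integral>x. ((1/2) *\<^sub>R h (t, x)) \<bullet> \<theta> x \<partial>\<tau>) \<partial>unit_time)"
proof -
  interpret N: prob_space \<nu> by fact
  interpret U: prob_space unit_time by (rule prob_space_unit_time)
  interpret UN: pair_prob_space unit_time \<nu> ..
  have \<mu>: "prob_space (return borel x0)" "sets (return borel x0) = sets borel" by (auto intro: prob_space_return)
  have "bounded (\<phi>t ` ({0<..<1} \<times> UNIV))" "bounded (h ` ({0<..<1} \<times> UNIV))" using c unfolding Cb12_def by blast+
  then obtain B M where B: "\<And>t x. t \<in> {0<..<1} \<Longrightarrow> \<bar>\<phi>t (t, x)\<bar> \<le> B" and M: "\<And>t x. t \<in> {0<..<1} \<Longrightarrow> norm (h (t, x)) \<le> M"
    unfolding bounded_iff by fastforce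
  note parts = integral_by_parts_in_time[OF c s B]
  have cont: "continuous_on ({0<..<1} \<times> UNIV) \<phi>" "continuous_on ({0<..<1} \<times> UNIV) \<phi>t" using c unfolding Cb12_def by blast+
  have sl: "(\<lambda>x. w (t, x)) \<in> borel_measurable borel" if "continuous_on ({0<..<1} \<times> UNIV) w" "t \<in> {0<..<1}" for w :: "real \<times> (real^'n) \<Rightarrow> real" and t
    by (intro borel_measurable_continuous_onI continuous_on_compose2[OF that(1)]) (use that(2) in \<open>auto intro!: continuous_intros\<close>)
  have pm: "w \<in> borel_measurable (unit_time \<Otimes>\<^sub>M \<nu>)" if "continuous_on ({0<..<1} \<times> UNIV) w" for w :: "real \<times> (real^'n) \<Rightarrow> real"
  proof -
    have "w \<in> borel_measurable spacetime" unfolding spacetime_def by (rule borel_measurable_continuous_on_restrict[OF that])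
    from measurable_compose[OF unit_time_borel_pair this] have "w \<in> borel_measurable (unit_time \<Otimes>\<^sub>M borel)" .
    moreover have "sets (unit_time \<Otimes>\<^sub>M \<nu>) = sets (unit_time \<Otimes>\<^sub>M borel)" by (rule sets_pair_measure_cong) (auto simp: \<nu>)
    ultimately show ?thesis using measurable_cong_sets by blast
  qed
  have tm: "(\<lambda>z. fst z) \<in> borel_measurable (unit_time \<Otimes>\<^sub>M \<nu>)"
    by (rule measurable_compose[OF measurable_fst measurable_unit_time_borel])
  have it: "integrable (unit_time \<Otimes>\<^sub>M \<nu>) (\<lambda>z. fst z * \<phi>t z)"
  proof (rule UN.P.integrable_const_bound[of _ "1 * B"])
    show "AE z in unit_time \<Otimes>\<^sub>M \<nu>. norm (fst z * \<phi>t z) \<le> 1 * B"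
      using B by (intro AE_I2) (auto simp: space_pair_measure abs_mult intro!: order_trans[OF mult_left_le_one_le B])
  qed (intro borel_measurable_times tm pm cont)
  have ip: "integrable (unit_time \<Otimes>\<^sub>M \<nu>) \<phi>"
  proof (rule UN.P.integrable_const_bound[of _ B])
    show "AE z in unit_time \<Otimes>\<^sub>M \<nu>. norm (\<phi> z) \<le> B"
      using test_function_bounded[OF c s B] by (intro AE_I2) (auto simp: space_pair_measure)
  qed (intro pm cont)
  have fub: "(\<integral>x. (\<integral>t. w (t, x) \<partial>unit_time) \<partial>\<nu>) = (\<integral>t. (\<integral>x. w (t, x) \<partial>\<nu>) \<partial>unit_time)"
    "integrable unit_time (\<lambda>t. \<integral>x. w (t, x) \<partial>\<nu>)"
    if "integrable (unit_time \<Otimes>\<^sub>M \<nu>) w" for w :: "real \<times> (real^'n) \<Rightarrow> real"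
    using UN.Fubini_integral[of "\<lambda>t x. w (t, x)"] UN.integrable_fst'[of w] that by (simp_all add: case_prod_beta')
  have "(\<integral>t. (\<integral>x. \<phi>t (t, x) \<partial>interpolation (return borel x0) \<nu> t) \<partial>unit_time)
      = (\<integral>t. (\<integral>x. t * \<phi>t (t, x) \<partial>\<nu>) + (1 + (-1) * t) * \<phi>t (t, x0) \<partial>unit_time)"
  proof (rule Bochner_Integration.integral_cong[OF refl])
    fix t assume "t \<in> space unit_time"
    then have t: "t \<in> {0<..<1}" by simp
    show "(\<integral>x. \<phi>t (t, x) \<partial>interpolation (return borel x0) \<nu> t) = (\<integral>x. t * \<phi>t (t, x) \<partial>\<nu>) + (1 + (-1) * t) * \<phi>t (t, x0)"
      using integral_interpolation[OF \<mu> \<nu> sl[OF cont(2) t] B[OF t]] t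
      by (simp add: integral_return_borel[OF sl[OF cont(2) t]])
  qed
  also have "\<dots> = (\<integral>t. (\<integral>x. t * \<phi>t (t, x) \<partial>\<nu>) \<partial>unit_time) + (\<integral>t. (1 + (-1) * t) * \<phi>t (t, x0) \<partial>unit_time)"
  proof (rule Bochner_Integration.integral_add)
    show "integrable unit_time (\<lambda>t. \<integral>x. t * \<phi>t (t, x) \<partial>\<nu>)" using fub(2)[OF it] by simp
    show "integrable unit_time (\<lambda>t. (1 + (-1) * t) * \<phi>t (t, x0))"
    proof (rule Bochner_Integration.integrable_bound[OF parts(2)[of x0]])
      show "(\<lambda>t. (1 + (-1) * t) * \<phi>t (t, x0)) \<in> borel_measurable unit_time"
        using parts(2)[of x0] by (intro borel_measurable_times) auto
    qed (auto simp: abs_mult intro!: mult_left_le_one_le)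
  qed
  also have "(\<integral>t. (\<integral>x. t * \<phi>t (t, x) \<partial>\<nu>) \<partial>unit_time) = (\<integral>x. (\<integral>t. (0 + 1 * t) * \<phi>t (t, x) \<partial>unit_time) \<partial>\<nu>)"
    using fub(1)[OF it] by simp
  also have "\<dots> = (\<integral>x. - 1 * (\<integral>t. \<phi> (t, x) \<partial>unit_time) \<partial>\<nu>)"
    by (rule Bochner_Integration.integral_cong[OF refl parts(1)])
  also have "\<dots> = - (\<integral>x. (\<integral>t. \<phi> (t, x) \<partial>unit_time) \<partial>\<nu>)" by simp
  also have "(\<integral>x. (\<integral>t. \<phi> (t, x) \<partial>unit_time) \<partial>\<nu>) = (\<integral>t. (\<integral>x. \<phi> (t, x) \<partial>\<nu>) \<partial>unit_time)" by (rule fub(1)[OF ip])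
  also have "(\<integral>t. (1 + (-1) * t) * \<phi>t (t, x0) \<partial>unit_time) = (\<integral>t. \<phi> (t, x0) \<partial>unit_time)"
    using parts(1)[of 1 "-1" x0] by (simp only: minus_minus mult_1)
  also have "- (\<integral>t. (\<integral>x. \<phi> (t, x) \<partial>\<nu>) \<partial>unit_time) + (\<integral>t. \<phi> (t, x0) \<partial>unit_time)
      = - (\<integral>t. (\<integral>x. \<phi> (t, x) \<partial>\<nu>) - \<phi> (t, x0) \<partial>unit_time)"
    using fub(2)[OF ip] parts(3)[of x0] by simp
  also have "(\<integral>t. (\<integral>x. \<phi> (t, x) \<partial>\<nu>) - \<phi> (t, x0) \<partial>unit_time) = (\<integral>t. (\<integral>x. ((1/2) *\<^sub>R h (t, x)) \<bullet> \<theta> x \<partial>\<tau>) \<partial>unit_time)"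
  proof (rule Bochner_Integration.integral_cong[OF refl])
    fix t assume "t \<in> space unit_time"
    then have t: "t \<in> {0<..<1}" by simp
    show "(\<integral>x. \<phi> (t, x) \<partial>\<nu>) - \<phi> (t, x0) = (\<integral>x. ((1/2) *\<^sub>R h (t, x)) \<bullet> \<theta> x \<partial>\<tau>)"
      by (rule static_equation_bounded[OF eq \<nu> \<tau> Cb12_slice[OF c t]])
         (rule test_function_bounded[OF c s B t] M[OF t] | assumption)+
  qed
  finally show ?thesis .
qed

text \<open>Homogeneity of \<open>f\<close> makes the action independent of the reference measure:
  \<open>f (\<theta> / \<bar>\<theta>\<bar>) \<bar>\<theta>\<bar> = f \<theta>\<close>.\<close>

lemma (in integrand) action_const_density:
  assumes d: "has_vector_density borel l \<tau> \<theta>" and fin: "(\<integral>\<^sup>+x. sym_ext f (\<theta> x) \<partial>\<tau>) < \<infinity>"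
  shows "action f (\<lambda>t. l) = (\<integral>\<^sup>+x. sym_ext f (\<theta> x) \<partial>\<tau>)"
proof -
  note D = has_vector_densityD[OF d]
  have [measurable]: "\<theta> \<in> borel_measurable \<tau>" using D(4) by auto
  have [measurable]: "(\<lambda>x. sym_ext f (\<theta> x)) \<in> borel_measurable \<tau>" 
    by (rule measurable_compose[OF _ sym_ext_measurable]) simp
  have V: "total_variation borel l = density \<tau> (\<lambda>x. ennreal (norm (\<theta> x)))" by (rule total_variation_density[OF d])
  have AEf: "AE x in \<tau>. sym_ext f (\<theta> x) < \<infinity>" using nn_integral_PInf_AE[OF _ less_imp_neq[OF fin]] by (simp add: less_top)
  let ?V = "density \<tau> (\<lambda>x. ennreal (norm (\<theta> x)))" and ?g = "\<lambda>x. (1 / norm (\<theta> x)) *\<^sub>R \<theta> x"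
  have "(\<integral>\<^sup>+x. f (polar_density borel l x) \<partial>?V) = (\<integral>\<^sup>+x. sym_ext f (?g x) \<partial>?V)"
  proof (rule nn_integral_cong_AE)
    have "AE x in \<tau>. \<theta> x \<in> sym_mats" using AEf by eventually_elim (auto simp: sym_ext_def split: if_splits)
    then have "AE x in ?V. \<theta> x \<in> sym_mats" by (subst AE_density) auto
    then show "AE x in ?V. f (polar_density borel l x) = sym_ext f (?g x)"
      using polar_density_props(3)[OF d] unfolding V
      by eventually_elim (simp add: sym_ext_def sym_mats_scaleR)
  qed
  also have "\<dots> = (\<integral>\<^sup>+x. ennreal (norm (\<theta> x)) * sym_ext f (?g x) \<partial>\<tau>)"
  proof (rule nn_integral_density)
    show "(\<lambda>x. sym_ext f (?g x)) \<in> borel_measurable \<tau>" by (rule measurable_compose[OF _ sym_ext_measurable]) simp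
  qed simp
  also have "\<dots> = (\<integral>\<^sup>+x. sym_ext f (\<theta> x) \<partial>\<tau>)"
  proof (rule nn_integral_cong_AE)
    show "AE x in \<tau>. ennreal (norm (\<theta> x)) * sym_ext f (?g x) = sym_ext f (\<theta> x)"
      using AEf
    proof eventually_elim
      case (elim x)
      show ?case
      proof (cases "\<theta> x = 0")
        case True
        then show ?thesis by (simp add: sym_ext_def zero_sym_mats f_zero)
      next
        case False
        then have "ennreal (norm (\<theta> x)) * sym_ext f (?g x) = (ennreal (norm (\<theta> x)) * ennreal (1 / norm (\<theta> x))) * sym_ext f (\<theta> x)"
          using sym_ext_scale[OF _ elim, of "1 / norm (\<theta> x)"] by (simp add: mult.assoc)
        also have "ennreal (norm (\<theta> x)) * ennreal (1 / norm (\<theta> x)) = 1"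
          using False by (subst ennreal_mult[symmetric]) auto
        finally show ?thesis by simp
      qed
    qed
  qed
  finally have *: "(\<integral>\<^sup>+x. f (polar_density borel l x) \<partial>total_variation borel l) = (\<integral>\<^sup>+x. sym_ext f (\<theta> x) \<partial>\<tau>)"
    unfolding V .
  interpret U: prob_space unit_time by (rule prob_space_unit_time)
  show ?thesis unfolding action_def * by (simp add: U.emeasure_space_1[simplified])
qed

text \<open>Interpolate linearly between the Dirac measure and \<open>\<nu>\<close> and keep the flux constant
  in time. Because \<open>f\<close> is homogeneous, the action depends on the total flux only and not on how it
  is distributed over time.\<close>

lemma (in integrand) point_cost_le_static:
  fixes x0 :: "real^'n"
  assumes eq: "static_equation x0 \<nu> \<tau> \<theta>" and \<nu>: "prob_space \<nu>" "sets \<nu> = sets borel"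
    and \<tau>: "finite_measure \<tau>" "sets \<tau> = sets borel" "integrable \<tau> \<theta>"
    and fin: "(\<integral>\<^sup>+x. sym_ext f (\<theta> x) \<partial>\<tau>) < \<infinity>"
  shows "point_cost f x0 \<nu> \<le> (\<integral>\<^sup>+x. sym_ext f (\<theta> x) \<partial>\<tau>)" and "\<nu> \<in> P2"
proof -
  interpret N: prob_space \<nu> by fact
  interpret U: prob_space unit_time by (rule prob_space_unit_time)
  let ?\<mu> = "return borel x0"
  have \<mu>: "prob_space ?\<mu>" "sets ?\<mu> = sets borel" by (auto intro: prob_space_return)
  define m where "m = interpolation ?\<mu> \<nu>"
  define l where "l E = (LINT x:E|\<tau>. \<theta> x)" for E
  define L where "L E = (\<integral>t. l (Pair t -` E) \<partial>unit_time)" for E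
  have [measurable]: "\<theta> \<in> borel_measurable \<tau>" using \<tau>(3) by auto
  have sm: "(\<lambda>x. sym_ext f (\<theta> x)) \<in> borel_measurable \<tau>" by (rule measurable_compose[OF _ sym_ext_measurable]) simp
  have AEpsd: "AE x in \<tau>. \<theta> x \<in> psd_mats"
    using nn_integral_PInf_AE[OF sm less_imp_neq[OF fin]] by eventually_elim (auto intro: sym_ext_finite_psd simp: less_top)
  have d: "has_vector_density borel l \<tau> \<theta>" using \<tau> unfolding has_vector_density_def l_def by auto
  have mom: "(\<integral>\<^sup>+x. ennreal ((norm x)\<^sup>2) \<partial>\<nu>) < \<infinity>" by (rule static_equation_moment[OF eq \<nu> \<tau>(2,3)])
  then show P2\<nu>: "\<nu> \<in> P2" unfolding P2_def using \<nu> by simp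
  let ?M = "(\<integral>\<^sup>+x. ennreal ((norm x)\<^sup>2) \<partial>\<nu>) + ennreal ((norm x0)\<^sup>2)"
  have mom_m: "(\<integral>\<^sup>+x. ennreal ((norm x)\<^sup>2) \<partial>m t) \<le> ?M" if "t \<in> {0..1}" for t
  proof -
    have "(\<integral>\<^sup>+x. ennreal ((norm x)\<^sup>2) \<partial>m t) = ennreal t * (\<integral>\<^sup>+x. ennreal ((norm x)\<^sup>2) \<partial>\<nu>) + ennreal (1 - t) * ennreal ((norm x0)\<^sup>2)"
      unfolding m_def using that by (subst nn_integral_interpolation[OF \<mu> \<nu>]) (auto simp: nn_integral_return)
    also have "\<dots> \<le> 1 * (\<integral>\<^sup>+x. ennreal ((norm x)\<^sup>2) \<partial>\<nu>) + 1 * ennreal ((norm x0)\<^sup>2)"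
      using that by (intro add_mono mult_right_mono) (auto simp: ennreal_le_1)
    finally show ?thesis by simp
  qed
  have M_fin: "?M < \<infinity>" using mom by (simp add: ennreal_add_less_top)
  have mP2: "m t \<in> P2" if "t \<in> {0..1}" for t
    using mom_m[OF that] M_fin prob_space_interpolation[OF \<mu> \<nu>] sets_interpolation[OF \<mu> \<nu>]
    unfolding P2_def m_def by (auto intro: order_le_less_trans)
  have mk: "m \<in> unit_time \<rightarrow>\<^sub>M prob_algebra borel" unfolding m_def by (rule measurable_interpolation[OF \<mu> \<nu>])
  have sm_m: "sets (m t) = sets borel" for t unfolding m_def by (rule sets_interpolation[OF \<mu> \<nu>])
  define k where "k t = distr (m t) spacetime (Pair t)" for t
  define \<rho> where "\<rho> = unit_time \<bind> k"
  have Pm: "Pair t \<in> m t \<rightarrow>\<^sub>M spacetime" if "t \<in> {0<..<1}" for t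
    using Pair_measurable_spacetime[OF that] by (simp add: measurable_cong_sets[OF sm_m refl])
  have k: "k \<in> unit_time \<rightarrow>\<^sub>M subprob_algebra spacetime"
    unfolding k_def
  proof (rule measurable_distr2)
    show "case_prod Pair \<in> unit_time \<Otimes>\<^sub>M borel \<rightarrow>\<^sub>M spacetime" using unit_time_borel_pair by (simp add: case_prod_beta')
    show "m \<in> unit_time \<rightarrow>\<^sub>M subprob_algebra borel" using mk by (rule measurable_prob_algebraD)
  qed
  have s\<rho>: "sets \<rho> = sets spacetime" unfolding \<rho>_def by (rule sets_bind) (auto simp: k_def)
  have em\<rho>: "emeasure \<rho> E = (\<integral>\<^sup>+t. emeasure (m t) (Pair t -` E) \<partial>unit_time)" if "E \<in> sets spacetime" for E
    unfolding \<rho>_def emeasure_bind[OF U.not_empty k that]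
    by (intro nn_integral_cong) (simp add: k_def emeasure_distr[OF Pm that] sets_eq_imp_space_eq[OF sm_m])
  have prob\<rho>: "prob_space \<rho>" unfolding \<rho>_def
  proof (rule U.prob_space_bind[OF _ k], rule AE_I2)
    fix t assume "t \<in> space unit_time"
    then show "prob_space (k t)" unfolding k_def
      using prob_space.prob_space_distr[OF prob_space_interpolation[OF \<mu> \<nu>, of t] Pm[of t, unfolded m_def]]
      by (simp add: m_def)
  qed
  have mom\<rho>: "(\<integral>\<^sup>+z. ennreal ((norm (snd z))\<^sup>2) \<partial>\<rho>) < \<infinity>"
  proof -
    have w: "(\<lambda>z. ennreal ((norm (snd z))\<^sup>2)) \<in> borel_measurable (spacetime :: (real \<times> (real^'n)) measure)"
      unfolding spacetime_def
      by (intro measurable_restrict_space1 measurable_compose[OF _ measurable_ennreal]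
          borel_measurable_continuous_onI continuous_intros)
    have "(\<integral>\<^sup>+z. ennreal ((norm (snd z))\<^sup>2) \<partial>\<rho>) = (\<integral>\<^sup>+t. (\<integral>\<^sup>+z. ennreal ((norm (snd z))\<^sup>2) \<partial>k t) \<partial>unit_time)"
      unfolding \<rho>_def by (rule nn_integral_bind[OF w k])
    also have "\<dots> \<le> (\<integral>\<^sup>+t. ?M \<partial>unit_time)"
    proof (rule nn_integral_mono)
      fix t assume "t \<in> space unit_time"
      then have t: "t \<in> {0<..<1}" by simp
      show "(\<integral>\<^sup>+z. ennreal ((norm (snd z))\<^sup>2) \<partial>k t) \<le> ?M"
        unfolding k_def using mom_m[of t] t by (subst nn_integral_distr[OF Pm[OF t]]) (simp_all add: w)
    qed
    also have "\<dots> = ?M" by (simp add: U.emeasure_space_1[simplified])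
    finally show ?thesis using M_fin by (rule order_le_less_trans)
  qed
  have psd: "psd_measure borel l" unfolding l_def by (rule psd_measure_density[OF \<tau>(3,2) AEpsd])
  have fp: "fokker_planck \<rho> m L (\<lambda>t. l)"
    unfolding fokker_planck_def
  proof (intro conjI allI impI)
    show "\<rho> \<in> P2_spacetime" unfolding P2_spacetime_def using s\<rho> prob\<rho> mom\<rho> by simp
    show "psd_measure spacetime L" unfolding L_def l_def by (rule psd_measure_spacetime[OF \<tau> AEpsd])
    show "disintegration \<rho> unit_time m" unfolding disintegration_def using mk em\<rho> s\<rho> by simp
    show "psd_disintegration L (\<lambda>t. l)" unfolding psd_disintegration_def
      using psd slice_density(1)[OF \<tau>] by (auto simp: L_def l_def)
    have "(\<integral>\<^sup>+t. emeasure (total_variation borel l) UNIV \<partial>unit_time) = emeasure (total_variation borel l) UNIV"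
      by (simp add: U.emeasure_space_1[simplified])
    then show "(\<integral>\<^sup>+t. emeasure (total_variation borel l) UNIV \<partial>unit_time) < \<infinity>"
      using finite_measure.emeasure_finite[OF finite_measure_total_variation[OF d], of UNIV] by (simp add: less_top)
    fix \<phi> \<phi>t :: "real \<times> (real^'n) \<Rightarrow> real" and g h
    assume c: "Cb12 \<phi> \<phi>t g h" and s: "supported_inside \<phi>"
    have "(\<integral>t. vector_lint borel l (\<lambda>x. (1/2) *\<^sub>R h (t, x)) \<partial>unit_time) = (\<integral>t. (\<integral>x. ((1/2) *\<^sub>R h (t, x)) \<bullet> \<theta> x \<partial>\<tau>) \<partial>unit_time)"
    proof (rule Bochner_Integration.integral_cong[OF refl])
      fix t assume "t \<in> space unit_time"
      then have t: "t \<in> {0<..<1}" by simp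
      have "(\<lambda>x. (1/2) *\<^sub>R h (t, x)) \<in> borel_measurable borel"
        using C2D(5)[OF Cb12_slice[OF c t]] by (intro borel_measurable_continuous_onI continuous_intros)
      from vector_lint_density[OF d this]
      show "vector_lint borel l (\<lambda>x. (1/2) *\<^sub>R h (t, x)) = (\<integral>x. ((1/2) *\<^sub>R h (t, x)) \<bullet> \<theta> x \<partial>\<tau>)" .
    qed
    then show "(\<integral>t. (\<integral>x. \<phi>t (t, x) \<partial>m t) \<partial>unit_time) = - (\<integral>t. vector_lint borel l (\<lambda>x. (1/2) *\<^sub>R h (t, x)) \<partial>unit_time)"
      unfolding m_def using interpolation_solves[OF eq \<nu> \<tau>(2,3) c s] by simp
  qed
  have rep: "continuous_representative m m" unfolding continuous_representative_def
  proof (intro conjI)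
    show "narrowly_continuous m" unfolding narrowly_continuous_def
    proof (intro allI impI)
      fix u :: "real^'n \<Rightarrow> real" assume u: "continuous_on UNIV u" "bounded (range u)"
      obtain B where B: "\<And>x. \<bar>u x\<bar> \<le> B" using u(2) by (auto simp: bounded_iff)
      have "continuous_on {0..1} (\<lambda>t. t * (\<integral>x. u x \<partial>\<nu>) + (1 - t) * (\<integral>x. u x \<partial>?\<mu>))" by (intro continuous_intros)
      then show "continuous_on {0..1} (\<lambda>t. \<integral>x. u x \<partial>m t)"
        unfolding m_def using integral_interpolation[OF \<mu> \<nu> borel_measurable_continuous_onI[OF u(1)] B, symmetric]
        by (rule continuous_on_eq)
    qed
  qed (use mP2 in auto)
  have m0: "m 0 = ?\<mu>"
    by (rule measure_eqI) (auto simp: sm_m m_def emeasure_interpolation[OF \<mu> \<nu>] sets_interpolation[OF \<mu> \<nu>])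
  have m1: "m 1 = \<nu>"
    by (rule measure_eqI) (auto simp: sm_m m_def emeasure_interpolation[OF \<mu> \<nu>] sets_interpolation[OF \<mu> \<nu>] \<nu>)
  have "point_cost f x0 \<nu> \<le> action f (\<lambda>t. l)"
    unfolding point_cost_def dyn_cost_def using fp rep m0 m1 by (intro Inf_lower) blast
  then show "point_cost f x0 \<nu> \<le> (\<integral>\<^sup>+x. sym_ext f (\<theta> x) \<partial>\<tau>)" unfolding action_const_density[OF d fin] .
qed


section \<open>Weak duality\<close>

text \<open>A function that is not integrable has Bochner integral \<open>0\<close>, so the bound persists; it
  can therefore be applied to fluxes whose dependence on time is not known to be integrable.\<close>

lemma ennreal_integral_le_nn_integral:
  fixes w :: "'a \<Rightarrow> real"
  assumes "AE x in M. ennreal (w x) \<le> F x"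
  shows "ennreal (\<integral>x. w x \<partial>M) \<le> (\<integral>\<^sup>+x. F x \<partial>M)"
proof (cases "integrable M w")
  case True
  have "(\<integral>x. w x \<partial>M) \<le> (\<integral>x. max 0 (w x) \<partial>M)"
    using True by (intro integral_mono) auto
  then have "ennreal (\<integral>x. w x \<partial>M) \<le> ennreal (\<integral>x. max 0 (w x) \<partial>M)" by (rule ennreal_leI)
  also have "\<dots> = (\<integral>\<^sup>+x. ennreal (max 0 (w x)) \<partial>M)"
    using True by (intro nn_integral_eq_integral[symmetric]) auto
  also have "\<dots> \<le> (\<integral>\<^sup>+x. F x \<partial>M)"
    using assms by (intro nn_integral_mono_AE) (auto simp: max_def ennreal_neg)
  finally show ?thesis .
qed (simp add: not_integrable_integral_eq)

text \<open>A \<open>C\<^sup>1\<close> step function, increasing from 0 to 1 on the unit interval.\<close>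

definition step :: "real \<Rightarrow> real" where
  "step y = 2 * (max 0 y ^ 2 - 2 * max 0 (y - 1/2) ^ 2 + max 0 (y - 1) ^ 2)"

definition hat :: "real \<Rightarrow> real" where
  "hat y = 4 * (max 0 y - 2 * max 0 (y - 1/2) + max 0 (y - 1))"

lemma DERIV_step: "(step has_real_derivative hat y) (at y)"
proof -
  have d: "((\<lambda>y. max 0 (y - c) ^ 2) has_real_derivative 2 * max 0 (y - c)) (at y)" for c
  proof -
    have "((\<lambda>y. max 0 (y - c) ^ Suc (Suc 0)) has_real_derivative (real (Suc (Suc 0)) * max 0 (y - c) ^ Suc 0) * 1) (at y)"
      by (rule DERIV_chain2[OF DERIV_max0_power]) (auto intro!: derivative_eq_intros)
    then show ?thesis by (simp add: numeral_2_eq_2)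
  qed
  show ?thesis unfolding step_def[abs_def] hat_def
    by (rule derivative_eq_intros d[of 0, simplified] d refl)+ simp
qed

lemma hat_nonneg: "0 \<le> hat y"
  unfolding hat_def by (auto simp: max_def)

lemma hat_zero: "y \<le> 0 \<Longrightarrow> hat y = 0" "1 \<le> y \<Longrightarrow> hat y = 0"
  unfolding hat_def by (auto simp: max_def)

lemma step_zero: "y \<le> 0 \<Longrightarrow> step y = 0"
  unfolding step_def by (auto simp: max_def)

lemma step_one: "1 \<le> y \<Longrightarrow> step y = 1"
  unfolding step_def by (auto simp: max_def power2_eq_square algebra_simps)

lemma step_mono: "x \<le> y \<Longrightarrow> step x \<le> step y"
  by (rule DERIV_nonneg_imp_nondecreasing) (use DERIV_step hat_nonneg in auto)

lemma step_range: "0 \<le> step y" "step y \<le> 1"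
  using step_mono[of "min y 0" y] step_mono[of y "max y 1"] step_zero[of "min y 0"] step_one[of "max y 1"] by auto

lemma continuous_hat: "continuous_on S (\<lambda>t. hat (a t))" if "continuous_on S a"
  unfolding hat_def by (intro continuous_intros that)

lemma continuous_step: "continuous_on S (\<lambda>t. step (a t))" if "continuous_on S a"
  unfolding step_def by (intro continuous_intros that)

text \<open>For \<open>n \<ge> 4\<close> it rises from 0 to 1 on \<open>[1/n, 2/n]\<close> and falls back to 0
  on \<open>[1 - 2/n, 1 - 1/n]\<close>.\<close>

definition plateau :: "nat \<Rightarrow> real \<Rightarrow> real" where
  "plateau n t = step (real n * t - 1) - step (real n * t - real n + 2)"

definition plateau_deriv :: "nat \<Rightarrow> real \<Rightarrow> real" where
  "plateau_deriv n t = real n * hat (real n * t - 1) - real n * hat (real n * t - real n + 2)"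

lemma DERIV_plateau: "(plateau n has_real_derivative plateau_deriv n t) (at t)"
proof -
  have 1: "((\<lambda>t. step (real n * t - 1)) has_real_derivative hat (real n * t - 1) * real n) (at t)"
    by (rule DERIV_chain2[OF DERIV_step]) (auto intro!: derivative_eq_intros)
  have 2: "((\<lambda>t. step (real n * t - real n + 2)) has_real_derivative hat (real n * t - real n + 2) * real n) (at t)"
    by (rule DERIV_chain2[OF DERIV_step]) (auto intro!: derivative_eq_intros)
  show ?thesis unfolding plateau_def[abs_def] plateau_deriv_def
    using DERIV_diff[OF 1 2] by (simp add: mult.commute)
qed

lemma plateau_range: "3 \<le> n \<Longrightarrow> 0 \<le> plateau n t" "plateau n t \<le> 1"
proof -
  show "3 \<le> n \<Longrightarrow> 0 \<le> plateau n t" unfolding plateau_def using step_mono[of "real n * t - real n + 2" "real n * t - 1"] by simp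
  show "plateau n t \<le> 1" unfolding plateau_def
    using step_range(2)[of "real n * t - 1"] step_range(1)[of "real n * t - real n + 2"] by linarith
qed

lemma plateau_support:
  assumes "3 \<le> n" "plateau n t \<noteq> 0" shows "1 / real n \<le> t" "t \<le> 1 - 1 / real n"
proof -
  have n: "real n > 0" "real n \<ge> 3" using assms by auto
  show "1 / real n \<le> t"
  proof (rule ccontr)
    assume "\<not> ?thesis"
    then have "real n * t < 1" using n by (simp add: field_simps)
    then show False using assms n unfolding plateau_def by (simp add: step_zero)
  qed
  show "t \<le> 1 - 1 / real n"
  proof (rule ccontr)
    assume "\<not> ?thesis"
    then have "real n * t > real n - 1" using n by (simp add: field_simps)
    then show False using assms n unfolding plateau_def by (simp add: step_one)
  qed
qed

lemma integral_hat:
  assumes n: "n \<noteq> 0"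
  shows "(\<integral>t. n * hat (n * t - c) \<partial>unit_time) = step (n - c) - step (- c)"
    and "integrable unit_time (\<lambda>t. n * hat (n * t - c))"
proof -
  have cont: "continuous_on S (\<lambda>t. n * hat (n * t - c))" for S by (intro continuous_intros continuous_hat)
  have "(LBINT t=ereal 0..ereal 1. n * hat (n * t - c)) = step (n * 1 - c) - step (n * 0 - c)"
  proof (rule interval_integral_FTC_finite[where F = "\<lambda>t. step (n * t - c)"])
    fix t
    have "((\<lambda>t. step (n * t - c)) has_real_derivative hat (n * t - c) * n) (at t)"
      by (rule DERIV_chain2[OF DERIV_step]) (auto intro!: derivative_eq_intros)
    then show "((\<lambda>t. step (n * t - c)) has_vector_derivative n * hat (n * t - c)) (at t within {min 0 1..max 0 1})"
      by (auto simp: has_real_derivative_iff_has_vector_derivative mult.commute intro: has_vector_derivative_at_within)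
  qed (rule cont)
  then show "(\<integral>t. n * hat (n * t - c) \<partial>unit_time) = step (n - c) - step (- c)"
    unfolding integral_unit_time by (simp add: interval_lebesgue_integral_def)
  have "bounded ((\<lambda>t. n * hat (n * t - c)) ` {0..1})" by (intro compact_imp_bounded compact_continuous_image cont) simp
  then obtain B where "\<forall>y\<in>(\<lambda>t. n * hat (n * t - c)) ` {0..1}. norm y \<le> B" unfolding bounded_iff by blast
  then have B: "\<And>t. t \<in> {0..1} \<Longrightarrow> \<bar>n * hat (n * t - c)\<bar> \<le> B" by auto
  show "integrable unit_time (\<lambda>t. n * hat (n * t - c))"
    by (rule finite_measure.integrable_const_bound[OF prob_space.finite_measure[OF prob_space_unit_time], where B = B])
       (use B in \<open>auto intro!: measurable_compose[OF measurable_unit_time_borel] borel_measurable_continuous_onI cont\<close>)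
qed

text \<open>The product with a compactly supported \<open>u\<close> separates time and space in the weak
  equation.\<close>

lemma plateau_product_test_function:
  assumes u: "C2c u g h" and n: "3 \<le> n"
  shows "Cb12 (\<lambda>z. plateau n (fst z) * u (snd z)) (\<lambda>z. plateau_deriv n (fst z) * u (snd z))
    (\<lambda>z. plateau n (fst z) *\<^sub>R g (snd z)) (\<lambda>z. plateau n (fst z) *\<^sub>R h (snd (z :: real \<times> (real^'n))))"
    and "supported_inside (\<lambda>z. plateau n (fst z) * u (snd (z :: real \<times> (real^'n))))"
proof -
  have c2: "C2 u g h" using u unfolding C2c_def by blast
  note D = C2D[OF c2]
  have cp: "continuous_on S (\<lambda>z. plateau n (fst z))" and cpd: "continuous_on S (\<lambda>z. plateau_deriv n (fst z))" for S :: "(real \<times> (real^'n)) set"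
    unfolding plateau_def plateau_deriv_def by (intro continuous_intros continuous_hat continuous_step)+
  have cs: "continuous_on S (\<lambda>z. w (snd z))" if "continuous_on UNIV w" for w :: "real^'n \<Rightarrow> 'c::topological_space" and S :: "(real \<times> (real^'n)) set"
    by (rule continuous_on_compose2[OF that]) (auto intro!: continuous_intros)
  obtain B where B: "\<And>x. \<bar>u x\<bar> \<le> B" using Cc_bounded[OF C2c_Cc(1)[OF u]] by blast
  obtain R where R: "\<And>x. R \<le> norm x \<Longrightarrow> u x = 0 \<and> g x = 0 \<and> h x = 0" using u unfolding C2c_def by auto
  have "compact (h ` cball 0 R)" using D(5) by (intro compact_continuous_image continuous_on_subset[OF D(5)]) auto
  then have "bounded (h ` cball 0 R)" by (rule compact_imp_bounded)
  then obtain M where "\<forall>y\<in>h ` cball 0 R. norm y \<le> M" unfolding bounded_iff by blast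
  then have M: "\<And>x. x \<in> cball 0 R \<Longrightarrow> norm (h x) \<le> M" by auto
  have M': "norm (h x) \<le> max 0 M" for x using M[of x] R[of x] by (cases "norm x \<le> R") auto
  have "continuous_on {0..1} (plateau_deriv n)" unfolding plateau_deriv_def by (intro continuous_intros continuous_hat)
  then have "bounded (plateau_deriv n ` {0..1})" by (intro compact_imp_bounded compact_continuous_image) auto
  then obtain P where "\<forall>y\<in>plateau_deriv n ` {0..1}. norm y \<le> P" unfolding bounded_iff by blast
  then have P: "\<And>t. t \<in> {0..1} \<Longrightarrow> \<bar>plateau_deriv n t\<bar> \<le> P" by auto
  have P0: "0 \<le> P" using P[of 0] by auto
  have pr: "\<bar>plateau n t\<bar> \<le> 1" for t using plateau_range(1)[OF n, of t] plateau_range(2)[of n t] by simp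
  show "Cb12 (\<lambda>z. plateau n (fst z) * u (snd z)) (\<lambda>z. plateau_deriv n (fst z) * u (snd z))
    (\<lambda>z. plateau n (fst z) *\<^sub>R g (snd z)) (\<lambda>z. plateau n (fst z) *\<^sub>R h (snd (z :: real \<times> (real^'n))))"
    unfolding Cb12_def
  proof (intro conjI ballI allI)
    fix t :: real and x :: "real^'n"
    show "((\<lambda>s. plateau n (fst (s, x)) * u (snd (s, x))) has_real_derivative plateau_deriv n (fst (t, x)) * u (snd (t, x))) (at t)"
      using DERIV_cmult_right[OF DERIV_plateau[of n t], of "u x"] by simp
    show "((\<lambda>y. plateau n (fst (t, y)) * u (snd (t, y))) has_derivative (\<lambda>v. (plateau n (fst (t, x)) *\<^sub>R g (snd (t, x))) \<bullet> v)) (at x)"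
      using C2D(1)[OF C2_scale[OF c2, of "plateau n t"]] by simp
    show "((\<lambda>y. plateau n (fst (t, y)) *\<^sub>R g (snd (t, y))) has_derivative (\<lambda>v. (plateau n (fst (t, x)) *\<^sub>R h (snd (t, x))) *v v)) (at x)"
      using C2D(2)[OF C2_scale[OF c2, of "plateau n t"]] by simp
  next
    show "bounded ((\<lambda>z. plateau_deriv n (fst z) * u (snd z)) ` ({0<..<1} \<times> UNIV))"
      unfolding bounded_iff using P B P0 by (auto simp: abs_mult intro!: exI[of _ "P * B"] mult_mono)
    show "bounded ((\<lambda>z. plateau n (fst z) *\<^sub>R h (snd z)) ` ({0<..<1} \<times> (UNIV :: (real^'n) set)))"
      unfolding bounded_iff using mult_mono[OF pr M'] by (auto intro!: exI[of _ "1 * max 0 M"])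
  qed (intro continuous_intros cp cpd cs D)+
  have "closed ({1 / real n..1 - 1 / real n} \<times> (UNIV :: (real^'n) set))" by (intro closed_Times) auto
  then have "closure {z \<in> {0<..<1} \<times> UNIV. plateau n (fst z) * u (snd z) \<noteq> 0} \<subseteq> {1 / real n..1 - 1 / real n} \<times> UNIV"
    using plateau_support[OF n] by (intro closure_minimal) auto
  also have "\<dots> \<subseteq> {0<..<1} \<times> UNIV"
  proof -
    have "1 / real n > 0" using n by simp
    then have "{1 / real n..1 - 1 / real n} \<subseteq> {0<..<1}"
      by (intro subsetI) (simp only: atLeastAtMost_iff greaterThanLessThan_iff, linarith)
    then show ?thesis by blast
  qed
  finally show "supported_inside (\<lambda>z. plateau n (fst z) * u (snd (z :: real \<times> (real^'n))))" unfolding supported_inside_def .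
qed

context integrand
begin

lemma vector_lint_le_cost:
  assumes l: "psd_measure borel (l :: (real^'n) set \<Rightarrow> real^'n^'n)" and \<Phi>: "\<And>x. \<Phi> x \<in> polar_set f"
  shows "ennreal (vector_lint borel l \<Phi>) \<le> (\<integral>\<^sup>+x. f (polar_density borel l x) \<partial>total_variation borel l)"
proof -
  obtain \<tau> \<theta> where d: "has_vector_density borel l \<tau> \<theta>" using ex_density_of_psd_measure[OF l] by blast
  have "AE x in total_variation borel l. polar_density borel l x \<in> sym_mats"
    by (rule sym_polar_density[OF d]) (use l in \<open>auto simp: psd_measure_def psd_mats_def\<close>)
  then have "AE x in total_variation borel l. ennreal (\<Phi> x \<bullet> polar_density borel l x) \<le> f (polar_density borel l x)"
    by eventually_elim (use \<Phi> in \<open>auto simp: polar_set_def\<close>)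
  then show ?thesis unfolding vector_lint_def by (rule ennreal_integral_le_nn_integral)
qed

text \<open>Test the equation with \<open>plateau n t * u x\<close>. Its right-hand side is at most the action,
  since half the Hessian takes values in the polar set; as \<open>n\<close> grows, its left-hand side tends to
  the difference of the end values of \<open>t \<mapsto> \<integral>u d\<rho>\<^sub>t\<close>.\<close>

lemma weak_duality:
  fixes x0 :: "real^'n"
  assumes u: "C2c u g h" and adm: "\<And>x. (1/2) *\<^sub>R h x \<in> polar_set f"
  shows "ennreal ((\<integral>x. u x \<partial>\<nu>) - u x0) \<le> point_cost f x0 \<nu>"
  unfolding point_cost_def dyn_cost_def
proof (rule Inf_greatest, safe)
  fix \<rho> \<rho>t l lt \<rho>c
  assume fp: "fokker_planck \<rho> \<rho>t l lt" and rep: "continuous_representative \<rho>t \<rho>c"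
    and \<rho>0: "\<rho>c 0 = return borel x0" and \<nu>: "\<nu> = \<rho>c 1"
  interpret U: prob_space unit_time by (rule prob_space_unit_time)
  have ucont: "continuous_on UNIV u" using u C2D(3) unfolding C2c_def by blast
  obtain B where B: "\<And>x. \<bar>u x\<bar> \<le> B" using Cc_bounded[OF C2c_Cc(1)[OF u]] by blast
  define a where "a t = (\<integral>x. u x \<partial>\<rho>c t)" for t
  have acont: "continuous_on {0..1} a"
  proof -
    have "bounded (range u)" using B by (auto simp: bounded_iff)
    then show ?thesis using rep ucont unfolding continuous_representative_def narrowly_continuous_def a_def by blast
  qed
  have am: "a \<in> borel_measurable unit_time"
  proof -
    have "continuous_on {0<..<1} a" by (rule continuous_on_subset[OF acont]) auto
    from borel_measurable_continuous_on_restrict[OF this] show ?thesis unfolding unit_time_def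
      by (simp add: measurable_cong_sets[OF sets_restrict_space_cong[OF sets_lborel] refl])
  qed
  have a0: "a 0 = u x0" unfolding a_def \<rho>0 by (rule integral_return_borel) (rule borel_measurable_continuous_onI[OF ucont])
  have psd: "psd_measure borel (lt t)" if "t \<in> {0<..<1}" for t
    using fp that unfolding fokker_planck_def psd_disintegration_def by blast
  have key: "ennreal (- (\<integral>t. plateau_deriv n t * a t \<partial>unit_time)) \<le> action f lt" if n: "3 \<le> n" for n
  proof -
    have eq: "(\<integral>t. (\<integral>x. plateau_deriv n t * u x \<partial>\<rho>t t) \<partial>unit_time) =
        - (\<integral>t. vector_lint borel (lt t) (\<lambda>x. (1/2) *\<^sub>R (plateau n t *\<^sub>R h x)) \<partial>unit_time)"
    proof -
      have "\<forall>\<phi> \<phi>t g h. Cb12 \<phi> \<phi>t g h \<longrightarrow> supported_inside \<phi> \<longrightarrow>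
        (\<integral>t. (\<integral>x. \<phi>t (t, x) \<partial>\<rho>t t) \<partial>unit_time) =
        - (\<integral>t. vector_lint borel (lt t) (\<lambda>x. (1 / 2) *\<^sub>R h (t, x)) \<partial>unit_time)"
        using fp unfolding fokker_planck_def by blast
      from this[rule_format, OF plateau_product_test_function[OF u n]] show ?thesis by simp
    qed
    have "(\<integral>t. (\<integral>x. plateau_deriv n t * u x \<partial>\<rho>t t) \<partial>unit_time) = (\<integral>t. plateau_deriv n t * a t \<partial>unit_time)"
    proof (rule integral_cong_AE)
      have pd: "plateau_deriv n \<in> borel_measurable unit_time"
        by (rule measurable_compose[OF measurable_unit_time_borel], rule borel_measurable_continuous_onI)
           (unfold plateau_deriv_def, intro continuous_intros continuous_hat)
      have \<rho>tm: "\<rho>t \<in> unit_time \<rightarrow>\<^sub>M subprob_algebra borel"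
        using fp unfolding fokker_planck_def disintegration_def by (auto dest: measurable_prob_algebraD)
      have "(\<lambda>t. \<integral>x. u x \<partial>\<rho>t t) \<in> borel_measurable unit_time"
        by (rule measurable_compose[OF \<rho>tm])
           (intro integral_measurable_subprob_algebra borel_measurable_continuous_onI[OF ucont])
      then show "(\<lambda>t. \<integral>x. plateau_deriv n t * u x \<partial>\<rho>t t) \<in> borel_measurable unit_time" using pd by simp
      show "(\<lambda>t. plateau_deriv n t * a t) \<in> borel_measurable unit_time" using pd am by simp
      show "AE t in unit_time. (\<integral>x. plateau_deriv n t * u x \<partial>\<rho>t t) = plateau_deriv n t * a t"
        using rep unfolding continuous_representative_def a_def by auto
    qed
    then have "- (\<integral>t. plateau_deriv n t * a t \<partial>unit_time) = (\<integral>t. vector_lint borel (lt t) (\<lambda>x. (1/2) *\<^sub>R (plateau n t *\<^sub>R h x)) \<partial>unit_time)"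
      using eq by simp
    also have "ennreal \<dots> \<le> action f lt" unfolding action_def
    proof (rule ennreal_integral_le_nn_integral, rule AE_I2)
      fix t assume "t \<in> space unit_time"
      then have t: "t \<in> {0<..<1}" by simp
      show "ennreal (vector_lint borel (lt t) (\<lambda>x. (1/2) *\<^sub>R (plateau n t *\<^sub>R h x)))
          \<le> (\<integral>\<^sup>+x. f (polar_density borel (lt t) x) \<partial>total_variation borel (lt t))"
      proof (rule vector_lint_le_cost[OF psd[OF t]])
        fix x
        have "plateau n t *\<^sub>R ((1/2) *\<^sub>R h x) \<in> polar_set f"
          using plateau_range(1)[OF n] plateau_range(2) by (intro polar_shrink adm)
        then show "(1/2) *\<^sub>R (plateau n t *\<^sub>R h x) \<in> polar_set f" by (simp add: mult.commute)
      qed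
    qed
    finally show ?thesis .
  qed
  show "ennreal ((\<integral>x. u x \<partial>\<rho>c 1) - u x0) \<le> action f lt"
  proof (rule ennreal_le_epsilon)
    fix e :: real assume e: "e > 0"
    obtain d where d: "d > 0" "\<And>t. t \<in> {0..1} \<Longrightarrow> \<bar>t - 0\<bar> < d \<Longrightarrow> \<bar>a t - a 0\<bar> < e/2"
      using acont[unfolded continuous_on_iff, rule_format, of 0 "e/2"] e by (auto simp: dist_real_def)
    obtain d' where d': "d' > 0" "\<And>t. t \<in> {0..1} \<Longrightarrow> \<bar>t - 1\<bar> < d' \<Longrightarrow> \<bar>a t - a 1\<bar> < e/2"
      using acont[unfolded continuous_on_iff, rule_format, of 1 "e/2"] e by (auto simp: dist_real_def)
    \<comment> \<open>The time derivative of the plateau is concentrated on \<open>[0, 2/n]\<close> and \<open>[1 - 2/n, 1]\<close>, where \<open>a\<close> differs from its end values by less than \<open>e/2\<close>.\<close>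
    obtain n :: nat where n: "max 3 (2 / min d d') < real n" using reals_Archimedean2 by blast
    have n3: "3 \<le> n" using n by simp
    have "2 / real n < min d d'" using n d(1) d'(1) by (simp add: field_simps del: min_less_iff_conj)
    then have nd: "2 / real n < d" "2 / real n < d'" by auto
    \<comment> \<open>Two bumps of unit mass, the upward and the downward flank of the plateau.\<close>
    let ?r = "\<lambda>t. real n * hat (real n * t - 1)" and ?q = "\<lambda>t. real n * hat (real n * t - (real n - 2))"
    have pd: "plateau_deriv n t = ?r t - ?q t" for t unfolding plateau_deriv_def by (simp add: algebra_simps)
    have r: "(\<integral>t. ?r t \<partial>unit_time) = 1" "integrable unit_time ?r"
      using integral_hat[of "real n" 1] n3 by (simp_all add: step_one step_zero)
    have q: "(\<integral>t. ?q t \<partial>unit_time) = 1" "integrable unit_time ?q"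
      using integral_hat[of "real n" "real n - 2"] n3 by (simp_all add: step_one step_zero)
    obtain A where "\<forall>y\<in>a ` {0..1}. norm y \<le> A"
      using compact_imp_bounded[OF compact_continuous_image[OF acont]] unfolding bounded_iff by blast
    then have A: "\<And>t. t \<in> {0..1} \<Longrightarrow> \<bar>a t\<bar> \<le> A" by auto
    have ia: "integrable unit_time (\<lambda>t. - (plateau_deriv n t * a t))"
    proof (rule Bochner_Integration.integrable_bound)
      show "integrable unit_time (\<lambda>t. A * (?r t + ?q t))" using r q by simp
      show "(\<lambda>t. - (plateau_deriv n t * a t)) \<in> borel_measurable unit_time" unfolding pd using am r(2) q(2) by auto
      show "AE t in unit_time. norm (- (plateau_deriv n t * a t)) \<le> norm (A * (?r t + ?q t))"
      proof (rule AE_I2)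
        fix t assume "t \<in> space unit_time"
        then have t: "t \<in> {0..1}" by simp
        have "\<bar>plateau_deriv n t\<bar> \<le> ?r t + ?q t" unfolding pd
          using hat_nonneg[of "real n * t - 1"] hat_nonneg[of "real n * t - (real n - 2)"]
            mult_nonneg_nonneg[of "real n" "hat (real n * t - 1)"] mult_nonneg_nonneg[of "real n" "hat (real n * t - (real n - 2))"] by linarith
        then have "\<bar>plateau_deriv n t\<bar> * \<bar>a t\<bar> \<le> (?r t + ?q t) * A" using A[OF t] by (intro mult_mono) auto
        then have "\<bar>plateau_deriv n t * a t\<bar> \<le> A * (?r t + ?q t)" by (simp add: abs_mult mult.commute)
        then show "norm (- (plateau_deriv n t * a t)) \<le> norm (A * (?r t + ?q t))"
          unfolding real_norm_def abs_minus_cancel by (rule order_trans[OF _ abs_ge_self])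
      qed
    qed
    have ennreal_add_le: "ennreal (y + e) \<le> ennreal y + ennreal e" for y
      using e by (cases "y \<ge> 0") (auto simp: ennreal_neg ennreal_leI)
    have "(a 1 - e/2) * 1 - (a 0 + e/2) * 1 = (\<integral>t. ?q t * (a 1 - e/2) - ?r t * (a 0 + e/2) \<partial>unit_time)"
      using r q by (subst Bochner_Integration.integral_diff) (auto simp: mult.commute)
    also have "\<dots> \<le> (\<integral>t. - (plateau_deriv n t * a t) \<partial>unit_time)"
    proof (rule integral_mono[OF _ ia])
      show "integrable unit_time (\<lambda>t. ?q t * (a 1 - e/2) - ?r t * (a 0 + e/2))" using r q by simp
      fix t assume "t \<in> space unit_time"
      then have t: "t \<in> {0..1}" by simp
      have "?q t * (a 1 - e/2) \<le> ?q t * a t"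
      proof (cases "?q t = 0")
        case False
        then have "real n - 2 < real n * t" using hat_zero(1)[of "real n * t - (real n - 2)"] by (cases "real n * t \<le> real n - 2") auto
        then have "1 - t < 2 / real n" using n3 by (simp add: field_simps)
        then have "\<bar>a t - a 1\<bar> < e/2" using d'(2)[OF t] nd t by auto
        then have "a 1 - e/2 \<le> a t" by linarith
        then show ?thesis by (intro mult_left_mono) (simp_all add: hat_nonneg)
      qed auto
      moreover have "?r t * a t \<le> ?r t * (a 0 + e/2)"
      proof (cases "?r t = 0")
        case False
        then have "real n * t < 2" using hat_zero(2)[of "real n * t - 1"] by (cases "2 \<le> real n * t") auto
        then have "t < 2 / real n" using n3 by (simp add: field_simps)
        then have "\<bar>a t - a 0\<bar> < e/2" using d(2)[OF t] nd t by auto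
        then have "a t \<le> a 0 + e/2" by linarith
        then show ?thesis by (intro mult_left_mono) (simp_all add: hat_nonneg)
      qed auto
      ultimately show "?q t * (a 1 - e/2) - ?r t * (a 0 + e/2) \<le> - (plateau_deriv n t * a t)"
        unfolding pd by (simp add: left_diff_distrib)
    qed
    finally have "(\<integral>x. u x \<partial>\<rho>c 1) - u x0 \<le> - (\<integral>t. plateau_deriv n t * a t \<partial>unit_time) + e"
      unfolding a0[symmetric] a_def[of 1, symmetric] by simp
    then have "ennreal ((\<integral>x. u x \<partial>\<rho>c 1) - u x0) \<le> ennreal (- (\<integral>t. plateau_deriv n t * a t \<partial>unit_time) + e)" by (rule ennreal_leI)
    also have "\<dots> \<le> ennreal (- (\<integral>t. plateau_deriv n t * a t \<partial>unit_time)) + ennreal e" by (rule ennreal_add_le)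
    also have "\<dots> \<le> action f lt + ennreal e" by (intro add_right_mono key n3)
    finally show "ennreal ((\<integral>x. u x \<partial>\<rho>c 1) - u x0) \<le> action f lt + ennreal e" .
  qed
qed

end


section \<open>Countable approximation and lower integrals\<close>

lemma Cc_uniformly_continuous:
  fixes u :: "'a::euclidean_space \<Rightarrow> real"
  assumes u: "u \<in> Cc" and e: "e > 0"
  obtains d where "d > 0" "\<And>x y. dist x y < d \<Longrightarrow> \<bar>u x - u y\<bar> < e"
proof -
  obtain K where K: "compact K" "\<And>x. x \<notin> K \<Longrightarrow> u x = 0" using u unfolding Cc_def by auto
  obtain R where R: "\<And>x. x \<in> K \<Longrightarrow> norm x \<le> R" using compact_imp_bounded[OF K(1)] bounded_iff by blast
  have z: "u x = 0" if "norm x > R" for x using K(2)[of x] R[of x] that by force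
  have "uniformly_continuous_on (cball 0 (R + 1)) u"
    by (intro compact_uniformly_continuous continuous_on_subset[OF Cc_continuous[OF u]]) auto
  then obtain d where d: "d > 0" "\<And>x y. x \<in> cball 0 (R+1) \<Longrightarrow> y \<in> cball 0 (R+1) \<Longrightarrow> dist y x < d \<Longrightarrow> dist (u y) (u x) < e"
    unfolding uniformly_continuous_on_def using e by metis
  have "\<bar>u x - u y\<bar> < e" if "dist x y < min d 1" for x y
  proof (cases "x \<in> cball 0 (R+1) \<and> y \<in> cball 0 (R+1)")
    case True
    then show ?thesis using d(2)[of y x] that by (simp add: dist_real_def)
  next
    case False
    have "\<bar>norm x - norm y\<bar> < 1" using norm_triangle_ineq3[of x y] that by (simp add: dist_norm)
    then have "norm x > R" "norm y > R" using False by auto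
    then show ?thesis using z e by simp
  qed
  then show ?thesis using that[of "min d 1"] d(1) by auto
qed

text \<open>Constant on the cells of a grid of mesh \<open>1 / k\<close>; finitely many cells carry a rational
  value, so there are countably many such functions.\<close>

definition grid_function :: "nat \<Rightarrow> (('n \<Rightarrow> int) \<times> rat) list \<Rightarrow> real^'n \<Rightarrow> real" where
  "grid_function k l x = (case map_of l (\<lambda>i. \<lfloor>real k * x $ i\<rfloor>) of Some r \<Rightarrow> of_rat r | None \<Rightarrow> 0)"

lemma grid_function_approximation:
  fixes u :: "real^'n \<Rightarrow> real"
  assumes u: "u \<in> Cc" and e: "e > 0"
  obtains k l where "\<And>x. \<bar>u x - grid_function k l x\<bar> \<le> e"
proof -
  obtain K where K: "compact K" "\<And>x. x \<notin> K \<Longrightarrow> u x = 0" using u unfolding Cc_def by auto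
  obtain R where R: "\<And>x. x \<in> K \<Longrightarrow> norm x \<le> R" using compact_imp_bounded[OF K(1)] bounded_iff by blast
  have z: "u x = 0" if "norm x > R" for x using K(2)[of x] R[of x] that by force
  obtain d where d: "d > 0" "\<And>x y. dist x y < d \<Longrightarrow> \<bar>u x - u y\<bar> < e/2" using Cc_uniformly_continuous[OF u, of "e/2"] e by auto
  obtain k :: nat where k: "real CARD('n) / d < real k" using reals_Archimedean2 by blast
  then have k0: "real k > 0" using d(1) by (smt (verit) divide_nonneg_pos of_nat_0_le_iff)
  define N where "N = \<lceil>real k * (R + 1)\<rceil> + 1"
  define J where "J = (UNIV :: 'n set) \<rightarrow>\<^sub>E {- N..N}"
  have J: "j \<in> J \<longleftrightarrow> (\<forall>i. - N \<le> j i \<and> j i \<le> N)" for j unfolding J_def PiE_UNIV_domain by auto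
  have "finite J" unfolding J_def by (intro finite_PiE) auto
  then obtain js where js: "set js = J" using finite_list by blast
  define pt where "pt j = (\<chi> i. real_of_int (j i) / real k :: real^'n)" for j
  have "\<exists>r. \<bar>of_rat r - y\<bar> < e/2" for y :: real
  proof -
    obtain r where "y - e/2 < of_rat r" "of_rat r < y + e/2" using of_rat_dense[of "y - e/2" "y + e/2"] e by auto
    then have "\<bar>of_rat r - y\<bar> < e/2" by linarith
    then show ?thesis ..
  qed
  then obtain q :: "real \<Rightarrow> rat" where q: "\<And>y. \<bar>of_rat (q y) - y\<bar> < e/2" by metis
  define l where "l = map (\<lambda>j. (j, q (u (pt j)))) js"
  have "\<bar>u x - grid_function k l x\<bar> \<le> e" for x
  proof -
    let ?j = "\<lambda>i. \<lfloor>real k * x $ i\<rfloor>"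
    show ?thesis
    proof (cases "?j \<in> J")
      case True
      then have g: "grid_function k l x = of_rat (q (u (pt ?j)))"
        unfolding grid_function_def l_def by (simp add: map_of_map_restrict js)
      have "norm (x - pt ?j) \<le> (\<Sum>i\<in>UNIV. \<bar>(x - pt ?j) $ i\<bar>)" by (rule norm_le_l1_cart)
      also have "\<dots> \<le> (\<Sum>i\<in>(UNIV :: 'n set). 1 / real k)"
      proof (rule sum_mono)
        fix i
        have "0 \<le> real k * x $ i - real_of_int (?j i)" "real k * x $ i - real_of_int (?j i) \<le> 1" by linarith+
        then have "\<bar>real k * x $ i - real_of_int (?j i)\<bar> / real k \<le> 1 / real k" using k0 by (intro divide_right_mono) auto
        moreover have "(x - pt ?j) $ i = (real k * x $ i - real_of_int (?j i)) / real k"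
          unfolding pt_def using k0 by (simp add: field_simps)
        ultimately show "\<bar>(x - pt ?j) $ i\<bar> \<le> 1 / real k" using k0 by (simp add: abs_divide)
      qed
      also have "\<dots> = real CARD('n) / real k" by simp
      also have "\<dots> < d" using k k0 d(1) by (simp add: field_simps)
      finally have "\<bar>u x - u (pt ?j)\<bar> < e/2" by (intro d(2)) (simp add: dist_norm)
      then show ?thesis using q[of "u (pt ?j)"] unfolding g by linarith
    next
      case False
      then obtain i where i: "?j i < - N \<or> N < ?j i" unfolding J by (auto simp: not_le)
      have "real k * (R + 1) < \<bar>real k * x $ i\<bar>"
      proof -
        have "real k * (R + 1) \<le> real_of_int N - 1" unfolding N_def by linarith
        moreover have "real_of_int N < \<bar>real k * x $ i\<bar> + 1 \<or> real_of_int N < \<bar>real k * x $ i\<bar>" using i by linarith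
        moreover have "N < ?j i \<Longrightarrow> real_of_int N + 1 \<le> real k * x $ i" by linarith
        moreover have "?j i < - N \<Longrightarrow> real k * x $ i < - real_of_int N" by linarith
        ultimately show ?thesis using i by linarith
      qed
      then have "R + 1 < \<bar>x $ i\<bar>" using k0 by (simp add: abs_mult)
      then have "norm x > R" using component_le_norm_cart[of x i] by linarith
      moreover have "grid_function k l x = 0"
      proof -
        have "map_of l ?j = None" using False js unfolding l_def by (auto simp: map_of_eq_None_iff)
        then show ?thesis unfolding grid_function_def by simp
      qed
      ultimately show ?thesis using z e by simp
    qed
  qed
  then show ?thesis using that by blast
qed

text \<open>For every grid function and every accuracy choose one member of \<open>A\<close> that close to it,
  if there is any.\<close>

lemma countable_uniformly_dense:
  fixes A :: "(real^'n \<Rightarrow> real) set"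
  assumes A: "A \<subseteq> Cc"
  obtains D where "countable D" "D \<subseteq> A" "\<And>u e. u \<in> A \<Longrightarrow> e > 0 \<Longrightarrow> \<exists>v\<in>D. \<forall>x. \<bar>u x - v x\<bar> \<le> e"
proof -
  define P where "P key v \<longleftrightarrow> v \<in> A \<and> (\<forall>x. \<bar>v x - grid_function (fst (snd key)) (snd (snd key)) x\<bar> \<le> 1 / real (Suc (fst key)))"
    for key :: "nat \<times> nat \<times> (('n \<Rightarrow> int) \<times> rat) list" and v
  define D where "D = (\<lambda>key. SOME v. P key v) ` {key. \<exists>v. P key v}"
  have PD: "P key (SOME v. P key v)" if "\<exists>v. P key v" for key using someI_ex[OF that] .
  have "countable D" unfolding D_def by (rule countable_image) simp
  moreover have "D \<subseteq> A" unfolding D_def using PD unfolding P_def by blast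
  moreover have "\<exists>v\<in>D. \<forall>x. \<bar>u x - v x\<bar> \<le> e" if u: "u \<in> A" and e: "e > 0" for u e
  proof -
    obtain m where m: "inverse (real (Suc m)) < e / 2" using reals_Archimedean[of "e/2"] e by auto
    obtain k l where kl: "\<And>x. \<bar>u x - grid_function k l x\<bar> \<le> 1 / real (Suc m)"
      using grid_function_approximation[of u "1 / real (Suc m)"] u A by auto
    have "P (m, k, l) u" unfolding P_def using u kl by simp
    then have "\<exists>v\<in>D. P (m, k, l) v" unfolding D_def using PD[of "(m, k, l)"] by blast
    then obtain v where v: "v \<in> D" "P (m, k, l) v" by blast
    have "\<bar>u x - v x\<bar> \<le> e" for x
    proof -
      have "\<bar>v x - grid_function k l x\<bar> \<le> 1 / real (Suc m)" using v(2) unfolding P_def by simp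
      then have "\<bar>u x - v x\<bar> \<le> 1 / real (Suc m) + 1 / real (Suc m)" using kl[of x] by linarith
      then show ?thesis using m unfolding inverse_eq_divide by linarith
    qed
    then show ?thesis using v(1) by blast
  qed
  ultimately show ?thesis using that by blast
qed

text \<open>Inf-convolution with \<open>n * dist x z\<close>: Lipschitz with constant \<open>n\<close>, and
  convergent by lower semicontinuity at \<open>x\<close>, since far points \<open>z\<close> are penalised beyond
  the upper bound \<open>M\<close>.\<close>

lemma bounded_lsc_approximation:
  fixes \<phi> :: "real^'n \<Rightarrow> real"
  assumes lsc: "lsc_on UNIV \<phi>" and b: "\<And>x. 0 \<le> \<phi> x" "\<And>x. \<phi> x \<le> M"
  obtains w :: "nat \<Rightarrow> real^'n \<Rightarrow> real" where "\<And>n. continuous_on UNIV (w n)" "\<And>n x. 0 \<le> w n x" "\<And>n x. w n x \<le> \<phi> x"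
    "\<And>x. (\<lambda>n. w n x) \<longlonglongrightarrow> \<phi> x"
proof -
  define w where "w n x = (INF z. \<phi> z + real n * dist x z)" for n x
  have bdd: "bdd_below (range (\<lambda>z. \<phi> z + real n * dist x z))" for n x
    by (rule bdd_belowI[of _ 0]) (use b in auto)
  have low: "w n x \<le> \<phi> z + real n * dist x z" for n x z unfolding w_def by (rule cINF_lower[OF bdd]) simp
  have w0: "0 \<le> w n x" for n x unfolding w_def by (rule cINF_greatest) (use b in auto)
  have wle: "w n x \<le> \<phi> x" for n x using low[of n x x] by simp
  have lip: "w n x - real n * dist x y \<le> w n y" for n x y
    unfolding w_def[of n y]
  proof (rule cINF_greatest)
    fix z
    have "real n * dist x z \<le> real n * (dist x y + dist y z)" by (intro mult_left_mono dist_triangle) auto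
    then show "w n x - real n * dist x y \<le> \<phi> z + real n * dist y z" using low[of n x z] by (simp add: distrib_left)
  qed simp
  have "continuous_on UNIV (w n)" for n
    unfolding continuous_on_iff
  proof (intro ballI allI impI)
    fix x :: "real^'n" and e :: real assume e: "e > 0"
    have "dist (w n y) (w n x) < e" if d: "dist y x < e / (real n + 1)" for y
    proof -
      have "\<bar>w n y - w n x\<bar> \<le> real n * dist y x"
        using lip[of n x y] lip[of n y x] by (auto simp: abs_le_iff dist_commute)
      also have "\<dots> \<le> (real n + 1) * dist y x" by (intro mult_right_mono) auto
      also have "\<dots> < e" using d by (simp add: field_simps)
      finally show ?thesis by (simp add: dist_real_def)
    qed
    then show "\<exists>d>0. \<forall>y\<in>UNIV. dist y x < d \<longrightarrow> dist (w n y) (w n x) < e"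
      using e by (intro exI[of _ "e / (real n + 1)"]) auto
  qed
  moreover have "(\<lambda>n. w n x) \<longlonglongrightarrow> \<phi> x" for x
  proof (rule LIMSEQ_I)
    fix e :: real assume e: "e > 0"
    have "\<forall>\<^sub>F y in at x. \<phi> x - e/2 < \<phi> y" using lsc e unfolding lsc_on_def by auto
    then obtain d where d: "d > 0" "\<And>y. y \<noteq> x \<Longrightarrow> dist y x < d \<Longrightarrow> \<phi> x - e/2 < \<phi> y"
      unfolding eventually_at by auto
    obtain N :: nat where N: "M / d < real N" using reals_Archimedean2 by blast
    have "norm (w n x - \<phi> x) < e" if n: "n \<ge> N" for n
    proof -
      have "\<phi> x - e/2 \<le> w n x" unfolding w_def
      proof (rule cINF_greatest)
        fix z
        show "\<phi> x - e/2 \<le> \<phi> z + real n * dist x z"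
        proof (cases "dist z x < d")
          case True
          then have "\<phi> x - e/2 \<le> \<phi> z" using d(2)[of z] e by (cases "z = x") auto
          then show ?thesis by (simp add: add_increasing2)
        next
          case False
          have "M \<le> real N * d" using N d(1) by (simp add: field_simps)
          also have "\<dots> \<le> real n * dist x z" using n False d(1) by (intro mult_mono) (auto simp: dist_commute)
          finally show ?thesis using b[of x] b[of z] e by linarith
        qed
      qed simp
      then show ?thesis using wle[of n x] e by (simp add: abs_if)
    qed
    then show "\<exists>N. \<forall>n\<ge>N. norm (w n x - \<phi> x) < e" by blast
  qed
  ultimately show ?thesis using that w0 wle by blast
qed

text \<open>The nonnegative integral is a supremum over simple functions below \<open>w\<close>, that is, a
  lower integral when \<open>w\<close> is arbitrary; a countable subfamily attains it.\<close>

lemma ex_measurable_minorant: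
  obtains s where "s \<in> borel_measurable M" "s \<le> w" "(\<integral>\<^sup>+x. w x \<partial>M) = (\<integral>\<^sup>+x. s x \<partial>M)"
proof -
  let ?S = "{g. simple_function M g \<and> g \<le> w}"
  have "?S \<noteq> {}" by (auto intro!: exI[of _ "\<lambda>_. 0"] simp: le_fun_def)
  then obtain ys :: "nat \<Rightarrow> ennreal" where ys: "range ys \<subseteq> integral\<^sup>S M ` ?S" "Sup (integral\<^sup>S M ` ?S) = Sup (range ys)"
    using ennreal_SUP_countable_SUP[of ?S "integral\<^sup>S M"] by blast
  have "\<exists>g. g \<in> ?S \<and> integral\<^sup>S M g = ys n" for n
  proof -
    have "ys n \<in> integral\<^sup>S M ` ?S" using ys(1) by (rule range_subsetD)
    then obtain g where "ys n = integral\<^sup>S M g" "g \<in> ?S" by (rule imageE)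
    then show ?thesis by (intro exI[of _ g]) simp
  qed
  from choice[OF allI[OF this]] obtain g where "\<forall>n. g n \<in> ?S \<and> integral\<^sup>S M (g n) = ys n" by (rule exE)
  then have g': "\<And>n. g n \<in> ?S" "\<And>n. integral\<^sup>S M (g n) = ys n" by blast+
  have g: "(SUP x\<in>?S. integral\<^sup>S M x) = (SUP n. integral\<^sup>S M (g n))" unfolding g'(2) using ys(2) by simp
  have gS: "simple_function M (g n)" "g n \<le> w" for n using g'(1) by auto
  define s where "s x = (SUP n. g n x)" for x
  have sm: "s \<in> borel_measurable M" unfolding s_def[abs_def] using gS(1) by (intro borel_measurable_SUP borel_measurable_simple_function) auto
  have sw: "s \<le> w" unfolding s_def le_fun_def using gS(2) by (auto intro!: SUP_least simp: le_fun_def)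
  have "(\<integral>\<^sup>+x. w x \<partial>M) \<le> (\<integral>\<^sup>+x. s x \<partial>M)"
    unfolding nn_integral_def[of M w] g
  proof (rule SUP_least)
    fix n
    have "integral\<^sup>S M (g n) = (\<integral>\<^sup>+x. g n x \<partial>M)" by (rule nn_integral_eq_simple_integral[symmetric, OF gS(1)])
    also have "\<dots> \<le> (\<integral>\<^sup>+x. s x \<partial>M)" by (intro nn_integral_mono) (auto simp: s_def intro: SUP_upper)
    finally show "integral\<^sup>S M (g n) \<le> (\<integral>\<^sup>+x. s x \<partial>M)" .
  qed
  moreover have "(\<integral>\<^sup>+x. s x \<partial>M) \<le> (\<integral>\<^sup>+x. w x \<partial>M)" using sw by (intro nn_integral_mono) (auto simp: le_fun_def)
  ultimately show ?thesis using that sm sw by (meson antisym)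
qed

lemma measurable_completion_AE_eq:
  assumes s: "s \<in> M \<rightarrow>\<^sub>M N" and ae: "AE x in M. s x = w x" and w: "\<And>x. w x \<in> space N"
  shows "w \<in> completion M \<rightarrow>\<^sub>M N"
proof (rule measurableI)
  fix A assume A: "A \<in> sets N"
  have 1: "Measurable.pred (completion M) (\<lambda>x. s x \<in> A \<and> w x \<notin> A)"
    by (rule sets_completion_AE) (use ae in eventually_elim, auto)
  have 2: "Measurable.pred (completion M) (\<lambda>x. s x \<notin> A \<and> w x \<in> A)"
    by (rule sets_completion_AE) (use ae in eventually_elim, auto)
  have 3: "Measurable.pred (completion M) (\<lambda>x. s x \<in> A)"
    using measurable_completion[OF s] A by (rule pred_sets2[rotated])
  have "w -` A \<inter> space (completion M) =
      ({x \<in> space (completion M). s x \<in> A} - {x \<in> space (completion M). s x \<in> A \<and> w x \<notin> A})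
      \<union> {x \<in> space (completion M). s x \<notin> A \<and> w x \<in> A}" by auto
  also have "\<dots> \<in> sets (completion M)"
    using 1 2 3 unfolding pred_def by (intro sets.Un sets.Diff)
  finally show "w -` A \<inter> space (completion M) \<in> sets (completion M)" .
qed (rule w)

text \<open>If the lower integrals of \<open>w\<close> and of its complement to 1 add up to 1, then the lower
  and the upper integral of \<open>w\<close> agree, so \<open>w\<close> is squeezed between measurable functions
  that coincide almost everywhere.\<close>

lemma measurable_of_complementary_integrals:
  assumes p: "prob_space p" and sum: "\<And>x. w x + w' x = (1::ennreal)"
    and int: "(\<integral>\<^sup>+x. w x \<partial>p) + (\<integral>\<^sup>+x. w' x \<partial>p) = 1"
  shows "w \<in> borel_measurable (completion p)"
proof -
  interpret p: prob_space p by fact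
  obtain s where s: "s \<in> borel_measurable p" "s \<le> w" "(\<integral>\<^sup>+x. w x \<partial>p) = (\<integral>\<^sup>+x. s x \<partial>p)"
    by (rule ex_measurable_minorant)
  obtain s' where s': "s' \<in> borel_measurable p" "s' \<le> w'" "(\<integral>\<^sup>+x. w' x \<partial>p) = (\<integral>\<^sup>+x. s' x \<partial>p)"
    by (rule ex_measurable_minorant)
  have le1: "s x + s' x \<le> 1" for x using add_mono[OF le_funD[OF s(2)] le_funD[OF s'(2)]] sum[of x] by metis
  have one: "(\<integral>\<^sup>+x. s x + s' x \<partial>p) = 1" using s s' int by (subst nn_integral_add) auto
  have "(\<integral>\<^sup>+x. 1 - (s x + s' x) \<partial>p) = (\<integral>\<^sup>+x. 1 \<partial>p) - (\<integral>\<^sup>+x. s x + s' x \<partial>p)"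
    using s(1) s'(1) le1 one by (intro nn_integral_diff) auto
  then have "(\<integral>\<^sup>+x. 1 - (s x + s' x) \<partial>p) = 0" using one p.emeasure_space_1 by simp
  then have "AE x in p. 1 - (s x + s' x) = 0" using s(1) s'(1) by (subst (asm) nn_integral_0_iff_AE) auto
  then have "AE x in p. s x = w x"
  proof eventually_elim
    case (elim x)
    then have "1 \<le> s x + s' x" by (simp add: diff_eq_0_iff_ennreal)
    then have eq: "w x + w' x = s x + s' x" using antisym[OF le1[of x]] sum[of x] by simp
    have fin: "w' x \<noteq> \<infinity>" using sum[of x] by auto
    have "s x + s' x \<le> s x + w' x" using s'(2) by (intro add_left_mono) (simp add: le_fun_def)
    then have "w' x + w x \<le> w' x + s x" unfolding eq[symmetric] by (simp add: add.commute)
    then have "w x \<le> s x" using fin by (simp add: ennreal_add_left_cancel_le)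
    then show ?case using s(2) by (simp add: le_fun_def antisym)
  qed
  then show ?thesis by (rule measurable_completion_AE_eq[OF s(1)]) simp
qed


section \<open>Strong duality\<close>

context integrand
begin

definition admissible :: "(real^'n \<Rightarrow> real) set" where
  "admissible = {u. \<exists>g h. C2c u g h \<and> (\<forall>x. (1/2) *\<^sub>R h x \<in> polar_set f)}"

text \<open>The supremum over test functions whose half Hessian takes values in the polar set.\<close>

definition dual_cost :: "real^'n \<Rightarrow> (real^'n) measure \<Rightarrow> ennreal" where
  "dual_cost x p = (SUP u\<in>admissible. ennreal ((\<integral>y. u y \<partial>p) - u x))"

lemma zero_admissible: "(\<lambda>_. 0) \<in> admissible"
  unfolding admissible_def using C2c_zero polar_zero by force

lemma admissible_Cc: "u \<in> admissible \<Longrightarrow> u \<in> Cc"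
  unfolding admissible_def using C2c_Cc(1) by blast

lemma dual_cost_le_point_cost: "dual_cost x p \<le> point_cost f x p"
  unfolding dual_cost_def admissible_def by (intro SUP_least) (auto intro: weak_duality)

text \<open>Constants are added to the compactly supported functions in order to control the total mass of a
  representing measure. The pairing of such a pair with \<open>(p, \<theta> \<tau>)\<close> is the defect in the
  static equation.\<close>

definition hessian_pairs :: "((real^'n) \<Rightarrow>\<^sub>C (real \<times> (real^'n^'n))) set" where
  "hessian_pairs = {z. \<exists>a u g h. C2c u g h \<and> (\<forall>y. apply_bcontfun z y = (a + u y, (- 1/2) *\<^sub>R h y))}"

lemma subspace_hessian_pairs: "subspace hessian_pairs"
proof (rule subspaceI)
  show "0 \<in> hessian_pairs" unfolding hessian_pairs_def using C2c_zero
    by (intro CollectI exI[of _ 0] exI[of _ "\<lambda>_. 0"]) (auto simp: zero_prod_def intro!: exI[of _ "\<lambda>_. 0"])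
next
  fix y z assume "y \<in> hessian_pairs" "z \<in> hessian_pairs"
  then obtain a u g h a' u' g' h' where c: "C2c u g h" "C2c u' g' h'"
    and eq: "\<And>x. apply_bcontfun y x = (a + u x, (- 1/2) *\<^sub>R h x)" "\<And>x. apply_bcontfun z x = (a' + u' x, (- 1/2) *\<^sub>R h' x)"
    unfolding hessian_pairs_def by auto
  have "apply_bcontfun (y + z) x = ((a + a') + (u x + u' x), (- 1/2) *\<^sub>R (h x + h' x))" for x
    by (simp add: eq scaleR_add_right)
  then show "y + z \<in> hessian_pairs" unfolding hessian_pairs_def using C2c_add[OF c] by blast
next
  fix y and r :: real assume "y \<in> hessian_pairs"
  then obtain a u g h where c: "C2c u g h" and eq: "\<And>x. apply_bcontfun y x = (a + u x, (- 1/2) *\<^sub>R h x)"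
    unfolding hessian_pairs_def by auto
  have "apply_bcontfun (r *\<^sub>R y) x = (r * a + r * u x, (- 1/2) *\<^sub>R (r *\<^sub>R h x))" for x
    by (simp add: eq algebra_simps)
  then show "r *\<^sub>R y \<in> hessian_pairs" unfolding hessian_pairs_def using C2c_scale[OF c, of r] by blast
qed

lemma C2c_pair_bcontfun:
  assumes c: "C2c u g h"
  shows "(\<lambda>y. (a + s * u y, t *\<^sub>R h y)) \<in> bcontfun"
proof -
  have d: "continuous_on UNIV u" "continuous_on UNIV h" using c C2D unfolding C2c_def by blast+
  obtain R where R: "\<And>x. R \<le> norm x \<Longrightarrow> u x = 0 \<and> g x = 0 \<and> h x = 0" using c unfolding C2c_def by auto
  let ?z = "\<lambda>y. (a + s * u y, t *\<^sub>R h y)"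
  have zc: "continuous_on S ?z" for S using d continuous_on_subset[OF d(1)] continuous_on_subset[OF d(2)] by (intro continuous_intros) auto
  have "bounded (?z ` cball 0 R)" by (intro compact_imp_bounded compact_continuous_image zc) simp
  then obtain B where B: "\<forall>y\<in>?z ` cball 0 R. norm y \<le> B" unfolding bounded_iff by blast
  have "norm (?z y) \<le> max B (norm (a, 0 :: real^'n^'n))" for y
  proof (cases "norm y \<le> R")
    case True
    then have "norm (?z y) \<le> B" using B by auto
    then show ?thesis by (rule max.coboundedI1)
  next
    case False
    then show ?thesis using R[of y] by simp
  qed
  then show ?thesis by (intro bcontfun_normI zc)
qed

definition C2c_pair :: "real \<Rightarrow> (real^'n \<Rightarrow> real) \<Rightarrow> (real^'n \<Rightarrow> real^'n^'n) \<Rightarrow> ((real^'n) \<Rightarrow>\<^sub>C (real \<times> (real^'n^'n)))" where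
  "C2c_pair a u h = Bcontfun (\<lambda>y. (a + u y, (- 1/2) *\<^sub>R h y))"

lemma apply_C2c_pair: "C2c u g h \<Longrightarrow> apply_bcontfun (C2c_pair a u h) y = (a + u y, (- 1/2) *\<^sub>R h y)"
  unfolding C2c_pair_def using C2c_pair_bcontfun[of u g h a 1 "- 1/2"] by (simp add: Bcontfun_inverse)

lemma C2c_pair_in: "C2c u g h \<Longrightarrow> C2c_pair a u h \<in> hessian_pairs"
  unfolding hessian_pairs_def using apply_C2c_pair by blast

definition inl :: "((real^'n) \<Rightarrow>\<^sub>C real) \<Rightarrow> ((real^'n) \<Rightarrow>\<^sub>C (real \<times> (real^'n^'n)))" where
  "inl g = Bcontfun (\<lambda>y. (apply_bcontfun g y, 0))"

definition inr :: "((real^'n) \<Rightarrow>\<^sub>C (real^'n^'n)) \<Rightarrow> ((real^'n) \<Rightarrow>\<^sub>C (real \<times> (real^'n^'n)))" where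
  "inr \<psi> = Bcontfun (\<lambda>y. (0, apply_bcontfun \<psi> y))"

lemma apply_inl [simp]: "apply_bcontfun (inl g) y = (apply_bcontfun g y, 0)"
  and apply_inr [simp]: "apply_bcontfun (inr \<psi>) y = (0, apply_bcontfun \<psi> y)"
proof -
  have "(\<lambda>y. (apply_bcontfun g y, 0 :: real^'n^'n)) \<in> bcontfun"
    by (rule bcontfun_normI[of _ "norm g"]) (use norm_bounded[of g] in \<open>auto intro!: continuous_intros\<close>)
  then show "apply_bcontfun (inl g) y = (apply_bcontfun g y, 0)" unfolding inl_def by (simp add: Bcontfun_inverse)
  have "(\<lambda>y. (0 :: real, apply_bcontfun \<psi> y)) \<in> bcontfun"
    by (rule bcontfun_normI[of _ "norm \<psi>"]) (use norm_bounded[of \<psi>] in \<open>auto intro!: continuous_intros\<close>)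
  then show "apply_bcontfun (inr \<psi>) y = (0, apply_bcontfun \<psi> y)" unfolding inr_def by (simp add: Bcontfun_inverse)
qed

lemma linear_inr: "linear inr"
  by (auto intro!: linearI bcontfun_eqI)

lemma pair_bcontfun_bounds:
  fixes z :: "(real^'n) \<Rightarrow>\<^sub>C (real \<times> (real^'n^'n))"
  shows "\<bar>fst (apply_bcontfun z y)\<bar> \<le> norm z" "norm (snd (apply_bcontfun z y)) \<le> norm z"
  using norm_bounded[of z y] norm_fst_le[of "fst (apply_bcontfun z y)" "snd (apply_bcontfun z y)"]
    norm_snd_le[of "snd (apply_bcontfun z y)" "fst (apply_bcontfun z y)"] by simp_all

text \<open>The second component of a functional on pairs is an integral against \<open>\<theta> \<tau>\<close>;
  on Hessian pairs this splits off the flux term of the static equation.\<close>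

lemma matrix_part_representation:
  fixes \<Lambda> :: "((real^'n) \<Rightarrow>\<^sub>C (real \<times> (real^'n^'n))) \<Rightarrow> real"
  assumes lin: "linear \<Lambda>" and bd: "\<And>\<psi>. (\<And>x. apply_bcontfun \<psi> x \<in> polar_set f) \<Longrightarrow> \<Lambda> (inr \<psi>) \<le> K"
  obtains \<tau> :: "(real^'n) measure" and \<theta> where "finite_measure \<tau>" "sets \<tau> = sets borel" "integrable \<tau> \<theta>"
    "\<And>a u g h \<gamma>. C2c u g h \<Longrightarrow> (\<And>y. apply_bcontfun \<gamma> y = a + u y) \<Longrightarrow>
       \<Lambda> (C2c_pair a u h) = \<Lambda> (inl \<gamma>) - (\<integral>x. ((1/2) *\<^sub>R h x) \<bullet> \<theta> x \<partial>\<tau>)"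
    "(\<integral>\<^sup>+x. sym_ext f (\<theta> x) \<partial>\<tau>) \<le> ennreal K"
proof -
  have l: "linear (\<lambda>\<psi>. \<Lambda> (inr \<psi>))" using linear_compose[OF linear_inr lin] by (simp add: o_def)
  obtain \<tau> :: "(real^'n) measure" and \<theta> where t: "finite_measure \<tau>" "sets \<tau> = sets borel" "integrable \<tau> \<theta>"
    "\<And>\<psi>. (\<And>i j. (\<lambda>x. apply_bcontfun \<psi> x $ i $ j) \<in> Cc) \<Longrightarrow> \<Lambda> (inr \<psi>) = (\<integral>x. apply_bcontfun \<psi> x \<bullet> \<theta> x \<partial>\<tau>)"
    "(\<integral>\<^sup>+x. sym_ext f (\<theta> x) \<partial>\<tau>) \<le> ennreal K"
  proof (rule matrix_functional_representation[of "\<lambda>\<psi>. \<Lambda> (inr \<psi>)" K, OF l])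
    fix \<psi> :: "(real^'n) \<Rightarrow>\<^sub>C (real^'n^'n)" assume "\<And>x. apply_bcontfun \<psi> x \<in> polar_set f"
    then show "\<Lambda> (inr \<psi>) \<le> K" by (rule bd)
  next
    fix \<tau> :: "(real^'n) measure" and \<theta>
    assume "finite_measure \<tau>" "sets \<tau> = sets borel" "integrable \<tau> \<theta>"
      "\<And>\<psi>. (\<And>i j. (\<lambda>x. apply_bcontfun \<psi> x $ i $ j) \<in> Cc) \<Longrightarrow> \<Lambda> (inr \<psi>) = (\<integral>x. apply_bcontfun \<psi> x \<bullet> \<theta> x \<partial>\<tau>)"
      "(\<integral>\<^sup>+x. sym_ext f (\<theta> x) \<partial>\<tau>) \<le> ennreal K"
    then show thesis by (rule that)
  qed
  have "\<Lambda> (C2c_pair a u h) = \<Lambda> (inl \<gamma>) - (\<integral>x. ((1/2) *\<^sub>R h x) \<bullet> \<theta> x \<partial>\<tau>)"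
    if c: "C2c u g h" and \<gamma>: "\<And>y. apply_bcontfun \<gamma> y = a + u y" for a u g h \<gamma>
  proof -
    define \<psi> where "\<psi> = Bcontfun (\<lambda>y. (- 1/2) *\<^sub>R h y)"
    have "(\<lambda>y. snd (0 + 0 * u y, (- 1/2) *\<^sub>R h y)) \<in> bcontfun"
    proof -
      have "(\<lambda>y. (0 + 0 * u y, (- 1/2) *\<^sub>R h y)) \<in> bcontfun" by (rule C2c_pair_bcontfun[OF c])
      then obtain B where "\<And>y. norm (0 + 0 * u y, (- 1/2) *\<^sub>R h y) \<le> B" "continuous_on UNIV (\<lambda>y. (0 + 0 * u y, (- 1/2) *\<^sub>R h y))"
        unfolding bcontfun_def bounded_iff by auto
      then show ?thesis by (intro bcontfun_normI[of _ B] continuous_on_snd) (auto intro: order_trans[OF norm_snd_le])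
    qed
    then have \<psi>: "apply_bcontfun \<psi> y = (- 1/2) *\<^sub>R h y" for y unfolding \<psi>_def by (simp add: Bcontfun_inverse)
    have "C2c_pair a u h = inl \<gamma> + inr \<psi>"
      by (rule bcontfun_eqI) (simp add: apply_C2c_pair[OF c] \<gamma> \<psi>)
    then have "\<Lambda> (C2c_pair a u h) = \<Lambda> (inl \<gamma>) + \<Lambda> (inr \<psi>)" using linear_add[OF lin] by simp
    also have "\<Lambda> (inr \<psi>) = (\<integral>x. apply_bcontfun \<psi> x \<bullet> \<theta> x \<partial>\<tau>)"
    proof (rule t(4))
      fix i j
      have "(\<lambda>x. (- 1/2) * h x $ i $ j) \<in> Cc" by (intro Cc_cmult C2c_Cc(2)[OF c])
      then show "(\<lambda>x. apply_bcontfun \<psi> x $ i $ j) \<in> Cc" by (simp add: \<psi>)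
    qed
    also have "\<dots> = - (\<integral>x. ((1/2) *\<^sub>R h x) \<bullet> \<theta> x \<partial>\<tau>)" unfolding \<psi> by simp
    finally show ?thesis by simp
  qed
  then show ?thesis using that t by blast
qed

text \<open>On Hessian pairs the functional \<open>L0 z = z\<^sub>1 x0 - \<integral>z\<^sub>1 dp\<close> is
  bounded by the dual value \<open>K\<close> as long as the second component is polar-valued. Its Hahn-Banach
  extension \<open>\<Lambda>\<close> with the same bound annihilates pairs \<open>(\<gamma>, 0)\<close>, hence
  is given by a matrix measure \<open>\<theta> \<tau>\<close> of cost at most \<open>K\<close>, and the values
  of \<open>\<Lambda>\<close> on Hessian pairs are the static equation.\<close>

lemma point_cost_le_dual_cost:
  assumes p: "prob_space p" "sets p = sets borel"
  shows "point_cost f x0 p \<le> dual_cost x0 p"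
proof (cases "dual_cost x0 p = \<infinity>")
  case False
  then obtain K where K: "0 \<le> K" "dual_cost x0 p = ennreal K" by (cases "dual_cost x0 p") auto
  interpret prob_space p by fact
  have cm: "v \<in> borel_measurable p" if "continuous_on UNIV v" for v :: "real^'n \<Rightarrow> real"
    using borel_measurable_continuous_onI[OF that] by (simp add: measurable_cong_sets[OF p(2) refl])
  have int: "integrable p (\<lambda>y. fst (apply_bcontfun z y))" for z :: "(real^'n) \<Rightarrow>\<^sub>C (real \<times> (real^'n^'n))"
    by (rule integrable_const_bound[of _ "norm z"])
       (auto intro!: cm continuous_intros AE_I2 pair_bcontfun_bounds)
  define S :: "((real^'n) \<Rightarrow>\<^sub>C (real \<times> (real^'n^'n))) set" where "S = {z. \<forall>y. snd (apply_bcontfun z y) \<in> polar_set f}"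
  define L0 where "L0 z = fst (apply_bcontfun z x0) - (\<integral>y. fst (apply_bcontfun z y) \<partial>p)" for z :: "(real^'n) \<Rightarrow>\<^sub>C (real \<times> (real^'n^'n))"
  obtain r where r: "r > 0" "\<And>B. norm B \<le> r \<Longrightarrow> B \<in> polar_set f" using polar_ball by blast
  have linL0: "linear L0" by (rule linearI) (auto simp: L0_def int algebra_simps)
  obtain \<Lambda> where \<Lambda>: "linear \<Lambda>" "\<And>w. w \<in> hessian_pairs \<Longrightarrow> \<Lambda> w = L0 w" "\<And>z. z \<in> S \<Longrightarrow> \<Lambda> z \<le> K"
  proof (rule Hahn_Banach_absorbing[of S hessian_pairs L0 K])
    show "convex S" unfolding S_def convex_def using convexD[OF polar_convex] by auto
    show "0 \<in> S" unfolding S_def using polar_zero by simp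
    \<comment> \<open>A ball of radius \<open>r\<close> in the polar set absorbs all bounded matrix-valued functions.\<close>
    show "\<exists>t>0. (1 / t) *\<^sub>R z \<in> S" for z :: "(real^'n) \<Rightarrow>\<^sub>C (real \<times> (real^'n^'n))"
    proof (intro exI[of _ "(norm z + 1) / r"] conjI)
      show "(norm z + 1) / r > 0" using r(1) by (simp add: add_nonneg_pos)
      have "norm ((1 / ((norm z + 1) / r)) *\<^sub>R snd (apply_bcontfun z y)) \<le> r" for y
      proof -
        have "norm (snd (apply_bcontfun z y)) \<le> norm z + 1" using pair_bcontfun_bounds(2)[of z y] by linarith
        then have "r / (norm z + 1) * norm (snd (apply_bcontfun z y)) \<le> r / (norm z + 1) * (norm z + 1)"
          using r(1) by (intro mult_left_mono) (auto simp: add_nonneg_pos)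
        also have "\<dots> = r" using norm_ge_zero[of z] by (simp add: add_nonneg_pos less_imp_neq[THEN not_sym])
        finally show ?thesis using r(1) by (simp add: add_nonneg_pos)
      qed
      then show "(1 / ((norm z + 1) / r)) *\<^sub>R z \<in> S" unfolding S_def using r(2) by simp
    qed
    show "L0 w \<le> K" if w: "w \<in> hessian_pairs" "w \<in> S" for w
    proof -
      obtain a u g h where c: "C2c u g h" and eq: "\<And>y. apply_bcontfun w y = (a + u y, (- 1/2) *\<^sub>R h y)"
        using w(1) unfolding hessian_pairs_def by auto
      have "(1/2) *\<^sub>R ((-1) *\<^sub>R h y) = (- 1/2) *\<^sub>R h y" for y by simp
      moreover have "(- 1/2) *\<^sub>R h y \<in> polar_set f" for y using w(2) eq[of y] unfolding S_def by (metis (mono_tags, lifting) mem_Collect_eq snd_conv)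
      ultimately have "(\<lambda>y. -1 * u y) \<in> admissible" unfolding admissible_def
        using C2c_scale[OF c, of "-1"] by (intro CollectI exI conjI) (assumption, simp only: simp_thms)
      then have "ennreal ((\<integral>y. -1 * u y \<partial>p) - -1 * u x0) \<le> dual_cost x0 p"
        unfolding dual_cost_def by (rule SUP_upper)
      then have "(\<integral>y. -1 * u y \<partial>p) - -1 * u x0 \<le> K" unfolding K(2) using K(1) by (simp add: ennreal_le_iff)
      moreover have "integrable p u"
        using int[of "C2c_pair 0 u h"] by (simp add: apply_C2c_pair[OF c])
      ultimately show ?thesis unfolding L0_def eq by (simp add: prob_space)
    qed
  qed (use subspace_hessian_pairs linL0 K in auto)
  \<comment> \<open>\<open>S\<close> contains all real multiples of \<open>inl \<gamma>\<close>, and a linear functional bounded above on a line vanishes on it.\<close>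
  have inl0: "\<Lambda> (inl \<gamma>) = 0" for \<gamma>
  proof -
    have le: "t * \<Lambda> (inl \<gamma>) \<le> K" for t
    proof -
      have "t *\<^sub>R inl \<gamma> \<in> S" unfolding S_def using polar_zero by simp
      then show ?thesis using \<Lambda>(3)[of "t *\<^sub>R inl \<gamma>"] linear_cmul[OF \<Lambda>(1), of t "inl \<gamma>"] by simp
    qed
    show ?thesis
    proof (rule ccontr)
      assume "\<Lambda> (inl \<gamma>) \<noteq> 0"
      then show False using le[of "(K + 1) / \<Lambda> (inl \<gamma>)"] by simp
    qed
  qed
  obtain \<tau> :: "(real^'n) measure" and \<theta> where t: "finite_measure \<tau>" "sets \<tau> = sets borel" "integrable \<tau> \<theta>"
    "\<And>a u g h \<gamma>. C2c u g h \<Longrightarrow> (\<And>y. apply_bcontfun \<gamma> y = a + u y) \<Longrightarrow>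
       \<Lambda> (C2c_pair a u h) = \<Lambda> (inl \<gamma>) - (\<integral>x. ((1/2) *\<^sub>R h x) \<bullet> \<theta> x \<partial>\<tau>)"
    "(\<integral>\<^sup>+x. sym_ext f (\<theta> x) \<partial>\<tau>) \<le> ennreal K"
    by (rule matrix_part_representation[OF \<Lambda>(1), of K]) (auto intro!: \<Lambda>(3) simp: S_def)
  have "static_equation x0 p \<tau> \<theta>" unfolding static_equation_def
  proof (intro allI impI)
    fix u :: "real^'n \<Rightarrow> real" and g h assume c: "C2c u g h"
    have "u \<in> bcontfun" using Cc_scaleR_bcontfun[OF C2c_Cc(1)[OF c], of "1::real"] by simp
    then have "\<Lambda> (C2c_pair 0 u h) = \<Lambda> (inl (Bcontfun u)) - (\<integral>x. ((1/2) *\<^sub>R h x) \<bullet> \<theta> x \<partial>\<tau>)"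
      by (intro t(4)[OF c]) (simp add: Bcontfun_inverse)
    moreover have "\<Lambda> (C2c_pair 0 u h) = u x0 - (\<integral>y. u y \<partial>p)"
      unfolding \<Lambda>(2)[OF C2c_pair_in[OF c]] L0_def by (simp add: apply_C2c_pair[OF c])
    ultimately show "(\<integral>x. u x \<partial>p) - u x0 = (\<integral>x. ((1/2) *\<^sub>R h x) \<bullet> \<theta> x \<partial>\<tau>)" unfolding inl0 by simp
  qed
  moreover have "(\<integral>\<^sup>+x. sym_ext f (\<theta> x) \<partial>\<tau>) < \<infinity>" using t(5) by (simp add: order_le_less_trans)
  ultimately have "point_cost f x0 p \<le> (\<integral>\<^sup>+x. sym_ext f (\<theta> x) \<partial>\<tau>)"
    by (intro point_cost_le_static(1)[OF _ p t(1-3)])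
  then show ?thesis unfolding K(2) using t(5) by (rule order_trans)
qed simp

theorem duality:
  assumes "prob_space p" "sets p = sets borel"
  shows "point_cost f x p = dual_cost x p"
  using point_cost_le_dual_cost[OF assms] dual_cost_le_point_cost by (rule antisym)

text \<open>Weak duality gives \<open>v x \<le> \<integral>v dp + G x p\<close> for these \<open>v\<close> and
  every \<open>p\<close>, so they bound the transform of \<open>\<phi>\<close> from below.\<close>

definition subsolutions :: "(real^'n \<Rightarrow> real) \<Rightarrow> (real^'n \<Rightarrow> real) set" where
  "subsolutions \<phi> = {v. \<exists>a u. v = (\<lambda>y. a + u y) \<and> (\<lambda>y. - u y) \<in> admissible \<and> (\<forall>y. v y \<le> \<phi> y)}"

text \<open>The same extension argument with the transform as dual problem: now the measure \<open>p\<close> is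
  unknown as well, the functional is evaluation of the first component at \<open>x0\<close>, and the first
  component is constrained by \<open>\<phi>\<close>. Riesz representation of the first component gives
  \<open>p\<close>; testing with \<open>bump R\<close>, whose Hessian tends to \<open>0\<close>, shows that no
  mass escapes to infinity. The bound \<open>c\<close> is shared between both components: \<open>s\<close> goes
  to \<open>\<integral>\<phi> dp\<close> and \<open>c - s\<close> to the cost.\<close>

lemma primal_attainment:
  fixes \<phi> :: "real^'n \<Rightarrow> real"
  assumes lsc: "lsc_on UNIV \<phi>" and b: "\<And>x. 1 \<le> \<phi> x" "\<And>x. \<phi> x \<le> M"
    and c: "\<And>v. v \<in> subsolutions \<phi> \<Longrightarrow> v x0 \<le> c"
  obtains p where "p \<in> P2" "ennreal (\<integral>y. \<phi> y \<partial>p) + point_cost f x0 p \<le> ennreal c"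
proof -
  have one_sub: "(\<lambda>_. 1) \<in> subsolutions \<phi>" unfolding subsolutions_def
    using b(1) zero_admissible by (intro CollectI exI[of _ 1] exI[of _ "\<lambda>_. 0"]) auto
  have c1: "1 \<le> c" using c[OF one_sub] .
  define S :: "((real^'n) \<Rightarrow>\<^sub>C (real \<times> (real^'n^'n))) set" where
    "S = {z. \<forall>y. fst (apply_bcontfun z y) \<le> \<phi> y \<and> snd (apply_bcontfun z y) \<in> polar_set f}"
  define L0 where "L0 z = fst (apply_bcontfun z x0)" for z :: "(real^'n) \<Rightarrow>\<^sub>C (real \<times> (real^'n^'n))"
  obtain r where r: "r > 0" "\<And>B. norm B \<le> r \<Longrightarrow> B \<in> polar_set f" using polar_ball by blast
  have linL0: "linear L0" by (rule linearI) (auto simp: L0_def)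
  obtain \<Lambda> where \<Lambda>: "linear \<Lambda>" "\<And>w. w \<in> hessian_pairs \<Longrightarrow> \<Lambda> w = L0 w" "\<And>z. z \<in> S \<Longrightarrow> \<Lambda> z \<le> c"
  proof (rule Hahn_Banach_absorbing[of S hessian_pairs L0 c])
    show "convex S" unfolding S_def
      using convexD[OF polar_convex] by (auto intro!: convexI convex_bound_le)
    show "0 \<in> S" unfolding S_def using polar_zero b(1) order_trans[OF zero_le_one b(1)] by simp
    show "\<exists>t>0. (1 / t) *\<^sub>R z \<in> S" for z :: "(real^'n) \<Rightarrow>\<^sub>C (real \<times> (real^'n^'n))"
    proof (intro exI[of _ "(norm z + 1) / min r 1"] conjI)
      let ?m = "min r 1"
      have m: "?m > 0" "?m \<le> 1" "?m \<le> r" using r(1) by auto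
      have nz: "norm z + 1 > 0" using norm_ge_zero[of z] by linarith
      show "(norm z + 1) / ?m > 0" using m(1) nz by simp
      have le: "?m / (norm z + 1) * q \<le> ?m" if "q \<le> norm z" for q
      proof -
        have "?m / (norm z + 1) * q \<le> ?m / (norm z + 1) * (norm z + 1)" using that m nz by (intro mult_left_mono) auto
        then show ?thesis using nz by simp
      qed
      have f: "fst (apply_bcontfun z y) \<le> norm z" "norm (snd (apply_bcontfun z y)) \<le> norm z" for y
        using pair_bcontfun_bounds[of z y] by (simp_all add: abs_le_iff)
      have "(1 / ((norm z + 1) / ?m)) *\<^sub>R snd (apply_bcontfun z y) \<in> polar_set f" for y
        using le[OF f(2)[of y]] m nz by (intro r(2)) simp
      moreover have "(1 / ((norm z + 1) / ?m)) * fst (apply_bcontfun z y) \<le> \<phi> y" for y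
        using le[OF f(1)[of y]] m(2) b(1)[of y] by simp
      ultimately show "(1 / ((norm z + 1) / ?m)) *\<^sub>R z \<in> S" unfolding S_def by simp
    qed
    show "L0 w \<le> c" if w: "w \<in> hessian_pairs" "w \<in> S" for w
    proof -
      obtain a u g h where cc: "C2c u g h" and eq: "\<And>y. apply_bcontfun w y = (a + u y, (- 1/2) *\<^sub>R h y)"
        using w(1) unfolding hessian_pairs_def by auto
      have "(1/2) *\<^sub>R ((-1) *\<^sub>R h y) = (- 1/2) *\<^sub>R h y" for y by simp
      moreover have "(- 1/2) *\<^sub>R h y \<in> polar_set f" for y using w(2) eq[of y] unfolding S_def by (metis (mono_tags, lifting) mem_Collect_eq snd_conv)
      ultimately have "(\<lambda>y. -1 * u y) \<in> admissible" unfolding admissible_def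
        using C2c_scale[OF cc, of "-1"] by (intro CollectI exI conjI) (assumption, simp only: simp_thms)
      then have "(\<lambda>y. - u y) \<in> admissible" by simp
      moreover have "a + u y \<le> \<phi> y" for y using w(2) eq[of y] unfolding S_def by (auto dest: spec[of _ y])
      ultimately have "(\<lambda>y. a + u y) \<in> subsolutions \<phi>" unfolding subsolutions_def by blast
      from c[OF this] show ?thesis unfolding L0_def eq by simp
    qed
  qed (use subspace_hessian_pairs linL0 c1 in auto)
  define em where "em g = inl (Bcontfun g)" for g :: "real^'n \<Rightarrow> real"
  have Cc_b: "g \<in> bcontfun" if "g \<in> Cc" for g :: "real^'n \<Rightarrow> real" using Cc_scaleR_bcontfun[OF that, of "1::real"] by simp
  have em: "apply_bcontfun (em g) y = (g y, 0)" if "g \<in> Cc" for g y unfolding em_def using Cc_b[OF that] by (simp add: Bcontfun_inverse)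
  have emS: "em g \<in> S" if "g \<in> Cc" "\<And>y. g y \<le> \<phi> y" for g unfolding S_def using em[OF that(1)] that(2) polar_zero by simp
  have em_scale: "em (\<lambda>x. s * g x) = s *\<^sub>R em g" if "g \<in> Cc" for s g
    by (rule bcontfun_eqI) (simp add: em that Cc_cmult)
  interpret L: bounded_positive_functional "\<lambda>g. \<Lambda> (em g)" c
  proof
    fix g h :: "real^'n \<Rightarrow> real" assume g: "g \<in> Cc"
    show "\<Lambda> (em (\<lambda>x. g x + h x)) = \<Lambda> (em g) + \<Lambda> (em h)" if h: "h \<in> Cc"
    proof -
      have "em (\<lambda>x. g x + h x) = em g + em h" by (rule bcontfun_eqI) (simp add: em g h Cc_add)
      then show ?thesis using linear_add[OF \<Lambda>(1)] by simp
    qed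
    show cm: "\<Lambda> (em (\<lambda>x. s * g x)) = s * \<Lambda> (em g)" for s
      using linear_cmul[OF \<Lambda>(1), of s "em g"] em_scale[OF g] by simp
    show "\<Lambda> (em g) \<le> c" if "\<And>x. g x \<le> 1" by (intro \<Lambda>(3) emS g order_trans[OF that b(1)])
    \<comment> \<open>All negative multiples of \<open>em g\<close> belong to \<open>S\<close>, where \<open>\<Lambda>\<close> is bounded above.\<close>
    show "0 \<le> \<Lambda> (em g)" if "\<And>x. 0 \<le> g x"
    proof (rule ccontr)
      assume n: "\<not> ?thesis"
      let ?t = "- ((c + 1) / \<Lambda> (em g))"
      have t: "?t \<ge> 0" using n c1 by (simp add: divide_nonneg_neg)
      have "em (\<lambda>x. - ?t * g x) \<in> S"
        using g that t b(1) order_trans[OF _ order_trans[OF zero_le_one b(1)]] mult_nonneg_nonneg[OF t that]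
        by (intro emS Cc_cmult) auto
      from \<Lambda>(3)[OF this] have "- ?t * \<Lambda> (em g) \<le> c" unfolding cm .
      then show False using n by simp
    qed
  qed
  define p where "p = L.repr"
  have sp: "sets p = sets borel" unfolding p_def by simp
  interpret p: finite_measure p unfolding p_def by (rule L.finite_measure_repr)
  have rep: "\<Lambda> (em g) = (\<integral>x. g x \<partial>p)" "integrable p g" if "g \<in> Cc" for g
    unfolding p_def using that by (rule L.representation, rule L.integrable_repr)
  \<comment> \<open>The value \<open>s\<close> is the integral of \<open>\<phi>\<close>, seen from below by continuous functions; adding the two components in \<open>S\<close>
    leaves \<open>c - s\<close> for the matrix part.\<close>
  define G where "G = {g \<in> Cc. \<forall>y. g y \<le> \<phi> y}"
  define s where "s = (SUP g\<in>G. \<integral>x. g x \<partial>p)"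
  have G0: "(\<lambda>_. 0) \<in> G" unfolding G_def using Cc_zero order_trans[OF zero_le_one b(1)] by auto
  have Gc: "(\<integral>x. g x \<partial>p) \<le> c" if "g \<in> G" for g using \<Lambda>(3)[OF emS[of g]] that rep(1)[of g] unfolding G_def by simp
  have bddG: "bdd_above ((\<lambda>g. \<integral>x. g x \<partial>p) ` G)" by (rule bdd_aboveI2[of _ _ c]) (rule Gc)
  have s_up: "(\<integral>x. g x \<partial>p) \<le> s" if "g \<in> G" for g unfolding s_def by (rule cSUP_upper[OF that bddG])
  have s0: "0 \<le> s" using s_up[OF G0] by simp
  have s_bd: "s \<le> c - \<Lambda> (inr \<psi>)" if \<psi>: "\<And>x. apply_bcontfun \<psi> x \<in> polar_set f" for \<psi>
    unfolding s_def
  proof (rule cSUP_least)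
    show "G \<noteq> {}" using G0 by blast
    fix g assume g: "g \<in> G"
    then have gC: "g \<in> Cc" "\<And>y. g y \<le> \<phi> y" unfolding G_def by auto
    have "em g + inr \<psi> \<in> S" unfolding S_def using em[OF gC(1)] gC(2) \<psi> by simp
    from \<Lambda>(3)[OF this] show "(\<integral>x. g x \<partial>p) \<le> c - \<Lambda> (inr \<psi>)"
      using linear_add[OF \<Lambda>(1), of "em g" "inr \<psi>"] rep(1)[OF gC(1)] by simp
  qed
  obtain \<tau> :: "(real^'n) measure" and \<theta> where t: "finite_measure \<tau>" "sets \<tau> = sets borel" "integrable \<tau> \<theta>"
    "\<And>a u g h \<gamma>. C2c u g h \<Longrightarrow> (\<And>y. apply_bcontfun \<gamma> y = a + u y) \<Longrightarrow>
       \<Lambda> (C2c_pair a u h) = \<Lambda> (inl \<gamma>) - (\<integral>x. ((1/2) *\<^sub>R h x) \<bullet> \<theta> x \<partial>\<tau>)"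
    "(\<integral>\<^sup>+x. sym_ext f (\<theta> x) \<partial>\<tau>) \<le> ennreal (c - s)"
  proof (rule matrix_part_representation[OF \<Lambda>(1), of "c - s"])
    fix \<psi> :: "(real^'n) \<Rightarrow>\<^sub>C (real^'n^'n)" assume "\<And>x. apply_bcontfun \<psi> x \<in> polar_set f"
    from s_bd[OF this] show "\<Lambda> (inr \<psi>) \<le> c - s" by simp
  next
    fix \<tau> :: "(real^'n) measure" and \<theta>
    assume "finite_measure \<tau>" "sets \<tau> = sets borel" "integrable \<tau> \<theta>"
      "\<And>a u g h \<gamma>. C2c u g h \<Longrightarrow> (\<And>y. apply_bcontfun \<gamma> y = a + u y) \<Longrightarrow>
       \<Lambda> (C2c_pair a u h) = \<Lambda> (inl \<gamma>) - (\<integral>x. ((1/2) *\<^sub>R h x) \<bullet> \<theta> x \<partial>\<tau>)"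
      "(\<integral>\<^sup>+x. sym_ext f (\<theta> x) \<partial>\<tau>) \<le> ennreal (c - s)"
    then show thesis by (rule that)
  qed
  have stat: "static_equation x0 p \<tau> \<theta>" unfolding static_equation_def
  proof (intro allI impI)
    fix u :: "real^'n \<Rightarrow> real" and g h assume cc: "C2c u g h"
    have uC: "u \<in> Cc" by (rule C2c_Cc(1)[OF cc])
    have "\<Lambda> (C2c_pair 0 u h) = \<Lambda> (inl (Bcontfun u)) - (\<integral>x. ((1/2) *\<^sub>R h x) \<bullet> \<theta> x \<partial>\<tau>)"
      using Cc_b[OF uC] by (intro t(4)[OF cc]) (simp add: Bcontfun_inverse)
    moreover have "\<Lambda> (C2c_pair 0 u h) = u x0"
      unfolding \<Lambda>(2)[OF C2c_pair_in[OF cc]] L0_def by (simp add: apply_C2c_pair[OF cc])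
    ultimately show "(\<integral>x. u x \<partial>p) - u x0 = (\<integral>x. ((1/2) *\<^sub>R h x) \<bullet> \<theta> x \<partial>\<tau>)"
      using rep(1)[OF uC] unfolding em_def by simp
  qed
  have [measurable]: "\<theta> \<in> borel_measurable \<tau>" using t(3) by auto
  \<comment> \<open>Compactly supported functions alone would allow part of the mass to escape. Testing the equation with \<open>bump R\<close> as
    \<open>R \<longlonglongrightarrow> \<infinity>\<close> gives total mass 1, the limit of \<open>bump R x0\<close>.\<close>
  have prob: "prob_space p"
  proof
    let ?b = "\<lambda>m. bump (real (Suc m)) :: real^'n \<Rightarrow> real" and ?h = "\<lambda>m. bump_hess (real (Suc m)) :: real^'n \<Rightarrow> _"
    have cb: "C2c (?b m) (bump_grad (real (Suc m))) (?h m)" for m by (rule C2c_bump) simp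
    have bm: "?b m \<in> borel_measurable p" for m
      using Cc_measurable[OF C2c_Cc(1)[OF cb[of m]]] by (simp add: measurable_cong_sets[OF sp refl])
    have hm[measurable]: "?h m \<in> borel_measurable \<tau>" for m
      using borel_measurable_continuous_onI[OF C2D(5)[OF C2_bump]] by (simp add: measurable_cong_sets[OF t(2) refl])
    have 1: "(\<lambda>m. \<integral>x. ?b m x \<partial>p) \<longlonglongrightarrow> (\<integral>x. 1 \<partial>p)"
      by (rule integral_dominated_convergence[where w = "\<lambda>_. 1"])
         (auto intro: bm bump_tendsto simp: bump_bounds abs_of_nonneg simp del: of_nat_Suc)
    let ?C = "6 * norm (mat 1 :: real^'n^'n) + 24"
    have "(\<lambda>m. \<integral>x. ((1/2) *\<^sub>R ?h m x) \<bullet> \<theta> x \<partial>\<tau>) \<longlonglongrightarrow> (\<integral>x. ((1/2) *\<^sub>R 0) \<bullet> \<theta> x \<partial>\<tau>)"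
    proof (rule integral_dominated_convergence[where w = "\<lambda>x. ?C * norm (\<theta> x)"])
      show "AE x in \<tau>. (\<lambda>m. ((1/2) *\<^sub>R ?h m x) \<bullet> \<theta> x) \<longlonglongrightarrow> ((1/2) *\<^sub>R 0) \<bullet> \<theta> x"
        by (intro AE_I2 tendsto_intros bump_hess_tendsto)
      show "AE x in \<tau>. norm (((1/2) *\<^sub>R ?h m x) \<bullet> \<theta> x) \<le> ?C * norm (\<theta> x)" for m
      proof (rule AE_I2)
        fix x
        have "norm (?h m x) \<le> ?C / (real (Suc m))\<^sup>2" by (rule bump_hess_bound) simp
        also have "\<dots> \<le> ?C / 1" by (intro divide_left_mono) (auto simp: one_le_power)
        finally have hb: "norm (?h m x) \<le> ?C" by simp
        have "norm (((1/2) *\<^sub>R ?h m x) \<bullet> \<theta> x) \<le> norm ((1/2) *\<^sub>R ?h m x) * norm (\<theta> x)" using Cauchy_Schwarz_ineq2 by simp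
        also have "\<dots> \<le> norm (?h m x) * norm (\<theta> x)" by (intro mult_right_mono) auto
        also have "\<dots> \<le> ?C * norm (\<theta> x)" by (rule mult_right_mono[OF hb]) simp
        finally show "norm (((1/2) *\<^sub>R ?h m x) \<bullet> \<theta> x) \<le> ?C * norm (\<theta> x)" .
      qed
      show "integrable \<tau> (\<lambda>x. ?C * norm (\<theta> x))" using t(3) by simp
    qed measurable
    then have "(\<lambda>m. ?b m x0 + (\<integral>x. ((1/2) *\<^sub>R ?h m x) \<bullet> \<theta> x \<partial>\<tau>)) \<longlonglongrightarrow> 1 + 0"
      by (intro tendsto_add bump_tendsto) simp
    moreover have "?b m x0 + (\<integral>x. ((1/2) *\<^sub>R ?h m x) \<bullet> \<theta> x \<partial>\<tau>) = (\<integral>x. ?b m x \<partial>p)" for m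
      using stat[unfolded static_equation_def, rule_format, OF cb[of m]] by linarith
    ultimately have "measure p (space p) = 1" using LIMSEQ_unique[OF 1] by simp
    then show "emeasure p (space p) = 1" by (simp add: p.emeasure_eq_measure)
  qed
  have fin: "(\<integral>\<^sup>+x. sym_ext f (\<theta> x) \<partial>\<tau>) < \<infinity>" using t(5) by (simp add: order_le_less_trans)
  note cost = point_cost_le_static[OF stat prob sp t(1-3) fin]
  have "(\<integral>y. \<phi> y \<partial>p) \<le> s"
  proof -
    obtain w where w: "\<And>n. continuous_on UNIV (w n)" "\<And>n x. 0 \<le> w n x" "\<And>n x. w n x \<le> \<phi> x" "\<And>x. (\<lambda>n. w n x) \<longlonglongrightarrow> \<phi> x"
      using bounded_lsc_approximation[OF lsc order_trans[OF zero_le_one b(1)] b(2)] by metis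
    let ?g = "\<lambda>n x. bump (real (Suc n)) x * w n x"
    have cb: "C2c (bump (real (Suc m))) (bump_grad (real (Suc m))) (bump_hess (real (Suc m)) :: real^'n \<Rightarrow> _)" for m by (rule C2c_bump) simp
    have gC: "?g n \<in> Cc" for n
      by (rule Cc_I[OF C2c_Cc(1)[OF cb[of n]]]) (auto intro!: continuous_intros w(1) C2D(3)[OF C2_bump])
    have gle: "?g n x \<le> \<phi> x" for n x
      using mult_mono[OF bump_bounds(2) w(3) zero_le_one w(2), of "real (Suc n)" x n] by simp
    have g0: "0 \<le> ?g n x" for n x by (intro mult_nonneg_nonneg bump_bounds w)
    have glim: "(\<lambda>n. ?g n x) \<longlonglongrightarrow> \<phi> x" for x using tendsto_mult[OF bump_tendsto[of x] w(4)[of x]] by simp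
    have gm: "?g n \<in> borel_measurable p" for n using Cc_measurable[OF gC[of n]] by (simp add: measurable_cong_sets[OF sp refl])
    have "(\<lambda>n. \<integral>x. ?g n x \<partial>p) \<longlonglongrightarrow> (\<integral>x. \<phi> x \<partial>p)"
    proof (rule integral_dominated_convergence[where w = "\<lambda>_. M"])
      show "\<phi> \<in> borel_measurable p" by (rule borel_measurable_LIMSEQ_real[OF glim gm])
      show "AE x in p. norm (?g n x) \<le> M" for n using g0 order_trans[OF gle b(2)] by (intro AE_I2) (simp add: abs_of_nonneg del: of_nat_Suc)
    qed (use gm glim in auto)
    moreover have "?g n \<in> G" for n unfolding G_def using gC gle by auto
    ultimately show ?thesis using s_up by (intro LIMSEQ_le_const2) auto
  qed
  then have "ennreal (\<integral>y. \<phi> y \<partial>p) + point_cost f x0 p \<le> ennreal s + ennreal (c - s)"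
    using cost(1) t(5) by (intro add_mono ennreal_leI) auto
  also have "\<dots> = ennreal c"
  proof -
    have "\<Lambda> (inr 0) \<le> c - s" using s_bd[of 0] polar_zero by simp
    moreover have "inr 0 = 0" by (rule linear_0[OF linear_inr])
    ultimately have "0 \<le> c - s" using linear_0[OF \<Lambda>(1)] by simp
    then show ?thesis using s0 by (simp add: ennreal_plus[symmetric] del: ennreal_plus)
  qed
  finally show ?thesis using that cost(2) by blast
qed

end


section \<open>Triangle inequalities\<close>

lemma P2D: "p \<in> P2 \<Longrightarrow> prob_space p" "p \<in> P2 \<Longrightarrow> sets p = sets borel"
  unfolding P2_def by auto

lemma return_P2: "return borel (x::real^'n) \<in> P2"
proof -
  have "(\<integral>\<^sup>+y. ennreal ((norm y)\<^sup>2) \<partial>return borel x) = ennreal ((norm x)\<^sup>2)" by (rule nn_integral_return) auto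
  then show ?thesis unfolding P2_def by (auto intro: prob_space_return)
qed

lemma ennreal_add_le: "ennreal (a + b) \<le> ennreal a + ennreal b"
  by (auto simp: ennreal_plus_if intro: ennreal_leI)

context integrand
begin

lemma point_cost_return: "point_cost f x (return borel x) = 0"
proof -
  have "ennreal ((\<integral>y. u y \<partial>return borel x) - u x) = 0" if "u \<in> admissible" for u
    using integral_return_borel[of u x] Cc_measurable[OF admissible_Cc[OF that]] by simp
  then have "dual_cost x (return borel x) \<le> 0" unfolding dual_cost_def by (intro SUP_least) simp
  then show ?thesis using duality[of "return borel x" x] by (simp add: prob_space_return)
qed

lemma admissible_le_point_cost: "u \<in> admissible \<Longrightarrow> ennreal ((\<integral>y. u y \<partial>p) - u x) \<le> point_cost f x p"
  using dual_cost_le_point_cost[of x p] SUP_upper[of u admissible "\<lambda>u. ennreal ((\<integral>y. u y \<partial>p) - u x)"]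
  unfolding dual_cost_def by (meson order_trans)

text \<open>In the dual formula \<open>\<integral>u d(M \<bind> \<kappa>) - u x\<close> is the sum of
  \<open>\<integral>u dM - u x\<close> and of the \<open>M\<close>-integral of
  \<open>\<integral>u d\<kappa>\<^sub>y - u y\<close>, and each part is bounded by the corresponding cost.
  Gluing the fluxes themselves would require selecting them measurably in \<open>y\<close>.\<close>

lemma point_cost_bind:
  fixes M :: "(real^'n) measure"
  assumes M: "prob_space M" and id: "(\<lambda>y. y) \<in> borel_measurable M" and \<kappa>: "\<kappa> \<in> M \<rightarrow>\<^sub>M prob_algebra borel"
  shows "point_cost f x (M \<bind> \<kappa>) \<le> point_cost f x (distr M borel (\<lambda>y. y)) + (\<integral>\<^sup>+y. point_cost f y (\<kappa> y) \<partial>M)"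
proof -
  interpret prob_space M by fact
  have \<kappa>s: "\<kappa> \<in> M \<rightarrow>\<^sub>M subprob_algebra borel" by (rule measurable_prob_algebraD[OF \<kappa>])
  have \<kappa>p: "prob_space (\<kappa> y)" if "y \<in> space M" for y
    using measurable_space[OF \<kappa> that] by (simp add: space_prob_algebra)
  have pr: "prob_space (M \<bind> \<kappa>)" using \<kappa>p by (intro prob_space_bind[OF _ \<kappa>s] AE_I2)
  have se: "sets (M \<bind> \<kappa>) = sets borel" by (rule sets_bind[OF sets_kernel[OF \<kappa>s] not_empty])
  have "dual_cost x (M \<bind> \<kappa>) \<le> point_cost f x (distr M borel (\<lambda>y. y)) + (\<integral>\<^sup>+y. point_cost f y (\<kappa> y) \<partial>M)"
    unfolding dual_cost_def
  proof (rule SUP_least)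
    fix u assume u: "u \<in> admissible"
    have um: "u \<in> borel_measurable borel" by (rule Cc_measurable[OF admissible_Cc[OF u]])
    obtain B where B: "\<And>y. \<bar>u y\<bar> \<le> B" using Cc_bounded[OF admissible_Cc[OF u]] by blast
    have uM: "u \<in> borel_measurable M" using measurable_compose[OF id um] .
    have iu: "integrable M u" by (rule integrable_const_bound[of _ B]) (auto simp: B uM)
    define U where "U y = (\<integral>z. u z \<partial>\<kappa> y)" for y
    have Um: "U \<in> borel_measurable M" unfolding U_def[abs_def]
      by (rule measurable_compose[OF \<kappa>s integral_measurable_subprob_algebra[OF um]])
    have Ub: "\<bar>U y\<bar> \<le> B" if "y \<in> space M" for y
    proof -
      interpret k: prob_space "\<kappa> y" by (rule \<kappa>p[OF that])
      have "\<bar>U y\<bar> \<le> (\<integral>z. \<bar>u z\<bar> \<partial>\<kappa> y)" unfolding U_def by (rule integral_abs_bound)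
      also have "\<dots> \<le> (\<integral>z. B \<partial>\<kappa> y)"
        by (rule integral_mono_AE') (use B order_trans[OF abs_ge_zero B] in auto)
      finally show ?thesis by (simp add: k.prob_space)
    qed
    have iU: "integrable M U" by (rule integrable_const_bound[of _ B]) (auto simp: Ub Um)
    have "(\<integral>y. u y \<partial>(M \<bind> \<kappa>)) = (\<integral>y. U y \<partial>M)" unfolding U_def
    proof (rule integral_bind[OF um B \<kappa>s finite_measure_axioms])
      show "AE y in M. emeasure (\<kappa> y) (space (\<kappa> y)) \<le> ennreal 1"
        using prob_space.emeasure_space_1[OF \<kappa>p] by (intro AE_I2) simp
    qed
    then have "(\<integral>y. u y \<partial>(M \<bind> \<kappa>)) - u x = ((\<integral>y. u y \<partial>M) - u x) + (\<integral>y. U y - u y \<partial>M)"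
      using iU iu by simp
    also have "(\<integral>y. u y \<partial>M) = (\<integral>y. u y \<partial>distr M borel (\<lambda>y. y))" by (rule integral_distr[OF id um, symmetric])
    finally have split: "(\<integral>y. u y \<partial>(M \<bind> \<kappa>)) - u x =
        ((\<integral>y. u y \<partial>distr M borel (\<lambda>y. y)) - u x) + (\<integral>y. U y - u y \<partial>M)" .
    have "ennreal ((\<integral>y. u y \<partial>(M \<bind> \<kappa>)) - u x) \<le>
        ennreal ((\<integral>y. u y \<partial>distr M borel (\<lambda>y. y)) - u x) + ennreal (\<integral>y. U y - u y \<partial>M)"
      unfolding split by (rule ennreal_add_le)
    also have "\<dots> \<le> point_cost f x (distr M borel (\<lambda>y. y)) + (\<integral>\<^sup>+y. point_cost f y (\<kappa> y) \<partial>M)"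
    proof (rule add_mono[OF admissible_le_point_cost[OF u]], rule ennreal_integral_le_nn_integral, rule AE_I2)
      fix y show "ennreal (U y - u y) \<le> point_cost f y (\<kappa> y)" unfolding U_def by (rule admissible_le_point_cost[OF u])
    qed
    finally show "ennreal ((\<integral>y. u y \<partial>(M \<bind> \<kappa>)) - u x) \<le> point_cost f x (distr M borel (\<lambda>y. y)) + (\<integral>\<^sup>+y. point_cost f y (\<kappa> y) \<partial>M)" .
  qed
  then show ?thesis using duality[OF pr se] by simp
qed

text \<open>By uniform approximation the dual formula is a countable supremum.\<close>

lemma point_cost_measurable:
  assumes \<kappa>: "\<kappa> \<in> borel \<rightarrow>\<^sub>M prob_algebra borel"
  shows "(\<lambda>x. point_cost f x (\<kappa> x)) \<in> borel_measurable borel"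
proof -
  obtain D where D: "countable D" "D \<subseteq> admissible" "\<And>u e. u \<in> admissible \<Longrightarrow> e > 0 \<Longrightarrow> \<exists>v\<in>D. \<forall>x. \<bar>u x - v x\<bar> \<le> e"
    using countable_uniformly_dense[of admissible] admissible_Cc by blast
  have \<kappa>p: "prob_space (\<kappa> x)" "sets (\<kappa> x) = sets borel" for x
    using measurable_space[OF \<kappa>, of x] by (auto simp: space_prob_algebra)
  have eq: "point_cost f x (\<kappa> x) = (SUP u\<in>D. ennreal ((\<integral>y. u y \<partial>\<kappa> x) - u x))" for x
    unfolding duality[OF \<kappa>p] dual_cost_def
  proof (rule antisym[OF SUP_least SUP_subset_mono])
    fix u assume u: "u \<in> admissible"
    show "ennreal ((\<integral>y. u y \<partial>\<kappa> x) - u x) \<le> (SUP u\<in>D. ennreal ((\<integral>y. u y \<partial>\<kappa> x) - u x))"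
    proof (rule ennreal_le_epsilon)
      fix e :: real assume e: "e > 0"
      obtain v where v: "v \<in> D" "\<And>x. \<bar>u x - v x\<bar> \<le> e/2" using D(3)[OF u, of "e/2"] e by auto
      interpret k: prob_space "\<kappa> x" by (rule \<kappa>p)
      have i: "integrable (\<kappa> x) w" if "w \<in> admissible" for w
      proof -
        have wC: "w \<in> Cc" by (rule admissible_Cc[OF that])
        obtain B where B: "\<And>y. \<bar>w y\<bar> \<le> B" using Cc_bounded[OF wC] by blast
        have "w \<in> borel_measurable (\<kappa> x)" using Cc_measurable[OF wC] by (simp add: measurable_cong_sets[OF \<kappa>p(2) refl])
        then show ?thesis by (intro k.integrable_const_bound[of _ B]) (auto simp: B)
      qed
      have iv: "integrable (\<kappa> x) v" using i v(1) D(2) by blast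
      have "(\<integral>y. u y \<partial>\<kappa> x) \<le> (\<integral>y. v y + e/2 \<partial>\<kappa> x)"
      proof (rule integral_mono[OF i[OF u]])
        show "integrable (\<kappa> x) (\<lambda>y. v y + e/2)" using iv by simp
        fix y show "u y \<le> v y + e/2" using v(2)[of y] by linarith
      qed
      also have "\<dots> = (\<integral>y. v y \<partial>\<kappa> x) + e/2" using iv by (simp add: k.prob_space)
      finally have "(\<integral>y. u y \<partial>\<kappa> x) - u x \<le> ((\<integral>y. v y \<partial>\<kappa> x) - v x) + e" using v(2)[of x] by linarith
      then have "ennreal ((\<integral>y. u y \<partial>\<kappa> x) - u x) \<le> ennreal (((\<integral>y. v y \<partial>\<kappa> x) - v x) + e)" by (rule ennreal_leI)
      also have "\<dots> \<le> ennreal ((\<integral>y. v y \<partial>\<kappa> x) - v x) + ennreal e" by (rule ennreal_add_le)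
      also have "\<dots> \<le> (SUP u\<in>D. ennreal ((\<integral>y. u y \<partial>\<kappa> x) - u x)) + ennreal e"
        by (intro add_right_mono SUP_upper v(1))
      finally show "ennreal ((\<integral>y. u y \<partial>\<kappa> x) - u x) \<le> (SUP u\<in>D. ennreal ((\<integral>y. u y \<partial>\<kappa> x) - u x)) + ennreal e" .
    qed
  qed (use D(2) in auto)
  have "(\<lambda>x. SUP u\<in>D. ennreal ((\<integral>y. u y \<partial>\<kappa> x) - u x)) \<in> borel_measurable borel"
  proof (rule borel_measurable_SUP[OF D(1)])
    fix u assume "u \<in> D"
    then have um: "u \<in> borel_measurable borel" using D(2) Cc_measurable[OF admissible_Cc] by blast
    have "(\<lambda>x. \<integral>y. u y \<partial>\<kappa> x) \<in> borel_measurable borel"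
      by (rule measurable_compose[OF measurable_prob_algebraD[OF \<kappa>] integral_measurable_subprob_algebra[OF um]])
    then show "(\<lambda>x. ennreal ((\<integral>y. u y \<partial>\<kappa> x) - u x)) \<in> borel_measurable borel" using um by measurable
  qed
  then show ?thesis unfolding eq .
qed

text \<open>The mixture identity for a set \<open>E\<close> and for its complement forces
  \<open>y \<mapsto> \<kappa> y E\<close> to be measurable for the completion of \<open>p\<close>. Hence
  \<open>\<nu>\<close> is the composition of \<open>p\<close> with a measurable kernel, and the previous bound
  applies.\<close>

theorem kernel_triangle_inequality:
  fixes \<nu> p :: "(real^'n) measure"
  assumes \<nu>: "\<nu> \<in> P2" and p: "p \<in> P2" and \<kappa>: "\<And>y. \<kappa> y \<in> P2" and mix: "mixture p \<kappa> \<nu>"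
  shows "point_cost f x \<nu> \<le> point_cost f x p + (\<integral>\<^sup>+y. point_cost f y (\<kappa> y) \<partial>completion p)"
proof -
  let ?M = "completion p"
  interpret p: prob_space p by (rule P2D[OF p])
  interpret N: prob_space \<nu> by (rule P2D[OF \<nu>])
  note sp = P2D(2)[OF p] and s\<nu> = P2D(2)[OF \<nu>]
  have M: "prob_space ?M" by standard (simp add: p.emeasure_space_1)
  have id_p: "(\<lambda>y. y) \<in> borel_measurable p" by (simp add: measurable_cong_sets[OF sp refl])
  have id: "(\<lambda>y. y) \<in> borel_measurable ?M" by (rule measurable_completion[OF id_p])
  have meas: "(\<lambda>y. emeasure (\<kappa> y) E) \<in> borel_measurable ?M" if E: "E \<in> sets borel" for E
  proof (rule measurable_of_complementary_integrals[where w' = "\<lambda>y. emeasure (\<kappa> y) (- E)"])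
    show "prob_space p" by (rule p.prob_space_axioms)
    show "emeasure (\<kappa> y) E + emeasure (\<kappa> y) (- E) = 1" for y
    proof -
      interpret k: prob_space "\<kappa> y" by (rule P2D[OF \<kappa>])
      have sk: "sets (\<kappa> y) = sets borel" by (rule P2D[OF \<kappa>])
      have "emeasure (\<kappa> y) E + emeasure (\<kappa> y) (- E) = emeasure (\<kappa> y) (E \<union> - E)"
        by (rule plus_emeasure) (use E sk in auto)
      then show ?thesis using k.emeasure_space_1 sets_eq_imp_space_eq[OF sk] by simp
    qed
    have "(\<integral>\<^sup>+y. emeasure (\<kappa> y) E \<partial>p) + (\<integral>\<^sup>+y. emeasure (\<kappa> y) (- E) \<partial>p) = emeasure \<nu> E + emeasure \<nu> (- E)"
      using mix E unfolding mixture_def by (simp add: nn_integral_completion)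
    also have "\<dots> = emeasure \<nu> (E \<union> - E)" by (rule plus_emeasure) (use E s\<nu> in auto)
    finally show "(\<integral>\<^sup>+y. emeasure (\<kappa> y) E \<partial>p) + (\<integral>\<^sup>+y. emeasure (\<kappa> y) (- E) \<partial>p) = 1"
      using N.emeasure_space_1 sets_eq_imp_space_eq[OF s\<nu>] by simp
  qed
  have \<kappa>m: "\<kappa> \<in> ?M \<rightarrow>\<^sub>M prob_algebra borel"
    by (intro measurable_prob_algebraI measurable_subprob_algebra prob_space_imp_subprob_space P2D[OF \<kappa>] meas)
  have \<nu>_eq: "\<nu> = ?M \<bind> \<kappa>"
  proof (rule measure_eqI)
    have "space ?M \<noteq> {}" by (rule prob_space.not_empty[OF M])
    then show "sets \<nu> = sets (?M \<bind> \<kappa>)" using s\<nu> P2D(2)[OF \<kappa>] by (subst sets_bind) auto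
    fix E assume "E \<in> sets \<nu>"
    then have E: "E \<in> sets borel" using s\<nu> by simp
    show "emeasure \<nu> E = emeasure (?M \<bind> \<kappa>) E"
      using mix E emeasure_bind[OF prob_space.not_empty[OF M] measurable_prob_algebraD[OF \<kappa>m] E] unfolding mixture_def by simp
  qed
  have "distr ?M borel (\<lambda>y. y) = distr p borel (\<lambda>y. y)" by (rule distr_completion[OF id_p])
  also have "\<dots> = p" by (rule distr_id2) (simp add: sp)
  finally have "distr ?M borel (\<lambda>y. y) = p" .
  then show ?thesis using point_cost_bind[OF M id \<kappa>m, of x] unfolding \<nu>_eq by simp
qed

lemma disintegration_bind:
  assumes \<mu>: "prob_space \<mu>" "sets \<mu> = sets borel" and \<gamma>: "\<gamma> \<in> couplings \<mu> \<nu>" and d: "disintegration \<gamma> \<mu> \<kappa>"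
  shows "\<nu> = \<mu> \<bind> \<kappa>" "\<kappa> \<in> borel \<rightarrow>\<^sub>M prob_algebra borel"
proof -
  interpret prob_space \<mu> by fact
  have \<kappa>: "\<kappa> \<in> \<mu> \<rightarrow>\<^sub>M prob_algebra borel" using d unfolding disintegration_def by blast
  then show "\<kappa> \<in> borel \<rightarrow>\<^sub>M prob_algebra borel" by (simp add: measurable_cong_sets[OF \<mu>(2) refl])
  note \<kappa>s = measurable_prob_algebraD[OF \<kappa>]
  have g: "sets \<gamma> = sets borel" "distr \<gamma> borel snd = \<nu>" using \<gamma> unfolding couplings_def by auto
  have sn: "sets \<nu> = sets borel" using g(2) by (metis sets_distr)
  have sm: "snd \<in> borel_measurable \<gamma>"
    using borel_measurable_continuous_onI[OF continuous_on_snd[OF continuous_on_id]] by (simp add: measurable_cong_sets[OF g(1) refl])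
  show "\<nu> = \<mu> \<bind> \<kappa>"
  proof (rule measure_eqI)
    show "sets \<nu> = sets (\<mu> \<bind> \<kappa>)" using sn sets_bind[OF sets_kernel[OF \<kappa>s] not_empty] by simp
    fix E assume "E \<in> sets \<nu>"
    then have E: "E \<in> sets borel" using sn by simp
    have "emeasure \<nu> E = emeasure \<gamma> (snd -` E)"
      using emeasure_distr[OF sm E] unfolding g(2) sets_eq_imp_space_eq[OF g(1)] by simp
    also have "\<dots> = (\<integral>\<^sup>+x. emeasure (\<kappa> x) (Pair x -` snd -` E) \<partial>\<mu>)"
    proof -
      have "snd -` E \<in> sets \<gamma>" using measurable_sets[OF sm E] unfolding sets_eq_imp_space_eq[OF g(1)] by simp
      then show ?thesis using d unfolding disintegration_def by blast
    qed
    also have "\<dots> = emeasure (\<mu> \<bind> \<kappa>) E" unfolding emeasure_bind[OF not_empty \<kappa>s E] by (simp add: vimage_def)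
    finally show "emeasure \<nu> E = emeasure (\<mu> \<bind> \<kappa>) E" .
  qed
qed

lemma ex_coupling_of_kernel:
  assumes \<mu>: "prob_space \<mu>" "sets \<mu> = sets borel" and \<kappa>: "\<kappa> \<in> borel \<rightarrow>\<^sub>M prob_algebra (borel :: (real^'n) measure)"
  obtains \<gamma> where "\<gamma> \<in> couplings \<mu> (\<mu> \<bind> \<kappa>)" "disintegration \<gamma> \<mu> \<kappa>"
proof -
  interpret prob_space \<mu> by fact
  have \<kappa>m: "\<kappa> \<in> \<mu> \<rightarrow>\<^sub>M prob_algebra borel" using \<kappa> by (simp add: measurable_cong_sets[OF \<mu>(2) refl])
  note \<kappa>s = measurable_prob_algebraD[OF \<kappa>m]
  have sp: "space \<mu> = UNIV" using sets_eq_imp_space_eq[OF \<mu>(2)] by simp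
  have kp: "prob_space (\<kappa> x)" "sets (\<kappa> x) = sets borel" for x using measurable_space[OF \<kappa>, of x] by (auto simp: space_prob_algebra)
  define k where "k x = distr (\<kappa> x) (borel :: ((real^'n) \<times> (real^'n)) measure) (Pair x)" for x
  have pm: "Pair x \<in> \<kappa> x \<rightarrow>\<^sub>M borel" for x
    using borel_measurable_continuous_onI[OF continuous_on_Pair[OF continuous_on_const continuous_on_id], of x] 
    by (simp add: measurable_cong_sets[OF kp(2) refl])
  have k: "k \<in> \<mu> \<rightarrow>\<^sub>M subprob_algebra borel" unfolding k_def
  proof (rule measurable_distr2[OF _ \<kappa>s])
    have s: "sets (\<mu> \<Otimes>\<^sub>M (borel :: (real^'n) measure)) = sets (borel \<Otimes>\<^sub>M borel)" by (rule sets_pair_measure_cong) (auto simp: \<mu>)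
    show "case_prod Pair \<in> \<mu> \<Otimes>\<^sub>M borel \<rightarrow>\<^sub>M (borel :: ((real^'n) \<times> (real^'n)) measure)"
      unfolding measurable_cong_sets[OF s refl] borel_prod by simp
  qed
  define \<gamma> where "\<gamma> = \<mu> \<bind> k"
  have s\<gamma>: "sets \<gamma> = sets borel" unfolding \<gamma>_def by (rule sets_bind[OF sets_kernel[OF k] not_empty])
  have em: "emeasure \<gamma> E = (\<integral>\<^sup>+x. emeasure (\<kappa> x) (Pair x -` E) \<partial>\<mu>)" if "E \<in> sets borel" for E
    unfolding \<gamma>_def emeasure_bind[OF not_empty k that]
    by (intro nn_integral_cong) (simp add: k_def emeasure_distr[OF pm that] sets_eq_imp_space_eq[OF kp(2)])
  have pr: "prob_space \<gamma>" unfolding \<gamma>_def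
    by (rule prob_space_bind[OF _ k]) (auto simp: k_def intro!: prob_space.prob_space_distr kp pm)
  have fm: "fst \<in> borel_measurable \<gamma>" "snd \<in> borel_measurable \<gamma>"
    using borel_measurable_continuous_onI[OF continuous_on_snd[OF continuous_on_id]]
      borel_measurable_continuous_onI[OF continuous_on_fst[OF continuous_on_id]] by (simp_all add: measurable_cong_sets[OF s\<gamma> refl])
  have vm: "(fst -` E :: ((real^'n) \<times> (real^'n)) set) \<in> sets borel" "(snd -` E :: ((real^'n) \<times> (real^'n)) set) \<in> sets borel" if "E \<in> sets borel" for E :: "(real^'n) set"
    using measurable_sets[OF fm(1) that] measurable_sets[OF fm(2) that] s\<gamma> sets_eq_imp_space_eq[OF s\<gamma>] by simp_all
  have "distr \<gamma> borel fst = \<mu>"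
  proof (rule measure_eqI)
    fix E assume "E \<in> sets (distr \<gamma> borel fst)"
    then have E: "E \<in> sets borel" by simp
    have "emeasure (distr \<gamma> borel fst) E = (\<integral>\<^sup>+x. emeasure (\<kappa> x) (Pair x -` fst -` E) \<partial>\<mu>)"
      using emeasure_distr[OF fm(1) E] em[OF vm(1)[OF E]] sets_eq_imp_space_eq[OF s\<gamma>] by simp
    also have "\<dots> = (\<integral>\<^sup>+x. indicator E x \<partial>\<mu>)"
    proof (rule nn_integral_cong)
      fix x
      have "emeasure (\<kappa> x) UNIV = 1" using prob_space.emeasure_space_1[OF kp(1)[of x]] sets_eq_imp_space_eq[OF kp(2)[of x]] by simp
      then show "emeasure (\<kappa> x) (Pair x -` fst -` E) = indicator E x" by (cases "x \<in> E") (auto simp: vimage_def)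
    qed
    also have "\<dots> = emeasure \<mu> E" using E \<mu>(2) by simp
    finally show "emeasure (distr \<gamma> borel fst) E = emeasure \<mu> E" .
  qed (simp add: \<mu>)
  moreover have "distr \<gamma> borel snd = \<mu> \<bind> \<kappa>"
  proof (rule measure_eqI)
    show "sets (distr \<gamma> borel snd) = sets (\<mu> \<bind> \<kappa>)" using sets_bind[OF sets_kernel[OF \<kappa>s] not_empty] by simp
    fix E assume "E \<in> sets (distr \<gamma> borel snd)"
    then have E: "E \<in> sets borel" by simp
    show "emeasure (distr \<gamma> borel snd) E = emeasure (\<mu> \<bind> \<kappa>) E"
      using emeasure_distr[OF fm(2) E] em[OF vm(2)[OF E]] sets_eq_imp_space_eq[OF s\<gamma>]
      unfolding emeasure_bind[OF not_empty \<kappa>s E] by (simp add: vimage_def)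
  qed
  ultimately have "\<gamma> \<in> couplings \<mu> (\<mu> \<bind> \<kappa>)" unfolding couplings_def using s\<gamma> pr by simp
  moreover have "disintegration \<gamma> \<mu> \<kappa>" unfolding disintegration_def using \<kappa>m em s\<gamma> by simp
  ultimately show ?thesis using that by blast
qed

text \<open>Compose the kernels of two nearly optimal couplings and integrate the pointwise bound; measurability
  of the cost along kernels lets the integral of the sum split.\<close>

theorem weak_cost_triangle_inequality:
  fixes \<mu> \<nu> p :: "(real^'n) measure"
  assumes \<mu>: "\<mu> \<in> P2" and p: "p \<in> P2"
  shows "weak_cost f \<mu> \<nu> \<le> weak_cost f \<mu> p + weak_cost f p \<nu>"
proof -
  interpret m: prob_space \<mu> by (rule P2D[OF \<mu>])
  interpret p: prob_space p by (rule P2D[OF p])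
  note s\<mu> = P2D(2)[OF \<mu>] and sp = P2D(2)[OF p]
  have le: "weak_cost f \<mu> \<nu> \<le> (\<integral>\<^sup>+x. point_cost f x (\<kappa>1 x) \<partial>\<mu>) + (\<integral>\<^sup>+x. point_cost f x (\<kappa>2 x) \<partial>p)"
    if g1: "\<gamma>1 \<in> couplings \<mu> p" "disintegration \<gamma>1 \<mu> \<kappa>1" and g2: "\<gamma>2 \<in> couplings p \<nu>" "disintegration \<gamma>2 p \<kappa>2" for \<gamma>1 \<kappa>1 \<gamma>2 \<kappa>2
  proof -
    have k1: "p = \<mu> \<bind> \<kappa>1" "\<kappa>1 \<in> borel \<rightarrow>\<^sub>M prob_algebra borel"
      using disintegration_bind[OF m.prob_space_axioms s\<mu> g1] by auto
    have k2: "\<nu> = p \<bind> \<kappa>2" "\<kappa>2 \<in> borel \<rightarrow>\<^sub>M prob_algebra borel"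
      using disintegration_bind[OF p.prob_space_axioms sp g2] by auto
    have k1m: "\<kappa>1 \<in> \<mu> \<rightarrow>\<^sub>M subprob_algebra borel"
      using measurable_prob_algebraD[OF k1(2)] by (simp add: measurable_cong_sets[OF s\<mu> refl])
    define \<kappa> where "\<kappa> x = \<kappa>1 x \<bind> \<kappa>2" for x
    have k: "\<kappa> \<in> borel \<rightarrow>\<^sub>M prob_algebra borel" unfolding \<kappa>_def by (rule measurable_bind_prob_space[OF k1(2) k2(2)])
    have \<nu>: "\<mu> \<bind> \<kappa> = \<nu>" unfolding \<kappa>_def k2(1) k1(1)
      by (rule bind_assoc[symmetric, OF k1m measurable_prob_algebraD[OF k2(2)]])
    obtain \<gamma> where g: "\<gamma> \<in> couplings \<mu> \<nu>" "disintegration \<gamma> \<mu> \<kappa>"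
      using ex_coupling_of_kernel[OF m.prob_space_axioms s\<mu> k] unfolding \<nu> by blast
    have kp: "prob_space (\<kappa>1 x)" "sets (\<kappa>1 x) = sets borel" for x using measurable_space[OF k1(2), of x] by (auto simp: space_prob_algebra)
    have pt: "point_cost f x (\<kappa> x) \<le> point_cost f x (\<kappa>1 x) + (\<integral>\<^sup>+y. point_cost f y (\<kappa>2 y) \<partial>\<kappa>1 x)" for x
    proof -
      have "distr (\<kappa>1 x) borel (\<lambda>y. y) = \<kappa>1 x" by (rule distr_id2) (simp add: kp)
      moreover have "(\<lambda>y. y) \<in> borel_measurable (\<kappa>1 x)" "\<kappa>2 \<in> \<kappa>1 x \<rightarrow>\<^sub>M prob_algebra borel"
        using k2(2) by (simp_all add: measurable_cong_sets[OF kp(2) refl])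
      ultimately show ?thesis unfolding \<kappa>_def using point_cost_bind[OF kp(1)[of x], of \<kappa>2 x] by simp
    qed
    have m1: "(\<lambda>x. point_cost f x (\<kappa>1 x)) \<in> borel_measurable \<mu>"
      using point_cost_measurable[OF k1(2)] by (simp add: measurable_cong_sets[OF s\<mu> refl])
    have m2: "(\<lambda>x. \<integral>\<^sup>+y. point_cost f y (\<kappa>2 y) \<partial>\<kappa>1 x) \<in> borel_measurable \<mu>"
      by (rule measurable_compose[OF k1m nn_integral_measurable_subprob_algebra[OF point_cost_measurable[OF k2(2)]]])
    have "weak_cost f \<mu> \<nu> \<le> (\<integral>\<^sup>+x. point_cost f x (\<kappa> x) \<partial>\<mu>)"
      unfolding weak_cost_def using g by (intro Inf_lower) blast
    also have "\<dots> \<le> (\<integral>\<^sup>+x. point_cost f x (\<kappa>1 x) + (\<integral>\<^sup>+y. point_cost f y (\<kappa>2 y) \<partial>\<kappa>1 x) \<partial>\<mu>)"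
      by (intro nn_integral_mono pt)
    also have "\<dots> = (\<integral>\<^sup>+x. point_cost f x (\<kappa>1 x) \<partial>\<mu>) + (\<integral>\<^sup>+x. \<integral>\<^sup>+y. point_cost f y (\<kappa>2 y) \<partial>\<kappa>1 x \<partial>\<mu>)"
      by (rule nn_integral_add[OF m1 m2])
    also have "(\<integral>\<^sup>+x. \<integral>\<^sup>+y. point_cost f y (\<kappa>2 y) \<partial>\<kappa>1 x \<partial>\<mu>) = (\<integral>\<^sup>+y. point_cost f y (\<kappa>2 y) \<partial>p)"
      unfolding k1(1) by (rule nn_integral_bind[OF point_cost_measurable[OF k2(2)] k1m, symmetric])
    finally show ?thesis .
  qed
  show ?thesis
  proof (cases "weak_cost f \<mu> p + weak_cost f p \<nu> = \<infinity>")
    case True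
    show ?thesis unfolding True by simp
  next
    case False
    then have fin: "weak_cost f \<mu> p \<noteq> \<infinity>" "weak_cost f p \<nu> \<noteq> \<infinity>" by auto
    show ?thesis
    proof (rule ennreal_le_epsilon)
      fix e :: real assume e: "e > 0"
      have ex: "\<exists>\<gamma> \<kappa>. \<gamma> \<in> couplings a b \<and> disintegration \<gamma> a \<kappa> \<and> (\<integral>\<^sup>+x. point_cost f x (\<kappa> x) \<partial>a) \<le> weak_cost f a b + ennreal (e/2)"
        if "weak_cost f a b \<noteq> \<infinity>" for a b
      proof -
        have "weak_cost f a b + 0 < weak_cost f a b + ennreal (e/2)"
          using that e by (subst ennreal_add_left_cancel_less) auto
        then have "Inf {\<integral>\<^sup>+x. point_cost f x (\<kappa> x) \<partial>a | \<gamma> \<kappa>. \<gamma> \<in> couplings a b \<and> disintegration \<gamma> a \<kappa>} < weak_cost f a b + ennreal (e/2)"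
          unfolding weak_cost_def by simp
        then show ?thesis unfolding Inf_less_iff by (auto intro: less_imp_le)
      qed
      obtain \<gamma>1 \<kappa>1 where 1: "\<gamma>1 \<in> couplings \<mu> p" "disintegration \<gamma>1 \<mu> \<kappa>1" "(\<integral>\<^sup>+x. point_cost f x (\<kappa>1 x) \<partial>\<mu>) \<le> weak_cost f \<mu> p + ennreal (e/2)"
        using ex[OF fin(1)] by blast
      obtain \<gamma>2 \<kappa>2 where 2: "\<gamma>2 \<in> couplings p \<nu>" "disintegration \<gamma>2 p \<kappa>2" "(\<integral>\<^sup>+x. point_cost f x (\<kappa>2 x) \<partial>p) \<le> weak_cost f p \<nu> + ennreal (e/2)"
        using ex[OF fin(2)] by blast
      have "weak_cost f \<mu> \<nu> \<le> (weak_cost f \<mu> p + ennreal (e/2)) + (weak_cost f p \<nu> + ennreal (e/2))"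
        by (rule order_trans[OF le[OF 1(1,2) 2(1,2)] add_mono[OF 1(3) 2(3)]])
      also have "\<dots> = (weak_cost f \<mu> p + weak_cost f p \<nu>) + (ennreal (e/2) + ennreal (e/2))" by (simp add: ac_simps)
      also have "ennreal (e/2) + ennreal (e/2) = ennreal e" using e by (simp add: ennreal_plus[symmetric] del: ennreal_plus)
      finally show "weak_cost f \<mu> \<nu> \<le> weak_cost f \<mu> p + weak_cost f p \<nu> + ennreal e" .
    qed
  qed
qed

end


section \<open>Idempotence of the transform\<close>

context integrand
begin

lemma subsolution_continuous: "v \<in> subsolutions \<phi> \<Longrightarrow> continuous_on UNIV v"
proof -
  assume "v \<in> subsolutions \<phi>"
  then obtain a u where v: "v = (\<lambda>y. a + u y)" and u: "(\<lambda>y. - u y) \<in> admissible" unfolding subsolutions_def by auto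
  have "continuous_on UNIV (\<lambda>y. a - (- u y))" by (intro continuous_intros Cc_continuous[OF admissible_Cc[OF u]])
  then show ?thesis unfolding v by simp
qed

text \<open>Weak duality, integrated against the comparison \<open>v \<le> \<psi>\<close>.\<close>

lemma subsolution_le_transform:
  fixes \<psi> :: "real^'n \<Rightarrow> real"
  assumes v: "v \<in> subsolutions \<phi>" and le: "\<And>y. v y \<le> \<psi> y"
    and \<psi>: "\<psi> \<in> borel_measurable borel" "\<And>y. \<bar>\<psi> y\<bar> \<le> M"
  shows "ereal (v x) \<le> g_transform f \<psi> x"
  unfolding g_transform_def
proof (rule INF_greatest)
  fix p :: "(real^'n) measure" assume p: "p \<in> P2"
  interpret p: prob_space p by (rule P2D[OF p])
  note sp = P2D(2)[OF p]
  obtain a u where v_eq: "v = (\<lambda>y. a + u y)" and u: "(\<lambda>y. - u y) \<in> admissible"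
    using v unfolding subsolutions_def by auto
  have uC: "(\<lambda>y. - u y) \<in> Cc" by (rule admissible_Cc[OF u])
  obtain B where B: "\<And>y. \<bar>- u y\<bar> \<le> B" using Cc_bounded[OF uC] by blast
  have "(\<lambda>y. - u y) \<in> borel_measurable p" using Cc_measurable[OF uC] by (simp add: measurable_cong_sets[OF sp refl])
  then have "integrable p (\<lambda>y. - u y)" using B by (intro p.integrable_const_bound[of _ B]) auto
  then have iu: "integrable p u" by simp
  have \<psi>m: "\<psi> \<in> borel_measurable p" using \<psi>(1) by (simp add: measurable_cong_sets[OF sp refl])
  have i\<psi>: "integrable p \<psi>" by (rule p.integrable_const_bound[of _ M]) (use \<psi>(2) \<psi>m in auto)
  have int: "(\<integral>y. \<psi> y \<partial>completion p) = (\<integral>y. \<psi> y \<partial>p)" by (rule integral_completion[OF \<psi>m])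
  show "ereal (v x) \<le> ereal (\<integral>y. \<psi> y \<partial>completion p) + enn2ereal (point_cost f x p)"
  proof (cases "point_cost f x p")
    case (real r)
    have "ennreal ((\<integral>y. - u y \<partial>p) - - u x) \<le> ennreal r" using admissible_le_point_cost[OF u, of p x] unfolding real(2) .
    then have "u x - (\<integral>y. u y \<partial>p) \<le> r" using real(1) by (simp add: ennreal_le_iff)
    then have "v x \<le> (\<integral>y. a + u y \<partial>p) + r" unfolding v_eq using iu by (simp add: p.prob_space)
    also have "(\<integral>y. a + u y \<partial>p) \<le> (\<integral>y. \<psi> y \<partial>p)"
      using le unfolding v_eq by (intro integral_mono i\<psi>) (use iu in auto)
    finally show ?thesis unfolding int real(2) using real(1) by (simp add: enn2ereal_ennreal)
  qed simp
qed

text \<open>By strong duality the transform of \<open>\<phi>\<close> is the supremum \<open>V\<close> of all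
  subsolutions below \<open>\<phi>\<close>. These subsolutions are also below \<open>V\<close>, so the transform
  of \<open>V\<close> is at least \<open>V\<close>; the Dirac measure at \<open>x\<close> shows that it is at
  most \<open>V\<close>.\<close>

theorem transform_idempotent:
  fixes \<phi> :: "real^'n \<Rightarrow> real"
  assumes \<phi>: "\<phi> \<in> bounded_lsc"
  shows "g_transform2 f \<phi> = g_transform f \<phi>"
proof -
  have lsc: "lsc_on UNIV \<phi>" and "bounded (range \<phi>)" using \<phi> unfolding bounded_lsc_def by auto
  then obtain M where M: "\<And>x. \<bar>\<phi> x\<bar> \<le> M" by (auto simp: bounded_iff)
  have shift: "lsc_on UNIV (\<lambda>y. \<phi> y + k)" for k :: real
    unfolding lsc_on_def
  proof (intro ballI allI impI)
    fix x c assume "c < \<phi> x + k"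
    then have "c - k < \<phi> x" by simp
    then have "\<forall>\<^sub>F y in at x. c - k < \<phi> y" using lsc unfolding lsc_on_def by blast
    then show "\<forall>\<^sub>F y in at x. c < \<phi> y + k" by eventually_elim simp
  qed
  have b: "0 \<le> \<phi> x + M" "\<phi> x + M \<le> 2 * M" "1 \<le> \<phi> x + (M + 1)" "\<phi> x + (M + 1) \<le> 2 * M + 1" for x
    using M[of x] by (auto simp: abs_le_iff)
  obtain w where w: "\<And>n. continuous_on UNIV (w n)" "\<And>x. (\<lambda>n. w n x) \<longlonglongrightarrow> \<phi> x + M"
    using bounded_lsc_approximation[OF shift b(1,2)] by metis
  have "(\<lambda>x. \<phi> x + M) \<in> borel_measurable borel"
    by (rule borel_measurable_LIMSEQ_real[OF w(2)]) (intro borel_measurable_continuous_onI w(1))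
  then have "(\<lambda>x. (\<phi> x + M) - M) \<in> borel_measurable borel" by measurable
  then have \<phi>m: "\<phi> \<in> borel_measurable borel" by simp
  define V where "V x = (SUP v\<in>subsolutions \<phi>. v x)" for x
  have const: "(\<lambda>_. - M) \<in> subsolutions \<phi>" unfolding subsolutions_def
    using zero_admissible M by (intro CollectI exI[of _ "- M"] exI[of _ "\<lambda>_. 0"]) (auto simp: abs_le_iff minus_le_iff)
  have v_le: "v x \<le> \<phi> x" if "v \<in> subsolutions \<phi>" for v x using that unfolding subsolutions_def by auto
  have bdd: "bdd_above ((\<lambda>v. v x) ` subsolutions \<phi>)" for x by (rule bdd_aboveI2[of _ _ "\<phi> x"]) (rule v_le)
  have V_up: "v x \<le> V x" if "v \<in> subsolutions \<phi>" for v x unfolding V_def by (rule cSUP_upper[OF that bdd])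
  have V_le: "V x \<le> \<phi> x" for x unfolding V_def using const v_le by (intro cSUP_least) auto
  have V_bd: "\<bar>V x\<bar> \<le> M" for x using V_up[OF const, of x] V_le[of x] M[of x] by (auto simp: abs_le_iff)
  have "open {x. y < V x}" for y
  proof -
    have "{x. y < V x} = (\<Union>v\<in>subsolutions \<phi>. {x. y < v x})"
      unfolding V_def using less_cSUP_iff[OF _ bdd] const by auto
    moreover have "open {x. y < v x}" if "v \<in> subsolutions \<phi>" for v
      by (intro open_Collect_less continuous_intros subsolution_continuous[OF that])
    ultimately show ?thesis by auto
  qed
  then have Vm: "V \<in> borel_measurable borel" unfolding borel_measurable_iff_greater by simp
  have le_of_subsolutions: "ereal (V x) \<le> E" if "\<And>v. v \<in> subsolutions \<phi> \<Longrightarrow> ereal (v x) \<le> E" for x E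
  proof (cases E)
    case (real r)
    have "v x \<le> r" if "v \<in> subsolutions \<phi>" for v using \<open>\<And>v. v \<in> subsolutions \<phi> \<Longrightarrow> ereal (v x) \<le> E\<close>[OF that] real by simp
    then have "V x \<le> r" unfolding V_def using const by (intro cSUP_least) auto
    then show ?thesis using real by simp
  next
    case MInf
    then show ?thesis using that[OF const] by simp
  qed simp
  have gV: "g_transform f \<phi> x = ereal (V x)" for x
  proof (rule antisym)
    show "ereal (V x) \<le> g_transform f \<phi> x"
      by (rule le_of_subsolutions) (rule subsolution_le_transform[OF _ v_le \<phi>m M])
    have "v x \<le> V x + (M + 1)" if v: "v \<in> subsolutions (\<lambda>y. \<phi> y + (M + 1))" for v
    proof -
      obtain a u where "v = (\<lambda>y. a + u y)" "(\<lambda>y. - u y) \<in> admissible" "\<And>y. v y \<le> \<phi> y + (M + 1)"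
        using v unfolding subsolutions_def by auto
      then have "(\<lambda>y. (a - (M + 1)) + u y) \<in> subsolutions \<phi>" "v x = (a - (M + 1)) + u x + (M + 1)"
        unfolding subsolutions_def by (auto intro!: exI[of _ "a - (M + 1)"] exI[of _ u] simp: algebra_simps)
      then show ?thesis using V_up[of "\<lambda>y. (a - (M + 1)) + u y" x] by simp
    qed
    then obtain p where p: "p \<in> P2" "ennreal (\<integral>y. \<phi> y + (M + 1) \<partial>p) + point_cost f x p \<le> ennreal (V x + (M + 1))"
      using primal_attainment[OF shift b(3,4), of x "V x + (M + 1)"] by metis
    interpret p: prob_space p by (rule P2D[OF p(1)])
    have \<phi>p: "\<phi> \<in> borel_measurable p" using \<phi>m by (simp add: measurable_cong_sets[OF P2D(2)[OF p(1)] refl])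
    have ip: "integrable p \<phi>" by (rule p.integrable_const_bound[of _ M]) (use M \<phi>p in auto)
    have I: "(\<integral>y. \<phi> y + (M + 1) \<partial>p) = (\<integral>y. \<phi> y \<partial>p) + (M + 1)" using ip by (simp add: p.prob_space)
    have I0: "0 \<le> (\<integral>y. \<phi> y + (M + 1) \<partial>p)" using b(3) by (intro integral_nonneg_AE AE_I2) (meson order_trans zero_le_one)
    have "point_cost f x p \<le> ennreal (V x + (M + 1))" using p(2) by (rule order_trans[rotated]) simp
    then obtain r where r: "point_cost f x p = ennreal r" "0 \<le> r" by (cases "point_cost f x p") (auto simp: top_unique)
    have "ennreal ((\<integral>y. \<phi> y + (M + 1) \<partial>p) + r) \<le> ennreal (V x + (M + 1))" using p(2) I0 r by simp
    moreover have "0 \<le> V x + (M + 1)" using V_bd[of x] by (simp add: abs_le_iff)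
    ultimately have "(\<integral>y. \<phi> y \<partial>p) + r \<le> V x" unfolding I by (simp add: ennreal_le_iff)
    then have "ereal (\<integral>y. \<phi> y \<partial>completion p) + enn2ereal (point_cost f x p) \<le> ereal (V x)"
      unfolding integral_completion[OF \<phi>p] r(1) using r(2) by (simp add: enn2ereal_ennreal)
    then show "g_transform f \<phi> x \<le> ereal (V x)" unfolding g_transform_def by (intro INF_lower2[OF p(1)])
  qed
  have "g_transform f V x = ereal (V x)" for x
  proof (rule antisym)
    show "ereal (V x) \<le> g_transform f V x"
      by (rule le_of_subsolutions) (rule subsolution_le_transform[OF _ V_up Vm V_bd])
    have "ereal (\<integral>y. V y \<partial>completion (return borel x)) + enn2ereal (point_cost f x (return borel x)) = ereal (V x)"
      using Vm by (simp add: integral_completion integral_return_borel point_cost_return zero_ennreal.rep_eq)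
    then show "g_transform f V x \<le> ereal (V x)" unfolding g_transform_def
      by (intro INF_lower2[OF return_P2[of x]]) simp
  qed
  then show ?thesis unfolding g_transform2_def gV by (auto simp: gV)
qed

end

theorem proposition3p18:
  fixes f :: "real ^ 'n ^ 'n \<Rightarrow> ennreal"
  assumes "convex_integrand f"
    and "pos_homogeneous f"
    and "lsc_on sym_mats f"
    and "eff_dom f \<subseteq> psd_mats"
    and "eff_dom f \<noteq> {}"
    and "eff_dom f \<subseteq> closure (eff_dom f \<inter> pd_mats)"
    and "coercive f"
  shows
    "((\<forall>\<mu>\<in>P2. \<forall>\<nu>\<in>P2. \<forall>p\<in>P2. weak_cost f \<mu> \<nu> \<le> weak_cost f \<mu> p + weak_cost f p \<nu>)
      \<longleftrightarrow>
      (\<forall>x. \<forall>\<nu>\<in>P2. \<forall>p\<in>P2. \<forall>\<kappa>\<in>analytic_kernels. mixture p \<kappa> \<nu> \<longrightarrow>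
         point_cost f x \<nu> \<le> point_cost f x p + (\<integral>\<^sup>+y. point_cost f y (\<kappa> y) \<partial>completion p)))
     \<and>
     ((\<forall>x. \<forall>\<nu>\<in>P2. \<forall>p\<in>P2. \<forall>\<kappa>\<in>analytic_kernels. mixture p \<kappa> \<nu> \<longrightarrow>
         point_cost f x \<nu> \<le> point_cost f x p + (\<integral>\<^sup>+y. point_cost f y (\<kappa> y) \<partial>completion p))
      \<longleftrightarrow>
      (\<forall>\<phi>\<in>bounded_lsc. g_transform2 f \<phi> = g_transform f \<phi>))"
proof -
  interpret integrand f by (rule integrand.intro) (fact assms)+
  have P2_valued: "\<kappa> y \<in> P2" if "\<kappa> \<in> analytic_kernels" for \<kappa> :: "real^'n \<Rightarrow> (real^'n) measure" and y
  proof -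
    have "\<kappa> y \<in> space P2_borel"
      using that unfolding analytic_kernels_def by (rule measurable_space) (simp add: space_measure_of_conv)
    then show ?thesis unfolding P2_borel_def by (simp add: space_measure_of_conv)
  qed
  have "\<forall>\<mu>\<in>P2. \<forall>\<nu>\<in>P2. \<forall>p\<in>P2. weak_cost f \<mu> \<nu> \<le> weak_cost f \<mu> p + weak_cost f p \<nu>"
    using weak_cost_triangle_inequality by blast
  moreover have "\<forall>x. \<forall>\<nu>\<in>P2. \<forall>p\<in>P2. \<forall>\<kappa>\<in>analytic_kernels. mixture p \<kappa> \<nu> \<longrightarrow>
         point_cost f x \<nu> \<le> point_cost f x p + (\<integral>\<^sup>+y. point_cost f y (\<kappa> y) \<partial>completion p)"
    using kernel_triangle_inequality P2_valued by blast
  moreover have "\<forall>\<phi>\<in>bounded_lsc. g_transform2 f \<phi> = g_transform f \<phi>"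
    using transform_idempotent by blast
  ultimately show ?thesis by blast
qed

end
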